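(* Let $d\in\{1,2,3\}$, let $\Omega\subset\mathbb{R}^d$ be a bounded Lipschitz domain with a conforming simplicial initial triangulation $\mathcal T_0$, let $f,g\in L^2(\Omega)$ and $\boldsymbol f,\boldsymbol g\in[L^2(\Omega)]^d$, and let $A\colon\Omega\to\mathbb{R}^{d\times d}_{\rm sym}$ and $b\colon\Omega\times\mathbb{R}\to\mathbb{R}$. Assume the following. (RHS) If $d\ge2$, there is $p>d$ such that $\boldsymbol f,\boldsymbol g\in[L^p(\Omega)]^d$ and $f,g\in L^q(\Omega)$, where $1/q:=1/p+1/d$; moreover $\boldsymbol f|_T,\boldsymbol g|_T\in H({\rm div},T)$ and $\boldsymbol f|_T\cdot\boldsymbol n,\boldsymbol g|_T\cdot\boldsymbol n\in L^2(\partial T)$ for all $T\in\mathcal T_0$. (ELL) $A\in L^\infty(\Omega;\mathbb{R}^{d\times d}_{\rm sym})$ with $0<\mu_0:=\inf_{x\in\Omega}\lambda_{\min}(A(x))\le\mu_1:=\sup_{x\in\Omega}\lambda_{\max}(A(x))<\infty$; moreover $A|_T\in W^{1,\infty}(T)$ for all $T\in\mathcal T_0$. (CAR) For all $j\in\mathbb{N}_0$, $x\mapsto\partial_\xi^j b(x,\xi)$ is measurable on $\Omega$ for every $\xi\in\mathbb{R}$, and $\xi\mapsto\partial_\xi^j b(x,\xi)$ is smooth for every $x\in\Omega$. (MON) $b'(x,\xi):=\partial_\xi b(x,\xi)\ge0$ and $b(x,0)=0$ for all $x\in\Omega$, $\xi\in\mathbb{R}$. (CGC) There are $n\in\mathbb{N}$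 with $n\ge2$ (and $n\le3$ if $d=3$) and $R>0$ such that $|\partial_\xi^k b(x,\xi)|\le R(1+|\xi|^{n-k})$ for all $x\in\Omega$, $\xi\in\mathbb{R}$, $0\le k\le n$. Let $(u_\ell)_{\ell\in\mathbb{N}_0}$ be the discrete primal solutions generated by the adaptive algorithm described in the context (with any $0<\theta\le1$, $1\le C_{\rm mark}\le\infty$). Then, for all $0<\varepsilon<1$, there exists $\ell_0\in\mathbb{N}$ such that for all $\ell\ge\ell_0$ and all $k\in\mathbb{N}_0$, $$\|u-u_{\ell+k}\|_A^2+\|u_{\ell+k}-u_\ell\|_A^2\le\frac{1}{1-\varepsilon}\,\|u-u_\ell\|_A^2.$$
   Context: Notation: $\langle v,w\rangle:=\int_\Omega vw\,dx$; $b(v)$ denotes $x\mapsto b(x,v(x))$, likewise $b'(v)$; $a(v,w):=\langle A\nabla v,\nabla w\rangle$, $\|v\|_A:=a(v,v)^{1/2}$; $G(v):=\langle g,v\rangle+\langle\boldsymbol g,\nabla v\rangle$. Meshes and spaces: mesh refinement is newest vertex bisection (NVB; bisection if $d=1$). $\mathbb{T}$ is the set of all triangulations obtained from $\mathcal T_0$ by finitely many NVB refinement steps; ${\tt refine}(\mathcal T_H,\mathcal M_H)$ is the coarsest NVB refinement of $\mathcal T_H$ in which all elements of $\mathcal M_H\subseteq\mathcal T_H$ have been refined. For a fixed degree $m\in\mathbb{N}$ and $\mathcal T_H\in\mathbb{T}$, $\mathcal X_H:=\{v\in H^1_0(\Omega):v|_T\text{ polynomial of degree}\le m\ \forall T\in\mathcal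 T_H\}$. Problems: $u\in H^1_0(\Omega)$ is the unique solution of $a(u,v)+\langle b(u),v\rangle=\langle f,v\rangle+\langle\boldsymbol f,\nabla v\rangle$ for all $v\in H^1_0(\Omega)$, and $u_H\in\mathcal X_H$ the unique solution of the same equation with $H^1_0(\Omega)$ replaced by $\mathcal X_H$. For $w\in H^1_0(\Omega)$, $z_H[w]\in\mathcal X_H$ is the unique solution of $a(z_H[w],v_H)+\langle b'(w)z_H[w],v_H\rangle=G(v_H)$ for all $v_H\in\mathcal X_H$. Estimators: with $h_T:=|T|^{1/d}$, $\boldsymbol n$ the outer unit normal and $[\![\cdot]\!]$ the jump across interior facets ($[\![\cdot]\!]:=0$ if $d=1$), for $T\in\mathcal T_H$, $v_H\in\mathcal X_H$, $\eta_H(T,v_H)^2:=h_T^2\|f+{\rm div}(A\nabla v_H-\boldsymbol f)-b(v_H)\|_{L^2(T)}^2+h_T\|[\![(A\nabla v_H-\boldsymbol f)\cdot\boldsymbol n]\!]\|_{L^2(\partial T\cap\Omega)}^2$, $\zeta_H(w;T,v_H)^2:=h_T^2\|g+{\rm div}(A\nabla v_H-\boldsymbol g)-b'(w)v_H\|_{L^2(T)}^2+h_T\|[\![(A\nabla v_H-\boldsymbol g)\cdot\boldsymbol n]\!]\|_{L^2(\partial T\cap\Omega)}^2$. For $\mathcal U\subseteq\mathcal T_H$: $\eta_H(\mathcal U,v_H)^2:=\sum_{T\in\mathcal U}\eta_H(T,v_H)^2$, $\zeta_H(\mathcal U,z_H[w])^2:=\sum_{T\in\mathcal U}\zeta_H(w;T,z_H[w])^2$;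 $\eta_H(v_H):=\eta_H(\mathcal T_H,v_H)$, $\zeta_H(z_H[w]):=\zeta_H(\mathcal T_H,z_H[w])$, $\zeta_H(T,z_H[w]):=\zeta_H(w;T,z_H[w])$. Adaptive algorithm: input $0<\theta\le1$, $C_{\rm mark}\ge1$, $\mathcal T_0$. For $\ell=0,1,2,\dots$ (subscript $\ell$ refers to $\mathcal T_\ell$): (i) compute $u_\ell$, $z_\ell[u_\ell]\in\mathcal X_\ell$; (ii) compute $\eta_\ell(T,u_\ell)$ and $\zeta_\ell(T,z_\ell[u_\ell])$ for all $T\in\mathcal T_\ell$; (iii) determine sets $\overline{\mathcal M}{}_\ell^{u},\overline{\mathcal M}{}_\ell^{uz}\subseteq\mathcal T_\ell$ of, up to the multiplicative constant $C_{\rm mark}$, minimal cardinality (no cardinality restriction if $C_{\rm mark}=\infty$) such that $\theta\,\eta_\ell(u_\ell)^2\le\eta_\ell(\overline{\mathcal M}{}_\ell^{u},u_\ell)^2$ and $\theta[\eta_\ell(u_\ell)^2+\zeta_\ell(z_\ell[u_\ell])^2]\le\eta_\ell(\overline{\mathcal M}{}_\ell^{uz},u_\ell)^2+\zeta_\ell(\overline{\mathcal M}{}_\ell^{uz},z_\ell[u_\ell])^2$, respectively; (iv) select $\mathcal M_\ell^u\subseteq\overline{\mathcal M}{}_\ell^u$ and $\mathcal M_\ell^{uz}\subseteq\overline{\mathcal M}{}_\ell^{uz}$ with $\#\mathcal M_\ell^u=\#\mathcal M_\ell^{uz}=\min\{\#\overline{\mathcal M}{}_\ell^u,\#\overline{\mathcal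 M}{}_\ell^{uz}\}$; (v) set $\mathcal M_\ell:=\mathcal M_\ell^u\cup\mathcal M_\ell^{uz}$ and $\mathcal T_{\ell+1}:={\tt refine}(\mathcal T_\ell,\mathcal M_\ell)$. *)

theory Defs
  imports "HOL-Analysis.Analysis"
begin

section \<open>Domains, Lebesgue and Sobolev spaces\<close>

text \<open>Functions are total on \<open>real ^ 'd\<close>; only their values on the set under consideration matter,
  and elements of Lebesgue and Sobolev spaces are represented by arbitrary representatives of
  their almost-everywhere classes.\<close>

text \<open>Near each boundary point, \<open>\<Omega>\<close> is the part below the graph of a Lipschitz function over the
  hyperplane orthogonal to \<open>e\<close>; \<open>x - (x \<bullet> e) *\<^sub>R e\<close> is the projection to that hyperplane.\<close>

definition bounded_lipschitz_domain :: "(real ^ 'd) set \<Rightarrow> bool" where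
  "bounded_lipschitz_domain \<Omega> \<longleftrightarrow>
     open \<Omega> \<and> connected \<Omega> \<and> \<Omega> \<noteq> {} \<and> bounded \<Omega> \<and>
     (\<forall>p\<in>frontier \<Omega>. \<exists>r>0. \<exists>e L (\<gamma> :: real ^ 'd \<Rightarrow> real).
        norm e = 1 \<and> L-lipschitz_on UNIV \<gamma> \<and>
        (\<forall>x\<in>ball p r. x \<in> \<Omega> \<longleftrightarrow> x \<bullet> e < \<gamma> (x - (x \<bullet> e) *\<^sub>R e)))"

definition Lp :: "real \<Rightarrow> 'a measure \<Rightarrow> ('a \<Rightarrow> 'b::euclidean_space) set" where
  "Lp p M = {f \<in> borel_measurable M. integrable M (\<lambda>x. norm (f x) powr p)}"

abbreviation L2 :: "'a measure \<Rightarrow> ('a \<Rightarrow> 'b::euclidean_space) set" where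
  "L2 \<equiv> Lp 2"

definition Linf :: "'a measure \<Rightarrow> ('a \<Rightarrow> 'b::euclidean_space) set" where
  "Linf M = {f \<in> borel_measurable M. \<exists>C. AE x in M. norm (f x) \<le> C}"

definition L1_loc :: "(real ^ 'd) set \<Rightarrow> (real ^ 'd \<Rightarrow> 'b::euclidean_space) set" where
  "L1_loc S = {f \<in> borel_measurable (lebesgue_on S).
                 \<forall>K. compact K \<and> K \<subseteq> S \<longrightarrow> integrable (lebesgue_on K) f}"

definition grad :: "(real ^ 'd \<Rightarrow> real) \<Rightarrow> real ^ 'd \<Rightarrow> real ^ 'd" where
  "grad \<phi> x = (\<chi> i. frechet_derivative \<phi> (at x) (axis i 1))"

fun C_k :: "nat \<Rightarrow> (real ^ 'd \<Rightarrow> real) \<Rightarrow> bool" where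
  "C_k 0 \<phi> \<longleftrightarrow> continuous_on UNIV \<phi>"
| "C_k (Suc k) \<phi> \<longleftrightarrow> (\<forall>x. \<phi> differentiable at x) \<and> (\<forall>i. C_k k (\<lambda>x. grad \<phi> x $ i))"

definition smooth :: "(real ^ 'd \<Rightarrow> real) \<Rightarrow> bool" where
  "smooth \<phi> \<longleftrightarrow> (\<forall>k. C_k k \<phi>)"

definition test_functions :: "(real ^ 'd) set \<Rightarrow> (real ^ 'd \<Rightarrow> real) set" where
  "test_functions S =
     {\<phi>. smooth \<phi> \<and> compact (closure {x. \<phi> x \<noteq> 0}) \<and> closure {x. \<phi> x \<noteq> 0} \<subseteq> S}"

definition has_weak_grad ::
    "(real ^ 'd) set \<Rightarrow> (real ^ 'd \<Rightarrow> real) \<Rightarrow> (real ^ 'd \<Rightarrow> real ^ 'd) \<Rightarrow> bool" where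
  "has_weak_grad S v G \<longleftrightarrow> v \<in> L1_loc S \<and> G \<in> L1_loc S \<and>
     (\<forall>\<phi>\<in>test_functions S. \<forall>i.
        (LINT x|lebesgue_on S. v x * grad \<phi> x $ i) = - (LINT x|lebesgue_on S. G x $ i * \<phi> x))"

text \<open>The weak gradient and the weak divergence below are unique up to null sets.\<close>

definition wgrad :: "(real ^ 'd) set \<Rightarrow> (real ^ 'd \<Rightarrow> real) \<Rightarrow> real ^ 'd \<Rightarrow> real ^ 'd" where
  "wgrad S v = (SOME G. has_weak_grad S v G)"

definition has_weak_div ::
    "(real ^ 'd) set \<Rightarrow> (real ^ 'd \<Rightarrow> real ^ 'd) \<Rightarrow> (real ^ 'd \<Rightarrow> real) \<Rightarrow> bool" where
  "has_weak_div S \<sigma> w \<longleftrightarrow> \<sigma> \<in> L1_loc S \<and> w \<in> L1_loc S \<and>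
     (\<forall>\<phi>\<in>test_functions S.
        (LINT x|lebesgue_on S. \<sigma> x \<bullet> grad \<phi> x) = - (LINT x|lebesgue_on S. w x * \<phi> x))"

definition wdiv :: "(real ^ 'd) set \<Rightarrow> (real ^ 'd \<Rightarrow> real ^ 'd) \<Rightarrow> real ^ 'd \<Rightarrow> real" where
  "wdiv S \<sigma> = (SOME w. has_weak_div S \<sigma> w)"

definition Hdiv :: "(real ^ 'd) set \<Rightarrow> (real ^ 'd \<Rightarrow> real ^ 'd) set" where
  "Hdiv S = {\<sigma> \<in> L2 (lebesgue_on S). \<exists>w \<in> L2 (lebesgue_on S). has_weak_div S \<sigma> w}"

definition W1inf :: "(real ^ 'd) set \<Rightarrow> (real ^ 'd \<Rightarrow> real) set" where
  "W1inf S = {v \<in> Linf (lebesgue_on S). \<exists>G \<in> Linf (lebesgue_on S). has_weak_grad S v G}"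

definition H10 :: "(real ^ 'd) set \<Rightarrow> (real ^ 'd \<Rightarrow> real) set" where
  "H10 \<Omega> = {v \<in> L2 (lebesgue_on \<Omega>).
     \<exists>G \<in> L2 (lebesgue_on \<Omega>). has_weak_grad \<Omega> v G \<and>
       (\<exists>\<phi>. (\<forall>n. \<phi> n \<in> test_functions \<Omega>) \<and>
         (\<lambda>n::nat. LINT x|lebesgue_on \<Omega>. (v x - \<phi> n x)\<^sup>2) \<longlonglongrightarrow> 0 \<and>
         (\<lambda>n. LINT x|lebesgue_on \<Omega>. (norm (G x - grad (\<phi> n) x))\<^sup>2) \<longlonglongrightarrow> 0)}"


section \<open>Facets, normal traces and normal jumps\<close>

definition unit_normal :: "(real ^ 'd) set \<Rightarrow> real ^ 'd" where
  "unit_normal F = (SOME \<nu>. norm \<nu> = 1 \<and> (\<forall>x\<in>F. \<forall>y\<in>F. \<nu> \<bullet> (x - y) = 0))"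

text \<open>The \<open>(d - 1)\<close>-dimensional surface measure on a facet \<open>F\<close> of a simplex: the measure of a
  subset of \<open>F\<close> is the volume of the prism of height 1 over it, and \<open>closest_point F\<close> maps the
  prism over \<open>F\<close> orthogonally to \<open>F\<close>. For \<open>d = 1\<close>, this is the counting measure on a point.\<close>

definition facet_measure :: "(real ^ 'd) set \<Rightarrow> (real ^ 'd) measure" where
  "facet_measure F =
     distr (lebesgue_on {y + t *\<^sub>R unit_normal F | y t. y \<in> F \<and> t \<in> {0..1}}) borel (closest_point F)"

text \<open>The normal trace of \<open>\<sigma> \<in> Hdiv (interior T)\<close>, a functional on the traces of \<open>H\<^sup>1\<close> functions, is
  given by an \<open>L\<^sup>2\<close> function on the boundary of the simplex \<open>T\<close>. It is determined by Green's
  formula; testing with restrictions of smooth functions suffices, as these are dense in \<open>H\<^sup>1\<close>.\<close>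

definition normal_trace_in_L2 :: "(real ^ 'd) set \<Rightarrow> (real ^ 'd \<Rightarrow> real ^ 'd) \<Rightarrow> bool" where
  "normal_trace_in_L2 T \<sigma> \<longleftrightarrow>
     (\<exists>\<psi>. (\<forall>F. F facet_of T \<longrightarrow> \<psi> \<in> L2 (facet_measure F)) \<and>
        (\<forall>v. smooth v \<longrightarrow>
           (\<Sum>F | F facet_of T. LINT x|facet_measure F. \<psi> x * v x) =
           (LINT x|lebesgue_on (interior T). \<sigma> x \<bullet> grad v x + wdiv (interior T) \<sigma> x * v x)))"

text \<open>\<open>\<psi>\<close> is the jump of \<open>\<sigma> \<cdot> n\<close>, i.e. the sum of the two outer normal traces from \<open>T\<close> and \<open>T'\<close>,
  across the common facet \<open>F\<close>. It is characterized by Green's formula on \<open>T\<close> and on \<open>T'\<close>, since the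
  test functions vanish on the remaining facets. The two one-sided normal traces need not be
  functions on \<open>F\<close> by themselves if \<open>F\<close> is not contained in a facet of the initial mesh.\<close>

definition has_normal_jump ::
    "(real ^ 'd) set \<Rightarrow> (real ^ 'd) set \<Rightarrow> (real ^ 'd) set \<Rightarrow> (real ^ 'd \<Rightarrow> real ^ 'd)
       \<Rightarrow> (real ^ 'd \<Rightarrow> real) \<Rightarrow> bool" where
  "has_normal_jump T T' F \<sigma> \<psi> \<longleftrightarrow> \<psi> \<in> L2 (facet_measure F) \<and>
     (\<forall>\<phi>\<in>test_functions (interior (T \<union> T')).
        (LINT x|facet_measure F. \<psi> x * \<phi> x) =
        (LINT x|lebesgue_on (interior T). \<sigma> x \<bullet> grad \<phi> x + wdiv (interior T) \<sigma> x * \<phi> x) +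
        (LINT x|lebesgue_on (interior T'). \<sigma> x \<bullet> grad \<phi> x + wdiv (interior T') \<sigma> x * \<phi> x))"


section \<open>Meshes and newest vertex bisection\<close>

text \<open>Tagged simplices: an ordered list \<open>z\<^sub>0, \<dots>, z\<^sub>d\<close> of vertices together with a type
  in \<open>{0..<d}\<close>. The refinement edge connects \<open>z\<^sub>0\<close> and \<open>z\<^sub>d\<close>.\<close>

type_synonym 'd tsimplex = "(real ^ 'd) list \<times> nat"

type_synonym 'd mesh = "'d tsimplex set"

definition elt :: "'d tsimplex \<Rightarrow> (real ^ 'd) set" where
  "elt \<tau> = convex hull (set (fst \<tau>))"

definition tagged_simplex :: "('d::finite) tsimplex \<Rightarrow> bool" where
  "tagged_simplex \<tau> \<longleftrightarrow>
     length (fst \<tau>) = CARD('d) + 1 \<and> distinct (fst \<tau>) \<and> \<not> affine_dependent (set (fst \<tau>)) \<and>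
     snd \<tau> < CARD('d)"

definition conforming :: "('d::finite) mesh \<Rightarrow> bool" where
  "conforming M \<longleftrightarrow> inj_on elt M \<and> triangulation (elt ` M)"

definition initial_triangulation :: "(real ^ 'd) set \<Rightarrow> 'd mesh \<Rightarrow> bool" where
  "initial_triangulation \<Omega> M \<longleftrightarrow>
     finite M \<and> (\<forall>\<tau>\<in>M. tagged_simplex \<tau>) \<and> conforming M \<and> (\<Union>\<tau>\<in>M. elt \<tau>) = closure \<Omega>"

text \<open>Bisection rule of Maubach, in the form given by Stevenson (Math. Comp. 77, 2008): with
  \<open>m\<close> the midpoint of \<open>z\<^sub>0\<close> and \<open>z\<^sub>d\<close>, the children of \<open>z\<^sub>0, \<dots>, z\<^sub>d\<close> of type \<open>\<gamma>\<close> are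
  \<open>z\<^sub>0, m, z\<^sub>1, \<dots>, z\<^sub>d\<^sub>-\<^sub>1\<close> and \<open>z\<^sub>d, m, z\<^sub>1, \<dots>, z\<^sub>\<gamma>, z\<^sub>d\<^sub>-\<^sub>1, \<dots>, z\<^sub>\<gamma>\<^sub>+\<^sub>1\<close>, both of type
  \<open>(\<gamma> + 1) mod d\<close>.\<close>

definition children :: "('d::finite) tsimplex \<Rightarrow> 'd mesh" where
  "children = (\<lambda>(zs, \<gamma>).
     let a = hd zs; c = last zs; inner = butlast (tl zs); m = midpoint a c;
         \<gamma>' = (\<gamma> + 1) mod CARD('d)
     in {(a # m # inner, \<gamma>'), (c # m # take \<gamma> inner @ rev (drop \<gamma> inner), \<gamma>')})"

inductive bisect :: "('d::finite) mesh \<Rightarrow> 'd mesh \<Rightarrow> bool" where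
  "\<tau> \<in> M \<Longrightarrow> bisect M (M - {\<tau>} \<union> children \<tau>)"

definition is_conforming_refinement :: "('d::finite) mesh \<Rightarrow> 'd mesh \<Rightarrow> bool" where
  "is_conforming_refinement M M' \<longleftrightarrow> bisect\<^sup>*\<^sup>* M M' \<and> conforming M'"

text \<open>\<open>M' = refine(M, R)\<close>. This is a relation since, for \<open>d = 3\<close>, the existence of the coarsest
  refinement depends on the tagging of the initial mesh; uniqueness always holds.\<close>

definition is_refine :: "('d::finite) mesh \<Rightarrow> 'd mesh \<Rightarrow> 'd mesh \<Rightarrow> bool" where
  "is_refine M R M' \<longleftrightarrow>
     is_conforming_refinement M M' \<and> R \<inter> M' = {} \<and>
     (\<forall>M''. is_conforming_refinement M M'' \<and> R \<inter> M'' = {} \<longrightarrow> bisect\<^sup>*\<^sup>* M' M'')"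

definition polynomial_of_degree :: "nat \<Rightarrow> (real ^ 'd \<Rightarrow> real) \<Rightarrow> bool" where
  "polynomial_of_degree m p \<longleftrightarrow>
     (\<exists>c :: ('d \<Rightarrow> nat) \<Rightarrow> real. \<forall>x. p x = (\<Sum>\<alpha> | (\<Sum>i\<in>UNIV. \<alpha> i) \<le> m. c \<alpha> * (\<Prod>i\<in>UNIV. x $ i ^ \<alpha> i)))"

definition fe_space :: "(real ^ 'd) set \<Rightarrow> nat \<Rightarrow> 'd mesh \<Rightarrow> (real ^ 'd \<Rightarrow> real) set" where
  "fe_space \<Omega> m M = {v \<in> H10 \<Omega>. \<forall>\<tau>\<in>M. \<exists>p. polynomial_of_degree m p \<and>
                        (AE x in lebesgue_on (elt \<tau>). v x = p x)}"


section \<open>Assumptions on the data\<close>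

definition RHS :: "(real ^ 'd) set \<Rightarrow> 'd mesh \<Rightarrow>
    (real ^ 'd \<Rightarrow> real) \<Rightarrow> (real ^ 'd \<Rightarrow> real) \<Rightarrow>
    (real ^ 'd \<Rightarrow> real ^ 'd) \<Rightarrow> (real ^ 'd \<Rightarrow> real ^ 'd) \<Rightarrow> bool" where
  "RHS \<Omega> T0 f g fv gv \<longleftrightarrow>
     (CARD('d) \<ge> 2 \<longrightarrow>
       (\<exists>p q. p > real CARD('d) \<and> 1 / q = 1 / p + 1 / real CARD('d) \<and>
          fv \<in> Lp p (lebesgue_on \<Omega>) \<and> gv \<in> Lp p (lebesgue_on \<Omega>) \<and>
          f \<in> Lp q (lebesgue_on \<Omega>) \<and> g \<in> Lp q (lebesgue_on \<Omega>)) \<and>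
       (\<forall>\<tau>\<in>T0. fv \<in> Hdiv (interior (elt \<tau>)) \<and> gv \<in> Hdiv (interior (elt \<tau>)) \<and>
          normal_trace_in_L2 (elt \<tau>) fv \<and> normal_trace_in_L2 (elt \<tau>) gv))"

definition eigenvalues :: "real ^ 'd ^ 'd \<Rightarrow> real set" where
  "eigenvalues B = {s. \<exists>v. v \<noteq> 0 \<and> B *v v = s *\<^sub>R v}"

definition ELL :: "(real ^ 'd) set \<Rightarrow> 'd mesh \<Rightarrow> (real ^ 'd \<Rightarrow> real ^ 'd ^ 'd) \<Rightarrow> bool" where
  "ELL \<Omega> T0 A \<longleftrightarrow>
     A \<in> Linf (lebesgue_on \<Omega>) \<and> (\<forall>x\<in>\<Omega>. transpose (A x) = A x) \<and>
     0 < (INF x\<in>\<Omega>. ereal (Min (eigenvalues (A x)))) \<and>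
     (SUP x\<in>\<Omega>. ereal (Max (eigenvalues (A x)))) < \<infinity> \<and>
     (\<forall>\<tau>\<in>T0. \<forall>i j. (\<lambda>x. A x $ i $ j) \<in> W1inf (interior (elt \<tau>)))"

definition dxi :: "nat \<Rightarrow> ('x \<Rightarrow> real \<Rightarrow> real) \<Rightarrow> 'x \<Rightarrow> real \<Rightarrow> real" where
  "dxi j b x = (deriv ^^ j) (b x)"

definition CAR :: "(real ^ 'd) set \<Rightarrow> (real ^ 'd \<Rightarrow> real \<Rightarrow> real) \<Rightarrow> bool" where
  "CAR \<Omega> b \<longleftrightarrow>
     (\<forall>j \<xi>. (\<lambda>x. dxi j b x \<xi>) \<in> borel_measurable (lebesgue_on \<Omega>)) \<and>
     (\<forall>x\<in>\<Omega>. \<forall>j \<xi>. dxi j b x differentiable at \<xi>)"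

definition MON :: "(real ^ 'd) set \<Rightarrow> (real ^ 'd \<Rightarrow> real \<Rightarrow> real) \<Rightarrow> bool" where
  "MON \<Omega> b \<longleftrightarrow> (\<forall>x\<in>\<Omega>. \<forall>\<xi>. dxi 1 b x \<xi> \<ge> 0 \<and> b x 0 = 0)"

definition CGC :: "(real ^ 'd) set \<Rightarrow> (real ^ 'd \<Rightarrow> real \<Rightarrow> real) \<Rightarrow> bool" where
  "CGC \<Omega> b \<longleftrightarrow>
     (\<exists>n\<ge>2. (CARD('d) = 3 \<longrightarrow> n \<le> 3) \<and>
       (\<exists>R>0. \<forall>x\<in>\<Omega>. \<forall>\<xi>. \<forall>k\<le>n. \<bar>dxi k b x \<xi>\<bar> \<le> R * (1 + \<bar>\<xi>\<bar> ^ (n - k))))"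


section \<open>Primal and dual problem\<close>

definition a_form :: "(real ^ 'd) set \<Rightarrow> (real ^ 'd \<Rightarrow> real ^ 'd ^ 'd) \<Rightarrow>
    (real ^ 'd \<Rightarrow> real) \<Rightarrow> (real ^ 'd \<Rightarrow> real) \<Rightarrow> real" where
  "a_form \<Omega> A v w = (LINT x|lebesgue_on \<Omega>. (A x *v wgrad \<Omega> v x) \<bullet> wgrad \<Omega> w x)"

definition energy_norm ::
    "(real ^ 'd) set \<Rightarrow> (real ^ 'd \<Rightarrow> real ^ 'd ^ 'd) \<Rightarrow> (real ^ 'd \<Rightarrow> real) \<Rightarrow> real" where
  "energy_norm \<Omega> A v = sqrt (a_form \<Omega> A v v)"

definition load :: "(real ^ 'd) set \<Rightarrow> (real ^ 'd \<Rightarrow> real) \<Rightarrow> (real ^ 'd \<Rightarrow> real ^ 'd) \<Rightarrow>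
    (real ^ 'd \<Rightarrow> real) \<Rightarrow> real" where
  "load \<Omega> f fv v =
     (LINT x|lebesgue_on \<Omega>. f x * v x) + (LINT x|lebesgue_on \<Omega>. fv x \<bullet> wgrad \<Omega> v x)"

definition primal_solution ::
    "(real ^ 'd) set \<Rightarrow> (real ^ 'd \<Rightarrow> real ^ 'd ^ 'd) \<Rightarrow> (real ^ 'd \<Rightarrow> real \<Rightarrow> real) \<Rightarrow>
     (real ^ 'd \<Rightarrow> real) \<Rightarrow> (real ^ 'd \<Rightarrow> real ^ 'd) \<Rightarrow>
     (real ^ 'd \<Rightarrow> real) set \<Rightarrow> (real ^ 'd \<Rightarrow> real) \<Rightarrow> bool" where
  "primal_solution \<Omega> A b f fv V u \<longleftrightarrow> u \<in> V \<and>
     (\<forall>v\<in>V. a_form \<Omega> A u v + (LINT x|lebesgue_on \<Omega>. b x (u x) * v x) = load \<Omega> f fv v)"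

definition dual_solution ::
    "(real ^ 'd) set \<Rightarrow> (real ^ 'd \<Rightarrow> real ^ 'd ^ 'd) \<Rightarrow> (real ^ 'd \<Rightarrow> real \<Rightarrow> real) \<Rightarrow>
     (real ^ 'd \<Rightarrow> real) \<Rightarrow> (real ^ 'd \<Rightarrow> real ^ 'd) \<Rightarrow>
     (real ^ 'd \<Rightarrow> real) set \<Rightarrow> (real ^ 'd \<Rightarrow> real) \<Rightarrow> (real ^ 'd \<Rightarrow> real) \<Rightarrow> bool" where
  "dual_solution \<Omega> A b g gv V w z \<longleftrightarrow> z \<in> V \<and>
     (\<forall>v\<in>V. a_form \<Omega> A z v + (LINT x|lebesgue_on \<Omega>. dxi 1 b x (w x) * z x * v x) = load \<Omega> g gv v)"


section \<open>Error estimators\<close>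

text \<open>Norms are extended by \<open>\<infinity>\<close> to residuals that are not square-integrable functions. This can
  only happen for \<open>d = 1\<close>, where \<open>RHS\<close> does not provide an elementwise divergence of the data.\<close>

definition residual_sq ::
    "(real ^ 'd) set \<Rightarrow> (real ^ 'd \<Rightarrow> real) \<Rightarrow> (real ^ 'd \<Rightarrow> real ^ 'd) \<Rightarrow> (real ^ 'd \<Rightarrow> real) \<Rightarrow> ennreal" where
  "residual_sq T f \<sigma> r =
     (if \<sigma> \<in> Hdiv (interior T)
      then \<integral>\<^sup>+x. ennreal ((f x + wdiv (interior T) \<sigma> x - r x)\<^sup>2) \<partial>lebesgue_on (interior T) else \<infinity>)"

definition jump_sq ::
    "(real ^ 'd) set \<Rightarrow> (real ^ 'd) set \<Rightarrow> (real ^ 'd) set \<Rightarrow> (real ^ 'd \<Rightarrow> real ^ 'd) \<Rightarrow> ennreal" where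
  "jump_sq T T' F \<sigma> =
     (if \<exists>\<psi>. has_normal_jump T T' F \<sigma> \<psi>
      then \<integral>\<^sup>+x. ennreal (((SOME \<psi>. has_normal_jump T T' F \<sigma> \<psi>) x)\<^sup>2) \<partial>facet_measure F else \<infinity>)"

definition mesh_size :: "(real ^ 'd) set \<Rightarrow> real" where
  "mesh_size T = measure lebesgue T powr (1 / real CARD('d))"

text \<open>The squared refinement indicator of the element \<open>\<tau>\<close> of the mesh \<open>M\<close>, for source \<open>f\<close>, flux
  \<open>\<sigma>\<close> and reaction term \<open>r\<close>. Up to a null set, the part of the boundary of \<open>elt \<tau>\<close> inside the domain
  consists of the facets shared with another element.\<close>

definition indicator_sq :: "'d mesh \<Rightarrow> (real ^ 'd \<Rightarrow> real) \<Rightarrow> (real ^ 'd \<Rightarrow> real ^ 'd) \<Rightarrow>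
    (real ^ 'd \<Rightarrow> real) \<Rightarrow> 'd tsimplex \<Rightarrow> ennreal" where
  "indicator_sq M f \<sigma> r \<tau> =
     ennreal ((mesh_size (elt \<tau>))\<^sup>2) * residual_sq (elt \<tau>) f \<sigma> r +
     (if CARD('d) = 1 then 0
      else ennreal (mesh_size (elt \<tau>)) *
        (\<Sum>\<tau>'\<in>M - {\<tau>}. \<Sum>F | F facet_of elt \<tau> \<and> F facet_of elt \<tau>'. jump_sq (elt \<tau>) (elt \<tau>') F \<sigma>))"

definition eta_sq ::
    "(real ^ 'd) set \<Rightarrow> (real ^ 'd \<Rightarrow> real ^ 'd ^ 'd) \<Rightarrow> (real ^ 'd \<Rightarrow> real \<Rightarrow> real) \<Rightarrow>
     (real ^ 'd \<Rightarrow> real) \<Rightarrow> (real ^ 'd \<Rightarrow> real ^ 'd) \<Rightarrow>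
     'd mesh \<Rightarrow> 'd mesh \<Rightarrow> (real ^ 'd \<Rightarrow> real) \<Rightarrow> ennreal" where
  "eta_sq \<Omega> A b f fv M U v =
     (\<Sum>\<tau>\<in>U. indicator_sq M f (\<lambda>x. A x *v wgrad \<Omega> v x - fv x) (\<lambda>x. b x (v x)) \<tau>)"

definition zeta_sq ::
    "(real ^ 'd) set \<Rightarrow> (real ^ 'd \<Rightarrow> real ^ 'd ^ 'd) \<Rightarrow> (real ^ 'd \<Rightarrow> real \<Rightarrow> real) \<Rightarrow>
     (real ^ 'd \<Rightarrow> real) \<Rightarrow> (real ^ 'd \<Rightarrow> real ^ 'd) \<Rightarrow>
     'd mesh \<Rightarrow> (real ^ 'd \<Rightarrow> real) \<Rightarrow> 'd mesh \<Rightarrow> (real ^ 'd \<Rightarrow> real) \<Rightarrow> ennreal" where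
  "zeta_sq \<Omega> A b g gv M w U v =
     (\<Sum>\<tau>\<in>U. indicator_sq M g (\<lambda>x. A x *v wgrad \<Omega> v x - gv x) (\<lambda>x. dxi 1 b x (w x) * v x) \<tau>)"


section \<open>Adaptive algorithm\<close>

text \<open>\<open>R\<close> is a set of marked elements of the mesh \<open>M\<close> that satisfies the bulk criterion for the
  squared indicators \<open>\<mu>\<close>, of minimal cardinality up to the factor \<open>Cmark\<close>.\<close>

definition bulk :: "real \<Rightarrow> 'd mesh \<Rightarrow> ('d mesh \<Rightarrow> ennreal) \<Rightarrow> 'd mesh \<Rightarrow> bool" where
  "bulk \<theta> M \<mu> R \<longleftrightarrow> R \<subseteq> M \<and> ennreal \<theta> * \<mu> M \<le> \<mu> R"

definition doerfler_marking ::
    "real \<Rightarrow> ereal \<Rightarrow> 'd mesh \<Rightarrow> ('d mesh \<Rightarrow> ennreal) \<Rightarrow> 'd mesh \<Rightarrow> bool" where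
  "doerfler_marking \<theta> Cmark M \<mu> R \<longleftrightarrow> bulk \<theta> M \<mu> R \<and>
     (Cmark \<noteq> \<infinity> \<longrightarrow>
       (\<forall>R'. bulk \<theta> M \<mu> R' \<longrightarrow> ereal (real (card R)) \<le> Cmark * ereal (real (card R'))))"

definition combined_marking :: "real \<Rightarrow> ereal \<Rightarrow> 'd mesh \<Rightarrow>
    ('d mesh \<Rightarrow> ennreal) \<Rightarrow> ('d mesh \<Rightarrow> ennreal) \<Rightarrow> 'd mesh \<Rightarrow> bool" where
  "combined_marking \<theta> Cmark M \<eta>2 \<zeta>2 R \<longleftrightarrow>
     (\<exists>Ru' Ruz' Ru Ruz.
        doerfler_marking \<theta> Cmark M \<eta>2 Ru' \<and>
        doerfler_marking \<theta> Cmark M (\<lambda>U. \<eta>2 U + \<zeta>2 U) Ruz' \<and>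
        Ru \<subseteq> Ru' \<and> Ruz \<subseteq> Ruz' \<and>
        card Ru = min (card Ru') (card Ruz') \<and> card Ruz = min (card Ru') (card Ruz') \<and>
        R = Ru \<union> Ruz)"

definition adaptive_algorithm ::
    "(real ^ 'd) set \<Rightarrow> (real ^ 'd \<Rightarrow> real ^ 'd ^ 'd) \<Rightarrow> (real ^ 'd \<Rightarrow> real \<Rightarrow> real) \<Rightarrow>
     (real ^ 'd \<Rightarrow> real) \<Rightarrow> (real ^ 'd \<Rightarrow> real ^ 'd) \<Rightarrow>
     (real ^ 'd \<Rightarrow> real) \<Rightarrow> (real ^ 'd \<Rightarrow> real ^ 'd) \<Rightarrow>
     nat \<Rightarrow> real \<Rightarrow> ereal \<Rightarrow> 'd mesh \<Rightarrow>
     (nat \<Rightarrow> 'd mesh) \<Rightarrow> (nat \<Rightarrow> real ^ 'd \<Rightarrow> real) \<Rightarrow> (nat \<Rightarrow> real ^ 'd \<Rightarrow> real) \<Rightarrow> bool" where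
  "adaptive_algorithm \<Omega> A b f fv g gv m \<theta> Cmark T0 T u z \<longleftrightarrow>
     T 0 = T0 \<and>
     (\<forall>l. primal_solution \<Omega> A b f fv (fe_space \<Omega> m (T l)) (u l) \<and>
          dual_solution \<Omega> A b g gv (fe_space \<Omega> m (T l)) (u l) (z l) \<and>
          (\<exists>R. combined_marking \<theta> Cmark (T l)
                 (\<lambda>U. eta_sq \<Omega> A b f fv (T l) U (u l))
                 (\<lambda>U. zeta_sq \<Omega> A b g gv (T l) (u l) U (z l)) R \<and>
               is_refine (T l) R (T (Suc l))))"

end

theory Submission
  imports Defs
begin

text \<open>Since the finite element spaces are nested and the Galerkin solutions minimize a uniformly
  convex energy, \<open>u\<^sub>\<ell>\<close> is a Cauchy sequence in the energy norm. If it does not converge to \<open>u\<close>,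
  then the error is bounded away from zero, and the estimate holds because \<open>u\<^sub>\<ell>\<^sub>+\<^sub>k - u\<^sub>\<ell>\<close> becomes
  arbitrarily small. If it converges to \<open>u\<close>, then Galerkin orthogonality turns the mixed term
  \<open>a(u - u\<^sub>n, u\<^sub>n - u\<^sub>\<ell>)\<close> of the binomial formula into \<open>-\<langle>b(u) - b(u\<^sub>n), u\<^sub>n - u\<^sub>\<ell>\<rangle>\<close>. The normalized errors
  converge weakly to zero, hence strongly in \<open>L\<^sup>2\<close> by Rellich's theorem; with the Sobolev
  embedding, this makes the mixed term small compared with \<open>\<parallel>u - u\<^sub>n\<parallel> \<parallel>u\<^sub>n - u\<^sub>\<ell>\<parallel>\<close>.\<close>

section \<open>Elementary estimates\<close>

text \<open>Two quantitative statements stand in for weak limits. Rellich's theorem enters in the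
  form: for every \<open>\<delta>\<close>, the squared L2 norm of v is at most
  \<open>\<delta>\<close> times its squared energy norm plus a multiple of finitely many squared
  integrals of v over sets Q. Weak convergence of the normalized errors is thus needed only for
  finitely many functionals. Each of them is nearly represented, with respect to the form of the
  equation linearized at u, by a function y in the union of the discrete spaces; as this union need
  not be complete, y is only an approximate minimizer of a quadratic functional. For y and the
  error, Galerkin orthogonality leaves just the Taylor remainder of b, which is quadratic in the
  error and so negligible once the errors tend to zero. All integrability rests on one even exponent
  q + 3 = 2 k, so that products of powers are controlled by pointwise inequalities between
  monomials. For d = 3 the restriction n \<le> 3 makes the exponent 4 sufficient; it lies below the
  critical exponent 6 and comes from a planar inequality on slices.\<close>

lemma power_prod_le_sum3:
  fixes x y z :: real
  assumes "0 \<le> x" "0 \<le> y" "0 \<le> z"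
  shows "x ^ (q + 1) * y * z \<le> x ^ (q + 3) + y ^ (q + 3) + z ^ (q + 3)"
    and "x ^ q * y\<^sup>2 * z \<le> x ^ (q + 3) + y ^ (q + 3) + z ^ (q + 3)"
    and "y * z \<le> 1 + y ^ (q + 3) + z ^ (q + 3)"
    and "y\<^sup>2 * z \<le> 1 + y ^ (q + 3) + z ^ (q + 3)"
proof -
  have *: "x ^ (q + 1) * y * z \<le> x ^ (q + 3) + y ^ (q + 3) + z ^ (q + 3)"
          "x ^ q * y\<^sup>2 * z \<le> x ^ (q + 3) + y ^ (q + 3) + z ^ (q + 3)"
    if "0 \<le> x" "0 \<le> y" "0 \<le> z" for x y z :: real
  proof -
    \<comment> \<open>Both monomials have total degree q + 3, so the largest of the three variables
      dominates them, and its power is one of the summands.\<close>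
    define m where "m = max x (max y z)"
    have m: "x \<le> m" "y \<le> m" "z \<le> m" "0 \<le> m" using that by (auto simp: m_def)
    have le: "m ^ (q + 3) \<le> x ^ (q + 3) + y ^ (q + 3) + z ^ (q + 3)"
      using that unfolding m_def max_def by auto
    have "x ^ (q + 1) * y * z \<le> m ^ (q + 1) * m * m"
      using m that by (intro mult_mono power_mono) auto
    also have "\<dots> = m ^ (q + 3)" by (simp add: power_add power3_eq_cube)
    finally show "x ^ (q + 1) * y * z \<le> x ^ (q + 3) + y ^ (q + 3) + z ^ (q + 3)"
      using le by simp
    have "x ^ q * y\<^sup>2 * z \<le> m ^ q * m\<^sup>2 * m"
      using m that by (intro mult_mono power_mono) auto
    also have "\<dots> = m ^ (q + 3)" by (simp add: power_add power3_eq_cube power2_eq_square)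
    finally show "x ^ q * y\<^sup>2 * z \<le> x ^ (q + 3) + y ^ (q + 3) + z ^ (q + 3)"
      using le by simp
  qed
  show "x ^ (q + 1) * y * z \<le> x ^ (q + 3) + y ^ (q + 3) + z ^ (q + 3)"
    "x ^ q * y\<^sup>2 * z \<le> x ^ (q + 3) + y ^ (q + 3) + z ^ (q + 3)"
    using * assms by auto
  \<comment> \<open>The inequalities without x are the case x = 1.\<close>
  show "y * z \<le> 1 + y ^ (q + 3) + z ^ (q + 3)" "y\<^sup>2 * z \<le> 1 + y ^ (q + 3) + z ^ (q + 3)"
    using *[of 1 y z] assms by auto
qed

lemma power_le_one_plus:
  fixes z :: real
  assumes "0 \<le> z"
  shows "z \<le> 1 + z ^ (q + 3)" and "z\<^sup>2 \<le> 1 + z ^ (q + 3)"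
proof -
  show "z \<le> 1 + z ^ (q + 3)"
    using self_le_power[of z "q+3"] assms by (cases "z \<le> 1") (auto intro: add_increasing2)
  show "z\<^sup>2 \<le> 1 + z ^ (q + 3)"
  proof (cases "z \<le> 1")
    case True
    then have "z\<^sup>2 \<le> 1" using assms by (simp add: power_le_one)
    then show ?thesis using assms by (simp add: add_increasing2)
  next
    case False
    then have "z\<^sup>2 \<le> z ^ (q + 3)" by (intro power_increasing) auto
    then show ?thesis by simp
  qed
qed

lemma power_add_le:
  fixes x y :: real
  assumes "0 \<le> x" "0 \<le> y"
  shows "(x + y) ^ q \<le> 2 ^ q * (x ^ q + y ^ q)"
proof -
  have "(x + y) ^ q \<le> (2 * max x y) ^ q"
    using assms by (intro power_mono) auto
  also have "\<dots> = 2 ^ q * max x y ^ q" by (simp add: power_mult_distrib)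
  also have "max x y ^ q \<le> x ^ q + y ^ q" using assms by (auto simp: max_def)
  finally show ?thesis by simp
qed

text \<open>Rounding \<open>u\<close> down to multiples of 1 / (n + 1) gives functions with
  countably many values. For these the composition is measurable by countable selection, and
  continuity in the second argument passes to the limit.\<close>

lemma borel_measurable_caratheodory:
  fixes h :: "'a \<Rightarrow> real \<Rightarrow> real"
  assumes h: "\<And>\<xi>. (\<lambda>x. h x \<xi>) \<in> borel_measurable M"
    and cont: "\<And>x. x \<in> space M \<Longrightarrow> continuous_on UNIV (h x)"
    and u[measurable]: "u \<in> borel_measurable M"
  shows "(\<lambda>x. h x (u x)) \<in> borel_measurable M"
proof (rule borel_measurable_LIMSEQ_real)
  define r where "r n \<xi> = real_of_int \<lfloor>\<xi> * real (Suc n)\<rfloor> / real (Suc n)" for n and \<xi> :: real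
  show "(\<lambda>x. h x (r n (u x))) \<in> borel_measurable M" for n
  proof -
    have "(\<lambda>x. \<lfloor>u x * real (Suc n)\<rfloor>) \<in> measurable M (count_space UNIV)"
      by measurable
    then have "(\<lambda>x. h x (real_of_int (\<lfloor>u x * real (Suc n)\<rfloor>) / real (Suc n))) \<in> borel_measurable M"
      by (rule measurable_compose_countable[rotated]) (rule h)
    then show ?thesis by (simp add: r_def)
  qed
  fix x assume x: "x \<in> space M"
  have "(\<lambda>n. r n (u x)) \<longlonglongrightarrow> u x"
  proof (rule LIMSEQ_I)
    fix e :: real assume "0 < e"
    then obtain n0 where n0: "inverse (real (Suc n0)) < e" using reals_Archimedean by blast
    have "norm (r n (u x) - u x) < e" if "n \<ge> n0" for n
    proof -
      have "\<bar>real_of_int \<lfloor>u x * real (Suc n)\<rfloor> - u x * real (Suc n)\<bar> \<le> 1"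
        by linarith
      then have "\<bar>r n (u x) - u x\<bar> \<le> 1 / real (Suc n)"
        unfolding r_def by (simp add: divide_simps abs_if split: if_splits)
      also have "\<dots> \<le> inverse (real (Suc n0))" using that by (simp add: divide_simps)
      finally show ?thesis using n0 by simp
    qed
    then show "\<exists>n0. \<forall>n\<ge>n0. norm (r n (u x) - u x) < e" by blast
  qed
  then show "(\<lambda>n. h x (r n (u x))) \<longlonglongrightarrow> h x (u x)"
    using cont[OF x] by (auto simp: continuous_on_eq_continuous_at intro: isCont_tendsto_compose)
qed

lemma abs_integral_le:
  fixes f g :: "'a \<Rightarrow> real"
  assumes "integrable M f" "integrable M g" "\<And>x. x \<in> space M \<Longrightarrow> \<bar>f x\<bar> \<le> g x"
  shows "\<bar>integral\<^sup>L M f\<bar> \<le> integral\<^sup>L M g"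
proof -
  have "\<bar>integral\<^sup>L M f\<bar> \<le> (LINT x|M. \<bar>f x\<bar>)" by simp
  also have "\<dots> \<le> integral\<^sup>L M g" using assms by (intro integral_mono) auto
  finally show ?thesis .
qed

text \<open>The discriminant criterion, including the degenerate case A = 0. It gives the
  Cauchy-Schwarz inequality for forms that are only semidefinite, and with C = 0 it forces the
  linear coefficient to vanish.\<close>

lemma quadratic_nonneg_bound:
  fixes A B C :: real
  assumes "\<And>t. 0 \<le> A * t\<^sup>2 + 2 * B * t + C" "0 \<le> A"
  shows "B\<^sup>2 \<le> A * C"
proof (cases "A = 0")
  case True
  have "B = 0"
  proof (rule ccontr)
    assume "B \<noteq> 0"
    then show False using assms(1)[of "- (C + 1) / (2 * B)"] True by simp
  qed
  then show ?thesis using True by simp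
next
  case False
  then have "0 < A" using assms by simp
  have "0 \<le> A * (A * (- B / A)\<^sup>2 + 2 * B * (- B / A) + C)"
    using assms(1)[of "- B / A"] \<open>0 < A\<close> by (intro mult_nonneg_nonneg) auto
  also have "\<dots> = A * C - B\<^sup>2" using \<open>0 < A\<close> by (simp add: field_simps power2_eq_square)
  finally show ?thesis by simp
qed

text \<open>The antiderivative of g vanishing at 0, rescaled to the unit interval: no case
  distinction on the sign of s is needed, and when g and s depend on a point x, measurability in x
  becomes that of a parameter integral.\<close>

definition primitive :: "(real \<Rightarrow> real) \<Rightarrow> real \<Rightarrow> real" where
  "primitive g s = s * (LINT \<tau>|lborel. indicator {0..1} \<tau> * g (\<tau> * s))"

lemma primitive_antiderivative:
  assumes "continuous_on UNIV g"
  shows "(primitive g has_real_derivative g s) (at s)" and "primitive g 0 = 0"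
proof -
  obtain F where F: "\<And>x. (F has_vector_derivative g x) (at x)"
    using einterval_antiderivative[of "-\<infinity>" "\<infinity>" g] assms
    by (auto simp: continuous_on_eq_continuous_at)
  have eq: "primitive g s = F s - F 0" for s
  proof -
    have "((\<lambda>\<tau>. F (\<tau> * s)) has_real_derivative g (\<tau> * s) * s) (at \<tau> within A)" for \<tau> A
      by (rule DERIV_subset[of _ _ _ UNIV], rule DERIV_chain2[where f=F and g="\<lambda>\<tau>. \<tau> * s"])
        (use F in \<open>auto simp: has_real_derivative_iff_has_vector_derivative intro!: derivative_eq_intros\<close>)
    then have "((\<lambda>\<tau>. F (\<tau> * s)) has_vector_derivative g (\<tau> * s) * s) (at \<tau> within {0..1})" for \<tau>
      by (auto simp: has_real_derivative_iff_has_vector_derivative)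
    then have "has_bochner_integral lborel (\<lambda>x. indicator {0..1} x *\<^sub>R (g (x * s) * s)) (F (1 * s) - F (0 * s))"
      by (intro has_bochner_integral_FTC_Icc) 
        (auto intro!: continuous_intros continuous_on_compose2[OF assms])
    then have "F s - F 0 = (LINT x|lborel. indicator {0..1} x *\<^sub>R (g (x * s) * s))"
      by (simp add: has_bochner_integral_integral_eq)
    also have "\<dots> = s * (LINT x|lborel. indicator {0..1} x * g (x * s))"
      by (subst integral_mult_right_zero[symmetric]) (simp add: ac_simps)
    finally show ?thesis by (simp add: primitive_def)
  qed
  have "((\<lambda>s. F s - F 0) has_real_derivative g s) (at s)"
    using F[of s] by (auto simp: has_real_derivative_iff_has_vector_derivative[symmetric] intro!: derivative_eq_intros)
  then show "(primitive g has_real_derivative g s) (at s)" using eq by presburger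
  show "primitive g 0 = 0" by (simp add: eq)
qed

text \<open>Convexity of the antiderivative of a monotone function: the mean value point lies
  between s and t, so the slope there compares with \<open>g t\<close>.\<close>

lemma primitive_ge_tangent:
  assumes "continuous_on UNIV g" "mono g"
  shows "primitive g s - primitive g t \<ge> g t * (s - t)"
proof (cases s t rule: linorder_cases)
  case less
  then obtain z where z: "s < z" "z < t" "primitive g t - primitive g s = (t - s) * g z"
    using MVT2[OF less, of "primitive g" g] primitive_antiderivative[OF assms(1)] by blast
  have "(t - s) * g z \<le> (t - s) * g t" using less z assms(2) by (intro mult_left_mono) (auto simp: mono_def)
  then show ?thesis using z by (simp add: algebra_simps)
next
  case greater
  then obtain z where z: "t < z" "z < s" "primitive g s - primitive g t = (s - t) * g z"
    using MVT2[OF greater, of "primitive g" g] primitive_antiderivative[OF assms(1)] by blast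
  have "(s - t) * g t \<le> (s - t) * g z" using greater z assms(2) by (intro mult_left_mono) (auto simp: mono_def)
  then show ?thesis using z by (simp add: algebra_simps)
qed auto

lemma borel_measurable_primitive:
  fixes h :: "'a \<Rightarrow> real \<Rightarrow> real"
  assumes h: "\<And>\<xi>. (\<lambda>x. h x \<xi>) \<in> borel_measurable M"
    and cont: "\<And>x. x \<in> space M \<Longrightarrow> continuous_on UNIV (h x)"
    and u[measurable]: "u \<in> borel_measurable M"
  shows "(\<lambda>x. primitive (h x) (u x)) \<in> borel_measurable M"
proof -
  \<comment> \<open>The composition is taken on the product of the x-space with the line of the
    integration variable; the parameter integral in \<open>primitive\<close> is then measurable in
    x.\<close>
  have "(\<lambda>\<omega>. h (fst \<omega>) (snd \<omega> * u (fst \<omega>))) \<in> borel_measurable (M \<Otimes>\<^sub>M lborel)"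
    by (rule borel_measurable_caratheodory[where h="\<lambda>\<omega>. h (fst \<omega>)"])
      (use h cont in \<open>auto simp: space_pair_measure intro!: measurable_compose[OF measurable_fst]\<close>)
  then have [measurable]: "(\<lambda>(x, \<tau>). h x (\<tau> * u x)) \<in> borel_measurable (M \<Otimes>\<^sub>M lborel)"
    by (simp add: case_prod_unfold)
  show ?thesis unfolding primitive_def by measurable
qed

section \<open>Galerkin approximation of semilinear problems\<close>

definition linear_space :: "('a \<Rightarrow> real) set \<Rightarrow> bool" where
  "linear_space X \<longleftrightarrow> (\<lambda>x. 0) \<in> X \<and> (\<forall>v\<in>X. \<forall>w\<in>X. \<forall>s t. (\<lambda>x. s * v x + t * w x) \<in> X)"

lemma linear_space_lincomb:
  "linear_space X \<Longrightarrow> v \<in> X \<Longrightarrow> w \<in> X \<Longrightarrow> (\<lambda>x. s * v x + t * w x) \<in> X"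
  by (simp add: linear_space_def)

lemma linear_space_diff:
  "linear_space X \<Longrightarrow> v \<in> X \<Longrightarrow> w \<in> X \<Longrightarrow> (\<lambda>x. v x - w x) \<in> X"
  using linear_space_lincomb[of X v w 1 "-1"] by simp

lemma linear_space_scale:
  "linear_space X \<Longrightarrow> v \<in> X \<Longrightarrow> (\<lambda>x. s * v x) \<in> X"
  using linear_space_lincomb[of X v v s 0] by simp

text \<open>The elements of V are functions rather than classes, so \<open>a\<close> is only
  semidefinite; \<open>sobolev\<close> turns zero energy into vanishing almost everywhere.
  \<open>compactness\<close> is Rellich's theorem without sequences. The single exponent q + 3
  matches the growth of order q + 1 of the derivative \<open>b1\<close> and of order q of the second
  derivative \<open>b2\<close>: each of them, multiplied by the other factors that occur, has total
  degree q + 3.\<close>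

locale semilinear_problem = finite_measure M
  for M :: "'a measure" +
  fixes V :: "('a \<Rightarrow> real) set"
    and a :: "('a \<Rightarrow> real) \<Rightarrow> ('a \<Rightarrow> real) \<Rightarrow> real"
    and F :: "('a \<Rightarrow> real) \<Rightarrow> real"
    and b b1 b2 :: "'a \<Rightarrow> real \<Rightarrow> real"
    and q :: nat and R S :: real
  assumes V_linear: "linear_space V"
    and V_meas: "\<And>v. v \<in> V \<Longrightarrow> v \<in> borel_measurable M"
    and a_lincomb: "\<And>v w z s t. v \<in> V \<Longrightarrow> w \<in> V \<Longrightarrow> z \<in> V \<Longrightarrow>
          a (\<lambda>x. s * v x + t * w x) z = s * a v z + t * a w z"
    and a_sym: "\<And>v w. v \<in> V \<Longrightarrow> w \<in> V \<Longrightarrow> a v w = a w v"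
    and a_nonneg: "\<And>v. v \<in> V \<Longrightarrow> 0 \<le> a v v"
    and F_lincomb: "\<And>v w s t. v \<in> V \<Longrightarrow> w \<in> V \<Longrightarrow> F (\<lambda>x. s * v x + t * w x) = s * F v + t * F w"
    and sobolev_integrable: "\<And>v. v \<in> V \<Longrightarrow> integrable M (\<lambda>x. \<bar>v x\<bar> ^ (q + 3))"
    and sobolev: "\<And>v. v \<in> V \<Longrightarrow> (LINT x|M. \<bar>v x\<bar> ^ (q + 3)) \<le> S * sqrt (a v v) ^ (q + 3)"
    and compactness: "\<And>\<delta>. 0 < \<delta> \<Longrightarrow> \<exists>J C. finite J \<and> J \<subseteq> sets M \<and> 0 \<le> C \<and>
          (\<forall>v\<in>V. (LINT x|M. (v x)\<^sup>2) \<le> \<delta> * a v v + C * (\<Sum>Q\<in>J. (LINT x|M. indicator Q x * v x)\<^sup>2))"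
    and S_nonneg: "0 \<le> S" and R_nonneg: "0 \<le> R"
    and b_meas: "\<And>\<xi>. (\<lambda>x. b x \<xi>) \<in> borel_measurable M"
    and b1_meas: "\<And>\<xi>. (\<lambda>x. b1 x \<xi>) \<in> borel_measurable M"
    and b_deriv: "\<And>x \<xi>. x \<in> space M \<Longrightarrow> (b x has_real_derivative b1 x \<xi>) (at \<xi>)"
    and b1_deriv: "\<And>x \<xi>. x \<in> space M \<Longrightarrow> (b1 x has_real_derivative b2 x \<xi>) (at \<xi>)"
    and b_zero: "\<And>x. x \<in> space M \<Longrightarrow> b x 0 = 0"
    and b1_nonneg: "\<And>x \<xi>. x \<in> space M \<Longrightarrow> 0 \<le> b1 x \<xi>"
    and b1_bound: "\<And>x \<xi>. x \<in> space M \<Longrightarrow> \<bar>b1 x \<xi>\<bar> \<le> R * (1 + \<bar>\<xi>\<bar> ^ (q + 1))"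
    and b2_bound: "\<And>x \<xi>. x \<in> space M \<Longrightarrow> \<bar>b2 x \<xi>\<bar> \<le> R * (1 + \<bar>\<xi>\<bar> ^ q)"
begin

definition N :: "('a \<Rightarrow> real) \<Rightarrow> real" where "N v = sqrt (a v v)"

abbreviation dif :: "('a \<Rightarrow> real) \<Rightarrow> ('a \<Rightarrow> real) \<Rightarrow> 'a \<Rightarrow> real" where
  "dif v w \<equiv> \<lambda>x. v x - w x"

lemmas V_lincomb = linear_space_lincomb[OF V_linear]
  and V_diff = linear_space_diff[OF V_linear]
  and V_scale = linear_space_scale[OF V_linear]

section \<open>The energy seminorm\<close>

lemma N_nonneg [simp]: "v \<in> V \<Longrightarrow> 0 \<le> N v" by (simp add: N_def a_nonneg)

lemma N_square: "v \<in> V \<Longrightarrow> (N v)\<^sup>2 = a v v" by (simp add: N_def a_nonneg)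

lemma a_lincomb2:
  "v \<in> V \<Longrightarrow> w \<in> V \<Longrightarrow> z \<in> V \<Longrightarrow> a z (\<lambda>x. s * v x + t * w x) = s * a z v + t * a z w"
  using a_lincomb[of v w z s t] by (simp add: V_lincomb a_sym)

lemma a_diff: "v \<in> V \<Longrightarrow> w \<in> V \<Longrightarrow> z \<in> V \<Longrightarrow> a (dif v w) z = a v z - a w z"
  using a_lincomb[of v w z 1 "-1"] by simp

lemma a_diff2: "v \<in> V \<Longrightarrow> w \<in> V \<Longrightarrow> z \<in> V \<Longrightarrow> a z (dif v w) = a z v - a z w"
  using a_lincomb2[of v w z 1 "-1"] by simp

lemma a_scale: "v \<in> V \<Longrightarrow> z \<in> V \<Longrightarrow> a (\<lambda>x. s * v x) z = s * a v z"
  using a_lincomb[of v v z s 0] by simp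

lemma a_scale2: "v \<in> V \<Longrightarrow> z \<in> V \<Longrightarrow> a z (\<lambda>x. s * v x) = s * a z v"
  using a_lincomb2[of v v z s 0] by simp

lemma N_scale: "v \<in> V \<Longrightarrow> N (\<lambda>x. s * v x) = \<bar>s\<bar> * N v"
  by (simp add: N_def a_scale a_scale2 V_scale real_sqrt_mult mult.assoc[symmetric] power2_eq_square[symmetric])

lemma a_cauchy_schwarz: assumes "v \<in> V" "w \<in> V" shows "\<bar>a v w\<bar> \<le> N v * N w"
proof -
  have "0 \<le> a w w * t\<^sup>2 + 2 * a v w * t + a v v" for t
  proof -
    have "0 \<le> a (\<lambda>x. 1 * v x + t * w x) (\<lambda>x. 1 * v x + t * w x)"
      by (intro a_nonneg V_lincomb assms)
    also have "\<dots> = a w w * t\<^sup>2 + 2 * a v w * t + a v v"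
      using assms a_sym[OF assms] by (simp only: a_lincomb a_lincomb2 V_lincomb) (simp add: algebra_simps power2_eq_square)
    finally show ?thesis .
  qed
  then have "(a v w)\<^sup>2 \<le> a w w * a v v"
    by (rule quadratic_nonneg_bound) (rule a_nonneg[OF assms(2)])
  then have "(a v w)\<^sup>2 \<le> (N v * N w)\<^sup>2" using assms by (simp add: power_mult_distrib N_square mult.commute)
  then show ?thesis using assms by (simp add: abs_le_square_iff[symmetric])
qed

lemma N_triangle: assumes "v \<in> V" "w \<in> V" "z \<in> V"
  shows "N (dif v z) \<le> N (dif v w) + N (dif w z)"
proof -
  let ?e = "dif v w" and ?f = "dif w z"
  have V: "?e \<in> V" "?f \<in> V" "dif v z \<in> V" using assms by (auto intro: V_diff)
  have "dif v z = (\<lambda>x. 1 * ?e x + 1 * ?f x)" by auto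
  then have "(N (dif v z))\<^sup>2 = a (\<lambda>x. 1 * ?e x + 1 * ?f x) (\<lambda>x. 1 * ?e x + 1 * ?f x)"
    using N_square[OF V(3)] by metis
  also have "\<dots> = (N ?e)\<^sup>2 + 2 * a ?e ?f + (N ?f)\<^sup>2"
    using V a_sym[OF V(1,2)] by (simp only: a_lincomb a_lincomb2 V_lincomb N_square) (simp add: algebra_simps)
  also have "\<dots> \<le> (N ?e + N ?f)\<^sup>2"
    using a_cauchy_schwarz[OF V(1,2)] by (simp add: power2_sum algebra_simps)
  finally show ?thesis using V by (simp add: abs_le_square_iff[symmetric])
qed

lemma N_minus: assumes "v \<in> V" "w \<in> V" shows "N (dif v w) = N (dif w v)"
  using N_scale[OF V_diff[OF assms], of "-1"] by (simp add: algebra_simps)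

lemma AE_zero: assumes "v \<in> V" "N v = 0" shows "AE x in M. v x = 0"
proof -
  have [measurable]: "v \<in> borel_measurable M" by (rule V_meas) fact
  have "(LINT x|M. \<bar>v x\<bar> ^ (q + 3)) = 0"
    using sobolev[OF assms(1)] assms(2) by (intro antisym integral_nonneg_AE) (auto simp: N_def power_0_left)
  then have "AE x in M. \<bar>v x\<bar> ^ (q + 3) = 0"
    by (subst (asm) integral_nonneg_eq_0_iff_AE) (use sobolev_integrable[OF assms(1)] in auto)
  then show ?thesis by simp
qed

section \<open>Integrals of products, bounded by the Sobolev inequality\<close>

definition P :: "('a \<Rightarrow> real) \<Rightarrow> real" where "P v = (LINT x|M. \<bar>v x\<bar> ^ (q + 3))"

lemma P_bound: "v \<in> V \<Longrightarrow> N v \<le> r \<Longrightarrow> P v \<le> S * r ^ (q + 3)"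
proof -
  assume v: "v \<in> V" "N v \<le> r"
  have "S * N v ^ (q + 3) \<le> S * r ^ (q + 3)"
    by (intro mult_left_mono power_mono) (use v N_nonneg[OF v(1)] S_nonneg in auto)
  then show ?thesis using sobolev[OF v(1)] by (simp add: P_def N_def)
qed

lemma product_integrable:
  assumes "z \<in> V" "v \<in> V" "w \<in> V"
  shows "integrable M (\<lambda>x. (1 + \<bar>z x\<bar> ^ (q + 1)) * \<bar>v x\<bar> * \<bar>w x\<bar>)" (is "integrable M ?f")
    and "(LINT x|M. (1 + \<bar>z x\<bar> ^ (q + 1)) * \<bar>v x\<bar> * \<bar>w x\<bar>) \<le> measure M (space M) + P z + 2 * P v + 2 * P w"
proof -
  have [measurable]: "z \<in> borel_measurable M" "v \<in> borel_measurable M" "w \<in> borel_measurable M"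
    using assms V_meas by auto
  let ?g = "\<lambda>x. 1 + \<bar>z x\<bar> ^ (q + 3) + 2 * \<bar>v x\<bar> ^ (q + 3) + 2 * \<bar>w x\<bar> ^ (q + 3)"
  have g: "integrable M ?g"
    using assms by (intro Bochner_Integration.integrable_add integrable_mult_right sobolev_integrable) auto
  \<comment> \<open>The sum of two monomial inequalities, one for the constant 1 in the weight and
    one for the power of z; hence the coefficients 2.\<close>
  have le: "?f x \<le> ?g x" for x
    using power_prod_le_sum3(1,3)[where x="\<bar>z x\<bar>" and y="\<bar>v x\<bar>" and z="\<bar>w x\<bar>" and q=q] by (simp add: algebra_simps)
  show f: "integrable M ?f"
  proof (rule Bochner_Integration.integrable_bound[OF g])
    have "norm (?f x) \<le> norm (?g x)" for x
      using le[of x] by (simp add: abs_mult)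
    then show "AE x in M. norm (?f x) \<le> norm (?g x)" by simp
  qed measurable
  have "integral\<^sup>L M ?f \<le> integral\<^sup>L M ?g"
    by (rule integral_mono[OF f g le])
  also have "\<dots> = measure M (space M) + P z + 2 * P v + 2 * P w"
    using assms by (simp add: P_def sobolev_integrable)
  finally show "integral\<^sup>L M ?f \<le> measure M (space M) + P z + 2 * P v + 2 * P w" .
qed

text \<open>The bound of \<open>product_integrable\<close> for N z \<le> r and normalized v and w:
  \<open>P z\<close> is at most S r^(q+3), and 2 P v + 2 P w is at most 4 S.\<close>

definition K :: "real \<Rightarrow> real" where "K r = measure M (space M) + S * r ^ (q + 3) + 4 * S"

lemma K_nonneg: "0 \<le> r \<Longrightarrow> 0 \<le> K r" using S_nonneg by (simp add: K_def)

text \<open>By homogeneity, it suffices to consider normalized functions, and for these the pointwise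
  inequality between products and powers is enough.\<close>

lemma product_bound:
  assumes "z \<in> V" "v \<in> V" "w \<in> V" "N z \<le> r"
  shows "(LINT x|M. (1 + \<bar>z x\<bar> ^ (q + 1)) * \<bar>v x\<bar> * \<bar>w x\<bar>) \<le> K r * N v * N w"
proof (cases "N v = 0 \<or> N w = 0")
  case True
  then have "AE x in M. (1 + \<bar>z x\<bar> ^ (q + 1)) * \<bar>v x\<bar> * \<bar>w x\<bar> = 0"
    using AE_zero[OF assms(2)] AE_zero[OF assms(3)] by auto
  then have "(LINT x|M. (1 + \<bar>z x\<bar> ^ (q + 1)) * \<bar>v x\<bar> * \<bar>w x\<bar>) = 0"
    by (rule integral_eq_zero_AE)
  then show ?thesis using True by auto
next
  case False
  then have pos: "0 < N v" "0 < N w" using N_nonneg[OF assms(2)] N_nonneg[OF assms(3)] by auto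
  let ?v = "\<lambda>x. inverse (N v) * v x" and ?w = "\<lambda>x. inverse (N w) * w x"
  have V: "?v \<in> V" "?w \<in> V" using assms by (auto intro: V_scale)
  have 1: "N ?v \<le> 1" "N ?w \<le> 1" using pos assms by (auto simp: N_scale)
  have "(LINT x|M. (1 + \<bar>z x\<bar> ^ (q + 1)) * \<bar>v x\<bar> * \<bar>w x\<bar>) 
      = (LINT x|M. (N v * N w) * ((1 + \<bar>z x\<bar> ^ (q + 1)) * \<bar>?v x\<bar> * \<bar>?w x\<bar>))"
    using pos by (intro Bochner_Integration.integral_cong) (simp_all add: abs_mult field_simps)
  also have "\<dots> = (N v * N w) * (LINT x|M. (1 + \<bar>z x\<bar> ^ (q + 1)) * \<bar>?v x\<bar> * \<bar>?w x\<bar>)"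
    by (rule integral_mult_right_zero)
  also have "\<dots> \<le> (N v * N w) * (measure M (space M) + P z + 2 * P ?v + 2 * P ?w)"
    using pos by (intro mult_left_mono product_integrable assms V) auto
  also have "\<dots> \<le> (N v * N w) * K r"
    unfolding K_def using pos P_bound[OF V(1) 1(1)] P_bound[OF V(2) 1(2)] P_bound[OF assms(1,4)]
    by (intro mult_left_mono) auto
  finally show ?thesis by (simp add: mult_ac)
qed

text \<open>The weight grows like the second derivative of b, and v enters squared: this is the
  shape of a Taylor remainder tested with w.\<close>

lemma square_product_bound:
  assumes "z \<in> V" "v \<in> V" "w \<in> V"
  shows "integrable M (\<lambda>x. (1 + \<bar>z x\<bar> ^ q) * (v x)\<^sup>2 * \<bar>w x\<bar>)" (is "integrable M ?f")
    and "(LINT x|M. (1 + \<bar>z x\<bar> ^ q) * (v x)\<^sup>2 * \<bar>w x\<bar>) \<le> measure M (space M) + P z + 2 * P v + 2 * P w"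
proof -
  have [measurable]: "z \<in> borel_measurable M" "v \<in> borel_measurable M" "w \<in> borel_measurable M"
    using assms V_meas by auto
  let ?g = "\<lambda>x. 1 + \<bar>z x\<bar> ^ (q + 3) + 2 * \<bar>v x\<bar> ^ (q + 3) + 2 * \<bar>w x\<bar> ^ (q + 3)"
  have g: "integrable M ?g"
    using assms by (intro Bochner_Integration.integrable_add integrable_mult_right sobolev_integrable) auto
  have le: "?f x \<le> ?g x" for x
    using power_prod_le_sum3(2,4)[where x="\<bar>z x\<bar>" and y="\<bar>v x\<bar>" and z="\<bar>w x\<bar>" and q=q] by (simp add: algebra_simps)
  show f: "integrable M ?f"
  proof (rule Bochner_Integration.integrable_bound[OF g])
    have "norm (?f x) \<le> norm (?g x)" for x
      using le[of x] by (simp add: abs_mult)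
    then show "AE x in M. norm (?f x) \<le> norm (?g x)" by simp
  qed measurable
  have "integral\<^sup>L M ?f \<le> integral\<^sup>L M ?g"
    by (rule integral_mono[OF f g le])
  also have "\<dots> = measure M (space M) + P z + 2 * P v + 2 * P w"
    using assms by (simp add: P_def sobolev_integrable)
  finally show "integral\<^sup>L M ?f \<le> measure M (space M) + P z + 2 * P v + 2 * P w" .
qed

section \<open>Growth and Taylor estimates for the nonlinearity\<close>

lemma b_cont: "x \<in> space M \<Longrightarrow> continuous_on UNIV (b x)"
  by (auto simp: continuous_on_eq_continuous_at intro: DERIV_isCont b_deriv)

lemma b1_cont: "x \<in> space M \<Longrightarrow> continuous_on UNIV (b1 x)"
  by (auto simp: continuous_on_eq_continuous_at intro: DERIV_isCont b1_deriv)

lemma b_mono: "x \<in> space M \<Longrightarrow> mono (b x)"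
  by (intro monoI DERIV_nonneg_imp_nondecreasing[where f="b x"]) (use b_deriv b1_nonneg in blast)+

lemma b_comp_meas: "v \<in> V \<Longrightarrow> (\<lambda>x. b x (v x)) \<in> borel_measurable M"
  by (rule borel_measurable_caratheodory) (simp_all add: b_meas b_cont V_meas)

lemma b1_comp_meas: "v \<in> V \<Longrightarrow> (\<lambda>x. b1 x (v x)) \<in> borel_measurable M"
  by (rule borel_measurable_caratheodory) (simp_all add: b1_meas b1_cont V_meas)

text \<open>The mean value theorem with the intermediate point located by absolute values instead of
  the order of s and t, which is the form that growth conditions in |z| can use.\<close>

lemma mvt_abs:
  fixes f f' :: "real \<Rightarrow> real"
  assumes "\<And>x. (f has_real_derivative f' x) (at x)"
  obtains z where "f s - f t = (s - t) * f' z" "\<bar>z\<bar> \<le> \<bar>t\<bar> + \<bar>s - t\<bar>" "\<bar>z - t\<bar> \<le> \<bar>s - t\<bar>"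
proof (cases s t rule: linorder_cases)
  case less
  then obtain z where "s < z" "z < t" "f t - f s = (t - s) * f' z"
    using MVT2[OF less, of f f'] assms by blast
  then show ?thesis by (intro that[of z]) (auto simp: algebra_simps)
next
  case greater
  then obtain z where "t < z" "z < s" "f s - f t = (s - t) * f' z"
    using MVT2[OF greater, of f f'] assms by blast
  then show ?thesis by (intro that[of z]) (auto simp: algebra_simps)
next
  case equal
  then show ?thesis by (intro that[of t]) auto
qed

text \<open>Written in t and s - t because t will be u(x) and s - t the negative error at x. The
  power of 2 comes from splitting the power of |t| + |s - t| that bounds the intermediate
  point.\<close>

lemma b_diff_bound:
  assumes "x \<in> space M"
  shows "\<bar>b x s - b x t\<bar> \<le> 2 ^ (q + 1) * R * (1 + \<bar>t\<bar> ^ (q + 1) + \<bar>s - t\<bar> ^ (q + 1)) * \<bar>s - t\<bar>"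
proof -
  obtain z where z: "b x s - b x t = (s - t) * b1 x z" "\<bar>z\<bar> \<le> \<bar>t\<bar> + \<bar>s - t\<bar>"
    using mvt_abs[of "b x" "b1 x" s t] b_deriv[OF assms] by blast
  have "\<bar>b1 x z\<bar> \<le> R * (1 + \<bar>z\<bar> ^ (q + 1))" by (rule b1_bound[OF assms])
  also have "\<dots> \<le> R * (2 ^ (q + 1) + 2 ^ (q + 1) * (\<bar>t\<bar> ^ (q + 1) + \<bar>s - t\<bar> ^ (q + 1)))"
  proof (intro mult_left_mono add_mono R_nonneg)
    have "\<bar>z\<bar> ^ (q + 1) \<le> (\<bar>t\<bar> + \<bar>s - t\<bar>) ^ (q + 1)" using z by (intro power_mono) auto
    also have "\<dots> \<le> 2 ^ (q + 1) * (\<bar>t\<bar> ^ (q + 1) + \<bar>s - t\<bar> ^ (q + 1))" by (intro power_add_le) auto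
    finally show "\<bar>z\<bar> ^ (q + 1) \<le> 2 ^ (q + 1) * (\<bar>t\<bar> ^ (q + 1) + \<bar>s - t\<bar> ^ (q + 1))" .
  qed (rule one_le_power, simp)
  finally have "\<bar>b1 x z\<bar> \<le> 2 ^ (q + 1) * R * (1 + \<bar>t\<bar> ^ (q + 1) + \<bar>s - t\<bar> ^ (q + 1))"
    by (simp add: algebra_simps)
  then have "\<bar>b1 x z\<bar> * \<bar>s - t\<bar> \<le> 2 ^ (q + 1) * R * (1 + \<bar>t\<bar> ^ (q + 1) + \<bar>s - t\<bar> ^ (q + 1)) * \<bar>s - t\<bar>"
    by (intro mult_right_mono) auto
  then show ?thesis using z by (simp add: abs_mult mult.commute)
qed

text \<open>Two successive mean values, first for b and then for its derivative between t and the
  first intermediate point, yield the quadratic remainder with the growth of the second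
  derivative.\<close>

lemma b_taylor:
  assumes "x \<in> space M"
  shows "\<bar>b1 x t * (s - t) - (b x s - b x t)\<bar> \<le> 2 ^ q * R * (1 + \<bar>t\<bar> ^ q + \<bar>s - t\<bar> ^ q) * (s - t)\<^sup>2"
proof -
  obtain z where z: "b x s - b x t = (s - t) * b1 x z" "\<bar>z - t\<bar> \<le> \<bar>s - t\<bar>"
    using mvt_abs[of "b x" "b1 x" s t] b_deriv[OF assms] by blast
  obtain y where y: "b1 x z - b1 x t = (z - t) * b2 x y" "\<bar>y\<bar> \<le> \<bar>t\<bar> + \<bar>z - t\<bar>"
    using mvt_abs[of "b1 x" "b2 x" z t] b1_deriv[OF assms] by blast
  have "\<bar>b2 x y\<bar> \<le> R * (1 + \<bar>y\<bar> ^ q)" by (rule b2_bound[OF assms])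
  also have "\<dots> \<le> R * (2 ^ q + 2 ^ q * (\<bar>t\<bar> ^ q + \<bar>s - t\<bar> ^ q))"
  proof (intro mult_left_mono add_mono R_nonneg)
    have "\<bar>y\<bar> ^ q \<le> (\<bar>t\<bar> + \<bar>s - t\<bar>) ^ q" using z y by (intro power_mono) auto
    also have "\<dots> \<le> 2 ^ q * (\<bar>t\<bar> ^ q + \<bar>s - t\<bar> ^ q)" by (intro power_add_le) auto
    finally show "\<bar>y\<bar> ^ q \<le> 2 ^ q * (\<bar>t\<bar> ^ q + \<bar>s - t\<bar> ^ q)" .
  qed (rule one_le_power, simp)
  finally have *: "\<bar>b2 x y\<bar> \<le> 2 ^ q * R * (1 + \<bar>t\<bar> ^ q + \<bar>s - t\<bar> ^ q)"
    by (simp add: algebra_simps)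
  have "b1 x t * (s - t) - (b x s - b x t) = - (s - t) * ((z - t) * b2 x y)"
    unfolding z(1) y(1)[symmetric] by (simp add: algebra_simps)
  then have "\<bar>b1 x t * (s - t) - (b x s - b x t)\<bar> = \<bar>s - t\<bar> * \<bar>z - t\<bar> * \<bar>b2 x y\<bar>"
    by (simp only: abs_mult abs_minus_cancel mult.assoc)
  also have "\<dots> \<le> \<bar>s - t\<bar> * \<bar>s - t\<bar> * (2 ^ q * R * (1 + \<bar>t\<bar> ^ q + \<bar>s - t\<bar> ^ q))"
    using z * by (intro mult_mono) auto
  finally show ?thesis by (simp add: power2_eq_square mult_ac)
qed

lemma b_bound: "x \<in> space M \<Longrightarrow> \<bar>b x s\<bar> \<le> R * (1 + \<bar>s\<bar> ^ (q + 1)) * \<bar>s\<bar>"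
proof -
  assume x: "x \<in> space M"
  obtain z where z: "b x s - b x 0 = (s - 0) * b1 x z" "\<bar>z\<bar> \<le> \<bar>0\<bar> + \<bar>s - 0\<bar>"
    using mvt_abs[of "b x" "b1 x" s 0] b_deriv[OF x] by blast
  have "\<bar>b1 x z\<bar> \<le> R * (1 + \<bar>z\<bar> ^ (q + 1))" by (rule b1_bound[OF x])
  also have "\<dots> \<le> R * (1 + \<bar>s\<bar> ^ (q + 1))"
    using z by (intro mult_left_mono add_mono power_mono R_nonneg) auto
  finally have "\<bar>b1 x z\<bar> * \<bar>s\<bar> \<le> R * (1 + \<bar>s\<bar> ^ (q + 1)) * \<bar>s\<bar>" by (intro mult_right_mono) auto
  then show ?thesis using z b_zero[OF x] by (simp add: abs_mult mult.commute)
qed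

lemma b_integrable:
  assumes "w \<in> V" "v \<in> V"
  shows "integrable M (\<lambda>x. b x (w x) * v x)"
proof (rule Bochner_Integration.integrable_bound)
  show "integrable M (\<lambda>x. R * ((1 + \<bar>w x\<bar> ^ (q + 1)) * \<bar>w x\<bar> * \<bar>v x\<bar>))"
    by (intro integrable_mult_right product_integrable assms)
  show "(\<lambda>x. b x (w x) * v x) \<in> borel_measurable M"
    using b_comp_meas[OF assms(1)] V_meas[OF assms(2)] by measurable
  have "norm (b x (w x) * v x) \<le> norm (R * ((1 + \<bar>w x\<bar> ^ (q + 1)) * \<bar>w x\<bar> * \<bar>v x\<bar>))"
    if "x \<in> space M" for x
  proof -
    have "\<bar>b x (w x)\<bar> * \<bar>v x\<bar> \<le> (R * (1 + \<bar>w x\<bar> ^ (q + 1)) * \<bar>w x\<bar>) * \<bar>v x\<bar>"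
      by (intro mult_right_mono b_bound that) auto
    then show ?thesis using R_nonneg by (simp add: abs_mult mult_ac)
  qed
  then show "AE x in M. norm (b x (w x) * v x) \<le> norm (R * ((1 + \<bar>w x\<bar> ^ (q + 1)) * \<bar>w x\<bar> * \<bar>v x\<bar>))" by simp
qed

lemma b1_integrable:
  assumes "z \<in> V" "w \<in> V" "v \<in> V"
  shows "integrable M (\<lambda>x. b1 x (z x) * w x * v x)"
proof (rule Bochner_Integration.integrable_bound)
  show "integrable M (\<lambda>x. R * ((1 + \<bar>z x\<bar> ^ (q + 1)) * \<bar>w x\<bar> * \<bar>v x\<bar>))"
    by (intro integrable_mult_right product_integrable assms)
  show "(\<lambda>x. b1 x (z x) * w x * v x) \<in> borel_measurable M"
    using b1_comp_meas[OF assms(1)] V_meas[OF assms(2)] V_meas[OF assms(3)] by measurable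
  have "norm (b1 x (z x) * w x * v x) \<le> norm (R * ((1 + \<bar>z x\<bar> ^ (q + 1)) * \<bar>w x\<bar> * \<bar>v x\<bar>))"
    if "x \<in> space M" for x
  proof -
    have "\<bar>b1 x (z x)\<bar> * \<bar>w x\<bar> * \<bar>v x\<bar> \<le> (R * (1 + \<bar>z x\<bar> ^ (q + 1))) * \<bar>w x\<bar> * \<bar>v x\<bar>"
      by (intro mult_right_mono b1_bound that) auto
    then show ?thesis using R_nonneg by (simp add: abs_mult mult_ac)
  qed
  then show "AE x in M. norm (b1 x (z x) * w x * v x) \<le> norm (R * ((1 + \<bar>z x\<bar> ^ (q + 1)) * \<bar>w x\<bar> * \<bar>v x\<bar>))" by simp
qed

lemma primitive_integrable:
  assumes "v \<in> V" shows "integrable M (\<lambda>x. primitive (b x) (v x))"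
proof (rule Bochner_Integration.integrable_bound)
  show "integrable M (\<lambda>x. b x (v x) * v x)" by (intro b_integrable assms)
  show "(\<lambda>x. primitive (b x) (v x)) \<in> borel_measurable M"
    by (rule borel_measurable_primitive) (simp_all add: b_meas b_cont V_meas assms)
  \<comment> \<open>The tangents at \<open>v x\<close> and at 0 enclose the antiderivative between 0
    and b(x, v) v.\<close>
  have "norm (primitive (b x) (v x)) \<le> norm (b x (v x) * v x)" if "x \<in> space M" for x
    using primitive_ge_tangent[OF b_cont[OF that] b_mono[OF that], where t = "v x" and s = 0]
      primitive_ge_tangent[OF b_cont[OF that] b_mono[OF that], where t = 0 and s = "v x"]
      primitive_antiderivative(2)[OF b_cont[OF that]] b_zero[OF that]
    by auto
  then show "AE x in M. norm (primitive (b x) (v x)) \<le> norm (b x (v x) * v x)" by simp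
qed

section \<open>The convex energy and its minimizers\<close>

definition energy :: "('a \<Rightarrow> real) \<Rightarrow> real" where
  "energy v = a v v / 2 + (LINT x|M. primitive (b x) (v x)) - F v"

definition solves :: "('a \<Rightarrow> real) set \<Rightarrow> ('a \<Rightarrow> real) \<Rightarrow> bool" where
  "solves X w \<longleftrightarrow> w \<in> X \<and> (\<forall>v\<in>X. a w v + (LINT x|M. b x (w x) * v x) = F v)"

text \<open>The quadratic part of the energy contributes exactly half of the squared distance. What
  remains is bounded below by its linearization at w (convexity of the antiderivative), and this
  first-order part cancels by the equation for w tested with v - w.\<close>

lemma energy_gap:
  assumes "solves X w" "linear_space X" "X \<subseteq> V" "v \<in> X"
  shows "energy v - energy w \<ge> (N (dif v w))\<^sup>2 / 2"
proof -
  have V: "v \<in> V" "w \<in> V" and X: "dif v w \<in> X" using assms by (auto simp: solves_def intro: linear_space_diff)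
  then have D: "dif v w \<in> V" using assms by auto
  have "(LINT x|M. primitive (b x) (v x)) - (LINT x|M. primitive (b x) (w x))
    = (LINT x|M. primitive (b x) (v x) - primitive (b x) (w x))"
    by (intro Bochner_Integration.integral_diff[symmetric] primitive_integrable V)
  also have "\<dots> \<ge> (LINT x|M. b x (w x) * (v x - w x))"
    by (intro integral_mono b_integrable[OF V(2) D] Bochner_Integration.integrable_diff primitive_integrable V
        primitive_ge_tangent b_cont b_mono)
  finally have 1: "(LINT x|M. primitive (b x) (v x)) - (LINT x|M. primitive (b x) (w x))
      \<ge> (LINT x|M. b x (w x) * (v x - w x))" .
  have 2: "a w (dif v w) + (LINT x|M. b x (w x) * (v x - w x)) = F v - F w"
    using assms(1) X F_lincomb[OF V, of 1 "-1"] by (auto simp: solves_def)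
  have 3: "(N (dif v w))\<^sup>2 = a v v - 2 * a w v + a w w"
    using V D a_sym[OF V] by (simp add: N_square a_diff a_diff2)
  have 4: "a w (dif v w) = a w v - a w w" using V by (simp add: a_diff2)
  show ?thesis unfolding energy_def using 1 2 3 4 by (simp add: field_simps)
qed

section \<open>Low-order norms and unbounded weights\<close>

lemma V_integrable:
  assumes "v \<in> V"
  shows "integrable M v" "integrable M (\<lambda>x. (v x)\<^sup>2)"
proof -
  have [measurable]: "v \<in> borel_measurable M" by (rule V_meas) fact
  have g: "integrable M (\<lambda>x. 1 + \<bar>v x\<bar> ^ (q + 3))" using assms by (simp add: sobolev_integrable)
  show "integrable M v" "integrable M (\<lambda>x. (v x)\<^sup>2)"
    using power_le_one_plus[where z="\<bar>v x\<bar>" and q=q for x]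
    by (auto intro!: Bochner_Integration.integrable_bound[OF g])
qed

text \<open>Makes each functional \<open>v \<mapsto> \<integral>\<^sub>Q v\<close> bounded in the
  energy norm, so that it can be represented approximately. By homogeneity it suffices to integrate
  t \<le> 1 + t^(q+3) for a normalized function.\<close>

lemma L1_bound:
  assumes "v \<in> V"
  shows "(LINT x|M. \<bar>v x\<bar>) \<le> (measure M (space M) + S) * N v"
proof (cases "N v = 0")
  case True
  then have "(LINT x|M. \<bar>v x\<bar>) = 0" using AE_zero[OF assms] by (intro integral_eq_zero_AE) auto
  then show ?thesis using True by simp
next
  case False
  then have pos: "0 < N v" using N_nonneg[OF assms] by simp
  let ?v = "\<lambda>x. inverse (N v) * v x"
  have V: "?v \<in> V" using assms by (rule V_scale)
  have P1: "P ?v \<le> S * 1 ^ (q + 3)" by (rule P_bound[OF V]) (use pos assms in \<open>simp add: N_scale\<close>)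
  have "(LINT x|M. \<bar>v x\<bar>) = N v * (LINT x|M. \<bar>?v x\<bar>)"
    using pos by (subst integral_mult_right_zero[symmetric], intro Bochner_Integration.integral_cong) (auto simp: abs_mult)
  also have "(LINT x|M. \<bar>?v x\<bar>) \<le> (LINT x|M. 1 + \<bar>?v x\<bar> ^ (q + 3))"
    using V_integrable(1)[OF V] sobolev_integrable[OF V] power_le_one_plus(1)[where z="\<bar>?v x\<bar>" and q=q for x]
    by (intro integral_mono Bochner_Integration.integrable_add integrable_abs) auto
  also have "\<dots> = measure M (space M) + P ?v" using sobolev_integrable[OF V] by (simp add: P_def)
  also have "\<dots> \<le> measure M (space M) + S" using P1 by simp
  finally show ?thesis using pos by (simp add: mult_ac mult_left_mono)
qed

text \<open>Whichever of x and \<eta> y is the larger absorbs the other. A small \<eta> puts a small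
  factor on the power of y at the price of a large one on the power of x.\<close>

lemma young_weighted:
  fixes x y \<eta> :: real
  assumes "0 \<le> x" "0 \<le> y" "0 < \<eta>"
  shows "x ^ (q + 1) * y\<^sup>2 \<le> x ^ (q + 3) / \<eta>\<^sup>2 + \<eta> ^ (q + 1) * y ^ (q + 3)"
proof (cases "\<eta> * y \<le> x")
  case True
  then have "(\<eta> * y)\<^sup>2 \<le> x\<^sup>2" using assms by (intro power_mono) auto
  then have "y\<^sup>2 \<le> x\<^sup>2 / \<eta>\<^sup>2" using assms by (simp add: field_simps power_mult_distrib)
  then have "x ^ (q + 1) * y\<^sup>2 \<le> x ^ (q + 1) * (x\<^sup>2 / \<eta>\<^sup>2)" using assms by (intro mult_left_mono) auto
  also have "\<dots> = x ^ (q + 3) / \<eta>\<^sup>2" by (simp add: power_add power3_eq_cube power2_eq_square)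
  finally show ?thesis using assms by (simp add: add_increasing2)
next
  case False
  then have "x ^ (q + 1) * y\<^sup>2 \<le> (\<eta> * y) ^ (q + 1) * y\<^sup>2"
    using assms by (intro mult_right_mono power_mono) auto
  also have "\<dots> = \<eta> ^ (q + 1) * y ^ (q + 3)"
    by (simp add: power_add power3_eq_cube power2_eq_square power_mult_distrib)
  finally show ?thesis using assms by (simp add: add_increasing)
qed

lemma weight_integrable:
  assumes "u \<in> V" "e \<in> V"
  shows "integrable M (\<lambda>x. \<bar>u x\<bar> ^ (q + 1) * (e x)\<^sup>2)"
proof -
  have [measurable]: "u \<in> borel_measurable M" "e \<in> borel_measurable M" using V_meas assms by auto
  have "\<bar>u x\<bar> ^ (q + 1) * (e x)\<^sup>2 \<le> (1 + \<bar>u x\<bar> ^ (q + 1)) * \<bar>e x\<bar> * \<bar>e x\<bar>" for x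
    by (cases "e x \<ge> 0") (simp_all add: algebra_simps power2_eq_square)
  then show ?thesis
    by (intro Bochner_Integration.integrable_bound[OF product_integrable(1)[OF assms(1,2,2)]])
      (auto simp: abs_mult)
qed

text \<open>Where |u| is at most L, the weight is at most L^(q+1). Where it is larger, Young's
  inequality trades the product for the tail of |u|^(q+3), which is small for large L by dominated
  convergence, and for a small multiple of |e|^(q+3). The constant depends on u and \<delta> but not
  on e.\<close>

lemma weight_bound:
  assumes u: "u \<in> V" and "0 < \<delta>"
  shows "\<exists>C\<ge>0. \<forall>e\<in>V. (LINT x|M. \<bar>u x\<bar> ^ (q + 1) * (e x)\<^sup>2) \<le> C * (LINT x|M. (e x)\<^sup>2) + \<delta> * (N e)\<^sup>2"
proof -
  have [measurable]: "u \<in> borel_measurable M" by (rule V_meas[OF u])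
  \<comment> \<open>Small enough that the Sobolev bound of the last term, \<eta>^(q+1) S, is at most
    \<delta> / 2; the minimum with 1 allows \<eta>^(q+1) \<le> \<eta>, and S + 1 avoids dividing by
    zero.\<close>
  define \<eta> where "\<eta> = min 1 (\<delta> / (2 * (S + 1)))"
  have \<eta>: "0 < \<eta>" "\<eta> \<le> 1" "\<eta> * S \<le> \<delta> / 2"
  proof -
    show "0 < \<eta>" "\<eta> \<le> 1" using S_nonneg assms(2) by (auto simp: \<eta>_def)
    have "\<eta> * S \<le> \<delta> / (2 * (S + 1)) * (S + 1)" using S_nonneg assms(2) by (intro mult_mono) (auto simp: \<eta>_def)
    also have "\<dots> = \<delta> / 2" using S_nonneg by (simp add: field_simps)
    finally show "\<eta> * S \<le> \<delta> / 2" .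
  qed
  have \<eta>q: "\<eta> ^ (q + 1) * S \<le> \<delta> / 2"
  proof -
    have "\<eta> ^ (q + 1) \<le> \<eta> ^ 1" using \<eta> by (intro power_decreasing) auto
    then have "\<eta> ^ (q + 1) * S \<le> \<eta> * S" using S_nonneg by (intro mult_right_mono) auto
    then show ?thesis using \<eta> by linarith
  qed
  \<comment> \<open>The tail of the integrand |u|^(q+3) beyond level L. It will be divided by
    \<eta>^2, so it is made smaller than \<eta>^2 \<delta> / 2.\<close>
  define g where "g L x = indicator {x. \<bar>u x\<bar> > L} x * \<bar>u x\<bar> ^ (q + 3)" for L x
  have gm [measurable]: "g L \<in> borel_measurable M" for L
    unfolding g_def by measurable
  have g_int: "integrable M (g L)" for L
    by (rule Bochner_Integration.integrable_bound[OF sobolev_integrable[OF u]])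
      (auto simp: g_def indicator_def)
  have "(\<lambda>n::nat. integral\<^sup>L M (g (real n))) \<longlonglongrightarrow> (LINT x|M. 0)"
  proof (rule integral_dominated_convergence[where w="\<lambda>x. \<bar>u x\<bar> ^ (q + 3)"])
    show "AE x in M. (\<lambda>n. g (real n) x) \<longlonglongrightarrow> 0"
    proof (rule AE_I2)
      fix x
      obtain n0 :: nat where "\<bar>u x\<bar> \<le> real n0" using real_arch_simple by blast
      then have "g (real n) x = 0" if "n \<ge> n0" for n using that by (auto simp: g_def)
      then show "(\<lambda>n. g (real n) x) \<longlonglongrightarrow> 0"
        by (intro tendsto_eventually) (auto simp: eventually_sequentially)
    qed
  qed (auto simp: sobolev_integrable[OF u], auto simp: g_def indicator_def)
  then have "\<forall>\<^sub>F n in sequentially. integral\<^sup>L M (g (real n)) < \<eta>\<^sup>2 * (\<delta> / 2)"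
    using \<eta> assms(2) by (intro order_tendstoD(2)) auto
  then obtain L :: nat where L: "integral\<^sup>L M (g (real L)) < \<eta>\<^sup>2 * (\<delta> / 2)"
    by (auto simp: eventually_sequentially)
  let ?C = "real L ^ (q + 1)"
  \<comment> \<open>On the unit ball of the energy norm the (q+3)-th powers of e are controlled by
    S. The general claim follows because it is homogeneous of degree two in e.\<close>
  have main: "(LINT x|M. \<bar>u x\<bar> ^ (q + 1) * (e x)\<^sup>2) \<le> ?C * (LINT x|M. (e x)\<^sup>2) + \<delta>"
    if e: "e \<in> V" "N e \<le> 1" for e
  proof -
    have le: "\<bar>u x\<bar> ^ (q + 1) * (e x)\<^sup>2 \<le> ?C * (e x)\<^sup>2 + (g L x / \<eta>\<^sup>2 + \<eta> ^ (q + 1) * \<bar>e x\<bar> ^ (q + 3))" for x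
    proof (cases "\<bar>u x\<bar> > L")
      case True
      have "\<bar>u x\<bar> ^ (q + 1) * \<bar>e x\<bar>\<^sup>2 \<le> g L x / \<eta>\<^sup>2 + \<eta> ^ (q + 1) * \<bar>e x\<bar> ^ (q + 3)"
        using young_weighted[of "\<bar>u x\<bar>" "\<bar>e x\<bar>" \<eta>] True \<eta> by (simp add: g_def)
      moreover have "0 \<le> ?C * (e x)\<^sup>2" by simp
      ultimately show ?thesis by (simp only: power2_abs)
    next
      case False
      then have "\<bar>u x\<bar> ^ (q + 1) * (e x)\<^sup>2 \<le> ?C * (e x)\<^sup>2" by (intro mult_right_mono power_mono) auto
      then show ?thesis using \<eta> False by (simp add: g_def add_increasing2)
    qed
    have "(LINT x|M. \<bar>u x\<bar> ^ (q + 1) * (e x)\<^sup>2) 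
        \<le> (LINT x|M. ?C * (e x)\<^sup>2 + (g L x / \<eta>\<^sup>2 + \<eta> ^ (q + 1) * \<bar>e x\<bar> ^ (q + 3)))"
      by (intro integral_mono weight_integrable u e le Bochner_Integration.integrable_add
          integrable_mult_right V_integrable sobolev_integrable integrable_divide g_int)
    also have "\<dots> = ?C * (LINT x|M. (e x)\<^sup>2) + (integral\<^sup>L M (g L) / \<eta>\<^sup>2 + \<eta> ^ (q + 1) * P e)"
      by (simp add: P_def V_integrable e sobolev_integrable g_int)
    also have "\<dots> \<le> ?C * (LINT x|M. (e x)\<^sup>2) + (\<delta> / 2 + \<delta> / 2)"
    proof (intro add_mono order_refl)
      show "integral\<^sup>L M (g L) / \<eta>\<^sup>2 \<le> \<delta> / 2" using L \<eta> by (simp add: field_simps)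
      have "P e \<le> S * 1 ^ (q + 3)" by (rule P_bound[OF e])
      then have "\<eta> ^ (q + 1) * P e \<le> \<eta> ^ (q + 1) * S" using \<eta> by (intro mult_left_mono) auto
      then show "\<eta> ^ (q + 1) * P e \<le> \<delta> / 2" using \<eta>q by linarith
    qed
    finally show ?thesis by simp
  qed
  have "(LINT x|M. \<bar>u x\<bar> ^ (q + 1) * (e x)\<^sup>2) \<le> ?C * (LINT x|M. (e x)\<^sup>2) + \<delta> * (N e)\<^sup>2" if e: "e \<in> V" for e
  proof (cases "N e = 0")
    case True
    then have "(LINT x|M. \<bar>u x\<bar> ^ (q + 1) * (e x)\<^sup>2) = 0"
      using AE_zero[OF e] by (intro integral_eq_zero_AE) auto
    then show ?thesis using True by simp
  next
    case False
    then have pos: "0 < N e" using N_nonneg[OF e] by simp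
    let ?e = "\<lambda>x. inverse (N e) * e x"
    have V: "?e \<in> V" using e by (rule V_scale)
    have "(LINT x|M. \<bar>u x\<bar> ^ (q + 1) * (e x)\<^sup>2) = (N e)\<^sup>2 * (LINT x|M. \<bar>u x\<bar> ^ (q + 1) * (?e x)\<^sup>2)"
      using pos by (subst integral_mult_right_zero[symmetric], intro Bochner_Integration.integral_cong)
        (simp_all add: power_mult_distrib field_simps)
    also have "\<dots> \<le> (N e)\<^sup>2 * (?C * (LINT x|M. (?e x)\<^sup>2) + \<delta>)"
      by (intro mult_left_mono main V) (use pos e in \<open>simp_all add: N_scale\<close>)
    also have "(LINT x|M. (?e x)\<^sup>2) = (LINT x|M. (e x)\<^sup>2) / (N e)\<^sup>2"
      by (simp add: power_mult_distrib field_simps)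
    also have "(N e)\<^sup>2 * (?C * ((LINT x|M. (e x)\<^sup>2) / (N e)\<^sup>2) + \<delta>)
        = ?C * (LINT x|M. (e x)\<^sup>2) + \<delta> * (N e)\<^sup>2"
      using pos by (simp add: distrib_left mult_ac)
    finally show ?thesis .
  qed
  then show ?thesis by (intro exI[of _ ?C]) auto
qed

section \<open>The bilinear form of the problem linearized at u\<close>

definition B :: "('a \<Rightarrow> real) \<Rightarrow> ('a \<Rightarrow> real) \<Rightarrow> ('a \<Rightarrow> real) \<Rightarrow> real" where
  "B u v w = a v w + (LINT x|M. b1 x (u x) * v x * w x)"

lemma B_lincomb:
  assumes "u \<in> V" "v \<in> V" "w \<in> V" "z \<in> V"
  shows "B u (\<lambda>x. s * v x + t * w x) z = s * B u v z + t * B u w z"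
proof -
  have "(LINT x|M. b1 x (u x) * (s * v x + t * w x) * z x)
      = (LINT x|M. s * (b1 x (u x) * v x * z x) + t * (b1 x (u x) * w x * z x))"
    by (intro Bochner_Integration.integral_cong) (simp_all add: algebra_simps)
  also have "\<dots> = s * (LINT x|M. b1 x (u x) * v x * z x) + t * (LINT x|M. b1 x (u x) * w x * z x)"
    using b1_integrable[OF assms(1,2,4)] b1_integrable[OF assms(1,3,4)] by simp
  finally show ?thesis using assms by (simp add: B_def a_lincomb algebra_simps)
qed

lemma B_sym: "v \<in> V \<Longrightarrow> w \<in> V \<Longrightarrow> B u v w = B u w v"
  by (simp add: B_def a_sym mult_ac)

lemma B_lincomb2:
  "u \<in> V \<Longrightarrow> v \<in> V \<Longrightarrow> w \<in> V \<Longrightarrow> z \<in> V \<Longrightarrow> B u z (\<lambda>x. s * v x + t * w x) = s * B u z v + t * B u z w"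
  using B_lincomb[of u v w z s t] by (simp add: V_lincomb B_sym)

lemma B_bound:
  assumes "u \<in> V" "v \<in> V" "w \<in> V"
  shows "\<bar>B u v w\<bar> \<le> (1 + R * K (N u)) * N v * N w"
proof -
  have "\<bar>LINT x|M. b1 x (u x) * v x * w x\<bar> \<le> (LINT x|M. R * ((1 + \<bar>u x\<bar> ^ (q + 1)) * \<bar>v x\<bar> * \<bar>w x\<bar>))"
  proof (rule abs_integral_le)
    show "integrable M (\<lambda>x. b1 x (u x) * v x * w x)" by (intro b1_integrable assms)
    show "integrable M (\<lambda>x. R * ((1 + \<bar>u x\<bar> ^ (q + 1)) * \<bar>v x\<bar> * \<bar>w x\<bar>))"
      by (intro integrable_mult_right product_integrable assms)
    fix x assume x: "x \<in> space M"
    have "\<bar>b1 x (u x)\<bar> * \<bar>v x\<bar> * \<bar>w x\<bar> \<le> (R * (1 + \<bar>u x\<bar> ^ (q + 1))) * \<bar>v x\<bar> * \<bar>w x\<bar>"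
      by (intro mult_right_mono b1_bound x) auto
    then show "\<bar>b1 x (u x) * v x * w x\<bar> \<le> R * ((1 + \<bar>u x\<bar> ^ (q + 1)) * \<bar>v x\<bar> * \<bar>w x\<bar>)"
      by (simp add: abs_mult mult_ac)
  qed
  also have "\<dots> = R * (LINT x|M. (1 + \<bar>u x\<bar> ^ (q + 1)) * \<bar>v x\<bar> * \<bar>w x\<bar>)" by (rule integral_mult_right_zero)
  also have "\<dots> \<le> R * (K (N u) * N v * N w)"
    by (intro mult_left_mono product_bound assms R_nonneg order_refl)
  finally show ?thesis using a_cauchy_schwarz[OF assms(2,3)] by (simp add: B_def algebra_simps)
qed

lemma B_coercive:
  assumes "u \<in> V" "v \<in> V" shows "(N v)\<^sup>2 \<le> B u v v"
proof -
  have "0 \<le> (LINT x|M. b1 x (u x) * v x * v x)"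
    by (intro integral_nonneg_AE AE_I2) (simp add: b1_nonneg mult.assoc)
  then show ?thesis using assms by (simp add: B_def N_square)
qed

text \<open>A Riesz representation up to \<eta>, in a subspace whose completeness is not at hand: y
  nearly minimizes the quadratic functional J. Along each line y + t v the functional stays above J
  y minus the slack, and the discriminant of this quadratic in t bounds the residual in direction
  v.\<close>

lemma riesz_approx:
  assumes u: "u \<in> V" and U: "linear_space U" "U \<subseteq> V"
    and lin: "\<And>v w s t. v \<in> V \<Longrightarrow> w \<in> V \<Longrightarrow> l (\<lambda>x. s * v x + t * w x) = s * l v + t * l w"
    and bd: "\<And>v. v \<in> V \<Longrightarrow> \<bar>l v\<bar> \<le> c * N v"
    and "0 < \<eta>"
  shows "\<exists>y\<in>U. \<forall>v\<in>U. \<bar>B u y v - l v\<bar> \<le> \<eta> * N v"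
proof -
  define K' where "K' = 1 + R * K (N u)"
  have K': "1 \<le> K'" using R_nonneg K_nonneg[OF N_nonneg[OF u]] by (simp add: K'_def)
  define J where "J v = B u v v - 2 * l v" for v
  \<comment> \<open>Coercivity of the form, then completing the square.\<close>
  have J_ge: "J v \<ge> - c\<^sup>2" if "v \<in> V" for v
  proof -
    have "J v \<ge> (N v)\<^sup>2 - 2 * (c * N v)" using B_coercive[OF u that] bd[OF that] by (simp add: J_def)
    also have "(N v)\<^sup>2 - 2 * (c * N v) = (N v - c)\<^sup>2 - c\<^sup>2" by (simp add: power2_diff)
    finally show ?thesis using zero_le_power2[of "N v - c"] by linarith
  qed
  have bdd: "bdd_below (J ` U)" using J_ge U by (intro bdd_belowI[of _ "- c\<^sup>2"]) auto
  have ne: "J ` U \<noteq> {}" using U by (auto simp: linear_space_def)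
  \<comment> \<open>The slack is divided by the bound K' of the form, so that the discriminant
    inequality below ends in exactly (\<eta> N v)^2.\<close>
  have "Inf (J ` U) < Inf (J ` U) + \<eta>\<^sup>2 / K'" using K' assms(6) by simp
  then obtain y where y: "y \<in> U" "J y < Inf (J ` U) + \<eta>\<^sup>2 / K'"
    using cInf_lessD[OF ne] by blast
  have yV: "y \<in> V" using y U by auto
  have "\<bar>B u y v - l v\<bar> \<le> \<eta> * N v" if v: "v \<in> U" for v
  proof -
    have vV: "v \<in> V" using v U by auto
    have "0 \<le> B u v v * t\<^sup>2 + 2 * (B u y v - l v) * t + \<eta>\<^sup>2 / K'" for t
    proof -
      let ?w = "\<lambda>x. 1 * y x + t * v x"
      have "?w \<in> U" using linear_space_lincomb[OF U(1) y(1) v] .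
      then have "Inf (J ` U) \<le> J ?w" by (intro cInf_lower bdd) auto
      then have "J y < J ?w + \<eta>\<^sup>2 / K'" using y by linarith
      moreover have "J ?w = J y + (B u v v * t\<^sup>2 + 2 * (B u y v - l v) * t)"
        unfolding J_def lin[OF yV vV] using B_sym[OF yV vV, of u]
        by (simp only: B_lincomb B_lincomb2 u yV vV V_lincomb) (simp add: algebra_simps power2_eq_square)
      ultimately show ?thesis by linarith
    qed
    then have "(B u y v - l v)\<^sup>2 \<le> B u v v * (\<eta>\<^sup>2 / K')"
      by (rule quadratic_nonneg_bound) (use B_coercive[OF u vV] in \<open>smt (verit) zero_le_power2\<close>)
    also have "\<dots> \<le> (K' * N v * N v) * (\<eta>\<^sup>2 / K')"
      using B_bound[OF u vV vV] K' by (intro mult_right_mono) (auto simp: K'_def)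
    also have "\<dots> = (\<eta> * N v)\<^sup>2" using K' by (simp add: power2_eq_square)
    finally have "\<bar>B u y v - l v\<bar> \<le> \<bar>\<eta> * N v\<bar>" by (simp add: abs_le_square_iff)
    then show ?thesis using assms(6) N_nonneg[OF vV] by simp
  qed
  then show ?thesis using y by blast
qed

end

section \<open>Quasi-orthogonality\<close>

locale galerkin = semilinear_problem +
  fixes X :: "nat \<Rightarrow> ('a \<Rightarrow> real) set" and u :: "'a \<Rightarrow> real" and un :: "nat \<Rightarrow> 'a \<Rightarrow> real"
  assumes X_linear: "\<And>n. linear_space (X n)"
    and X_sub: "\<And>n. X n \<subseteq> V"
    and X_mono: "\<And>n. X n \<subseteq> X (Suc n)"
    and u_solves: "solves V u"
    and un_solves: "\<And>n. solves (X n) (un n)"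
begin

section \<open>Discrete solutions in nested spaces\<close>

lemma X_le: "m \<le> n \<Longrightarrow> X m \<subseteq> X n"
  using lift_Suc_mono_le[of X m n] X_mono by blast

lemma u_V: "u \<in> V" using u_solves by (simp add: solves_def)
lemma un_X: "un n \<in> X n" using un_solves by (simp add: solves_def)
lemma un_V: "un n \<in> V" using un_X X_sub by blast
lemma un_X_le: "m \<le> n \<Longrightarrow> un m \<in> X n" using un_X X_le by blast

definition e where "e n = dif u (un n)"

lemma e_V: "e n \<in> V" unfolding e_def by (intro V_diff u_V un_V)

lemma union_linear: "linear_space (\<Union>n. X n)"
  unfolding linear_space_def
proof safe
  show "(\<lambda>x. 0) \<in> (\<Union>n. X n)" using X_linear by (auto simp: linear_space_def)
  fix v w s t m n assume "v \<in> X m" "w \<in> X n"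
  then have "v \<in> X (max m n)" "w \<in> X (max m n)" using X_le by (meson max.cobounded1 max.cobounded2 subsetD)+
  then show "(\<lambda>x. s * v x + t * w x) \<in> (\<Union>n. X n)"
    using linear_space_lincomb[OF X_linear] by blast
qed

text \<open>The energies of the discrete solutions decrease, because the spaces are nested, and are
  bounded below by the energy of u; hence they converge. Half the squared distance of two discrete
  solutions is at most the difference of their energies. No identification of the limit is
  involved.\<close>

lemma un_cauchy:
  assumes "0 < \<eta>"
  shows "\<exists>n0. \<forall>n\<ge>n0. \<forall>k. N (dif (un (n + k)) (un n)) \<le> \<eta>"
proof -
  have gap: "energy (un m) - energy (un n) \<ge> (N (dif (un m) (un n)))\<^sup>2 / 2" if "m \<le> n" for m n
    by (rule energy_gap[OF un_solves X_linear X_sub un_X_le[OF that]])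
  have low: "energy (un n) \<ge> energy u" for n
    using energy_gap[OF u_solves V_linear order_refl un_V, of n] zero_le_power2[of "N (dif (un n) u)"] by linarith
  have dec: "decseq (\<lambda>n. energy (un n))"
  proof (unfold decseq_def, intro allI impI)
    fix m n :: nat assume "m \<le> n"
    then show "energy (un n) \<le> energy (un m)"
      using gap[of m n] zero_le_power2[of "N (dif (un m) (un n))"] by linarith
  qed
  then obtain L where L: "(\<lambda>n. energy (un n)) \<longlonglongrightarrow> L"
    using decseq_convergent[OF dec, of "energy u"] low by blast
  have ge: "energy (un n) \<ge> L" for n by (rule decseq_ge[OF dec L])
  have "\<forall>\<^sub>F n in sequentially. energy (un n) < L + \<eta>\<^sup>2 / 2"
    using assms by (intro order_tendstoD(2)[OF L]) auto
  then obtain n0 where n0: "\<forall>n\<ge>n0. energy (un n) < L + \<eta>\<^sup>2 / 2"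
    unfolding eventually_sequentially by blast
  have "N (dif (un (n + k)) (un n)) \<le> \<eta>" if "n \<ge> n0" for n k
  proof -
    have "(N (dif (un n) (un (n + k))))\<^sup>2 \<le> \<eta>\<^sup>2"
      using gap[OF le_add1[of n k]] n0[rule_format, OF that] ge[of "n + k"] by linarith
    then have "N (dif (un n) (un (n + k))) \<le> \<eta>" using assms by (rule power2_le_imp_le[OF _ less_imp_le])
    then show ?thesis by (subst N_minus[OF un_V un_V])
  qed
  then show ?thesis by blast
qed

section \<open>Asymptotic orthogonality of the errors\<close>

lemma galerkin_orthogonality:
  assumes "v \<in> X n"
  shows "a (e n) v = - (LINT x|M. (b x (u x) - b x (un n x)) * v x)"
proof -
  have v: "v \<in> V" using assms X_sub by auto
  have "a u v + (LINT x|M. b x (u x) * v x) = a (un n) v + (LINT x|M. b x (un n x) * v x)"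
    using u_solves un_solves[of n] assms v by (simp add: solves_def)
  moreover have "(LINT x|M. (b x (u x) - b x (un n x)) * v x)
      = (LINT x|M. b x (u x) * v x) - (LINT x|M. b x (un n x) * v x)"
    using b_integrable[OF u_V v] b_integrable[OF un_V v] by (simp add: left_diff_distrib)
  ultimately show ?thesis using v by (simp add: e_def a_diff u_V un_V)
qed

lemma linear_diff:
  assumes lin: "\<And>v w s t. v \<in> V \<Longrightarrow> w \<in> V \<Longrightarrow> l (\<lambda>x. s * v x + t * w x) = s * l v + t * l w"
    and "v \<in> V" "w \<in> V"
  shows "l (dif v w) = l v - (l w :: real)"
  using lin[of v w 1 "-1"] assms(2,3) by simp

text \<open>For discrete y, Galerkin orthogonality replaces the energy product of error and y by the
  difference of the reaction terms. Together with the linearized reaction this is the Taylor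
  remainder of b tested with y, which is quadratic in the error. The constant depends on y but not
  on n.\<close>

lemma B_error_bound:
  assumes y: "y \<in> X m"
  shows "\<exists>C\<ge>0. \<forall>n\<ge>m. N (e n) \<le> 1 \<longrightarrow> \<bar>B u y (e n)\<bar> \<le> C * (N (e n))\<^sup>2"
proof -
  \<comment> \<open>The sum of two instances of \<open>square_product_bound\<close>, one with weight
    u and one with weight \<open>e n\<close>, for the normalized error: P u + 2 S + 2 P y and S + 2
    S + 2 P y, each plus the total mass.\<close>
  define C where "C = 2 ^ q * R * (2 * measure M (space M) + P u + 5 * S + 4 * P y)"
  have yV: "y \<in> V" using y X_sub by auto
  have P0: "0 \<le> P v" for v unfolding P_def by (rule integral_nonneg_AE) simp
  have C: "0 \<le> C" unfolding C_def using P0[of u] P0[of y] R_nonneg S_nonneg by (intro mult_nonneg_nonneg add_nonneg_nonneg) auto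
  have "\<bar>B u y (e n)\<bar> \<le> C * (N (e n))\<^sup>2" if n: "n \<ge> m" "N (e n) \<le> 1" for n
  proof -
    let ?e = "e n"
    have yX: "y \<in> X n" using X_le[OF n(1)] y by auto
    have "B u y ?e = B u ?e y" by (rule B_sym[OF yV e_V])
    also have "\<dots> = (LINT x|M. b1 x (u x) * ?e x * y x) - (LINT x|M. (b x (u x) - b x (un n x)) * y x)"
      unfolding B_def galerkin_orthogonality[OF yX] by simp
    also have "\<dots> = (LINT x|M. b1 x (u x) * ?e x * y x - (b x (u x) - b x (un n x)) * y x)"
      using b1_integrable[OF u_V e_V yV] b_integrable[OF u_V yV] b_integrable[OF un_V yV]
      by (intro Bochner_Integration.integral_diff[symmetric]) (simp_all add: left_diff_distrib)
    finally have eq: "B u y ?e = (LINT x|M. b1 x (u x) * ?e x * y x - (b x (u x) - b x (un n x)) * y x)" .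
    let ?h = "\<lambda>x. 2 ^ q * R * ((1 + \<bar>u x\<bar> ^ q) * (?e x)\<^sup>2 * \<bar>y x\<bar> + (1 + \<bar>?e x\<bar> ^ q) * (?e x)\<^sup>2 * \<bar>y x\<bar>)"
    have h_int: "integrable M ?h"
      by (intro integrable_mult_right Bochner_Integration.integrable_add square_product_bound(1) u_V e_V yV)
    have le: "\<bar>B u y ?e\<bar> \<le> integral\<^sup>L M ?h"
      unfolding eq
    proof (rule abs_integral_le[OF _ h_int])
      show "integrable M (\<lambda>x. b1 x (u x) * ?e x * y x - (b x (u x) - b x (un n x)) * y x)"
        using b1_integrable[OF u_V e_V yV] b_integrable[OF u_V yV] b_integrable[OF un_V yV]
        by (intro Bochner_Integration.integrable_diff) (simp_all add: left_diff_distrib)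
      fix x assume x: "x \<in> space M"
      \<comment> \<open>The expansion is taken at u(x) with increment un(x) - u(x), the negative
        error.\<close>
      have "b1 x (u x) * ?e x * y x - (b x (u x) - b x (un n x)) * y x
          = - (b1 x (u x) * (un n x - u x) - (b x (un n x) - b x (u x))) * y x"
        by (simp add: e_def algebra_simps)
      then have "\<bar>b1 x (u x) * ?e x * y x - (b x (u x) - b x (un n x)) * y x\<bar>
          = \<bar>b1 x (u x) * (un n x - u x) - (b x (un n x) - b x (u x))\<bar> * \<bar>y x\<bar>"
        by (simp only: abs_mult abs_minus_cancel)
      also have "\<dots> \<le> 2 ^ q * R * (1 + \<bar>u x\<bar> ^ q + \<bar>un n x - u x\<bar> ^ q) * (un n x - u x)\<^sup>2 * \<bar>y x\<bar>"
        by (intro mult_right_mono b_taylor[OF x]) simp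
      also have "\<bar>un n x - u x\<bar> = \<bar>?e x\<bar>" by (simp add: e_def)
      also have "(un n x - u x)\<^sup>2 = (?e x)\<^sup>2" by (simp add: e_def power2_commute)
      also have "2 ^ q * R * (1 + \<bar>u x\<bar> ^ q + \<bar>?e x\<bar> ^ q) * (?e x)\<^sup>2 * \<bar>y x\<bar> \<le> ?h x"
      proof -
        have "2 ^ q * R * ((1 + \<bar>u x\<bar> ^ q + \<bar>?e x\<bar> ^ q) * (?e x)\<^sup>2 * \<bar>y x\<bar>) \<le> ?h x"
          using R_nonneg by (intro mult_left_mono) (simp_all add: algebra_simps)
        then show ?thesis by (simp only: mult.assoc)
      qed
      finally show "\<bar>b1 x (u x) * ?e x * y x - (b x (u x) - b x (un n x)) * y x\<bar> \<le> ?h x" .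
    qed
    show ?thesis
    proof (cases "N ?e = 0")
      case True
      have "AE x in M. ?h x = 0" using AE_zero[OF e_V True] by eventually_elim simp
      then have "integral\<^sup>L M ?h = 0" by (rule integral_eq_zero_AE)
      with le have "\<bar>B u y ?e\<bar> \<le> 0" by linarith
      then show ?thesis using C True by simp
    next
      case False
      define r where "r = N ?e"
      have r: "0 < r" "r \<le> 1" using False N_nonneg[OF e_V, of n] n by (auto simp: r_def)
      \<comment> \<open>Only the squared factor is normalized, which extracts r^2. The error inside
        the weight stays as it is; its (q+3)-integral is at most S because N (e n) \<le> 1.\<close>
      let ?f = "\<lambda>x. inverse r * ?e x"
      have fV: "?f \<in> V" by (rule V_scale[OF e_V])
      have Nf: "N ?f \<le> 1" using r e_V[of n] by (simp add: N_scale r_def)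
      have "integral\<^sup>L M ?h = (LINT x|M. (2 ^ q * R * r\<^sup>2) * ((1 + \<bar>u x\<bar> ^ q) * (?f x)\<^sup>2 * \<bar>y x\<bar> + (1 + \<bar>?e x\<bar> ^ q) * (?f x)\<^sup>2 * \<bar>y x\<bar>))"
        using r by (intro Bochner_Integration.integral_cong) (simp_all add: power_mult_distrib field_simps)
      also have "\<dots> = (2 ^ q * R * r\<^sup>2) * (LINT x|M. (1 + \<bar>u x\<bar> ^ q) * (?f x)\<^sup>2 * \<bar>y x\<bar> + (1 + \<bar>?e x\<bar> ^ q) * (?f x)\<^sup>2 * \<bar>y x\<bar>)"
        by (rule integral_mult_right_zero)
      also have "(LINT x|M. (1 + \<bar>u x\<bar> ^ q) * (?f x)\<^sup>2 * \<bar>y x\<bar> + (1 + \<bar>?e x\<bar> ^ q) * (?f x)\<^sup>2 * \<bar>y x\<bar>)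
          = (LINT x|M. (1 + \<bar>u x\<bar> ^ q) * (?f x)\<^sup>2 * \<bar>y x\<bar>) + (LINT x|M. (1 + \<bar>?e x\<bar> ^ q) * (?f x)\<^sup>2 * \<bar>y x\<bar>)"
        by (intro Bochner_Integration.integral_add square_product_bound(1) u_V e_V fV yV)
      also have "(2 ^ q * R * r\<^sup>2) * \<dots> \<le> (2 ^ q * R * r\<^sup>2) *
          (2 * measure M (space M) + P u + 5 * S + 4 * P y)"
        using square_product_bound(2)[OF u_V fV yV] square_product_bound(2)[OF e_V fV yV, of n]
          P_bound[OF fV Nf] P_bound[OF e_V n(2)] R_nonneg
        by (intro mult_left_mono) auto
      also have "\<dots> = C * (N ?e)\<^sup>2" by (simp add: C_def r_def)
      finally show ?thesis using le by linarith
    qed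
  qed
  then show ?thesis using C by blast
qed

text \<open>The errors are asymptotically orthogonal to every discrete function with respect to the
  linearized problem.\<close>

lemma error_weakly_null:
  assumes conv: "(\<lambda>n. N (e n)) \<longlonglongrightarrow> 0"
    and lin: "\<And>v w s t. v \<in> V \<Longrightarrow> w \<in> V \<Longrightarrow> l (\<lambda>x. s * v x + t * w x) = s * l v + t * l w"
    and bd: "\<And>v. v \<in> V \<Longrightarrow> \<bar>l v\<bar> \<le> c * N v"
    and "0 < \<delta>"
  shows "\<forall>\<^sub>F n in sequentially. \<bar>l (e n)\<bar> \<le> \<delta> * N (e n)"
proof -
  have US: "(\<Union>n. X n) \<subseteq> V" using X_sub by auto
  \<comment> \<open>One half of \<delta> is spent on the representation error; the other half will
    absorb the quadratic term B u y (e n).\<close>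
  have "\<exists>y\<in>\<Union>n. X n. \<forall>v\<in>\<Union>n. X n. \<bar>B u y v - l v\<bar> \<le> \<delta> / 2 * N v"
  proof (rule riesz_approx[OF u_V union_linear US])
    show "l (\<lambda>x. s * v x + t * w x) = s * l v + t * l w" if "v \<in> V" "w \<in> V" for v w s t
      by (rule lin[OF that])
    show "\<bar>l v\<bar> \<le> c * N v" if "v \<in> V" for v by (rule bd[OF that])
    show "0 < \<delta> / 2" using assms(4) by simp
  qed
  then obtain y m where y: "y \<in> X m" and yU: "\<And>v. v \<in> (\<Union>n. X n) \<Longrightarrow> \<bar>B u y v - l v\<bar> \<le> \<delta> / 2 * N v"
    by blast
  have yV: "y \<in> V" using y X_sub by auto
  define K' where "K' = (1 + R * K (N u)) * N y"
  \<comment> \<open>The error itself need not lie in the union of the discrete spaces, but it is the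
    energy limit of the discrete functions un k - un n as k grows, because e k tends to zero. The
    estimate for those carries over.\<close>
  have ext: "\<bar>B u y (e n) - l (e n)\<bar> \<le> \<delta> / 2 * N (e n)" for n
  proof (rule LIMSEQ_le_const)
    show "(\<lambda>k. \<delta> / 2 * N (e n) + (\<delta> / 2 + K' + \<bar>c\<bar>) * N (e k)) \<longlonglongrightarrow> \<delta> / 2 * N (e n)"
      by (rule tendsto_eq_intros conv refl | simp)+
    have "\<bar>B u y (e n) - l (e n)\<bar> \<le> \<delta> / 2 * N (e n) + (\<delta> / 2 + K' + \<bar>c\<bar>) * N (e k)" if k: "k \<ge> n" for k
    proof -
      have kn: "dif (un k) (un n) \<in> X k" by (intro linear_space_diff X_linear un_X un_X_le k)
      have split: "dif (e n) (e k) = dif (un k) (un n)" by (auto simp: e_def)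
      have 1: "\<bar>B u y (dif (un k) (un n)) - l (dif (un k) (un n))\<bar> \<le> \<delta> / 2 * N (dif (un k) (un n))"
        using kn by (intro yU) auto
      have 2: "B u y (dif (un k) (un n)) = B u y (e n) - B u y (e k)"
        unfolding split[symmetric] by (rule linear_diff) (simp_all add: B_lincomb2 u_V yV e_V)
      have 3: "l (dif (un k) (un n)) = l (e n) - l (e k)"
        unfolding split[symmetric] by (rule linear_diff) (simp_all add: lin e_V)
      have 4: "N (dif (un k) (un n)) \<le> N (e n) + N (e k)"
      proof -
        have "N (dif (un k) (un n)) \<le> N (dif (un k) u) + N (dif u (un n))"
          by (rule N_triangle) (auto intro: un_V u_V)
        also have "N (dif (un k) u) = N (e k)" unfolding e_def by (rule N_minus[OF un_V u_V])
        finally show ?thesis by (simp add: e_def)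
      qed
      have "\<delta> / 2 * N (dif (un k) (un n)) \<le> \<delta> / 2 * (N (e n) + N (e k))"
        using 4 assms(4) by (intro mult_left_mono) auto
      moreover have "\<bar>B u y (e k)\<bar> \<le> K' * N (e k)" using B_bound[OF u_V yV e_V] by (simp add: K'_def)
      moreover have "\<bar>l (e k)\<bar> \<le> \<bar>c\<bar> * N (e k)"
        using bd[OF e_V[of k]] mult_right_mono[OF abs_ge_self[of c] N_nonneg[OF e_V[of k]]] by linarith
      moreover have "\<delta> / 2 * N (e n) + (\<delta> / 2 + K' + \<bar>c\<bar>) * N (e k)
          = \<delta> / 2 * (N (e n) + N (e k)) + K' * N (e k) + \<bar>c\<bar> * N (e k)" by (simp add: algebra_simps)
      ultimately show ?thesis using 1 unfolding 2 3 by linarith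
    qed
    then show "\<exists>N0. \<forall>k\<ge>N0. \<bar>B u y (e n) - l (e n)\<bar> \<le> \<delta> / 2 * N (e n) + (\<delta> / 2 + K' + \<bar>c\<bar>) * N (e k)"
      by blast
  qed
  obtain C where C: "0 \<le> C" "\<And>n. n \<ge> m \<Longrightarrow> N (e n) \<le> 1 \<Longrightarrow> \<bar>B u y (e n)\<bar> \<le> C * (N (e n))\<^sup>2"
    using B_error_bound[OF y] by blast
  have "\<forall>\<^sub>F n in sequentially. N (e n) < min 1 (\<delta> / (2 * (C + 1)))"
    using C assms(4) by (intro order_tendstoD(2)[OF conv]) auto
  then show ?thesis using eventually_ge_at_top[of m]
  proof eventually_elim
    case (elim n)
    have N0: "0 \<le> N (e n)" by (rule N_nonneg[OF e_V])
    \<comment> \<open>The bound for B u y (e n) is quadratic in the error, and the threshold on N (e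
      n) makes one of the two factors small; C + 1 covers the case C = 0.\<close>
    have "C * N (e n) \<le> (C + 1) * (\<delta> / (2 * (C + 1)))"
      using C elim N0 by (intro mult_mono) auto
    also have "\<dots> = \<delta> / 2" using C by (simp add: field_simps)
    finally have "C * N (e n) * N (e n) \<le> \<delta> / 2 * N (e n)" using N0 by (rule mult_right_mono)
    then have "\<bar>B u y (e n)\<bar> \<le> \<delta> / 2 * N (e n)" using C(2)[OF elim(2)] elim(1) by (simp add: power2_eq_square)
    moreover have "\<delta> * N (e n) = \<delta> / 2 * N (e n) + \<delta> / 2 * N (e n)" by simp
    ultimately show ?case using ext[of n] by linarith
  qed
qed

text \<open>The compactness inequality with \<delta> / 2 leaves finitely many integrals over sets Q.
  Each is a bounded functional, so \<open>error_weakly_null\<close> makes all of them small relative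
  to the error at the same time.\<close>

lemma error_L2_small:
  assumes conv: "(\<lambda>n. N (e n)) \<longlonglongrightarrow> 0" and "0 < \<delta>"
  shows "\<forall>\<^sub>F n in sequentially. (LINT x|M. (e n x)\<^sup>2) \<le> \<delta> * (N (e n))\<^sup>2"
proof -
  obtain J C where J: "finite J" "J \<subseteq> sets M" "0 \<le> C"
    and JC: "\<And>v. v \<in> V \<Longrightarrow> (LINT x|M. (v x)\<^sup>2) \<le> \<delta> / 2 * a v v + C * (\<Sum>Q\<in>J. (LINT x|M. indicator Q x * v x)\<^sup>2)"
    using compactness[of "\<delta> / 2"] assms(2) by auto
  \<comment> \<open>Each of the card J squared integrals is at most \<eta>^2 times the squared
    error, so this choice bounds C times their sum by \<delta> / 2 of the squared error.\<close>
  define \<eta> where "\<eta> = sqrt (\<delta> / (2 * (C * card J + 1)))"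
  have den: "0 < C * card J + 1" using J(3) by (simp add: add_nonneg_pos)
  have \<eta>: "0 < \<eta>" "\<eta>\<^sup>2 = \<delta> / (2 * (C * card J + 1))" using den assms(2) by (simp_all add: \<eta>_def)
  have "\<forall>\<^sub>F n in sequentially. \<forall>Q\<in>J. \<bar>LINT x|M. indicator Q x * e n x\<bar> \<le> \<eta> * N (e n)"
  proof (rule eventually_ball_finite[OF J(1)], rule ballI)
    fix Q assume "Q \<in> J"
    then have Q[measurable]: "Q \<in> sets M" using J by auto
    have int: "integrable M (\<lambda>x. indicator Q x * v x)" if "v \<in> V" for v
      using integrable_real_mult_indicator[OF Q V_integrable(1)[OF that]] by (simp add: mult.commute)
    show "\<forall>\<^sub>F n in sequentially. \<bar>LINT x|M. indicator Q x * e n x\<bar> \<le> \<eta> * N (e n)"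
    proof (rule error_weakly_null[OF conv _ _ \<eta>(1)])
      fix v w s t assume vw: "v \<in> V" "w \<in> V"
      have "(LINT x|M. indicator Q x * (s * v x + t * w x)) = (LINT x|M. s * (indicator Q x * v x) + t * (indicator Q x * w x))"
        by (intro Bochner_Integration.integral_cong) (simp_all add: algebra_simps)
      then show "(LINT x|M. indicator Q x * (s * v x + t * w x)) = s * (LINT x|M. indicator Q x * v x) + t * (LINT x|M. indicator Q x * w x)"
        using int[OF vw(1)] int[OF vw(2)] by simp
    next
      fix v assume v: "v \<in> V"
      have "\<bar>LINT x|M. indicator Q x * v x\<bar> \<le> (LINT x|M. \<bar>v x\<bar>)"
        using int[OF v] V_integrable(1)[OF v] by (intro abs_integral_le) (auto simp: indicator_def)
      also have "\<dots> \<le> (measure M (space M) + S) * N v" by (rule L1_bound[OF v])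
      finally show "\<bar>LINT x|M. indicator Q x * v x\<bar> \<le> (measure M (space M) + S) * N v" .
    qed
  qed
  then show ?thesis
  proof eventually_elim
    case (elim n)
    have "(LINT x|M. indicator Q x * e n x)\<^sup>2 \<le> \<eta>\<^sup>2 * (N (e n))\<^sup>2" if "Q \<in> J" for Q
    proof -
      have "\<bar>LINT x|M. indicator Q x * e n x\<bar>\<^sup>2 \<le> (\<eta> * N (e n))\<^sup>2"
        by (rule power_mono[OF elim[rule_format, OF that]]) simp
      then show ?thesis by (simp only: power2_abs power_mult_distrib)
    qed
    then have "(\<Sum>Q\<in>J. (LINT x|M. indicator Q x * e n x)\<^sup>2) \<le> card J * (\<eta>\<^sup>2 * (N (e n))\<^sup>2)"
      by (rule sum_bounded_above)
    then have "C * (\<Sum>Q\<in>J. (LINT x|M. indicator Q x * e n x)\<^sup>2) \<le> C * (card J * (\<eta>\<^sup>2 * (N (e n))\<^sup>2))"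
      using J(3) by (rule mult_left_mono)
    also have "\<dots> = (C * card J * \<eta>\<^sup>2) * (N (e n))\<^sup>2" by simp
    also have "\<dots> \<le> \<delta> / 2 * (N (e n))\<^sup>2"
    proof (rule mult_right_mono)
      have "C * card J * \<eta>\<^sup>2 \<le> (C * card J + 1) * \<eta>\<^sup>2" by (intro mult_right_mono) auto
      also have "\<dots> = \<delta> / 2" using den unfolding \<eta>(2) by (simp add: field_simps)
      finally show "C * card J * \<eta>\<^sup>2 \<le> \<delta> / 2" .
    qed simp
    finally show ?case using JC[OF e_V[of n]] N_square[OF e_V[of n]] by (simp add: algebra_simps)
  qed
qed

text \<open>Three contributions of at most \<delta> / 3 each: the L2 norm, which also takes the part
  C of the weight in u; the remainder of that weight from \<open>weight_bound\<close>; and the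
  integral of |e|^(q+3), which is of order higher than two in the error.\<close>

lemma error_weighted_small:
  assumes conv: "(\<lambda>n. N (e n)) \<longlonglongrightarrow> 0" and "0 < \<delta>"
  shows "\<forall>\<^sub>F n in sequentially. 
    (LINT x|M. (1 + \<bar>u x\<bar> ^ (q + 1) + \<bar>e n x\<bar> ^ (q + 1)) * (e n x)\<^sup>2) \<le> \<delta> * (N (e n))\<^sup>2"
proof -
  obtain C where C: "0 \<le> C" "\<And>v. v \<in> V \<Longrightarrow> (LINT x|M. \<bar>u x\<bar> ^ (q + 1) * (v x)\<^sup>2) \<le> C * (LINT x|M. (v x)\<^sup>2) + \<delta> / 3 * (N v)\<^sup>2"
    using weight_bound[OF u_V, of "\<delta> / 3"] assms(2) by auto
  have "\<forall>\<^sub>F n in sequentially. (LINT x|M. (e n x)\<^sup>2) \<le> \<delta> / (3 * (C + 1)) * (N (e n))\<^sup>2"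
    using C assms(2) by (intro error_L2_small conv) auto
  moreover have "\<forall>\<^sub>F n in sequentially. N (e n) < min 1 (\<delta> / (3 * (S + 1)))"
    using S_nonneg assms(2) by (intro order_tendstoD(2)[OF conv]) auto
  ultimately show ?thesis
  proof eventually_elim
    case (elim n)
    let ?e = "e n"
    have N0: "0 \<le> N ?e" by (rule N_nonneg[OF e_V])
    have i1: "integrable M (\<lambda>x. (?e x)\<^sup>2)" "integrable M (\<lambda>x. \<bar>u x\<bar> ^ (q + 1) * (?e x)\<^sup>2)"
      "integrable M (\<lambda>x. \<bar>?e x\<bar> ^ (q + 3))"
      by (intro V_integrable weight_integrable sobolev_integrable e_V u_V)+
    have "(LINT x|M. (1 + \<bar>u x\<bar> ^ (q + 1) + \<bar>?e x\<bar> ^ (q + 1)) * (?e x)\<^sup>2)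
        = (LINT x|M. (?e x)\<^sup>2 + \<bar>u x\<bar> ^ (q + 1) * (?e x)\<^sup>2 + \<bar>?e x\<bar> ^ (q + 3))"
    proof (intro Bochner_Integration.integral_cong refl)
      fix x
      have "\<bar>?e x\<bar> ^ (q + 3) = \<bar>?e x\<bar> ^ (q + 1) * (?e x)\<^sup>2"
        by (simp add: power_add power3_eq_cube power2_eq_square)
      then show "(1 + \<bar>u x\<bar> ^ (q + 1) + \<bar>?e x\<bar> ^ (q + 1)) * (?e x)\<^sup>2 = (?e x)\<^sup>2 + \<bar>u x\<bar> ^ (q + 1) * (?e x)\<^sup>2 + \<bar>?e x\<bar> ^ (q + 3)"
        by (simp add: algebra_simps)
    qed
    also have "\<dots> = (LINT x|M. (?e x)\<^sup>2) + (LINT x|M. \<bar>u x\<bar> ^ (q + 1) * (?e x)\<^sup>2) + P ?e"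
      using i1 by (simp add: P_def)
    also have "\<dots> \<le> (C + 1) * (LINT x|M. (?e x)\<^sup>2) + \<delta> / 3 * (N ?e)\<^sup>2 + S * N ?e ^ (q + 3)"
      using C(2)[OF e_V[of n]] P_bound[OF e_V order_refl, of n] by (simp add: algebra_simps)
    also have "\<dots> \<le> \<delta> / 3 * (N ?e)\<^sup>2 + \<delta> / 3 * (N ?e)\<^sup>2 + \<delta> / 3 * (N ?e)\<^sup>2"
    proof (intro add_mono order_refl)
      have "(C + 1) * (LINT x|M. (?e x)\<^sup>2) \<le> (C + 1) * (\<delta> / (3 * (C + 1)) * (N ?e)\<^sup>2)"
        using C elim(1) by (intro mult_left_mono) auto
      also have "\<dots> = \<delta> / 3 * (N ?e)\<^sup>2" using C by (simp add: field_simps)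
      finally show "(C + 1) * (LINT x|M. (?e x)\<^sup>2) \<le> \<delta> / 3 * (N ?e)\<^sup>2" .
      have "N ?e ^ (q + 3) \<le> N ?e ^ 3" using N0 elim by (intro power_decreasing) auto
      then have "S * N ?e ^ (q + 3) \<le> (S + 1) * (N ?e * (N ?e)\<^sup>2)"
        using S_nonneg N0 by (intro mult_mono) (auto simp: power3_eq_cube power2_eq_square)
      also have "\<dots> \<le> (S + 1) * (\<delta> / (3 * (S + 1)) * (N ?e)\<^sup>2)"
        using S_nonneg elim by (intro mult_left_mono mult_right_mono) auto
      also have "\<dots> = \<delta> / 3 * (N ?e)\<^sup>2" using S_nonneg by (simp add: field_simps)
      finally show "S * N ?e ^ (q + 3) \<le> \<delta> / 3 * (N ?e)\<^sup>2" .
    qed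
    finally show ?case by simp
  qed
qed

text \<open>Smallness is available only for the error, while v is arbitrary. Young's inequality with
  a parameter \<eta> separates the two: the v-part is merely bounded but carries the small factor
  \<eta>, and the error part carries 1 / \<eta>, which is compensated by applying
  \<open>error_weighted_small\<close> with a correspondingly smaller constant. The threshold for n
  does not depend on v.\<close>

lemma nonlinearity_error_small:
  assumes conv: "(\<lambda>n. N (e n)) \<longlonglongrightarrow> 0" and "0 < \<delta>"
  shows "\<forall>\<^sub>F n in sequentially. \<forall>v\<in>V. 
    \<bar>LINT x|M. (b x (u x) - b x (un n x)) * v x\<bar> \<le> \<delta> * ((N (e n))\<^sup>2 + (N v)\<^sup>2)"
proof -
  define c where "c = 2 ^ (q + 1) * R"
  have c: "0 \<le> c" using R_nonneg by (simp add: c_def)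
  \<comment> \<open>Bounds the weighted square of v: the weight 1 + |u|^(q+1) gives K (N u), and 1 +
    |e|^(q+1) gives K 1 as soon as N (e n) is below 1.\<close>
  define L where "L = K (N u) + K 1"
  have L: "0 \<le> L" using K_nonneg[OF N_nonneg[OF u_V]] K_nonneg[of 1] by (simp add: L_def)
  \<comment> \<open>Chosen so that c L \<eta> \<le> \<delta>, which settles the v-part; adding 1
    keeps the denominator positive.\<close>
  define \<eta> where "\<eta> = \<delta> / (c * L + 1)"
  have \<eta>: "0 < \<eta>" "c * L * \<eta> \<le> \<delta>"
  proof -
    have p: "0 < c * L + 1" using c L by (simp add: add_nonneg_pos)
    then show "0 < \<eta>" using assms(2) by (simp add: \<eta>_def)
    have "c * L * \<eta> \<le> (c * L + 1) * \<eta>" using \<open>0 < \<eta>\<close> by (intro mult_right_mono) auto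
    also have "\<dots> = \<delta>" using p by (simp add: \<eta>_def)
    finally show "c * L * \<eta> \<le> \<delta>" .
  qed
  have "\<forall>\<^sub>F n in sequentially. 
    (LINT x|M. (1 + \<bar>u x\<bar> ^ (q + 1) + \<bar>e n x\<bar> ^ (q + 1)) * (e n x)\<^sup>2) \<le> \<delta> * \<eta> / (c + 1) * (N (e n))\<^sup>2"
    using c \<eta> assms(2) by (intro error_weighted_small conv) auto
  moreover have "\<forall>\<^sub>F n in sequentially. N (e n) < 1" by (intro order_tendstoD(2)[OF conv]) auto
  ultimately show ?thesis
  proof eventually_elim
    case (elim n)
    let ?e = "e n"
    let ?\<kappa> = "\<lambda>x. 1 + \<bar>u x\<bar> ^ (q + 1) + \<bar>?e x\<bar> ^ (q + 1)"
    have \<kappa>int: "integrable M (\<lambda>x. ?\<kappa> x * (v x)\<^sup>2)" if "v \<in> V" for v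
    proof -
      have "integrable M (\<lambda>x. (v x)\<^sup>2 + \<bar>u x\<bar> ^ (q + 1) * (v x)\<^sup>2 + \<bar>?e x\<bar> ^ (q + 1) * (v x)\<^sup>2)"
        by (intro Bochner_Integration.integrable_add V_integrable weight_integrable that u_V e_V)
      then show ?thesis by (simp add: distrib_right)
    qed
    show ?case
    proof
      fix v assume v: "v \<in> V"
      have pw: "\<bar>(b x (u x) - b x (un n x)) * v x\<bar> \<le> c * (inverse (2 * \<eta>) * (?\<kappa> x * (?e x)\<^sup>2) + \<eta> / 2 * (?\<kappa> x * (v x)\<^sup>2))"
        if x: "x \<in> space M" for x
      proof -
        have "\<bar>b x (u x) - b x (un n x)\<bar> = \<bar>b x (un n x) - b x (u x)\<bar>" by (rule abs_minus_commute)
        also have "\<dots> \<le> c * ?\<kappa> x * \<bar>?e x\<bar>"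
          using b_diff_bound[OF x, of "un n x" "u x"] by (simp add: c_def e_def abs_minus_commute)
        finally have "\<bar>(b x (u x) - b x (un n x)) * v x\<bar> \<le> c * ?\<kappa> x * \<bar>?e x\<bar> * \<bar>v x\<bar>"
          by (simp add: abs_mult mult_right_mono)
        also have "\<dots> = c * ?\<kappa> x * (\<bar>?e x\<bar> * \<bar>v x\<bar>)" by simp
        also have "\<dots> \<le> c * ?\<kappa> x * (inverse (2 * \<eta>) * (?e x)\<^sup>2 + \<eta> / 2 * (v x)\<^sup>2)"
        proof (rule mult_left_mono)
          have "0 \<le> (\<bar>?e x\<bar> - \<eta> * \<bar>v x\<bar>)\<^sup>2 / (2 * \<eta>)" using \<eta> by simp
          also have "\<dots> = inverse (2 * \<eta>) * (?e x)\<^sup>2 + \<eta> / 2 * (v x)\<^sup>2 - \<bar>?e x\<bar> * \<bar>v x\<bar>"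
            using \<eta> by (simp add: power2_diff power_mult_distrib field_simps power2_eq_square[of \<eta>])
          finally show "\<bar>?e x\<bar> * \<bar>v x\<bar> \<le> inverse (2 * \<eta>) * (?e x)\<^sup>2 + \<eta> / 2 * (v x)\<^sup>2" by simp
        qed (use c in auto)
        also have "\<dots> = c * (inverse (2 * \<eta>) * (?\<kappa> x * (?e x)\<^sup>2) + \<eta> / 2 * (?\<kappa> x * (v x)\<^sup>2))"
          by (simp add: distrib_left mult_ac)
        finally show ?thesis .
      qed
      have "\<bar>LINT x|M. (b x (u x) - b x (un n x)) * v x\<bar>
          \<le> (LINT x|M. c * (inverse (2 * \<eta>) * (?\<kappa> x * (?e x)\<^sup>2) + \<eta> / 2 * (?\<kappa> x * (v x)\<^sup>2)))"
      proof (rule abs_integral_le[OF _ _ pw])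
        show "integrable M (\<lambda>x. (b x (u x) - b x (un n x)) * v x)"
          using b_integrable[OF u_V v] b_integrable[OF un_V v] by (simp add: left_diff_distrib)
      qed (intro integrable_mult_right Bochner_Integration.integrable_add \<kappa>int e_V v)
      also have "\<dots> = c * (inverse (2 * \<eta>) * (LINT x|M. ?\<kappa> x * (?e x)\<^sup>2) + \<eta> / 2 * (LINT x|M. ?\<kappa> x * (v x)\<^sup>2))"
        using \<kappa>int[OF e_V[of n]] \<kappa>int[OF v] by simp
      also have "\<dots> \<le> c * (inverse (2 * \<eta>) * (\<delta> * \<eta> / (c + 1) * (N ?e)\<^sup>2) + \<eta> / 2 * (L * (N v)\<^sup>2))"
      proof (intro mult_left_mono add_mono elim(1) c)
        have "(LINT x|M. ?\<kappa> x * (v x)\<^sup>2) \<le> (LINT x|M. (1 + \<bar>u x\<bar> ^ (q + 1)) * \<bar>v x\<bar> * \<bar>v x\<bar> + (1 + \<bar>?e x\<bar> ^ (q + 1)) * \<bar>v x\<bar> * \<bar>v x\<bar>)"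
        proof (intro integral_mono \<kappa>int v Bochner_Integration.integrable_add product_integrable(1) u_V e_V)
          fix x
          have "\<bar>v x\<bar> * \<bar>v x\<bar> = (v x)\<^sup>2" by (simp add: power2_eq_square)
          then show "?\<kappa> x * (v x)\<^sup>2 \<le> (1 + \<bar>u x\<bar> ^ (q + 1)) * \<bar>v x\<bar> * \<bar>v x\<bar> + (1 + \<bar>?e x\<bar> ^ (q + 1)) * \<bar>v x\<bar> * \<bar>v x\<bar>"
            by (simp only: mult.assoc) (simp add: algebra_simps)
        qed
        also have "\<dots> = (LINT x|M. (1 + \<bar>u x\<bar> ^ (q + 1)) * \<bar>v x\<bar> * \<bar>v x\<bar>) + (LINT x|M. (1 + \<bar>?e x\<bar> ^ (q + 1)) * \<bar>v x\<bar> * \<bar>v x\<bar>)"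
          by (intro Bochner_Integration.integral_add product_integrable(1) u_V e_V v)
        also have "\<dots> \<le> K (N u) * N v * N v + K 1 * N v * N v"
          using elim by (intro add_mono product_bound u_V e_V v) auto
        also have "\<dots> = L * (N v)\<^sup>2" by (simp add: L_def power2_eq_square algebra_simps)
        finally show "(LINT x|M. ?\<kappa> x * (v x)\<^sup>2) \<le> L * (N v)\<^sup>2" .
      qed (use \<eta> in auto)
      also have "\<dots> = c / (c + 1) * (\<delta> / 2) * (N ?e)\<^sup>2 + c * L * \<eta> / 2 * (N v)\<^sup>2"
        using \<eta> by (simp add: field_simps)
      also have "\<dots> \<le> \<delta> * (N ?e)\<^sup>2 + \<delta> * (N v)\<^sup>2"
      proof (intro add_mono mult_right_mono)
        have "c / (c + 1) * (\<delta> / 2) \<le> 1 * \<delta>" using c assms(2) by (intro mult_mono) auto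
        then show "c / (c + 1) * (\<delta> / 2) \<le> \<delta>" by simp
        show "c * L * \<eta> / 2 \<le> \<delta>" using \<eta>(2) assms(2) by linarith
      qed auto
      finally show "\<bar>LINT x|M. (b x (u x) - b x (un n x)) * v x\<bar> \<le> \<delta> * ((N ?e)\<^sup>2 + (N v)\<^sup>2)"
        by (simp add: distrib_left)
    qed
  qed
qed

section \<open>From the mixed term to quasi-orthogonality\<close>

lemma pythagoras:
  "(N (e l))\<^sup>2 = (N (e n))\<^sup>2 + (N (dif (un n) (un l)))\<^sup>2 + 2 * a (e n) (dif (un n) (un l))"
proof -
  have d: "dif (un n) (un l) \<in> V" by (intro V_diff un_V)
  have "e l = (\<lambda>x. 1 * e n x + 1 * dif (un n) (un l) x)" by (auto simp: e_def)
  then have "(N (e l))\<^sup>2 = a (\<lambda>x. 1 * e n x + 1 * dif (un n) (un l) x) (\<lambda>x. 1 * e n x + 1 * dif (un n) (un l) x)"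
    using N_square[OF e_V] by metis
  also have "\<dots> = (N (e n))\<^sup>2 + 2 * a (e n) (dif (un n) (un l)) + (N (dif (un n) (un l)))\<^sup>2"
    using d a_sym[OF e_V d, of n] by (simp only: a_lincomb a_lincomb2 V_lincomb e_V N_square) simp
  finally show ?thesis by simp
qed

lemma quasi_orthogonality_convergent:
  assumes conv: "(\<lambda>n. N (e n)) \<longlonglongrightarrow> 0" and \<epsilon>: "0 < \<epsilon>" "\<epsilon> < 1"
  shows "\<exists>l0. \<forall>l\<ge>l0. \<forall>k. (N (e (l + k)))\<^sup>2 + (N (dif (un (l + k)) (un l)))\<^sup>2 \<le> 1 / (1 - \<epsilon>) * (N (e l))\<^sup>2"
proof -
  obtain l0 where l0: "\<And>n v. n \<ge> l0 \<Longrightarrow> v \<in> V \<Longrightarrow>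
      \<bar>LINT x|M. (b x (u x) - b x (un n x)) * v x\<bar> \<le> \<epsilon> / 2 * ((N (e n))\<^sup>2 + (N v)\<^sup>2)"
    using nonlinearity_error_small[OF conv, of "\<epsilon> / 2"] \<epsilon> unfolding eventually_sequentially by auto
  have "(N (e (l + k)))\<^sup>2 + (N (dif (un (l + k)) (un l)))\<^sup>2 \<le> 1 / (1 - \<epsilon>) * (N (e l))\<^sup>2" if "l \<ge> l0" for l k
  proof -
    let ?n = "l + k" and ?d = "dif (un (l + k)) (un l)"
    have dX: "?d \<in> X ?n" by (intro linear_space_diff X_linear un_X un_X_le) simp
    then have dV: "?d \<in> V" using X_sub by auto
    \<comment> \<open>The difference of the two discrete solutions lies in the finer space X (l +
      k), so orthogonality at that level applies; the constant \<epsilon> / 2 absorbs the factor 2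
      of the mixed term.\<close>
    have "\<bar>2 * a (e ?n) ?d\<bar> \<le> \<epsilon> * ((N (e ?n))\<^sup>2 + (N ?d)\<^sup>2)"
      using l0[OF trans_le_add1[OF that] dV, of k] unfolding galerkin_orthogonality[OF dX] by simp
    then have "(1 - \<epsilon>) * ((N (e ?n))\<^sup>2 + (N ?d)\<^sup>2) \<le> (N (e l))\<^sup>2"
      using pythagoras[of l ?n] by (simp add: algebra_simps)
    then show ?thesis using \<epsilon> by (simp add: field_simps)
  qed
  then show ?thesis by blast
qed

theorem quasi_orthogonality:
  assumes \<epsilon>: "0 < \<epsilon>" "\<epsilon> < 1"
  shows "\<exists>l0. \<forall>l\<ge>l0. \<forall>k. (N (e (l + k)))\<^sup>2 + (N (dif (un (l + k)) (un l)))\<^sup>2 \<le> 1 / (1 - \<epsilon>) * (N (e l))\<^sup>2"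
proof (cases "(\<lambda>n. N (e n)) \<longlonglongrightarrow> 0")
  case True
  then show ?thesis using quasi_orthogonality_convergent \<epsilon> by blast
next
  case False
  have tri: "N (e m) \<le> N (e n) + N (dif (un n) (un m))" for m n
    unfolding e_def by (rule N_triangle[OF u_V un_V un_V])
  \<comment> \<open>Without convergence to zero the errors are at least d infinitely often. Since
    the discrete solutions are Cauchy, all later errors are then at least d / 2.\<close>
  obtain d where d: "0 < d" "\<And>n0. \<exists>n\<ge>n0. N (e n) \<ge> d"
    using False N_nonneg[OF e_V] unfolding LIMSEQ_iff by (auto simp: not_less)
  \<comment> \<open>With s the error at level l and r the distance to the later solution, this gives
    r \<le> s \<epsilon> / 4. The sum (s + r)^2 + r^2 is at most s^2 + 4 s r, hence at most (1 +
    \<epsilon>) s^2, and (1 + \<epsilon>) (1 - \<epsilon>) \<le> 1.\<close>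
  define \<eta> where "\<eta> = d / 2 * (\<epsilon> / 4)"
  have \<eta>: "0 < \<eta>" "\<eta> \<le> d / 2" using d \<epsilon> by (auto simp: \<eta>_def)
  obtain n0 where n0: "\<And>n k. n \<ge> n0 \<Longrightarrow> N (dif (un (n + k)) (un n)) \<le> \<eta>"
    using un_cauchy[OF \<eta>(1)] by blast
  have low: "N (e l) \<ge> d / 2" if "l \<ge> n0" for l
  proof -
    obtain n where n: "n \<ge> l" "N (e n) \<ge> d" using d(2) by blast
    have "N (dif (un n) (un l)) \<le> \<eta>" using n0[OF that, of "n - l"] n by simp
    moreover have "N (e n) \<le> N (e l) + N (dif (un n) (un l))"
      using tri[of n l] N_minus[OF un_V un_V, of l n] by simp
    ultimately show ?thesis using n \<eta> by linarith
  qed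
  have "(N (e (l + k)))\<^sup>2 + (N (dif (un (l + k)) (un l)))\<^sup>2 \<le> 1 / (1 - \<epsilon>) * (N (e l))\<^sup>2" if "l \<ge> n0" for l k
  proof -
    define r where "r = N (dif (un (l + k)) (un l))"
    define s where "s = N (e l)"
    have r0: "0 \<le> r" unfolding r_def by (intro N_nonneg V_diff un_V)
    have s0: "0 < s" using low[OF that] d by (simp add: s_def)
    have r: "r \<le> s * (\<epsilon> / 4)"
    proof -
      have "r \<le> d / 2 * (\<epsilon> / 4)" using n0[OF that] by (simp add: r_def \<eta>_def)
      also have "\<dots> \<le> s * (\<epsilon> / 4)" using low[OF that] \<epsilon> by (intro mult_right_mono) (auto simp: s_def)
      finally show ?thesis .
    qed
    have "N (e (l + k)) \<le> s + r"
      using tri[of "l + k" l] N_minus[OF un_V un_V, of l "l + k"] by (simp add: r_def s_def)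
    then have "(N (e (l + k)))\<^sup>2 \<le> (s + r)\<^sup>2" by (intro power_mono N_nonneg e_V)
    moreover have "(s + r)\<^sup>2 + r\<^sup>2 = s\<^sup>2 + 2 * s * r + 2 * (r * r)" by (simp add: power2_eq_square algebra_simps)
    ultimately have "(N (e (l + k)))\<^sup>2 + r\<^sup>2 \<le> s\<^sup>2 + 2 * s * r + 2 * (r * r)" by linarith
    also have "\<dots> \<le> s\<^sup>2 + 2 * s * r + 2 * (s * r)"
    proof -
      have "r \<le> s * 1" by (rule order_trans[OF r mult_left_mono]) (use s0 \<epsilon> in auto)
      then have "r * r \<le> s * r" using r0 by (intro mult_right_mono) auto
      then show ?thesis by linarith
    qed
    also have "\<dots> = s\<^sup>2 + 4 * s * r" by simp
    also have "\<dots> \<le> s\<^sup>2 + 4 * s * (s * (\<epsilon> / 4))" using r s0 by (intro add_left_mono mult_left_mono) auto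
    also have "\<dots> = (1 + \<epsilon>) * s\<^sup>2" by (simp add: power2_eq_square algebra_simps)
    also have "\<dots> \<le> 1 / (1 - \<epsilon>) * s\<^sup>2"
    proof (rule mult_right_mono)
      have "(1 + \<epsilon>) * (1 - \<epsilon>) \<le> 1" by (simp add: algebra_simps)
      then show "1 + \<epsilon> \<le> 1 / (1 - \<epsilon>)" using \<epsilon> by (simp add: field_simps)
    qed simp
    finally show ?thesis by (simp add: r_def s_def)
  qed
  then show ?thesis by blast
qed

end

section \<open>Sobolev inequalities for continuously differentiable functions\<close>

text \<open>The gradient is an explicit function on a general Euclidean space, so that the
  restriction to a line with direction v has the derivative G \<bullet> v and the one-dimensional
  estimates apply on every line.\<close>

definition C1_grad :: "('a::euclidean_space \<Rightarrow> real) \<Rightarrow> ('a \<Rightarrow> 'a) \<Rightarrow> bool" where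
  "C1_grad \<phi> G \<longleftrightarrow> (\<forall>x. (\<phi> has_derivative (\<lambda>h. G x \<bullet> h)) (at x)) \<and> continuous_on UNIV G"

lemma C1_grad_continuous: "C1_grad \<phi> G \<Longrightarrow> continuous_on UNIV \<phi>"
  by (auto simp: C1_grad_def continuous_on_eq_continuous_at intro: has_derivative_continuous)

lemma C1_grad_measurable:
  assumes "C1_grad \<phi> G"
  shows "\<phi> \<in> borel_measurable borel" "G \<in> borel_measurable borel"
  using assms C1_grad_continuous[OF assms] by (auto simp: C1_grad_def intro: borel_measurable_continuous_onI)

lemma C1_grad_line:
  assumes "C1_grad \<phi> G"
  shows "((\<lambda>t. \<phi> (x + t *\<^sub>R v)) has_real_derivative G (x + t *\<^sub>R v) \<bullet> v) (at t within A)"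
proof -
  have "((\<lambda>t. \<phi> (x + t *\<^sub>R v)) has_derivative (\<lambda>h. G (x + t *\<^sub>R v) \<bullet> (h *\<^sub>R v))) (at t within A)"
    by (rule has_derivative_compose[where g=\<phi>])
      (use assms in \<open>auto simp: C1_grad_def intro!: derivative_eq_intros\<close>)
  then show ?thesis by (simp add: has_field_derivative_def mult_commute_abs)
qed

lemma C1_grad_line_continuous:
  assumes "C1_grad \<phi> G" shows "continuous_on A (\<lambda>t. G (x + t *\<^sub>R v) \<bullet> v)"
  using assms by (auto simp: C1_grad_def intro!: continuous_intros continuous_on_compose2[of UNIV G])

text \<open>The fundamental theorem in terms of nonnegative integrals, ready for exchanging the
  order of integration. The second part is its Cauchy-Schwarz form.\<close>

lemma FTC_nn_bound:
  fixes f f' :: "real \<Rightarrow> real"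
  assumes "a \<le> b" and f: "\<And>x. (f has_real_derivative f' x) (at x)" and c: "continuous_on UNIV f'"
  shows "ennreal \<bar>f b - f a\<bar> \<le> (\<integral>\<^sup>+t. indicator {a..b} t * ennreal \<bar>f' t\<bar> \<partial>lborel)"
    and "ennreal ((f b - f a)\<^sup>2) \<le> ennreal (b - a) * (\<integral>\<^sup>+t. indicator {a..b} t * ennreal ((f' t)\<^sup>2) \<partial>lborel)"
proof -
  have c': "continuous_on {a..b} f'" using c by (rule continuous_on_subset) simp
  have hb: "has_bochner_integral lborel (\<lambda>x. indicator {a..b} x *\<^sub>R f' x) (f b - f a)"
    by (rule has_bochner_integral_FTC_Icc[OF assms(1)])
      (use f c' in \<open>auto simp: has_real_derivative_iff_has_vector_derivative[symmetric] intro: DERIV_subset\<close>)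
  then have eq: "f b - f a = (LINT x|lborel. indicator {a..b} x * f' x)" and int: "integrable lborel (\<lambda>x. indicator {a..b} x * f' x)"
    by (simp_all add: has_bochner_integral_iff)
  have "ennreal \<bar>f b - f a\<bar> \<le> ennreal (LINT x|lborel. indicator {a..b} x * \<bar>f' x\<bar>)"
    using integral_abs_bound[of lborel "\<lambda>x. indicator {a..b} x * f' x"] unfolding eq
    by (intro ennreal_leI) (simp add: abs_mult)
  also have "\<dots> = (\<integral>\<^sup>+x. ennreal (indicator {a..b} x * \<bar>f' x\<bar>) \<partial>lborel)"
    using integrable_abs[OF int] by (intro nn_integral_eq_integral[symmetric]) (auto simp: abs_mult)
  finally show "ennreal \<bar>f b - f a\<bar> \<le> (\<integral>\<^sup>+t. indicator {a..b} t * ennreal \<bar>f' t\<bar> \<partial>lborel)"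
    by (simp add: ennreal_mult' ennreal_indicator)
  show "ennreal ((f b - f a)\<^sup>2) \<le> ennreal (b - a) * (\<integral>\<^sup>+t. indicator {a..b} t * ennreal ((f' t)\<^sup>2) \<partial>lborel)"
  proof (cases "a = b")
    case False
    then have ab: "a < b" using assms(1) by simp
    \<comment> \<open>The mean of f' over the interval; that its variance is nonnegative is the
      Cauchy-Schwarz inequality.\<close>
    define c where "c = (f b - f a) / (b - a)"
    have int2: "integrable lborel (\<lambda>x. indicator {a..b} x * (f' x)\<^sup>2)"
      using borel_integrable_compact[of "{a..b}" "\<lambda>x. (f' x)\<^sup>2"] c'
      by (auto intro!: continuous_intros simp: indicator_def if_distrib[where f="\<lambda>x. x * _"] cong: if_cong)
    have "0 \<le> (LINT x|lborel. indicator {a..b} x * (f' x - c)\<^sup>2)" by (intro integral_nonneg_AE) simp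
    also have "(LINT x|lborel. indicator {a..b} x * (f' x - c)\<^sup>2)
        = (LINT x|lborel. indicator {a..b} x * (f' x)\<^sup>2 - 2 * c * (indicator {a..b} x * f' x) + c\<^sup>2 * indicator {a..b} x)"
      by (intro Bochner_Integration.integral_cong) (auto simp: power2_diff algebra_simps)
    also have "\<dots> = (LINT x|lborel. indicator {a..b} x * (f' x)\<^sup>2) - 2 * c * (f b - f a) + c\<^sup>2 * (b - a)"
      using int int2 ab eq by simp
    also have "\<dots> = (LINT x|lborel. indicator {a..b} x * (f' x)\<^sup>2) - (f b - f a)\<^sup>2 / (b - a)"
      using ab by (simp add: c_def power2_eq_square)
    finally have "(f b - f a)\<^sup>2 \<le> (b - a) * (LINT x|lborel. indicator {a..b} x * (f' x)\<^sup>2)"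
      using ab by (simp add: field_simps)
    then have "ennreal ((f b - f a)\<^sup>2) \<le> ennreal (b - a) * ennreal (LINT x|lborel. indicator {a..b} x * (f' x)\<^sup>2)"
      using ab by (simp add: ennreal_leI ennreal_mult'[symmetric])
    also have "ennreal (LINT x|lborel. indicator {a..b} x * (f' x)\<^sup>2) = (\<integral>\<^sup>+x. ennreal (indicator {a..b} x * (f' x)\<^sup>2) \<partial>lborel)"
      using int2 by (intro nn_integral_eq_integral[symmetric]) auto
    finally show ?thesis by (simp add: ennreal_mult' ennreal_indicator)
  qed simp
qed

section \<open>Friedrichs' inequality\<close>

lemma nn_integral_translate:
  fixes f :: "'a::euclidean_space \<Rightarrow> ennreal"
  assumes [measurable]: "f \<in> borel_measurable borel"
  shows "(\<integral>\<^sup>+x. f (x + v) \<partial>lborel) = (\<integral>\<^sup>+x. f x \<partial>lborel)"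
proof -
  have "(\<integral>\<^sup>+x. f (x + v) \<partial>lborel) = (\<integral>\<^sup>+x. f x \<partial>distr lborel borel ((+) v))"
    by (subst nn_integral_distr) (auto simp: add.commute)
  then show ?thesis by (simp add: lborel_distr_plus)
qed

text \<open>Translation in one direction by more than the diameter of the support leads out of the support.\<close>

lemma friedrichs:
  fixes \<phi> :: "'a::euclidean_space \<Rightarrow> real"
  assumes "bounded \<Omega>"
  shows "\<exists>C\<ge>0. \<forall>\<phi> G. C1_grad \<phi> G \<and> (\<forall>x. x \<notin> \<Omega> \<longrightarrow> \<phi> x = 0) \<longrightarrow>
    (\<integral>\<^sup>+x. ennreal ((\<phi> x)\<^sup>2) \<partial>lborel) \<le> ennreal C * (\<integral>\<^sup>+x. ennreal ((norm (G x))\<^sup>2) \<partial>(lborel :: 'a measure))"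
proof -
  obtain r where r: "0 < r" "\<And>x. x \<in> \<Omega> \<Longrightarrow> norm x \<le> r" using assms by (auto simp: bounded_pos)
  obtain v :: 'a where v: "norm v = 1" using nonempty_Basis norm_Basis by blast
  \<comment> \<open>Exceeds the diameter 2 r of the ball that contains the set.\<close>
  define L where "L = 2 * r + 1"
  have L: "0 < L" using r by (simp add: L_def)
  have out: "x + L *\<^sub>R v \<notin> \<Omega>" if "x \<in> \<Omega>" for x
  proof
    assume "x + L *\<^sub>R v \<in> \<Omega>"
    then have "norm (L *\<^sub>R v) \<le> r + r"
      using norm_triangle_ineq4[of "x + L *\<^sub>R v" x] r(2)[of "x + L *\<^sub>R v"] r(2)[OF that] by simp
    then show False using v r by (simp add: L_def)
  qed
  have "(\<integral>\<^sup>+x. ennreal ((\<phi> x)\<^sup>2) \<partial>lborel) \<le> ennreal (L\<^sup>2) * (\<integral>\<^sup>+x. ennreal ((norm (G x))\<^sup>2) \<partial>lborel)"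
    if \<phi>: "C1_grad \<phi> G" "\<forall>x. x \<notin> \<Omega> \<longrightarrow> \<phi> x = 0" for \<phi> :: "'a \<Rightarrow> real" and G
  proof -
    have [measurable]: "\<phi> \<in> borel_measurable borel" "G \<in> borel_measurable borel"
      using C1_grad_measurable[OF \<phi>(1)] by auto
    have pt: "ennreal ((\<phi> x)\<^sup>2) \<le> ennreal L * (\<integral>\<^sup>+t. indicator {0..L} t * ennreal ((norm (G (x + t *\<^sub>R v)))\<^sup>2) \<partial>lborel)" for x
    proof (cases "x \<in> \<Omega>")
      case True
      have "ennreal ((\<phi> x)\<^sup>2) = ennreal ((\<phi> (x + L *\<^sub>R v) - \<phi> (x + 0 *\<^sub>R v))\<^sup>2)" using out[OF True] \<phi> by simp
      also have "\<dots> \<le> ennreal (L - 0) * (\<integral>\<^sup>+t. indicator {0..L} t * ennreal ((G (x + t *\<^sub>R v) \<bullet> v)\<^sup>2) \<partial>lborel)"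
        by (rule FTC_nn_bound(2)[where f="\<lambda>t. \<phi> (x + t *\<^sub>R v)"])
          (use L in \<open>auto intro: C1_grad_line[OF \<phi>(1)] C1_grad_line_continuous[OF \<phi>(1)]\<close>)
      also have "\<dots> \<le> ennreal L * (\<integral>\<^sup>+t. indicator {0..L} t * ennreal ((norm (G (x + t *\<^sub>R v)))\<^sup>2) \<partial>lborel)"
      proof -
        have "(G y \<bullet> v)\<^sup>2 \<le> (norm (G y))\<^sup>2" for y
          using Cauchy_Schwarz_ineq2[of "G y" v] v by (simp add: abs_le_square_iff[symmetric])
        then show ?thesis by (auto intro!: mult_left_mono nn_integral_mono ennreal_leI)
      qed
      finally show ?thesis .
    qed (use \<phi> in simp)
    have "(\<integral>\<^sup>+x. ennreal ((\<phi> x)\<^sup>2) \<partial>lborel) 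
        \<le> (\<integral>\<^sup>+x. ennreal L * (\<integral>\<^sup>+t. indicator {0..L} t * ennreal ((norm (G (x + t *\<^sub>R v)))\<^sup>2) \<partial>lborel) \<partial>lborel)"
      by (intro nn_integral_mono pt)
    also have "\<dots> = ennreal L * (\<integral>\<^sup>+x. \<integral>\<^sup>+t. indicator {0..L} t * ennreal ((norm (G (x + t *\<^sub>R v)))\<^sup>2) \<partial>lborel \<partial>lborel)"
      by (rule nn_integral_cmult) measurable
    also have "(\<integral>\<^sup>+x. \<integral>\<^sup>+t. indicator {0..L} t * ennreal ((norm (G (x + t *\<^sub>R v)))\<^sup>2) \<partial>lborel \<partial>lborel)
        = (\<integral>\<^sup>+t. \<integral>\<^sup>+x. indicator {0..L} t * ennreal ((norm (G (x + t *\<^sub>R v)))\<^sup>2) \<partial>lborel \<partial>lborel)"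
      by (rule lborel_pair.Fubini') measurable
    \<comment> \<open>Translation invariance makes the inner integral independent of t, so the
      t-integral contributes the second factor L.\<close>
    also have "\<dots> = (\<integral>\<^sup>+t. indicator {0..L} t * (\<integral>\<^sup>+x. ennreal ((norm (G x))\<^sup>2) \<partial>lborel) \<partial>lborel)"
      by (simp add: nn_integral_cmult nn_integral_translate[of "\<lambda>x. ennreal ((norm (G x))\<^sup>2)"])
    also have "\<dots> = ennreal L * (\<integral>\<^sup>+x. ennreal ((norm (G x))\<^sup>2) \<partial>lborel)"
      using L by (simp add: nn_integral_multc)
    finally show ?thesis using L by (simp add: power2_eq_square ennreal_mult mult.assoc)
  qed
  then show ?thesis by (intro exI[of _ "L\<^sup>2"]) auto
qed

text \<open>In nonnegative extended integrals, so that no integrability has to be known. The values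
  0 and infinity are treated apart because the weight in Young's inequality is a quotient of the two
  integrals.\<close>

lemma nn_integral_cauchy_schwarz:
  fixes f g :: "'a \<Rightarrow> real"
  assumes [measurable]: "f \<in> borel_measurable M" "g \<in> borel_measurable M"
    and nonneg: "\<And>x. 0 \<le> f x" "\<And>x. 0 \<le> g x"
  shows "(\<integral>\<^sup>+x. ennreal (f x * g x) \<partial>M)\<^sup>2 \<le> (\<integral>\<^sup>+x. ennreal ((f x)\<^sup>2) \<partial>M) * (\<integral>\<^sup>+x. ennreal ((g x)\<^sup>2) \<partial>M)"
    (is "?I\<^sup>2 \<le> ?X * ?Y")
proof (cases "?X = 0 \<or> ?Y = 0")
  case True
  then have "(AE x in M. ennreal ((f x)\<^sup>2) = 0) \<or> (AE x in M. ennreal ((g x)\<^sup>2) = 0)"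
    by (subst (asm) (1 2) nn_integral_0_iff_AE) auto
  then have "AE x in M. ennreal (f x * g x) = 0"
    by (auto elim!: eventually_mono)
  then have "?I = 0" by (subst nn_integral_0_iff_AE) auto
  then show ?thesis by simp
next
  case False
  show ?thesis
  proof (cases "?X = \<infinity> \<or> ?Y = \<infinity>")
    case True
    then have "?X * ?Y = \<infinity>" using False by (auto simp: ennreal_top_mult ennreal_mult_top)
    then show ?thesis by simp
  next
    case fin: False
    obtain x where x: "?X = ennreal x" "0 < x" using False fin by (cases ?X) (auto simp: less_le)
    obtain y where y: "?Y = ennreal y" "0 < y" using False fin by (cases ?Y) (auto simp: less_le)
    \<comment> \<open>The weight that balances the two terms of Young's inequality: each becomes
      half of sqrt x * sqrt y.\<close>
    define l where "l = sqrt y / sqrt x"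
    have l: "0 < l" using x y by (simp add: l_def)
    have pt: "f z * g z \<le> l / 2 * (f z)\<^sup>2 + inverse (2 * l) * (g z)\<^sup>2" for z
    proof -
      have "0 \<le> (l * f z - g z)\<^sup>2 / (2 * l)" using l by simp
      also have "\<dots> = l / 2 * (f z)\<^sup>2 + inverse (2 * l) * (g z)\<^sup>2 - f z * g z"
        using l by (simp add: power2_diff power_mult_distrib field_simps power2_eq_square[of l])
      finally show ?thesis by simp
    qed
    have "?I \<le> (\<integral>\<^sup>+z. ennreal (l / 2) * ennreal ((f z)\<^sup>2) + ennreal (inverse (2 * l)) * ennreal ((g z)\<^sup>2) \<partial>M)"
      using pt l by (intro nn_integral_mono) (simp add: ennreal_mult[symmetric] ennreal_plus[symmetric] ennreal_leI del: ennreal_plus)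
    also have "\<dots> = ennreal (l / 2) * ?X + ennreal (inverse (2 * l)) * ?Y"
      by (simp add: nn_integral_add nn_integral_cmult)
    also have "\<dots> = ennreal (l / 2 * x + inverse (2 * l) * y)"
      using l x y by (simp add: ennreal_mult[symmetric] ennreal_plus[symmetric] del: ennreal_plus)
    also have "l / 2 * x + inverse (2 * l) * y = sqrt x * sqrt y"
    proof -
      have "l * x = sqrt y * sqrt x"
        using x real_sqrt_mult_self[of x] by (simp add: l_def field_simps)
      moreover have "y / l = sqrt y * sqrt x"
        using x y real_sqrt_mult_self[of y] by (simp add: l_def field_simps)
      ultimately show ?thesis by (simp add: field_simps)
    qed
    finally have "?I\<^sup>2 \<le> (ennreal (sqrt x * sqrt y))\<^sup>2" by (intro power_mono) auto
    also have "\<dots> = ennreal (x * y)" using x y by (simp add: ennreal_power power_mult_distrib)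
    finally show ?thesis using x y by (simp add: ennreal_mult)
  qed
qed

text \<open>The fundamental theorem for the power h^(j+1), started at a zero a to the left of s.
  Integrating over the whole line makes the right-hand side independent of s; the planar inequality
  depends on this.\<close>

lemma compact_support_power_bound:
  fixes h h' :: "real \<Rightarrow> real"
  assumes h: "\<And>x. (h has_real_derivative h' x) (at x)" and c: "continuous_on UNIV h'"
    and "a \<le> s" "h a = 0"
  shows "ennreal (\<bar>h s\<bar> ^ Suc j) \<le> (\<integral>\<^sup>+t. ennreal (real (Suc j) * \<bar>h t\<bar> ^ j * \<bar>h' t\<bar>) \<partial>lborel)"
proof -
  have ch: "continuous_on UNIV h"
    by (auto simp: continuous_on_eq_continuous_at intro: DERIV_isCont h)
  have "ennreal \<bar>h s ^ Suc j - h a ^ Suc j\<bar> \<le> (\<integral>\<^sup>+t. indicator {a..s} t * ennreal \<bar>real (Suc j) * h t ^ j * h' t\<bar> \<partial>lborel)"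
  proof (rule FTC_nn_bound(1)[OF assms(3)])
    show "((\<lambda>x. h x ^ Suc j) has_real_derivative real (Suc j) * h x ^ j * h' x) (at x)" for x
      by (rule derivative_eq_intros h refl)+ (simp add: mult_ac)
    show "continuous_on UNIV (\<lambda>t. real (Suc j) * h t ^ j * h' t)"
      by (intro continuous_intros ch c)
  qed
  also have "\<dots> \<le> (\<integral>\<^sup>+t. ennreal (real (Suc j) * \<bar>h t\<bar> ^ j * \<bar>h' t\<bar>) \<partial>lborel)"
    by (intro nn_integral_mono) (auto simp: indicator_def abs_mult power_abs)
  finally show ?thesis using assms(4) by (simp add: power_abs abs_mult)
qed

text \<open>Ladyzhenskaya's inequality for \<open>f ^ Suc j\<close>: its square is bounded by a product of a function of
  \<open>s\<close> alone and a function of \<open>t\<close> alone.\<close>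

lemma plane_bound:
  fixes f f1 f2 g :: "real \<Rightarrow> real \<Rightarrow> real"
  assumes m[measurable]: "(\<lambda>(s, t). f s t) \<in> borel_measurable (lborel \<Otimes>\<^sub>M lborel)"
      "(\<lambda>(s, t). g s t) \<in> borel_measurable (lborel \<Otimes>\<^sub>M lborel)"
    and d1: "\<And>s t. ((\<lambda>s. f s t) has_real_derivative f1 s t) (at s)" "\<And>t. continuous_on UNIV (\<lambda>s. f1 s t)"
    and d2: "\<And>s t. ((\<lambda>t. f s t) has_real_derivative f2 s t) (at t)" "\<And>s. continuous_on UNIV (\<lambda>t. f2 s t)"
    and le: "\<And>s t. \<bar>f1 s t\<bar> \<le> g s t" "\<And>s t. \<bar>f2 s t\<bar> \<le> g s t"
    and supp: "\<And>s t. r < \<bar>s\<bar> \<Longrightarrow> f s t = 0" "\<And>s t. r < \<bar>t\<bar> \<Longrightarrow> f s t = 0"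
  shows "(\<integral>\<^sup>+s. \<integral>\<^sup>+t. ennreal (f s t ^ (2 * Suc j)) \<partial>lborel \<partial>lborel)
    \<le> ennreal ((real (Suc j))\<^sup>2) * (\<integral>\<^sup>+s. \<integral>\<^sup>+t. ennreal (f s t ^ (2 * j)) \<partial>lborel \<partial>lborel)
        * (\<integral>\<^sup>+s. \<integral>\<^sup>+t. ennreal ((g s t)\<^sup>2) \<partial>lborel \<partial>lborel)"
proof -
  have g0: "0 \<le> g s t" for s t using le(1)[of s t] by linarith
  let ?c = "real (Suc j)"
  let ?F = "\<lambda>s t. ennreal (?c * \<bar>f s t\<bar> ^ j * g s t)"
  \<comment> \<open>\<open>A t\<close> results from integrating along s and depends on t only;
    \<open>B s\<close> is the reverse. Both bound the same power of f, so their product bounds its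
    square and integrates to a product of two integrals.\<close>
  define A where "A t = (\<integral>\<^sup>+s. ?F s t \<partial>lborel)" for t
  define B where "B s = (\<integral>\<^sup>+t. ?F s t \<partial>lborel)" for s
  have [measurable]: "A \<in> borel_measurable lborel" "B \<in> borel_measurable lborel"
    unfolding A_def B_def by measurable
  have leA: "ennreal (\<bar>f s t\<bar> ^ Suc j) \<le> A t" for s t
  proof -
    have "ennreal (\<bar>f s t\<bar> ^ Suc j) \<le> (\<integral>\<^sup>+s. ennreal (?c * \<bar>f s t\<bar> ^ j * \<bar>f1 s t\<bar>) \<partial>lborel)"
      by (rule compact_support_power_bound[OF d1, where a="min s (- \<bar>r\<bar> - 1)"]) (auto intro: supp)
    also have "\<dots> \<le> A t" unfolding A_def using le
      by (intro nn_integral_mono ennreal_leI mult_left_mono) auto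
    finally show ?thesis .
  qed
  have leB: "ennreal (\<bar>f s t\<bar> ^ Suc j) \<le> B s" for s t
  proof -
    have "ennreal (\<bar>f s t\<bar> ^ Suc j) \<le> (\<integral>\<^sup>+t. ennreal (?c * \<bar>f s t\<bar> ^ j * \<bar>f2 s t\<bar>) \<partial>lborel)"
      by (rule compact_support_power_bound[OF d2, where a="min t (- \<bar>r\<bar> - 1)"]) (auto intro: supp)
    also have "\<dots> \<le> B s" unfolding B_def using le
      by (intro nn_integral_mono ennreal_leI mult_left_mono) auto
    finally show ?thesis .
  qed
  have "(\<integral>\<^sup>+s. \<integral>\<^sup>+t. ennreal (f s t ^ (2 * Suc j)) \<partial>lborel \<partial>lborel) \<le> (\<integral>\<^sup>+s. \<integral>\<^sup>+t. B s * A t \<partial>lborel \<partial>lborel)"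
  proof (intro nn_integral_mono)
    fix s t
    have "f s t ^ (2 * Suc j) = \<bar>f s t\<bar> ^ Suc j * \<bar>f s t\<bar> ^ Suc j"
      by (simp only: power_mult_distrib[symmetric] abs_mult_self_eq power_mult power2_eq_square)
    then have "ennreal (f s t ^ (2 * Suc j)) = ennreal (\<bar>f s t\<bar> ^ Suc j) * ennreal (\<bar>f s t\<bar> ^ Suc j)"
      by (simp only: ennreal_mult zero_le_power abs_ge_zero)
    also have "\<dots> \<le> B s * A t" by (intro mult_mono leA leB) auto
    finally show "ennreal (f s t ^ (2 * Suc j)) \<le> B s * A t" .
  qed
  also have "\<dots> = (\<integral>\<^sup>+s. B s \<partial>lborel) * (\<integral>\<^sup>+t. A t \<partial>lborel)"
    by (simp add: nn_integral_cmult nn_integral_multc)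
  also have "(\<integral>\<^sup>+t. A t \<partial>lborel) = (\<integral>\<^sup>+s. B s \<partial>lborel)"
    unfolding A_def B_def by (rule lborel_pair.Fubini') measurable
  also have "(\<integral>\<^sup>+s. B s \<partial>lborel) = (\<integral>\<^sup>+p. ennreal ((?c * \<bar>f (fst p) (snd p)\<bar> ^ j) * g (fst p) (snd p)) \<partial>(lborel \<Otimes>\<^sub>M lborel))"
    unfolding B_def by (subst lborel.nn_integral_fst[symmetric]) (simp_all add: case_prod_unfold)
  \<comment> \<open>The integrals of A and B are one and the same double integral; its square is
    split by Cauchy-Schwarz into the powers of f and the gradient bound g.\<close>
  also have "\<dots> * \<dots> \<le> (\<integral>\<^sup>+p. ennreal ((?c * \<bar>f (fst p) (snd p)\<bar> ^ j)\<^sup>2) \<partial>(lborel \<Otimes>\<^sub>M lborel))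
      * (\<integral>\<^sup>+p. ennreal ((g (fst p) (snd p))\<^sup>2) \<partial>(lborel \<Otimes>\<^sub>M lborel))"
    unfolding power2_eq_square[symmetric, where 'a=ennreal]
    using m by (intro nn_integral_cauchy_schwarz) (simp_all add: g0 case_prod_unfold)
  also have "(\<integral>\<^sup>+p. ennreal ((g (fst p) (snd p))\<^sup>2) \<partial>(lborel \<Otimes>\<^sub>M lborel)) = (\<integral>\<^sup>+s. \<integral>\<^sup>+t. ennreal ((g s t)\<^sup>2) \<partial>lborel \<partial>lborel)"
    using m by (subst lborel.nn_integral_fst[symmetric]) (simp_all add: case_prod_unfold)
  also have "(\<integral>\<^sup>+p. ennreal ((?c * \<bar>f (fst p) (snd p)\<bar> ^ j)\<^sup>2) \<partial>(lborel \<Otimes>\<^sub>M lborel))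
      = (\<integral>\<^sup>+p. ennreal (?c\<^sup>2) * ennreal (f (fst p) (snd p) ^ (2 * j)) \<partial>(lborel \<Otimes>\<^sub>M lborel))"
    by (intro nn_integral_cong) (simp add: power_mult_distrib ennreal_mult' power_mult[symmetric] mult.commute[of j] power_even_abs)
  also have "\<dots> = ennreal (?c\<^sup>2) * (\<integral>\<^sup>+p. ennreal (f (fst p) (snd p) ^ (2 * j)) \<partial>(lborel \<Otimes>\<^sub>M lborel))"
    using m by (intro nn_integral_cmult) (simp add: case_prod_unfold)
  also have "(\<integral>\<^sup>+p. ennreal (f (fst p) (snd p) ^ (2 * j)) \<partial>(lborel \<Otimes>\<^sub>M lborel)) = (\<integral>\<^sup>+s. \<integral>\<^sup>+t. ennreal (f s t ^ (2 * j)) \<partial>lborel \<partial>lborel)"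
    using m by (subst lborel.nn_integral_fst[symmetric]) (simp_all add: case_prod_unfold)
  finally show ?thesis .
qed

text \<open>The image of Lebesgue measure under the coordinate map agrees with \<open>lborel\<close>
  on boxes and hence equals it. The planar and spatial versions below rest on the same comparison of
  box volumes.\<close>

lemma nn_integral_line_coord:
  fixes F :: "'a::euclidean_space \<Rightarrow> ennreal"
  assumes B: "Basis = {i::'a}" and [measurable]: "F \<in> borel_measurable borel"
  shows "(\<integral>\<^sup>+x. F x \<partial>lborel) = (\<integral>\<^sup>+s. F (s *\<^sub>R i) \<partial>lborel)"
proof -
  have i: "i \<bullet> i = 1" by (rule inner_same_Basis) (simp add: B)
  have "lborel = distr lborel borel (\<lambda>s. s *\<^sub>R i)"
  proof (rule lborel_eqI)
    fix l u :: 'a assume le: "\<And>b. b \<in> Basis \<Longrightarrow> l \<bullet> b \<le> u \<bullet> b"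
    have "(\<lambda>s. s *\<^sub>R i) -` box l u = box (l \<bullet> i) (u \<bullet> i)" by (auto simp: box_def B i)
    then show "emeasure (distr lborel borel (\<lambda>s. s *\<^sub>R i)) (box l u) = (\<Prod>b\<in>Basis. (u - l) \<bullet> b)"
      using le by (subst emeasure_distr) (auto simp: B inner_diff_left)
  qed simp
  then have "(\<integral>\<^sup>+x. F x \<partial>lborel) = (\<integral>\<^sup>+x. F x \<partial>distr lborel borel (\<lambda>s. s *\<^sub>R i))" by simp
  then show ?thesis by (simp add: nn_integral_distr)
qed

lemma nn_integral_plane_coord:
  fixes F :: "'a::euclidean_space \<Rightarrow> ennreal"
  assumes B: "Basis = {i::'a, j}" "i \<noteq> j" and [measurable]: "F \<in> borel_measurable borel"
  shows "(\<integral>\<^sup>+x. F x \<partial>lborel) = (\<integral>\<^sup>+s. \<integral>\<^sup>+t. F (s *\<^sub>R i + t *\<^sub>R j) \<partial>lborel \<partial>lborel)"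
proof -
  have ip: "i \<bullet> i = 1" "j \<bullet> j = 1" "i \<bullet> j = 0" "j \<bullet> i = 0"
  proof -
    have "i \<in> Basis" "j \<in> Basis" unfolding B by auto
    then show "i \<bullet> i = 1" "j \<bullet> j = 1" "i \<bullet> j = 0" "j \<bullet> i = 0" using B(2) by (simp_all add: inner_Basis)
  qed
  let ?T = "\<lambda>p::real \<times> real. fst p *\<^sub>R i + snd p *\<^sub>R j"
  have T: "?T \<in> borel_measurable borel" by (intro borel_measurable_continuous_onI continuous_intros)
  have "lborel = distr lborel borel ?T"
  proof (rule lborel_eqI)
    fix l u :: 'a assume le: "\<And>b. b \<in> Basis \<Longrightarrow> l \<bullet> b \<le> u \<bullet> b"
    have "?T -` box l u = box (l \<bullet> i, l \<bullet> j) (u \<bullet> i, u \<bullet> j)"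
      by (auto simp: box_def B ip inner_simps Basis_prod_def)
    then show "emeasure (distr lborel borel ?T) (box l u) = (\<Prod>b\<in>Basis. (u - l) \<bullet> b)"
      using le by (subst emeasure_distr)
        (use T B(2) in \<open>auto simp: B inner_diff_left emeasure_lborel_box_eq Basis_prod_def ennreal_mult mult.commute\<close>)
  qed simp
  then have "(\<integral>\<^sup>+x. F x \<partial>lborel) = (\<integral>\<^sup>+x. F x \<partial>distr lborel borel ?T)" by simp
  also have "\<dots> = (\<integral>\<^sup>+p. F (?T p) \<partial>(lborel \<Otimes>\<^sub>M lborel))" using T by (simp add: nn_integral_distr lborel_prod)
  also have "\<dots> = (\<integral>\<^sup>+s. \<integral>\<^sup>+t. F (s *\<^sub>R i + t *\<^sub>R j) \<partial>lborel \<partial>lborel)"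
    by (subst lborel.nn_integral_fst[symmetric]) simp_all
  finally show ?thesis .
qed

text \<open>The coordinate along k is integrated last, so the two inner integrals run over a plane
  orthogonal to k, to which the planar inequality applies.\<close>

lemma nn_integral_space_coord:
  fixes F :: "'a::euclidean_space \<Rightarrow> ennreal"
  assumes B: "Basis = {i::'a, j, k}" "i \<noteq> j" "i \<noteq> k" "j \<noteq> k" and [measurable]: "F \<in> borel_measurable borel"
  shows "(\<integral>\<^sup>+x. F x \<partial>lborel) = (\<integral>\<^sup>+z. \<integral>\<^sup>+s. \<integral>\<^sup>+t. F (z *\<^sub>R k + (s *\<^sub>R i + t *\<^sub>R j)) \<partial>lborel \<partial>lborel \<partial>lborel)"
proof -
  have ip: "i \<bullet> i = 1" "j \<bullet> j = 1" "k \<bullet> k = 1" "i \<bullet> j = 0" "j \<bullet> i = 0" "i \<bullet> k = 0" "k \<bullet> i = 0" "j \<bullet> k = 0" "k \<bullet> j = 0"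
  proof -
    have "i \<in> Basis" "j \<in> Basis" "k \<in> Basis" unfolding B by auto
    then show "i \<bullet> i = 1" "j \<bullet> j = 1" "k \<bullet> k = 1" "i \<bullet> j = 0" "j \<bullet> i = 0" "i \<bullet> k = 0" "k \<bullet> i = 0" "j \<bullet> k = 0" "k \<bullet> j = 0"
      using B(2-4) by (simp_all add: inner_Basis)
  qed
  let ?T = "\<lambda>p::real \<times> real \<times> real. fst p *\<^sub>R k + (fst (snd p) *\<^sub>R i + snd (snd p) *\<^sub>R j)"
  have T: "?T \<in> borel_measurable borel" by (intro borel_measurable_continuous_onI continuous_intros)
  have "lborel = distr lborel borel ?T"
  proof (rule lborel_eqI)
    fix l u :: 'a assume le: "\<And>b. b \<in> Basis \<Longrightarrow> l \<bullet> b \<le> u \<bullet> b"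
    have "?T -` box l u = box (l \<bullet> k, l \<bullet> i, l \<bullet> j) (u \<bullet> k, u \<bullet> i, u \<bullet> j)"
      by (auto simp: box_def B ip inner_simps Basis_prod_def)
    then show "emeasure (distr lborel borel ?T) (box l u) = (\<Prod>b\<in>Basis. (u - l) \<bullet> b)"
      using le by (subst emeasure_distr)
        (use T B(2-4) in \<open>auto simp: B inner_diff_left emeasure_lborel_box_eq Basis_prod_def ennreal_mult mult_ac\<close>)
  qed simp
  have FT: "(\<lambda>p. F (?T p)) \<in> borel_measurable (lborel \<Otimes>\<^sub>M lborel)"
    unfolding lborel_prod using measurable_compose[OF T assms(5)] by simp
  from \<open>lborel = distr lborel borel ?T\<close> have "(\<integral>\<^sup>+x. F x \<partial>lborel) = (\<integral>\<^sup>+x. F x \<partial>distr lborel borel ?T)" by simp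
  also have "\<dots> = (\<integral>\<^sup>+p. F (?T p) \<partial>(lborel \<Otimes>\<^sub>M lborel))" using T by (simp add: nn_integral_distr lborel_prod)
  also have "\<dots> = (\<integral>\<^sup>+z. \<integral>\<^sup>+p. F (z *\<^sub>R k + (fst p *\<^sub>R i + snd p *\<^sub>R j)) \<partial>lborel \<partial>lborel)"
    using FT by (subst lborel.nn_integral_fst[symmetric]) simp_all
  also have "\<dots> = (\<integral>\<^sup>+z. \<integral>\<^sup>+p. F (z *\<^sub>R k + (fst p *\<^sub>R i + snd p *\<^sub>R j)) \<partial>(lborel \<Otimes>\<^sub>M lborel) \<partial>lborel)"
    by (simp add: lborel_prod)
  also have "\<dots> = (\<integral>\<^sup>+z. \<integral>\<^sup>+s. \<integral>\<^sup>+t. F (z *\<^sub>R k + (s *\<^sub>R i + t *\<^sub>R j)) \<partial>lborel \<partial>lborel \<partial>lborel)"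
    by (intro nn_integral_cong, subst lborel.nn_integral_fst[symmetric]) simp_all
  finally show ?thesis .
qed

section \<open>Sobolev inequalities in one, two and three dimensions\<close>

lemma C1_grad_slice:
  assumes "C1_grad \<phi> G"
  shows "((\<lambda>t. \<phi> (a + t *\<^sub>R v)) has_real_derivative G (a + t *\<^sub>R v) \<bullet> v) (at t)"
    "((\<lambda>t. \<phi> (t *\<^sub>R v + a)) has_real_derivative G (t *\<^sub>R v + a) \<bullet> v) (at t)"
    "continuous_on UNIV (\<lambda>t. G (a + t *\<^sub>R v) \<bullet> v)" "continuous_on UNIV (\<lambda>t. G (t *\<^sub>R v + a) \<bullet> v)"
  using C1_grad_line[OF assms, of a v] C1_grad_line_continuous[OF assms, of UNIV a v]
  by (simp_all add: add.commute)

text \<open>A bound along a line that does not depend on the point of the line: the derivative of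
  the square is 2 \<phi> times a directional derivative, hence at most the sum of the two
  squares.\<close>

lemma sq_bound_by_energy:
  fixes \<phi> :: "'a::euclidean_space \<Rightarrow> real"
  assumes \<phi>: "C1_grad \<phi> G" and v: "norm v = 1" and supp: "\<And>x. r < norm x \<Longrightarrow> \<phi> x = 0"
  shows "ennreal ((\<phi> (x + s *\<^sub>R v))\<^sup>2) \<le> (\<integral>\<^sup>+t. ennreal ((\<phi> (x + t *\<^sub>R v))\<^sup>2) + ennreal ((norm (G (x + t *\<^sub>R v)))\<^sup>2) \<partial>lborel)"
proof -
  \<comment> \<open>Far enough to the left that x + a v has norm larger than r, hence lies outside
    the support.\<close>
  define a where "a = min s (- \<bar>r\<bar> - norm x - 1)"
  have a: "a \<le> s" "\<phi> (x + a *\<^sub>R v) = 0"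
  proof -
    show "a \<le> s" by (simp add: a_def)
    have "\<bar>a\<bar> - norm x \<le> norm (x + a *\<^sub>R v)"
      using norm_triangle_ineq4[of "x + a *\<^sub>R v" x] v by simp
    moreover have "\<bar>a\<bar> \<ge> \<bar>r\<bar> + norm x + 1" by (simp add: a_def)
    ultimately show "\<phi> (x + a *\<^sub>R v) = 0" by (intro supp) linarith
  qed
  have "ennreal ((\<phi> (x + s *\<^sub>R v))\<^sup>2) = ennreal (\<bar>\<phi> (x + s *\<^sub>R v)\<bar> ^ Suc 1)" by (simp add: power2_eq_square)
  also have "\<dots> \<le> (\<integral>\<^sup>+t. ennreal (real (Suc 1) * \<bar>\<phi> (x + t *\<^sub>R v)\<bar> ^ 1 * \<bar>G (x + t *\<^sub>R v) \<bullet> v\<bar>) \<partial>lborel)"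
    by (rule compact_support_power_bound[where h="\<lambda>t. \<phi> (x + t *\<^sub>R v)", OF C1_grad_slice(1)[OF \<phi>] C1_grad_slice(3)[OF \<phi>] a])
  also have "\<dots> \<le> (\<integral>\<^sup>+t. ennreal ((\<phi> (x + t *\<^sub>R v))\<^sup>2) + ennreal ((norm (G (x + t *\<^sub>R v)))\<^sup>2) \<partial>lborel)"
  proof (intro nn_integral_mono)
    fix t
    let ?p = "\<bar>\<phi> (x + t *\<^sub>R v)\<bar>" and ?g = "G (x + t *\<^sub>R v)"
    have "\<bar>?g \<bullet> v\<bar> \<le> norm ?g" using Cauchy_Schwarz_ineq2[of ?g v] v by simp
    then have "real (Suc 1) * ?p ^ 1 * \<bar>?g \<bullet> v\<bar> \<le> 2 * ?p * norm ?g" by (simp add: mult_left_mono)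
    also have "\<dots> \<le> ?p\<^sup>2 + (norm ?g)\<^sup>2" by (rule sum_squares_bound)
    finally have "real (Suc 1) * ?p ^ 1 * \<bar>?g \<bullet> v\<bar> \<le> (\<phi> (x + t *\<^sub>R v))\<^sup>2 + (norm ?g)\<^sup>2" by simp
    then show "ennreal (real (Suc 1) * ?p ^ 1 * \<bar>?g \<bullet> v\<bar>) \<le> ennreal ((\<phi> (x + t *\<^sub>R v))\<^sup>2) + ennreal ((norm ?g)\<^sup>2)"
      by (simp add: ennreal_plus[symmetric] ennreal_leI del: ennreal_plus)
  qed
  finally show ?thesis .
qed

text \<open>Raises the exponent by 2 at the price of one gradient integral. On a line, the square of
  the function is bounded pointwise by the gradient integral; in the plane this is
  \<open>plane_bound\<close>.\<close>

lemma sobolev_step_dim_le_2: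
  assumes "bounded (\<Omega> :: 'a::euclidean_space set)" and dim: "DIM('a) \<le> 2" and "1 \<le> k"
  shows "\<exists>C\<ge>0. \<forall>\<phi> G. C1_grad \<phi> G \<and> (\<forall>x. x \<notin> \<Omega> \<longrightarrow> \<phi> x = 0) \<longrightarrow>
    (\<integral>\<^sup>+x. ennreal (\<phi> x ^ (2 * Suc k)) \<partial>lborel)
      \<le> ennreal C * (\<integral>\<^sup>+x. ennreal (\<phi> x ^ (2 * k)) \<partial>lborel) * (\<integral>\<^sup>+x. ennreal ((norm (G x))\<^sup>2) \<partial>(lborel :: 'a measure))"
proof -
  obtain r where r: "\<And>x. x \<in> \<Omega> \<Longrightarrow> norm x \<le> r" using assms(1) by (auto simp: bounded_iff)
  obtain C0 where C0: "0 \<le> C0" "\<And>\<phi> G. C1_grad \<phi> G \<Longrightarrow> (\<And>x. x \<notin> \<Omega> \<Longrightarrow> \<phi> x = 0) \<Longrightarrow>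
      (\<integral>\<^sup>+x. ennreal ((\<phi> x)\<^sup>2) \<partial>lborel) \<le> ennreal C0 * (\<integral>\<^sup>+x. ennreal ((norm (G x))\<^sup>2) \<partial>lborel)"
    using friedrichs[OF assms(1)] by metis
  have "card (Basis :: 'a set) = 1 \<or> card (Basis :: 'a set) = 2" using dim DIM_positive[where 'a='a] by linarith
  then consider i :: 'a where "Basis = {i}" | i j :: 'a where "Basis = {i, j}" "i \<noteq> j"
    by (auto simp: card_1_singleton_iff card_2_iff)
  then show ?thesis
  proof cases
    case (1 i)
    have i: "norm i = 1" by (rule norm_Basis) (simp add: 1)
    have repr: "x = 0 + (x \<bullet> i) *\<^sub>R i" for x using euclidean_representation[of x] by (simp add: 1)
    have "(\<integral>\<^sup>+x. ennreal (\<phi> x ^ (2 * Suc k)) \<partial>lborel)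
      \<le> ennreal (C0 + 1) * (\<integral>\<^sup>+x. ennreal (\<phi> x ^ (2 * k)) \<partial>lborel) * (\<integral>\<^sup>+x. ennreal ((norm (G x))\<^sup>2) \<partial>(lborel :: 'a measure))"
      if \<phi>: "C1_grad \<phi> G" "\<forall>x. x \<notin> \<Omega> \<longrightarrow> \<phi> x = 0" for \<phi> G
    proof -
      have [measurable]: "\<phi> \<in> borel_measurable borel" "G \<in> borel_measurable borel"
        using C1_grad_measurable[OF \<phi>(1)] by auto
      let ?D = "\<integral>\<^sup>+x. ennreal ((norm (G x))\<^sup>2) \<partial>lborel"
      have supp: "\<phi> x = 0" if "r < norm x" for x using r \<phi>(2) that by force
      \<comment> \<open>In dimension one the line is the whole space, so the bound along it is the
        full energy; Friedrichs' inequality absorbs its zero-order part.\<close>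
      have pt: "ennreal ((\<phi> x)\<^sup>2) \<le> ennreal (C0 + 1) * ?D" for x
      proof -
        have "ennreal ((\<phi> x)\<^sup>2) \<le> (\<integral>\<^sup>+t. ennreal ((\<phi> (0 + t *\<^sub>R i))\<^sup>2) + ennreal ((norm (G (0 + t *\<^sub>R i)))\<^sup>2) \<partial>lborel)"
          by (subst repr) (rule sq_bound_by_energy[OF \<phi>(1) i supp])
        also have "\<dots> = (\<integral>\<^sup>+x. ennreal ((\<phi> x)\<^sup>2) + ennreal ((norm (G x))\<^sup>2) \<partial>lborel)"
          by (subst nn_integral_line_coord[OF 1]) simp_all
        also have "\<dots> = (\<integral>\<^sup>+x. ennreal ((\<phi> x)\<^sup>2) \<partial>lborel) + ?D" by (simp add: nn_integral_add)
        also have "\<dots> \<le> ennreal C0 * ?D + ?D" using C0(2)[OF \<phi>(1)] \<phi>(2) by (intro add_right_mono) auto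
        also have "\<dots> = ennreal (C0 + 1) * ?D" using C0(1) by (simp add: distrib_right)
        finally show ?thesis .
      qed
      have "(\<integral>\<^sup>+x. ennreal (\<phi> x ^ (2 * Suc k)) \<partial>lborel) \<le> (\<integral>\<^sup>+x. (ennreal (C0 + 1) * ?D) * ennreal (\<phi> x ^ (2 * k)) \<partial>lborel)"
      proof (intro nn_integral_mono)
        fix x
        have "ennreal (\<phi> x ^ (2 * Suc k)) = ennreal ((\<phi> x)\<^sup>2) * ennreal (\<phi> x ^ (2 * k))"
          by (simp add: ennreal_mult[symmetric] power_add[symmetric])
        also have "\<dots> \<le> (ennreal (C0 + 1) * ?D) * ennreal (\<phi> x ^ (2 * k))" by (intro mult_right_mono pt) auto
        finally show "ennreal (\<phi> x ^ (2 * Suc k)) \<le> (ennreal (C0 + 1) * ?D) * ennreal (\<phi> x ^ (2 * k))" .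
      qed
      also have "\<dots> = (ennreal (C0 + 1) * ?D) * (\<integral>\<^sup>+x. ennreal (\<phi> x ^ (2 * k)) \<partial>lborel)"
        by (rule nn_integral_cmult) measurable
      finally show ?thesis by (simp add: mult_ac)
    qed
    then show ?thesis using C0(1) by (intro exI[of _ "C0 + 1"]) auto
  next
    case (2 i j)
    have ij: "i \<in> Basis" "j \<in> Basis" using 2 by auto
    have ip: "i \<bullet> j = 0" "j \<bullet> i = 0" "i \<bullet> i = 1" "j \<bullet> j = 1" using ij 2 by (simp_all add: inner_Basis)
    have "(\<integral>\<^sup>+x. ennreal (\<phi> x ^ (2 * Suc k)) \<partial>lborel)
      \<le> ennreal ((real (Suc k))\<^sup>2) * (\<integral>\<^sup>+x. ennreal (\<phi> x ^ (2 * k)) \<partial>lborel) * (\<integral>\<^sup>+x. ennreal ((norm (G x))\<^sup>2) \<partial>(lborel :: 'a measure))"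
      if \<phi>: "C1_grad \<phi> G" "\<forall>x. x \<notin> \<Omega> \<longrightarrow> \<phi> x = 0" for \<phi> G
    proof -
      have [measurable]: "\<phi> \<in> borel_measurable borel" "G \<in> borel_measurable borel"
        using C1_grad_measurable[OF \<phi>(1)] by auto
      have supp: "\<phi> x = 0" if "r < norm x" for x using r \<phi>(2) that by force
      have supp_ij: "\<phi> (s *\<^sub>R i + t *\<^sub>R j) = 0" if "r < \<bar>s\<bar> \<or> r < \<bar>t\<bar>" for s t
      proof (rule supp)
        have "\<bar>s\<bar> \<le> norm (s *\<^sub>R i + t *\<^sub>R j)" "\<bar>t\<bar> \<le> norm (s *\<^sub>R i + t *\<^sub>R j)"
          using Basis_le_norm[OF ij(1), of "s *\<^sub>R i + t *\<^sub>R j"] Basis_le_norm[OF ij(2), of "s *\<^sub>R i + t *\<^sub>R j"] ip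
          by (simp_all add: inner_simps)
        then show "r < norm (s *\<^sub>R i + t *\<^sub>R j)" using that by linarith
      qed
      have "(\<integral>\<^sup>+s. \<integral>\<^sup>+t. ennreal (\<phi> (s *\<^sub>R i + t *\<^sub>R j) ^ (2 * Suc k)) \<partial>lborel \<partial>lborel)
        \<le> ennreal ((real (Suc k))\<^sup>2) * (\<integral>\<^sup>+s. \<integral>\<^sup>+t. ennreal (\<phi> (s *\<^sub>R i + t *\<^sub>R j) ^ (2 * k)) \<partial>lborel \<partial>lborel)
        * (\<integral>\<^sup>+s. \<integral>\<^sup>+t. ennreal ((norm (G (s *\<^sub>R i + t *\<^sub>R j)))\<^sup>2) \<partial>lborel \<partial>lborel)"
      proof (rule plane_bound[where ?f1.0="\<lambda>s t. G (s *\<^sub>R i + t *\<^sub>R j) \<bullet> i" and ?f2.0="\<lambda>s t. G (s *\<^sub>R i + t *\<^sub>R j) \<bullet> j" and r=r])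
        show "(\<lambda>(s, t). \<phi> (s *\<^sub>R i + t *\<^sub>R j)) \<in> borel_measurable (lborel \<Otimes>\<^sub>M lborel)"
             "(\<lambda>(s, t). norm (G (s *\<^sub>R i + t *\<^sub>R j))) \<in> borel_measurable (lborel \<Otimes>\<^sub>M lborel)"
          by (simp_all add: case_prod_unfold)
      qed (use C1_grad_slice[OF \<phi>(1)] supp_ij Basis_le_norm[OF ij(1)] Basis_le_norm[OF ij(2)] in auto)
      moreover have "(\<integral>\<^sup>+x. ennreal (\<phi> x ^ n) \<partial>lborel) = (\<integral>\<^sup>+s. \<integral>\<^sup>+t. ennreal (\<phi> (s *\<^sub>R i + t *\<^sub>R j) ^ n) \<partial>lborel \<partial>lborel)" for n
        by (rule nn_integral_plane_coord[OF 2]) measurable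
      moreover have "(\<integral>\<^sup>+x. ennreal ((norm (G x))\<^sup>2) \<partial>lborel) = (\<integral>\<^sup>+s. \<integral>\<^sup>+t. ennreal ((norm (G (s *\<^sub>R i + t *\<^sub>R j)))\<^sup>2) \<partial>lborel \<partial>lborel)"
        by (rule nn_integral_plane_coord[OF 2]) measurable
      ultimately show ?thesis by (simp only:)
    qed
    then show ?thesis by (intro exI[of _ "(real (Suc k))\<^sup>2"]) auto
  qed
qed

text \<open>On each plane orthogonal to k, the integral of the fourth power is at most 4 times the
  product of the planar integrals of the square and of the squared gradient. The first factor is
  bounded uniformly over the planes, and the second sums up to the full gradient integral.\<close>

lemma sobolev_dim_3:
  assumes "bounded (\<Omega> :: 'a::euclidean_space set)" and dim: "DIM('a) = 3"
  shows "\<exists>C\<ge>0. \<forall>\<phi> G. C1_grad \<phi> G \<and> (\<forall>x. x \<notin> \<Omega> \<longrightarrow> \<phi> x = 0) \<longrightarrow>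
    (\<integral>\<^sup>+x. ennreal (\<phi> x ^ 4) \<partial>lborel) \<le> ennreal C * (\<integral>\<^sup>+x. ennreal ((norm (G x))\<^sup>2) \<partial>(lborel :: 'a measure))\<^sup>2"
proof -
  obtain r where r: "\<And>x. x \<in> \<Omega> \<Longrightarrow> norm x \<le> r" using assms(1) by (auto simp: bounded_iff)
  obtain C0 where C0: "0 \<le> C0" "\<And>\<phi> G. C1_grad \<phi> G \<Longrightarrow> (\<And>x. x \<notin> \<Omega> \<Longrightarrow> \<phi> x = 0) \<Longrightarrow>
      (\<integral>\<^sup>+x. ennreal ((\<phi> x)\<^sup>2) \<partial>lborel) \<le> ennreal C0 * (\<integral>\<^sup>+x. ennreal ((norm (G x))\<^sup>2) \<partial>lborel)"
    using friedrichs[OF assms(1)] by metis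
  obtain i j k :: 'a where B: "Basis = {i, j, k}" "i \<noteq> j" "i \<noteq> k" "j \<noteq> k"
    using dim unfolding card_3_iff by blast
  have ijk: "i \<in> Basis" "j \<in> Basis" "k \<in> Basis" using B by auto
  have ip: "i \<bullet> j = 0" "j \<bullet> i = 0" "i \<bullet> k = 0" "k \<bullet> i = 0" "j \<bullet> k = 0" "k \<bullet> j = 0" "i \<bullet> i = 1" "j \<bullet> j = 1"
    using ijk B(2-4) by (simp_all add: inner_Basis)
  have "(\<integral>\<^sup>+x. ennreal (\<phi> x ^ 4) \<partial>lborel) \<le> ennreal (4 * (C0 + 1)) * (\<integral>\<^sup>+x. ennreal ((norm (G x))\<^sup>2) \<partial>(lborel :: 'a measure))\<^sup>2"
    if \<phi>: "C1_grad \<phi> G" "\<forall>x. x \<notin> \<Omega> \<longrightarrow> \<phi> x = 0" for \<phi> G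
  proof -
    have [measurable]: "\<phi> \<in> borel_measurable borel" "G \<in> borel_measurable borel"
      using C1_grad_measurable[OF \<phi>(1)] by auto
    let ?D = "\<integral>\<^sup>+x. ennreal ((norm (G x))\<^sup>2) \<partial>lborel"
    have supp: "\<phi> x = 0" if "r < norm x" for x using r \<phi>(2) that by force
    let ?T = "\<lambda>z s t. z *\<^sub>R k + (s *\<^sub>R i + t *\<^sub>R j)"
    have supp_ij: "\<phi> (?T z s t) = 0" if "r < \<bar>s\<bar> \<or> r < \<bar>t\<bar>" for z s t
    proof (rule supp)
      have "\<bar>s\<bar> \<le> norm (?T z s t)" "\<bar>t\<bar> \<le> norm (?T z s t)"
        using Basis_le_norm[OF ijk(1), of "?T z s t"] Basis_le_norm[OF ijk(2), of "?T z s t"] ip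
        by (simp_all add: inner_simps)
      then show "r < norm (?T z s t)" using that by linarith
    qed
    \<comment> \<open>Each point of the plane is estimated along the line through it in direction k;
      integrating over the plane collects the whole space, whence a bound independent of z.\<close>
    have slice: "(\<integral>\<^sup>+s. \<integral>\<^sup>+t. ennreal (\<phi> (?T z s t) ^ 2) \<partial>lborel \<partial>lborel) \<le> ennreal (C0 + 1) * ?D" for z
    proof -
      have "(\<integral>\<^sup>+s. \<integral>\<^sup>+t. ennreal (\<phi> (?T z s t) ^ 2) \<partial>lborel \<partial>lborel)
        \<le> (\<integral>\<^sup>+s. \<integral>\<^sup>+t. \<integral>\<^sup>+z. ennreal ((\<phi> (s *\<^sub>R i + (t *\<^sub>R j + z *\<^sub>R k)))\<^sup>2) + ennreal ((norm (G (s *\<^sub>R i + (t *\<^sub>R j + z *\<^sub>R k))))\<^sup>2) \<partial>lborel \<partial>lborel \<partial>lborel)"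
      proof (intro nn_integral_mono)
        fix s t
        show "ennreal (\<phi> (?T z s t) ^ 2) \<le> (\<integral>\<^sup>+z. ennreal ((\<phi> (s *\<^sub>R i + (t *\<^sub>R j + z *\<^sub>R k)))\<^sup>2) + ennreal ((norm (G (s *\<^sub>R i + (t *\<^sub>R j + z *\<^sub>R k))))\<^sup>2) \<partial>lborel)"
          using sq_bound_by_energy[OF \<phi>(1) norm_Basis[OF ijk(3)] supp, where x="s *\<^sub>R i + t *\<^sub>R j" and s=z]
          by (simp add: add_ac)
      qed
      also have "\<dots> = (\<integral>\<^sup>+x. ennreal ((\<phi> x)\<^sup>2) + ennreal ((norm (G x))\<^sup>2) \<partial>lborel)"
        by (rule nn_integral_space_coord[symmetric]) (use B in auto)
      also have "\<dots> = (\<integral>\<^sup>+x. ennreal ((\<phi> x)\<^sup>2) \<partial>lborel) + ?D" by (simp add: nn_integral_add)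
      also have "\<dots> \<le> ennreal C0 * ?D + ?D" using C0(2)[OF \<phi>(1)] \<phi>(2) by (intro add_right_mono) auto
      also have "\<dots> = ennreal (C0 + 1) * ?D" using C0(1) by (simp add: distrib_right)
      finally show ?thesis .
    qed
    have plane: "(\<integral>\<^sup>+s. \<integral>\<^sup>+t. ennreal (\<phi> (?T z s t) ^ 4) \<partial>lborel \<partial>lborel)
        \<le> ennreal (4 * (C0 + 1)) * ?D * (\<integral>\<^sup>+s. \<integral>\<^sup>+t. ennreal ((norm (G (?T z s t)))\<^sup>2) \<partial>lborel \<partial>lborel)" for z
    proof -
      have "(\<integral>\<^sup>+s. \<integral>\<^sup>+t. ennreal (\<phi> (?T z s t) ^ (2 * Suc 1)) \<partial>lborel \<partial>lborel)
        \<le> ennreal ((real (Suc 1))\<^sup>2) * (\<integral>\<^sup>+s. \<integral>\<^sup>+t. ennreal (\<phi> (?T z s t) ^ (2 * 1)) \<partial>lborel \<partial>lborel)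
          * (\<integral>\<^sup>+s. \<integral>\<^sup>+t. ennreal ((norm (G (?T z s t)))\<^sup>2) \<partial>lborel \<partial>lborel)"
      proof (rule plane_bound[where ?f1.0="\<lambda>s t. G (?T z s t) \<bullet> i" and ?f2.0="\<lambda>s t. G (?T z s t) \<bullet> j" and r=r])
        show "(\<lambda>(s, t). \<phi> (?T z s t)) \<in> borel_measurable (lborel \<Otimes>\<^sub>M lborel)"
             "(\<lambda>(s, t). norm (G (?T z s t))) \<in> borel_measurable (lborel \<Otimes>\<^sub>M lborel)"
          by (simp_all add: case_prod_unfold)
        show "((\<lambda>s. \<phi> (?T z s t)) has_real_derivative G (?T z s t) \<bullet> i) (at s)"
             "continuous_on UNIV (\<lambda>s. G (?T z s t) \<bullet> i)" for s t
          using C1_grad_slice(1)[OF \<phi>(1), of "z *\<^sub>R k + t *\<^sub>R j" i s] C1_grad_slice(3)[OF \<phi>(1), of "z *\<^sub>R k + t *\<^sub>R j" i]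
          by (simp_all add: add_ac)
        show "((\<lambda>t. \<phi> (?T z s t)) has_real_derivative G (?T z s t) \<bullet> j) (at t)"
             "continuous_on UNIV (\<lambda>t. G (?T z s t) \<bullet> j)" for s t
          using C1_grad_slice(1)[OF \<phi>(1), of "z *\<^sub>R k + s *\<^sub>R i" j t] C1_grad_slice(3)[OF \<phi>(1), of "z *\<^sub>R k + s *\<^sub>R i" j]
          by (simp_all add: add_ac)
      qed (use supp_ij Basis_le_norm[OF ijk(1)] Basis_le_norm[OF ijk(2)] in auto)
      also have "\<dots> \<le> ennreal ((real (Suc 1))\<^sup>2) * (ennreal (C0 + 1) * ?D)
          * (\<integral>\<^sup>+s. \<integral>\<^sup>+t. ennreal ((norm (G (?T z s t)))\<^sup>2) \<partial>lborel \<partial>lborel)"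
        using slice[of z] by (intro mult_right_mono mult_left_mono) auto
      moreover have "ennreal (4 * (C0 + 1)) = ennreal ((real (Suc 1))\<^sup>2) * ennreal (C0 + 1)"
        using C0(1) by (subst ennreal_mult[symmetric]) auto
      moreover have "2 * Suc 1 = 4" by simp
      ultimately show ?thesis by (simp only: mult.assoc)
    qed
    have "(\<integral>\<^sup>+x. ennreal (\<phi> x ^ 4) \<partial>lborel) = (\<integral>\<^sup>+z. \<integral>\<^sup>+s. \<integral>\<^sup>+t. ennreal (\<phi> (?T z s t) ^ 4) \<partial>lborel \<partial>lborel \<partial>lborel)"
      by (rule nn_integral_space_coord[OF B]) measurable
    also have "\<dots> \<le> (\<integral>\<^sup>+z. (ennreal (4 * (C0 + 1)) * ?D) * (\<integral>\<^sup>+s. \<integral>\<^sup>+t. ennreal ((norm (G (?T z s t)))\<^sup>2) \<partial>lborel \<partial>lborel) \<partial>lborel)"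
      by (intro nn_integral_mono plane)
    also have "\<dots> = (ennreal (4 * (C0 + 1)) * ?D) * (\<integral>\<^sup>+z. \<integral>\<^sup>+s. \<integral>\<^sup>+t. ennreal ((norm (G (?T z s t)))\<^sup>2) \<partial>lborel \<partial>lborel \<partial>lborel)"
      by (rule nn_integral_cmult) measurable
    also have "(\<integral>\<^sup>+z. \<integral>\<^sup>+s. \<integral>\<^sup>+t. ennreal ((norm (G (?T z s t)))\<^sup>2) \<partial>lborel \<partial>lborel \<partial>lborel) = ?D"
      by (rule nn_integral_space_coord[OF B, symmetric]) measurable
    finally show ?thesis by (simp add: power2_eq_square mult.assoc)
  qed
  then show ?thesis using C0(1) by (intro exI[of _ "4 * (C0 + 1)"]) auto
qed

text \<open>In dimensions one and two the exponent climbs from Friedrichs' inequality, the case k =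
  1; in dimension three the fourth power is treated directly.\<close>

lemma sobolev_C1:
  assumes "bounded (\<Omega> :: 'a::euclidean_space set)" and dim: "DIM('a) \<le> 2 \<or> DIM('a) = 3 \<and> k = 2" and "1 \<le> k"
  shows "\<exists>C\<ge>0. \<forall>\<phi> G. C1_grad \<phi> G \<and> (\<forall>x. x \<notin> \<Omega> \<longrightarrow> \<phi> x = 0) \<longrightarrow>
    (\<integral>\<^sup>+x. ennreal (\<phi> x ^ (2 * k)) \<partial>lborel) \<le> ennreal C * (\<integral>\<^sup>+x. ennreal ((norm (G x))\<^sup>2) \<partial>(lborel :: 'a measure)) ^ k"
proof (cases "DIM('a) = 3")
  case True
  then show ?thesis using sobolev_dim_3[OF assms(1)] dim by auto
next
  case False
  then have d2: "DIM('a) \<le> 2" using dim by auto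
  from assms(3) show ?thesis
  proof (induction k rule: nat_induct_at_least)
    case base
    then show ?case using friedrichs[OF assms(1)] by simp
  next
    case (Suc k)
    obtain C where C: "0 \<le> C" "\<And>\<phi> G. C1_grad \<phi> G \<Longrightarrow> \<forall>x. x \<notin> \<Omega> \<longrightarrow> \<phi> x = 0 \<Longrightarrow>
      (\<integral>\<^sup>+x. ennreal (\<phi> x ^ (2 * k)) \<partial>lborel) \<le> ennreal C * (\<integral>\<^sup>+x. ennreal ((norm (G x))\<^sup>2) \<partial>(lborel :: 'a measure)) ^ k"
      using Suc.IH by blast
    obtain C' where C': "0 \<le> C'" "\<And>\<phi> G. C1_grad \<phi> G \<Longrightarrow> \<forall>x. x \<notin> \<Omega> \<longrightarrow> \<phi> x = 0 \<Longrightarrow>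
      (\<integral>\<^sup>+x. ennreal (\<phi> x ^ (2 * Suc k)) \<partial>lborel)
      \<le> ennreal C' * (\<integral>\<^sup>+x. ennreal (\<phi> x ^ (2 * k)) \<partial>lborel) * (\<integral>\<^sup>+x. ennreal ((norm (G x))\<^sup>2) \<partial>(lborel :: 'a measure))"
      using sobolev_step_dim_le_2[OF assms(1) d2 Suc.hyps] by blast
    have "(\<integral>\<^sup>+x. ennreal (\<phi> x ^ (2 * Suc k)) \<partial>lborel) \<le> ennreal (C' * C) * (\<integral>\<^sup>+x. ennreal ((norm (G x))\<^sup>2) \<partial>(lborel :: 'a measure)) ^ Suc k"
      if \<phi>: "C1_grad \<phi> G" "\<forall>x. x \<notin> \<Omega> \<longrightarrow> \<phi> x = 0" for \<phi> G
    proof -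
      let ?D = "\<integral>\<^sup>+x. ennreal ((norm (G x))\<^sup>2) \<partial>lborel"
      have "(\<integral>\<^sup>+x. ennreal (\<phi> x ^ (2 * Suc k)) \<partial>lborel) \<le> ennreal C' * (\<integral>\<^sup>+x. ennreal (\<phi> x ^ (2 * k)) \<partial>lborel) * ?D"
        by (rule C'(2)[OF \<phi>])
      also have "\<dots> \<le> ennreal C' * (ennreal C * ?D ^ k) * ?D"
        by (intro mult_right_mono mult_left_mono C(2)[OF \<phi>]) auto
      also have "\<dots> = ennreal (C' * C) * ?D ^ Suc k" using C(1) C'(1) by (simp add: ennreal_mult mult_ac)
      finally show ?thesis .
    qed
    then show ?case using C(1) C'(1) by (intro exI[of _ "C' * C"]) auto
  qed
qed

section \<open>Poincare inequality on convex sets and compactness\<close>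

lemma nn_integral_affine:
  fixes f :: "'a::euclidean_space \<Rightarrow> ennreal"
  assumes [measurable]: "f \<in> borel_measurable borel" and c: "c \<noteq> 0"
  shows "(\<integral>\<^sup>+x. f x \<partial>lborel) = ennreal (\<bar>c\<bar> ^ DIM('a)) * (\<integral>\<^sup>+x. f (t + c *\<^sub>R x) \<partial>lborel)"
  by (subst lborel_affine[OF c, of t])
    (simp add: nn_integral_density nn_integral_distr nn_integral_cmult)

lemma le_ennreal_mult:
  assumes "1 \<le> c" shows "X \<le> ennreal c * X"
proof -
  have "1 * X \<le> ennreal c * X" by (rule mult_right_mono) (use assms in auto)
  then show ?thesis by simp
qed

text \<open>Going from x only to the midpoint keeps t \<le> 1/2, so for fixed y the map x \<mapsto>
  t y + (1 - t) x scales by at least 1/2 and its inverse Jacobian is at most 2^d. Convexity keeps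
  the image in Q. The constant is \<epsilon>^2 / 2 from the fundamental theorem, times 2^d, times
  the length 1/2 of the t-interval.\<close>

lemma midpoint_difference_bound:
  fixes Q :: "'a::euclidean_space set"
  assumes \<phi>: "C1_grad \<phi> G" and Q: "convex Q" "Q \<in> sets borel"
    and diam: "\<And>x y. x \<in> Q \<Longrightarrow> y \<in> Q \<Longrightarrow> norm (y - x) \<le> \<epsilon>" and "0 \<le> \<epsilon>"
  shows "(\<integral>\<^sup>+x. \<integral>\<^sup>+y. indicator Q x * indicator Q y * ennreal ((\<phi> (x + (1/2) *\<^sub>R (y - x)) - \<phi> x)\<^sup>2) \<partial>lborel \<partial>lborel)
    \<le> ennreal (2 ^ DIM('a) * \<epsilon>\<^sup>2 / 4) * emeasure lborel Q * (\<integral>\<^sup>+x. indicator Q x * ennreal ((norm (G x))\<^sup>2) \<partial>lborel)"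
proof -
  note [measurable] = Q(2) C1_grad_measurable[OF \<phi>]
  let ?D = "\<integral>\<^sup>+x. indicator Q x * ennreal ((norm (G x))\<^sup>2) \<partial>lborel"
  let ?h = "\<lambda>x y t. indicator {0..1/2} t * (indicator Q x * indicator Q y * ennreal ((norm (G (x + t *\<^sub>R (y - x))))\<^sup>2)) :: ennreal"
  have pt: "indicator Q x * indicator Q y * ennreal ((\<phi> (x + (1/2) *\<^sub>R (y - x)) - \<phi> x)\<^sup>2)
      \<le> ennreal (\<epsilon>\<^sup>2 / 2) * (\<integral>\<^sup>+t. ?h x y t \<partial>lborel)" for x y
  proof (cases "x \<in> Q \<and> y \<in> Q")
    case True
    have "ennreal ((\<phi> (x + (1/2) *\<^sub>R (y - x)) - \<phi> (x + 0 *\<^sub>R (y - x)))\<^sup>2)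
        \<le> ennreal (1/2 - 0) * (\<integral>\<^sup>+t. indicator {0..1/2} t * ennreal ((G (x + t *\<^sub>R (y - x)) \<bullet> (y - x))\<^sup>2) \<partial>lborel)"
      by (rule FTC_nn_bound(2)[where f="\<lambda>t. \<phi> (x + t *\<^sub>R (y - x))"])
        (auto intro: C1_grad_line[OF \<phi>] C1_grad_line_continuous[OF \<phi>])
    also have "\<dots> \<le> ennreal (1/2 - 0) * (\<integral>\<^sup>+t. ennreal (\<epsilon>\<^sup>2) * ?h x y t \<partial>lborel)"
    proof (intro mult_left_mono nn_integral_mono)
      fix t
      let ?g = "G (x + t *\<^sub>R (y - x))"
      have "\<bar>?g \<bullet> (y - x)\<bar> \<le> norm ?g * \<epsilon>"
        using Cauchy_Schwarz_ineq2[of ?g "y - x"] diam[of x y] True mult_left_mono[of "norm (y - x)" \<epsilon> "norm ?g"] by auto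
      then have "(?g \<bullet> (y - x))\<^sup>2 \<le> (norm ?g * \<epsilon>)\<^sup>2"
        using assms(5) by (simp add: abs_le_square_iff[symmetric])
      then have "(?g \<bullet> (y - x))\<^sup>2 \<le> \<epsilon>\<^sup>2 * (norm ?g)\<^sup>2" by (simp add: power_mult_distrib mult.commute)
      then have "ennreal ((?g \<bullet> (y - x))\<^sup>2) \<le> ennreal (\<epsilon>\<^sup>2) * ennreal ((norm ?g)\<^sup>2)"
        by (simp add: ennreal_mult[symmetric] ennreal_leI)
      then show "indicator {0..1/2} t * ennreal ((?g \<bullet> (y - x))\<^sup>2) \<le> ennreal (\<epsilon>\<^sup>2) * ?h x y t"
        using True by (auto simp: indicator_def)
    qed simp
    also have "\<dots> = ennreal (1/2 - 0) * (ennreal (\<epsilon>\<^sup>2) * (\<integral>\<^sup>+t. ?h x y t \<partial>lborel))"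
      by (subst nn_integral_cmult) measurable
    also have "\<dots> = (ennreal (1/2 - 0) * ennreal (\<epsilon>\<^sup>2)) * (\<integral>\<^sup>+t. ?h x y t \<partial>lborel)"
      by (rule mult.assoc[symmetric])
    also have "ennreal (1/2 - 0) * ennreal (\<epsilon>\<^sup>2) = ennreal (\<epsilon>\<^sup>2 / 2)"
      by (subst ennreal_mult[symmetric]) auto
    finally show ?thesis using True by simp
  qed auto
  \<comment> \<open>The substitution in x for fixed y and t.\<close>
  have inner: "(\<integral>\<^sup>+x. ?h x y t \<partial>lborel) \<le> ennreal (2 ^ DIM('a)) * ?D * indicator {0..1/2} t * indicator Q y" for y t
  proof (cases "t \<in> {0..1/2} \<and> y \<in> Q")
    case True
    let ?c = "1 - t"
    have c: "1/2 \<le> ?c" "?c \<le> 1" using True by auto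
    have le1: "1 \<le> (2 * ?c) ^ DIM('a)" using c by (intro one_le_power) auto
    have "(\<integral>\<^sup>+x. ?h x y t \<partial>lborel) \<le> (\<integral>\<^sup>+x. indicator Q (t *\<^sub>R y + ?c *\<^sub>R x) * ennreal ((norm (G (t *\<^sub>R y + ?c *\<^sub>R x)))\<^sup>2) \<partial>lborel)"
    proof (intro nn_integral_mono)
      fix x
      have "x \<in> Q \<Longrightarrow> t *\<^sub>R y + ?c *\<^sub>R x \<in> Q" using Q(1) True by (auto intro: convexD)
      moreover have "x + t *\<^sub>R (y - x) = t *\<^sub>R y + ?c *\<^sub>R x" by (simp add: algebra_simps)
      ultimately show "?h x y t \<le> indicator Q (t *\<^sub>R y + ?c *\<^sub>R x) * ennreal ((norm (G (t *\<^sub>R y + ?c *\<^sub>R x)))\<^sup>2)"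
        using True by (auto simp: indicator_def)
    qed
    \<comment> \<open>Since 1 - t is at least 1/2, this factor is at least 1; it supplies the
      Jacobian (1 - t)^d of the substitution.\<close>
    also have "\<dots> \<le> ennreal ((2 * ?c) ^ DIM('a)) * \<dots>"
      by (rule le_ennreal_mult[OF le1])
    also have "\<dots> = ennreal (2 ^ DIM('a)) * (ennreal (\<bar>?c\<bar> ^ DIM('a)) * (\<integral>\<^sup>+x. indicator Q (t *\<^sub>R y + ?c *\<^sub>R x) * ennreal ((norm (G (t *\<^sub>R y + ?c *\<^sub>R x)))\<^sup>2) \<partial>lborel))"
    proof -
      have "ennreal ((2 * ?c) ^ DIM('a)) = ennreal (2 ^ DIM('a)) * ennreal (\<bar>?c\<bar> ^ DIM('a))"
        using c by (subst ennreal_mult[symmetric]) (simp_all add: power_mult_distrib[symmetric])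
      then show ?thesis by (simp only: mult.assoc)
    qed
    also have "\<dots> = ennreal (2 ^ DIM('a)) * ?D"
      using c by (subst nn_integral_affine[of "\<lambda>x. indicator Q x * ennreal ((norm (G x))\<^sup>2)" ?c "t *\<^sub>R y"]) auto
    finally show ?thesis using True by simp
  qed auto
  have "(\<integral>\<^sup>+x. \<integral>\<^sup>+y. indicator Q x * indicator Q y * ennreal ((\<phi> (x + (1/2) *\<^sub>R (y - x)) - \<phi> x)\<^sup>2) \<partial>lborel \<partial>lborel)
      \<le> (\<integral>\<^sup>+x. \<integral>\<^sup>+y. ennreal (\<epsilon>\<^sup>2 / 2) * (\<integral>\<^sup>+t. ?h x y t \<partial>lborel) \<partial>lborel \<partial>lborel)"
    by (intro nn_integral_mono pt)
  also have "\<dots> = ennreal (\<epsilon>\<^sup>2 / 2) * (\<integral>\<^sup>+x. \<integral>\<^sup>+y. \<integral>\<^sup>+t. ?h x y t \<partial>lborel \<partial>lborel \<partial>lborel)"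
    by (simp add: nn_integral_cmult)
  also have "(\<integral>\<^sup>+x. \<integral>\<^sup>+y. \<integral>\<^sup>+t. ?h x y t \<partial>lborel \<partial>lborel \<partial>lborel) = (\<integral>\<^sup>+y. \<integral>\<^sup>+x. \<integral>\<^sup>+t. ?h x y t \<partial>lborel \<partial>lborel \<partial>lborel)"
    by (rule lborel_pair.Fubini') measurable
  also have "\<dots> = (\<integral>\<^sup>+y. \<integral>\<^sup>+t. \<integral>\<^sup>+x. ?h x y t \<partial>lborel \<partial>lborel \<partial>lborel)"
    by (intro nn_integral_cong lborel_pair.Fubini') measurable
  also have "\<dots> \<le> (\<integral>\<^sup>+y. \<integral>\<^sup>+t. ennreal (2 ^ DIM('a)) * ?D * indicator {0..1/2::real} t * indicator Q y \<partial>lborel \<partial>lborel)"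
    by (intro nn_integral_mono inner)
  also have "\<dots> = ennreal (2 ^ DIM('a)) * ?D * ennreal (1/2) * emeasure lborel Q"
    by (simp add: nn_integral_cmult nn_integral_multc)
  finally have "(\<integral>\<^sup>+x. \<integral>\<^sup>+y. indicator Q x * indicator Q y * ennreal ((\<phi> (x + (1/2) *\<^sub>R (y - x)) - \<phi> x)\<^sup>2) \<partial>lborel \<partial>lborel)
    \<le> ennreal (\<epsilon>\<^sup>2 / 2) * (ennreal (2 ^ DIM('a)) * ?D * ennreal (1/2) * emeasure lborel Q)"
    by (simp add: mult_left_mono)
  also have "\<dots> = (ennreal (\<epsilon>\<^sup>2 / 2) * ennreal (2 ^ DIM('a)) * ennreal (1/2)) * emeasure lborel Q * ?D"
    by (simp only: mult_ac)
  also have "ennreal (\<epsilon>\<^sup>2 / 2) * ennreal (2 ^ DIM('a)) * ennreal (1/2) = ennreal (2 ^ DIM('a) * \<epsilon>\<^sup>2 / 4)"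
    by (subst ennreal_mult[symmetric], simp, simp)+ (simp add: mult.commute)
  finally show ?thesis .
qed

text \<open>The double integral of (\<phi> x - \<phi> y)^2 over the box is computed in two ways.
  Expanding gives 2 m s - 2 p^2, with m the volume, p the integral and s the integral of the square;
  comparison through the midpoint bounds it by the gradient.\<close>

lemma poincare_cbox:
  fixes a b :: "'a::euclidean_space"
  defines "Q \<equiv> cbox a b"
  assumes \<phi>: "C1_grad \<phi> G"
    and diam: "\<And>x y. x \<in> Q \<Longrightarrow> y \<in> Q \<Longrightarrow> norm (y - x) \<le> \<epsilon>" and "0 \<le> \<epsilon>"
  shows "(\<integral>\<^sup>+x. indicator Q x * ennreal ((\<phi> x)\<^sup>2) \<partial>lborel)
    \<le> ennreal (1 / measure lborel Q * (LINT x|lborel. indicator Q x * \<phi> x)\<^sup>2)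
      + ennreal (2 ^ DIM('a) * \<epsilon>\<^sup>2) * (\<integral>\<^sup>+x. indicator Q x * ennreal ((norm (G x))\<^sup>2) \<partial>lborel)"
    (is "?L \<le> _ + _ * ?D")
proof -
  have Qm [measurable]: "Q \<in> sets borel" and Qc: "compact Q" "convex Q" by (auto simp: Q_def)
  note [measurable] = C1_grad_measurable[OF \<phi>]
  have Qfin: "emeasure lborel Q = ennreal (measure lborel Q)"
    unfolding Q_def by (rule emeasure_eq_ennreal_measure) (use emeasure_lborel_cbox_finite[of a b] in \<open>simp add: less_top\<close>)
  let ?m = "measure lborel Q"
  have int: "integrable lborel (\<lambda>x. indicator Q x * f x)" if "continuous_on UNIV f" for f :: "'a \<Rightarrow> real"
    using borel_integrable_compact[OF Qc(1), of f] that continuous_on_subset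
    by (auto simp: indicator_def if_distrib[where f="\<lambda>x. x * _"] cong: if_cong)
  note c = C1_grad_continuous[OF \<phi>]
  have int1: "integrable lborel (\<lambda>x. indicator Q x * \<phi> x)" by (rule int[OF c])
  have int2: "integrable lborel (\<lambda>x. indicator Q x * (\<phi> x)\<^sup>2)" by (rule int) (intro continuous_intros c)
  have int0: "integrable lborel (\<lambda>x. indicator Q x :: real)" using int[of "\<lambda>_. 1"] by simp
  define p where "p = (LINT x|lborel. indicator Q x * \<phi> x)"
  define s where "s = (LINT x|lborel. indicator Q x * (\<phi> x)\<^sup>2)"
  have L: "?L = ennreal s"
  proof -
    have "ennreal s = (\<integral>\<^sup>+x. ennreal (indicator Q x * (\<phi> x)\<^sup>2) \<partial>lborel)"
      unfolding s_def by (rule nn_integral_eq_integral[symmetric, OF int2]) simp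
    then show ?thesis by (simp add: ennreal_mult' ennreal_indicator)
  qed
  have s0: "0 \<le> s" unfolding s_def by (intro integral_nonneg_AE) simp
  show ?thesis
  proof (cases "?m = 0")
    case True
    then have "AE x in lborel. x \<notin> Q" using Qfin by (intro AE_not_in) auto
    then have "?L = 0" by (subst nn_integral_0_iff_AE) (auto elim: eventually_mono)
    then show ?thesis by simp
  next
    case False
    then have m: "0 < ?m" by (simp add: zero_less_measure_iff)
    let ?H = "\<lambda>x y. indicator Q x * indicator Q y * ennreal ((\<phi> (x + (1/2) *\<^sub>R (y - x)) - \<phi> x)\<^sup>2) :: ennreal"
    let ?W = "\<integral>\<^sup>+x. \<integral>\<^sup>+y. indicator Q x * indicator Q y * ennreal ((\<phi> x - \<phi> y)\<^sup>2) \<partial>lborel \<partial>lborel"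
    have W1: "?W \<le> ennreal (2 ^ DIM('a) * \<epsilon>\<^sup>2) * ennreal ?m * ?D"
    proof -
      have "?W \<le> (\<integral>\<^sup>+x. \<integral>\<^sup>+y. 2 * ?H x y + 2 * ?H y x \<partial>lborel \<partial>lborel)"
      proof (intro nn_integral_mono)
        fix x y :: 'a
        \<comment> \<open>The midpoint is symmetric in x and y, so both halves of the segment are
          instances of the midpoint bound, with x and y exchanged.\<close>
        have mid: "x + (1/2) *\<^sub>R (y - x) = y + (1/2) *\<^sub>R (x - y)"
          by (rule euclidean_eqI) (simp add: inner_simps field_simps)
        define z where "z = \<phi> (x + (1/2) *\<^sub>R (y - x))"
        have "(\<phi> x - \<phi> y)\<^sup>2 \<le> 2 * (z - \<phi> x)\<^sup>2 + 2 * (z - \<phi> y)\<^sup>2"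
          using zero_le_power2[of "2 * z - \<phi> x - \<phi> y"] by (simp add: power2_eq_square algebra_simps)
        then have "ennreal ((\<phi> x - \<phi> y)\<^sup>2) \<le> ennreal (2 * (z - \<phi> x)\<^sup>2 + 2 * (z - \<phi> y)\<^sup>2)" by (rule ennreal_leI)
        also have "\<dots> = 2 * ennreal ((z - \<phi> x)\<^sup>2) + 2 * ennreal ((z - \<phi> y)\<^sup>2)"
          by (simp add: ennreal_mult')
        finally show "indicator Q x * indicator Q y * ennreal ((\<phi> x - \<phi> y)\<^sup>2) \<le> 2 * ?H x y + 2 * ?H y x"
          unfolding mid[symmetric] z_def by (auto simp: indicator_def)
      qed
      also have "\<dots> = 2 * (\<integral>\<^sup>+x. \<integral>\<^sup>+y. ?H x y \<partial>lborel \<partial>lborel) + 2 * (\<integral>\<^sup>+x. \<integral>\<^sup>+y. ?H y x \<partial>lborel \<partial>lborel)"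
        by (simp add: nn_integral_add nn_integral_cmult)
      also have "(\<integral>\<^sup>+x. \<integral>\<^sup>+y. ?H y x \<partial>lborel \<partial>lborel) = (\<integral>\<^sup>+x. \<integral>\<^sup>+y. ?H x y \<partial>lborel \<partial>lborel)"
        by (rule lborel_pair.Fubini') measurable
      also have "2 * (\<integral>\<^sup>+x. \<integral>\<^sup>+y. ?H x y \<partial>lborel \<partial>lborel) + 2 * (\<integral>\<^sup>+x. \<integral>\<^sup>+y. ?H x y \<partial>lborel \<partial>lborel) = 4 * (\<integral>\<^sup>+x. \<integral>\<^sup>+y. ?H x y \<partial>lborel \<partial>lborel)"
        by (simp flip: distrib_right)
      also have "\<dots> \<le> 4 * (ennreal (2 ^ DIM('a) * \<epsilon>\<^sup>2 / 4) * emeasure lborel Q * ?D)"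
        using midpoint_difference_bound[OF \<phi> Qc(2) Qm diam assms(4)] by (intro mult_left_mono) auto
      also have "\<dots> = (ennreal 4 * ennreal (2 ^ DIM('a) * \<epsilon>\<^sup>2 / 4)) * ennreal ?m * ?D"
        unfolding Qfin by (simp add: mult_ac)
      also have "ennreal 4 * ennreal (2 ^ DIM('a) * \<epsilon>\<^sup>2 / 4) = ennreal (2 ^ DIM('a) * \<epsilon>\<^sup>2)"
        by (subst ennreal_mult[symmetric]) auto
      finally show ?thesis .
    qed
    have inner: "(\<integral>\<^sup>+y. indicator Q x * indicator Q y * ennreal ((\<phi> x - \<phi> y)\<^sup>2) \<partial>lborel)
        = ennreal (indicator Q x * ((\<phi> x)\<^sup>2 * ?m - 2 * \<phi> x * p + s))" (is "?I x = _")
      and inner_nonneg: "0 \<le> indicator Q x * ((\<phi> x)\<^sup>2 * ?m - 2 * \<phi> x * p + s)" for x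
    proof -
      let ?f = "\<lambda>y. (\<phi> x)\<^sup>2 * indicator Q y - 2 * \<phi> x * (indicator Q y * \<phi> y) + indicator Q y * (\<phi> y)\<^sup>2"
      have f: "?f y = indicator Q y * (\<phi> x - \<phi> y)\<^sup>2" for y by (simp add: power2_diff algebra_simps)
      have If: "integral\<^sup>L lborel ?f = (\<phi> x)\<^sup>2 * ?m - 2 * \<phi> x * p + s"
        using int0 int1 int2 by (simp add: p_def s_def)
      have fi: "integrable lborel ?f" using int0 int1 int2 by simp
      have "(\<integral>\<^sup>+y. ennreal (?f y) \<partial>lborel) = ennreal ((\<phi> x)\<^sup>2 * ?m - 2 * \<phi> x * p + s)"
        unfolding If[symmetric] by (rule nn_integral_eq_integral[OF fi]) (simp add: f)
      then show "?I x = ennreal (indicator Q x * ((\<phi> x)\<^sup>2 * ?m - 2 * \<phi> x * p + s))"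
        by (cases "x \<in> Q") (simp_all add: f ennreal_mult' ennreal_indicator)
      have "0 \<le> integral\<^sup>L lborel ?f" by (intro integral_nonneg_AE) (simp add: f)
      then show "0 \<le> indicator Q x * ((\<phi> x)\<^sup>2 * ?m - 2 * \<phi> x * p + s)" unfolding If by simp
    qed
    have W2: "?W = ennreal (2 * ?m * s - 2 * p\<^sup>2)"
    proof -
      let ?f = "\<lambda>x. ?m * (indicator Q x * (\<phi> x)\<^sup>2) - 2 * p * (indicator Q x * \<phi> x) + s * indicator Q x"
      have f: "?f x = indicator Q x * ((\<phi> x)\<^sup>2 * ?m - 2 * \<phi> x * p + s)" for x by (simp add: algebra_simps)
      have fi: "integrable lborel ?f" using int0 int1 int2 by simp
      have "?W = (\<integral>\<^sup>+x. ennreal (?f x) \<partial>lborel)" unfolding inner f ..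
      also have "\<dots> = ennreal (integral\<^sup>L lborel ?f)"
        by (rule nn_integral_eq_integral[OF fi]) (use inner_nonneg in \<open>simp only: f AE_I2\<close>)
      also have "integral\<^sup>L lborel ?f = ?m * s - 2 * p * p + s * ?m"
        using int0 int1 int2 by (simp add: p_def s_def)
      finally show ?thesis by (simp add: power2_eq_square algebra_simps)
    qed
    show ?thesis
    \<comment> \<open>An infinite gradient integral makes the right-hand side infinite only if
      \<epsilon> is nonzero, since infinity times 0 is 0 in \<open>ennreal\<close>.\<close>
    proof (cases "?D = \<infinity> \<and> \<epsilon> \<noteq> 0")
      case True
      then have "ennreal (2 ^ DIM('a) * \<epsilon>\<^sup>2) * ?D = \<infinity>" by (simp add: ennreal_mult_top)
      then show ?thesis by simp
    next
      case False
      then obtain D where D: "ennreal (2 ^ DIM('a) * \<epsilon>\<^sup>2) * ?D = ennreal D" "0 \<le> D"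
      proof (cases "\<epsilon> = 0")
        case True
        then show ?thesis by (intro that[of 0]) auto
      next
        case eps: False
        then have "?D \<noteq> \<infinity>" using False by simp
        then obtain d where "?D = ennreal d" "0 \<le> d" by (cases ?D) auto
        then show ?thesis by (intro that[of "2 ^ DIM('a) * \<epsilon>\<^sup>2 * d"]) (simp_all add: ennreal_mult)
      qed
      have "ennreal (2 * ?m * s - 2 * p\<^sup>2) \<le> ennreal (?m * D)"
        using W1 unfolding W2 using D m by (simp add: ennreal_mult mult_ac)
      then have "2 * ?m * s - 2 * p\<^sup>2 \<le> ?m * D" using D m by (simp add: ennreal_le_iff)
      then have "s \<le> 1 / ?m * p\<^sup>2 + D / 2" using m by (simp add: field_simps)
      then have "s \<le> 1 / ?m * p\<^sup>2 + D" using D by simp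
      then have "ennreal s \<le> ennreal (1 / ?m * p\<^sup>2) + ennreal D"
        using m D by (simp add: ennreal_plus[symmetric] ennreal_leI del: ennreal_plus)
      then show ?thesis unfolding L p_def[symmetric] D .
    qed
  qed
qed

section \<open>Rellich's theorem for continuously differentiable functions\<close>

lemma AE_indicator_cbox_box:
  "AE x in lborel. indicator (cbox a b) x = (indicator (box a (b::'a::euclidean_space)) x :: ennreal)"
proof -
  have "emeasure lborel (cbox a b - box a b) = emeasure lborel (cbox a b) - emeasure lborel (box a b)"
    using emeasure_lborel_box_finite[of a b] by (intro emeasure_Diff) (auto simp: box_subset_cbox)
  also have "\<dots> = 0" by (simp add: emeasure_lborel_cbox_eq emeasure_lborel_box_eq)
  finally have "AE x in lborel. x \<notin> cbox a b - box a b" by (intro AE_not_in) auto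
  then show ?thesis by eventually_elim (use box_subset_cbox[of a b] in \<open>auto simp: indicator_def\<close>)
qed

text \<open>A box around the set is divided into cells of diameter at most \<epsilon>, where 2^d
  \<epsilon>^2 = \<delta>, and the Poincare inequalities of the cells are added. The integrals over
  the cells are the finitely many functionals.\<close>

lemma rellich_C1:
  assumes "bounded (\<Omega> :: 'a::euclidean_space set)" "0 < \<delta>"
  shows "\<exists>J C. finite J \<and> J \<subseteq> sets borel \<and> 0 \<le> C \<and> (\<forall>\<phi> G. C1_grad \<phi> G \<and> (\<forall>x. x \<notin> \<Omega> \<longrightarrow> \<phi> x = 0) \<longrightarrow>
    (\<integral>\<^sup>+x. ennreal ((\<phi> x)\<^sup>2) \<partial>lborel) \<le> ennreal (C * (\<Sum>Q\<in>J. (LINT x|lborel. indicator Q x * \<phi> x)\<^sup>2))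
      + ennreal \<delta> * (\<integral>\<^sup>+x. ennreal ((norm (G x))\<^sup>2) \<partial>(lborel :: 'a measure)))"
proof -
  define \<epsilon> where "\<epsilon> = sqrt (\<delta> / 2 ^ DIM('a))"
  have \<epsilon>: "0 < \<epsilon>" "2 ^ DIM('a) * \<epsilon>\<^sup>2 = \<delta>" using assms(2) by (simp_all add: \<epsilon>_def)
  obtain a b where ab: "\<Omega> \<subseteq> cbox a b" using bounded_subset_cbox_symmetric[OF assms(1)] by blast
  \<comment> \<open>A division that is fine for balls of radius \<epsilon> / 2 has cells of diameter
    at most \<epsilon>.\<close>
  have "gauge (\<lambda>x::'a. ball x (\<epsilon> / 2))" using \<epsilon> by (intro gauge_ball) auto
  then obtain p where p: "p tagged_division_of (cbox a b)" "(\<lambda>x. ball x (\<epsilon> / 2)) fine p"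
    using fine_division_exists by blast
  define J where "J = snd ` p"
  have J: "J division_of cbox a b" unfolding J_def by (rule division_of_tagged_division[OF p(1)])
  have finJ: "finite J" and UJ: "\<Union>J = cbox a b" using J by (auto simp: division_of_def)
  have Jbox: "\<exists>l u. Q = cbox l u" if "Q \<in> J" for Q using J that by (auto simp: division_of_def)
  have Jborel: "J \<subseteq> sets borel" using Jbox by fastforce
  have diam: "norm (y - x) \<le> \<epsilon>" if Q: "Q \<in> J" and xy: "x \<in> Q" "y \<in> Q" for Q x y
  proof -
    obtain z where "(z, Q) \<in> p" using Q by (auto simp: J_def)
    then have "Q \<subseteq> ball z (\<epsilon> / 2)" using p(2) by (auto simp: fine_def)
    then have "dist z x < \<epsilon> / 2" "dist z y < \<epsilon> / 2" using xy by auto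
    then show ?thesis using dist_triangle2[of x y z] by (simp add: dist_norm norm_minus_commute)
  qed
  \<comment> \<open>The sum dominates every inverse volume; a cell of measure zero contributes 1 / 0
    = 0.\<close>
  define C where "C = (\<Sum>Q\<in>J. 1 / measure lborel Q)"
  have C: "0 \<le> C" unfolding C_def by (intro sum_nonneg) simp
  have "(\<integral>\<^sup>+x. ennreal ((\<phi> x)\<^sup>2) \<partial>lborel) \<le> ennreal (C * (\<Sum>Q\<in>J. (LINT x|lborel. indicator Q x * \<phi> x)\<^sup>2))
      + ennreal \<delta> * (\<integral>\<^sup>+x. ennreal ((norm (G x))\<^sup>2) \<partial>(lborel :: 'a measure))"
    if \<phi>: "C1_grad \<phi> G" "\<forall>x. x \<notin> \<Omega> \<longrightarrow> \<phi> x = 0" for \<phi> G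
  proof -
    note [measurable] = C1_grad_measurable[OF \<phi>(1)]
    have [measurable]: "Q \<in> sets borel" if "Q \<in> J" for Q using Jborel that by auto
    let ?p = "\<lambda>Q. LINT x|lborel. indicator Q x * \<phi> x"
    have "(\<integral>\<^sup>+x. ennreal ((\<phi> x)\<^sup>2) \<partial>lborel) \<le> (\<integral>\<^sup>+x. (\<Sum>Q\<in>J. indicator Q x * ennreal ((\<phi> x)\<^sup>2)) \<partial>lborel)"
    proof (intro nn_integral_mono)
      fix x
      show "ennreal ((\<phi> x)\<^sup>2) \<le> (\<Sum>Q\<in>J. indicator Q x * ennreal ((\<phi> x)\<^sup>2))"
      proof (cases "x \<in> \<Omega>")
        case True
        then obtain Q where Q: "Q \<in> J" "x \<in> Q" using ab UJ by blast
        have "ennreal ((\<phi> x)\<^sup>2) = indicator Q x * ennreal ((\<phi> x)\<^sup>2)" using Q by simp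
        also have "\<dots> \<le> (\<Sum>Q\<in>J. indicator Q x * ennreal ((\<phi> x)\<^sup>2))"
          using finJ Q by (intro member_le_sum) auto
        finally show ?thesis .
      qed (use \<phi> in simp)
    qed
    also have "\<dots> = (\<Sum>Q\<in>J. \<integral>\<^sup>+x. indicator Q x * ennreal ((\<phi> x)\<^sup>2) \<partial>lborel)"
      by (rule nn_integral_sum) measurable
    also have "\<dots> \<le> (\<Sum>Q\<in>J. ennreal (C * (?p Q)\<^sup>2) + ennreal \<delta> * (\<integral>\<^sup>+x. indicator Q x * ennreal ((norm (G x))\<^sup>2) \<partial>lborel))"
    proof (intro sum_mono)
      fix Q assume Q: "Q \<in> J"
      obtain l u where lu: "Q = cbox l u" using Jbox[OF Q] by blast
      have "(\<integral>\<^sup>+x. indicator Q x * ennreal ((\<phi> x)\<^sup>2) \<partial>lborel) \<le> ennreal (1 / measure lborel Q * (?p Q)\<^sup>2)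
        + ennreal (2 ^ DIM('a) * \<epsilon>\<^sup>2) * (\<integral>\<^sup>+x. indicator Q x * ennreal ((norm (G x))\<^sup>2) \<partial>lborel)"
        unfolding lu by (rule poincare_cbox[OF \<phi>(1)]) (use diam[OF Q] \<epsilon> in \<open>auto simp: lu\<close>)
      also have "\<dots> \<le> ennreal (C * (?p Q)\<^sup>2) + ennreal (2 ^ DIM('a) * \<epsilon>\<^sup>2) * (\<integral>\<^sup>+x. indicator Q x * ennreal ((norm (G x))\<^sup>2) \<partial>lborel)"
      proof (intro add_right_mono ennreal_leI mult_right_mono)
        show "1 / measure lborel Q \<le> C" unfolding C_def
          using finJ Q by (intro member_le_sum[where f="\<lambda>Q. 1 / measure lborel Q"]) auto
      qed auto
      finally show "(\<integral>\<^sup>+x. indicator Q x * ennreal ((\<phi> x)\<^sup>2) \<partial>lborel) \<le> ennreal (C * (?p Q)\<^sup>2)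
        + ennreal \<delta> * (\<integral>\<^sup>+x. indicator Q x * ennreal ((norm (G x))\<^sup>2) \<partial>lborel)" unfolding \<epsilon>(2) .
    qed
    also have "\<dots> = ennreal (C * (\<Sum>Q\<in>J. (?p Q)\<^sup>2)) + ennreal \<delta> * (\<Sum>Q\<in>J. \<integral>\<^sup>+x. indicator Q x * ennreal ((norm (G x))\<^sup>2) \<partial>lborel)"
      using C by (simp add: sum.distrib sum_distrib_left)
    \<comment> \<open>The cells overlap in their boundaries, which are null sets. The interiors are
      disjoint, so the gradient integrals over them add up to at most the integral over the whole
      space.\<close>
    also have "(\<Sum>Q\<in>J. \<integral>\<^sup>+x. indicator Q x * ennreal ((norm (G x))\<^sup>2) \<partial>lborel)
        = (\<Sum>Q\<in>J. \<integral>\<^sup>+x. indicator (interior Q) x * ennreal ((norm (G x))\<^sup>2) \<partial>lborel)"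
    proof (intro sum.cong refl nn_integral_cong_AE)
      fix Q assume "Q \<in> J"
      then obtain l u where lu: "Q = cbox l u" using Jbox by blast
      show "AE x in lborel. indicator Q x * ennreal ((norm (G x))\<^sup>2) = indicator (interior Q) x * ennreal ((norm (G x))\<^sup>2)"
        using AE_indicator_cbox_box[of l u] unfolding lu interior_cbox by eventually_elim simp
    qed
    also have "\<dots> = (\<integral>\<^sup>+x. (\<Sum>Q\<in>J. indicator (interior Q) x * ennreal ((norm (G x))\<^sup>2)) \<partial>lborel)"
      by (rule nn_integral_sum[symmetric]) measurable
    also have "\<dots> \<le> (\<integral>\<^sup>+x. ennreal ((norm (G x))\<^sup>2) \<partial>lborel)"
    proof (intro nn_integral_mono)
      fix x
      show "(\<Sum>Q\<in>J. indicator (interior Q) x * ennreal ((norm (G x))\<^sup>2)) \<le> ennreal ((norm (G x))\<^sup>2)"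
      proof (cases "\<exists>Q\<in>J. x \<in> interior Q")
        case True
        then obtain Q where Q: "Q \<in> J" "x \<in> interior Q" by blast
        have "x \<notin> interior Q'" if "Q' \<in> J - {Q}" for Q'
          using division_ofD(5)[OF J Q(1), of Q'] that Q(2) by auto
        then have "(\<Sum>Q\<in>J. indicator (interior Q) x * ennreal ((norm (G x))\<^sup>2)) = indicator (interior Q) x * ennreal ((norm (G x))\<^sup>2)"
          using finJ Q by (subst sum.remove[OF finJ Q(1)]) (simp add: sum.neutral)
        then show ?thesis using Q by simp
      qed (simp add: sum.neutral)
    qed
    finally show ?thesis by (simp add: add_left_mono mult_left_mono)
  qed
  then show ?thesis using finJ Jborel C by (intro exI[of _ J] exI[of _ C]) auto
qed

section \<open>Smooth bump functions\<close>

text \<open>The functions p(1/t) exp(-1/t), extended by 0. Admitting all polynomials p closes the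
  class under differentiation, so smoothness follows by induction.\<close>

definition exp_flat :: "real poly \<Rightarrow> real \<Rightarrow> real" where
  "exp_flat p t = (if 0 < t then poly p (1 / t) * exp (- 1 / t) else 0)"

lemma poly_exp_tendsto_0: "((\<lambda>s. poly p s * exp (- s)) \<longlongrightarrow> (0::real)) at_top"
proof -
  have "((\<lambda>s. \<Sum>i\<le>degree p. coeff p i * (s ^ i / exp s)) \<longlongrightarrow> (\<Sum>i\<le>degree p. coeff p i * 0)) at_top"
    by (intro tendsto_sum tendsto_mult tendsto_const tendsto_power_div_exp_0)
  then show ?thesis by (simp add: poly_altdef sum_distrib_right exp_minus divide_inverse mult.assoc)
qed

text \<open>With s = 1/t, the product rule turns p(s) exp(-s) into s^2 (p(s) - p'(s)) exp(-s); the
  factor s^2 is \<open>monom 1 2\<close>.\<close>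

lemma exp_flat_deriv:
  "(exp_flat p has_real_derivative exp_flat (monom 1 2 * (p - pderiv p)) t) (at t)"
proof (cases t "0::real" rule: linorder_cases)
  case less
  have "((\<lambda>_. 0) has_real_derivative 0) (at t)" by simp
  then have "(exp_flat p has_real_derivative 0) (at t)"
    by (rule has_field_derivative_transform_within_open[where S="{..<0}"]) (use less in \<open>auto simp: exp_flat_def\<close>)
  then show ?thesis using less by (simp add: exp_flat_def)
next
  case greater
  have "((\<lambda>t. poly p (1 / t) * exp (- 1 / t)) has_real_derivative
      poly (pderiv p) (1 / t) * (- 1 / t\<^sup>2) * exp (- 1 / t) + poly p (1 / t) * (exp (- 1 / t) * (1 / t\<^sup>2))) (at t)"
    using greater by (auto intro!: derivative_eq_intros DERIV_chain2[OF poly_DERIV] simp: power2_eq_square)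
  also have "poly (pderiv p) (1 / t) * (- 1 / t\<^sup>2) * exp (- 1 / t) + poly p (1 / t) * (exp (- 1 / t) * (1 / t\<^sup>2))
      = exp_flat (monom 1 2 * (p - pderiv p)) t"
    using greater by (simp add: exp_flat_def poly_monom power_divide algebra_simps)
  finally show ?thesis
    by (rule has_field_derivative_transform_within_open[where S="{0<..}"]) (use greater in \<open>auto simp: exp_flat_def\<close>)
next
  case equal
  have "((\<lambda>h. exp_flat p h / h) \<longlongrightarrow> 0) (at 0)"
  proof (rule filterlim_split_at)
    show "((\<lambda>h. exp_flat p h / h) \<longlongrightarrow> 0) (at_left 0)"
      by (rule tendsto_eventually) (auto simp: eventually_at_filter exp_flat_def)
    \<comment> \<open>To the right of 0 the difference quotient is s p(s) exp(-s) with s = 1/h,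
      again a polynomial times a decaying exponential.\<close>
    have "((\<lambda>h. poly (monom 1 1 * p) (inverse h) * exp (- inverse h)) \<longlongrightarrow> (0::real)) (at_right 0)"
      by (rule filterlim_compose[OF poly_exp_tendsto_0 filterlim_inverse_at_top_right])
    then show "((\<lambda>h. exp_flat p h / h) \<longlongrightarrow> 0) (at_right 0)"
    proof (rule Lim_transform_eventually)
      show "\<forall>\<^sub>F h in at_right 0. poly (monom 1 1 * p) (inverse h) * exp (- inverse h) = exp_flat p h / h"
        using eventually_at_right_less[of 0]
        by eventually_elim (simp add: exp_flat_def poly_monom field_simps)
    qed
  qed
  then show ?thesis using equal by (simp add: has_field_derivative_iff exp_flat_def)
qed

section \<open>Algebra of k times differentiable functions\<close>

lemma grad_eqI:
  fixes f :: "real ^ 'd \<Rightarrow> real"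
  assumes "(f has_derivative f') (at x)"
  shows "grad f x $ i = f' (axis i 1)"
  using frechet_derivative_at[OF assms] by (simp add: grad_def)

lemma C_k_Suc_imp: "C_k (Suc k) f \<Longrightarrow> C_k k f"
proof (induction k arbitrary: f)
  case 0
  then show ?case by (auto simp: continuous_on_eq_continuous_at differentiable_imp_continuous_within)
next
  case (Suc k)
  then show ?case by simp
qed

lemma C_k_const: "C_k k (\<lambda>x::real^'d. c)"
proof (induction k arbitrary: c)
  case (Suc k)
  have "grad (\<lambda>x::real^'d. c) x $ i = 0" for x i
    by (subst grad_eqI[OF has_derivative_const]) simp
  then show ?case using Suc.IH[of 0] by simp
qed simp

lemma C_k_add: "C_k k f \<Longrightarrow> C_k k g \<Longrightarrow> C_k k (\<lambda>x. f x + g x)"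
proof (induction k arbitrary: f g)
  case (Suc k)
  have d: "f differentiable at x" "g differentiable at x" for x using Suc.prems by auto
  have "grad (\<lambda>x. f x + g x) x $ i = grad f x $ i + grad g x $ i" for x i
    by (subst grad_eqI[OF has_derivative_add[OF frechet_derivative_works[THEN iffD1, OF d(1)] frechet_derivative_works[THEN iffD1, OF d(2)]]]) (simp add: grad_def)
  then show ?case using Suc d by simp
qed (simp add: continuous_on_add)

lemma C_k_mult: "C_k k f \<Longrightarrow> C_k k g \<Longrightarrow> C_k k (\<lambda>x. f x * g x)"
proof (induction k arbitrary: f g)
  case (Suc k)
  have d: "f differentiable at x" "g differentiable at x" for x using Suc.prems by auto
  have "grad (\<lambda>x. f x * g x) x $ i = f x * grad g x $ i + grad f x $ i * g x" for x i
    by (subst grad_eqI[OF has_derivative_mult[OF frechet_derivative_works[THEN iffD1, OF d(1)] frechet_derivative_works[THEN iffD1, OF d(2)]]]) (simp add: grad_def)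
  moreover have "C_k k f" "C_k k g" using Suc.prems C_k_Suc_imp by blast+
  ultimately show ?case using Suc d by (simp add: C_k_add)
qed (simp add: continuous_on_mult)

lemma C_k_prod: "finite I \<Longrightarrow> (\<And>i. i \<in> I \<Longrightarrow> C_k k (f i)) \<Longrightarrow> C_k k (\<lambda>x. \<Prod>i\<in>I. f i x)"
  by (induction I rule: finite_induct) (auto intro: C_k_const C_k_mult)

lemma C_k_exp_flat: "C_k k (\<lambda>x::real^'d. exp_flat p (\<alpha> * x $ i + \<beta>))"
proof (induction k arbitrary: p)
  case 0
  have "continuous_on UNIV (exp_flat p)"
    by (auto simp: continuous_on_eq_continuous_at intro: DERIV_isCont exp_flat_deriv)
  then show ?case by (auto intro!: continuous_intros continuous_on_compose2[of UNIV "exp_flat p"])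
next
  case (Suc k)
  let ?q = "monom 1 2 * (p - pderiv p)"
  have d: "((\<lambda>x::real^'d. exp_flat p (\<alpha> * x $ i + \<beta>)) has_derivative (\<lambda>h. exp_flat ?q (\<alpha> * x $ i + \<beta>) * (\<alpha> * h $ i))) (at x)" for x
    by (rule has_derivative_compose[where g="exp_flat p", rotated, OF exp_flat_deriv[unfolded has_field_derivative_def]])
      (auto intro!: derivative_eq_intros bounded_linear_imp_has_derivative[OF bounded_linear_vec_nth])
  then have "grad (\<lambda>x::real^'d. exp_flat p (\<alpha> * x $ i + \<beta>)) x $ j = (\<alpha> * axis j 1 $ i) * exp_flat ?q (\<alpha> * x $ i + \<beta>)" for x j
    by (subst grad_eqI[OF d]) simp
  moreover have "(\<lambda>x::real^'d. exp_flat p (\<alpha> * x $ i + \<beta>)) differentiable at x" for x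
    using d[of x] by (rule differentiableI)
  ultimately show ?case using Suc by (simp add: C_k_mult C_k_const)
qed

text \<open>Each factor measures the distance to one face of the box. Scaling these distances by n +
  1 drives the factors to 1 inside, so the bumps approximate the indicator of the open box, with
  values between 0 and 1 throughout.\<close>

definition bump :: "nat \<Rightarrow> real ^ 'd \<Rightarrow> real ^ 'd \<Rightarrow> real ^ 'd \<Rightarrow> real" where
  "bump n a b x = (\<Prod>i\<in>UNIV. exp_flat 1 (real (Suc n) * (x $ i - a $ i)) * exp_flat 1 (real (Suc n) * (b $ i - x $ i)))"

lemma bump_smooth: "smooth (bump n a b)"
proof -
  have "C_k k (\<lambda>x. exp_flat 1 (real (Suc n) * (x $ i - a $ i)) * exp_flat 1 (real (Suc n) * (b $ i - x $ i)))" for k and i :: 'a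
    using C_k_mult[OF C_k_exp_flat[of k 1 "real (Suc n)" i "- real (Suc n) * a $ i"] C_k_exp_flat[of k 1 "- real (Suc n)" i "real (Suc n) * b $ i"]]
    by (simp add: algebra_simps)
  then show ?thesis unfolding smooth_def bump_def by (auto intro: C_k_prod)
qed

lemma bump_nonzero: "bump n a b x \<noteq> 0 \<Longrightarrow> x \<in> box a b"
  unfolding bump_def by (auto simp: mem_box_cart exp_flat_def zero_less_mult_iff split: if_splits)

lemma exp_flat_1_range: "0 \<le> exp_flat 1 t" "exp_flat 1 t \<le> 1"
  by (auto simp: exp_flat_def)

lemma bump_range: "0 \<le> bump n a b x" "bump n a b x \<le> 1"
  unfolding bump_def by (auto intro!: prod_nonneg prod_le_1 mult_nonneg_nonneg mult_le_one exp_flat_1_range)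

lemma bump_test_function: "cbox a b \<subseteq> S \<Longrightarrow> bump n a b \<in> test_functions S"
proof -
  assume S: "cbox a b \<subseteq> S"
  have "closure {x. bump n a b x \<noteq> 0} \<subseteq> cbox a b"
    by (rule closure_minimal) (use bump_nonzero box_subset_cbox in blast, auto)
  moreover from this have "compact (closure {x. bump n a b x \<noteq> 0})"
    using compact_cbox closed_closure by (metis compact_Int_closed inf.absorb_iff2)
  ultimately show ?thesis using S bump_smooth by (auto simp: test_functions_def)
qed

lemma bump_tendsto: "(\<lambda>n. bump n a b x) \<longlonglongrightarrow> indicator (box a b) x"
proof (cases "x \<in> box a b")
  case True
  have lim: "(\<lambda>n. exp_flat 1 (real (Suc n) * c)) \<longlonglongrightarrow> 1" if "0 < c" for c
  proof -
    have "(\<lambda>n. exp (- 1 / (real (Suc n) * c))) \<longlonglongrightarrow> exp 0"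
    proof (intro tendsto_exp)
      have "(\<lambda>n. (- 1 / c) * inverse (real (Suc n))) \<longlonglongrightarrow> (- 1 / c) * 0"
        by (intro tendsto_mult tendsto_const LIMSEQ_inverse_real_of_nat)
      then show "(\<lambda>n. - 1 / (real (Suc n) * c)) \<longlonglongrightarrow> 0" by (simp add: field_simps)
    qed
    then show ?thesis using that by (simp add: exp_flat_def)
  qed
  have "(\<lambda>n. bump n a b x) \<longlonglongrightarrow> (\<Prod>i\<in>(UNIV :: 'a set). 1 * 1)"
    unfolding bump_def by (intro tendsto_prod tendsto_mult lim) (use True in \<open>auto simp: mem_box_cart\<close>)
  then show ?thesis using True by simp
next
  case False
  then have "bump n a b x = 0" for n using bump_nonzero by blast
  then show ?thesis using False by simp
qed

section \<open>Weak gradients\<close>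

lemma integrable_lebesgue_on_iff:
  fixes f :: "'a::euclidean_space \<Rightarrow> real"
  assumes "S \<in> sets lebesgue"
  shows "integrable (lebesgue_on S) f \<longleftrightarrow> integrable lebesgue (\<lambda>x. indicator S x * f x)"
    and "(LINT x|lebesgue_on S. f x) = (LINT x|lebesgue. indicator S x * f x)"
  using assms by (simp_all add: integrable_restrict_space integral_restrict_space)

lemma borel_measurable_lebesgue_on:
  "f \<in> borel_measurable borel \<Longrightarrow> f \<in> borel_measurable (lebesgue_on S)"
  by (intro measurable_restrict_space1 measurable_completion) simp

text \<open>Serves test functions and components of their gradients alike. The indicator of the
  compact set K moves the integral to the whole space.\<close>

lemma L1_loc_mult_integrable:
  fixes f \<psi> :: "real ^ 'd \<Rightarrow> real"
  assumes "open S" and f: "f \<in> L1_loc S" and \<psi>: "\<psi> \<in> borel_measurable borel" "\<And>x. \<bar>\<psi> x\<bar> \<le> C"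
    and K: "compact K" "K \<subseteq> S" "\<And>x. x \<notin> K \<Longrightarrow> \<psi> x = 0"
  shows "integrable (lebesgue_on S) (\<lambda>x. f x * \<psi> x)"
    and "(LINT x|lebesgue_on S. f x * \<psi> x) = (LINT x|lebesgue. (indicator K x * f x) * \<psi> x)"
proof -
  have S: "S \<in> sets lebesgue" using assms(1) by (simp add: borel_open)
  have Km: "K \<in> sets lebesgue" using K(1) by (simp add: borel_compact)
  have int: "integrable lebesgue (\<lambda>x. indicator K x * f x)"
    using f K integrable_lebesgue_on_iff(1)[OF Km, of f] by (auto simp: L1_loc_def)
  have eq: "indicator S x * (f x * \<psi> x) = (indicator K x * f x) * \<psi> x" for x
    using K by (auto simp: indicator_def)
  have "integrable lebesgue (\<lambda>x. (indicator K x * f x) * \<psi> x)"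
  proof (rule Bochner_Integration.integrable_bound)
    show "integrable lebesgue (\<lambda>x. C * (indicator K x * f x))" using int by simp
    have "\<psi> \<in> borel_measurable lebesgue" using \<psi>(1) by (intro measurable_completion) simp
    then show "(\<lambda>x. indicator K x * f x * \<psi> x) \<in> borel_measurable lebesgue"
      by (rule borel_measurable_times[OF borel_measurable_integrable[OF int]])
    have "\<bar>indicator K x * f x\<bar> * \<bar>\<psi> x\<bar> \<le> \<bar>indicator K x * f x\<bar> * \<bar>C\<bar>" for x
      using \<psi>(2)[of x] by (intro mult_left_mono) auto
    then show "AE x in lebesgue. norm (indicator K x * f x * \<psi> x) \<le> norm (C * (indicator K x * f x))"
      by (intro AE_I2) (simp add: abs_mult mult_ac)
  qed
  then show "integrable (lebesgue_on S) (\<lambda>x. f x * \<psi> x)"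
    "(LINT x|lebesgue_on S. f x * \<psi> x) = (LINT x|lebesgue. (indicator K x * f x) * \<psi> x)"
    unfolding integrable_lebesgue_on_iff[OF S] eq by simp_all
qed

text \<open>Since \<open>ennreal\<close> truncates negative numbers to 0, \<open>?p\<close> and
  \<open>?n\<close> are the positive and negative parts of h. As densities they define measures that
  agree on boxes, an intersection-stable generator, so the measures and then the densities coincide;
  both parts can agree only where h vanishes.\<close>

lemma integral_boxes_zero_imp_AE_zero:
  fixes h :: "'a::euclidean_space \<Rightarrow> real"
  assumes int: "integrable lborel h"
    and zero: "\<And>l u. (LINT x|lborel. indicator (box l u) x * h x) = 0"
  shows "AE x in lborel. h x = 0"
proof -
  have [measurable]: "h \<in> borel_measurable borel" using int by (auto dest: borel_measurable_integrable)
  let ?p = "\<lambda>x. ennreal (h x)" and ?n = "\<lambda>x. ennreal (- h x)"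
  have ibox: "integrable lborel (\<lambda>x. indicator (box l u) x * g x)" if "integrable lborel g" for l u and g :: "'a \<Rightarrow> real"
    using integrable_mult_indicator[of "box l u" lborel g] that by simp
  have em: "emeasure (density lborel (\<lambda>x. ennreal (g x))) (box l u) = ennreal (LINT x|lborel. indicator (box l u) x * max 0 (g x))"
    if g: "integrable lborel g" for g :: "'a \<Rightarrow> real" and l u
  proof -
    have [measurable]: "g \<in> borel_measurable borel" using g by (auto dest: borel_measurable_integrable)
    have "integrable lborel (\<lambda>x. max 0 (g x))" using g by simp
    note ig = ibox[OF this, of l u]
    have "(\<integral>\<^sup>+x. ennreal (indicator (box l u) x * max 0 (g x)) \<partial>lborel) = ennreal (LINT x|lborel. indicator (box l u) x * max 0 (g x))"
      by (rule nn_integral_eq_integral[OF ig]) simp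
    moreover have "emeasure (density lborel (\<lambda>x. ennreal (g x))) (box l u) = (\<integral>\<^sup>+x. ennreal (indicator (box l u) x * max 0 (g x)) \<partial>lborel)"
      by (subst emeasure_density) (auto intro!: nn_integral_cong simp: indicator_def max_def ennreal_neg)
    ultimately show ?thesis by simp
  qed
  have eqbox: "emeasure (density lborel ?p) (box l u) = emeasure (density lborel ?n) (box l u)" for l u
  proof -
    have ip: "integrable lborel (\<lambda>x. max 0 (h x))" "integrable lborel (\<lambda>x. max 0 (- h x))" using int by simp_all
    have "(LINT x|lborel. indicator (box l u) x * max 0 (h x)) - (LINT x|lborel. indicator (box l u) x * max 0 (- h x))
        = (LINT x|lborel. indicator (box l u) x * max 0 (h x) - indicator (box l u) x * max 0 (- h x))"
      by (rule Bochner_Integration.integral_diff[symmetric]) (intro ibox ip)+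
    also have "\<dots> = (LINT x|lborel. indicator (box l u) x * h x)"
      by (intro Bochner_Integration.integral_cong) (auto simp: indicator_def)
    finally show ?thesis using em[OF int, of l u] em[of "\<lambda>x. - h x" l u] int zero[of l u] by simp
  qed
  have "density lborel ?p = density lborel ?n"
  proof (rule measure_eqI_generator_eq)
    let ?E = "range (\<lambda>(a, b). box a b :: 'a set)"
    show "Int_stable ?E" by (auto simp: Int_stable_def box_Int_box)
    show "?E \<subseteq> Pow UNIV" "sets (density lborel ?p) = sigma_sets UNIV ?E" "sets (density lborel ?n) = sigma_sets UNIV ?E"
      by (simp_all add: borel_eq_box)
    let ?A = "\<lambda>n::nat. box (- (real n *\<^sub>R One)) (real n *\<^sub>R One) :: 'a set"
    show "range ?A \<subseteq> ?E" "(\<Union>i. ?A i) = UNIV" unfolding UN_box_eq_UNIV by auto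
    show "emeasure (density lborel ?p) (?A i) \<noteq> \<infinity>" for i using em[OF int] by simp
    show "emeasure (density lborel ?p) X = emeasure (density lborel ?n) X" if "X \<in> ?E" for X
      using that eqbox by auto
  qed
  then have "AE x in lborel. ?p x = ?n x" by (intro sigma_finite_measure.density_unique[OF sigma_finite_lborel]) auto
  then show ?thesis
  proof eventually_elim
    case (elim x)
    then show ?case by (cases "0 \<le> h x") (auto simp: ennreal_neg ennreal_eq_0_iff)
  qed
qed

section \<open>The fundamental lemma of the calculus of variations\<close>

lemma borel_measurable_indicator_box:
  "(indicator (box l u) :: 'a::euclidean_space \<Rightarrow> real) \<in> borel_measurable lebesgue"
  by (intro measurable_completion) simp

text \<open>Bumps converge boundedly to indicators of boxes, so the integral of D over every box
  whose closure lies in a closed box inside S vanishes. Hence D is zero almost everywhere on each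
  such closed box, and countably many of them cover S.\<close>

lemma fundamental_lemma:
  fixes D :: "real ^ 'd \<Rightarrow> real"
  assumes S: "open S" and D: "D \<in> L1_loc S"
    and zero: "\<And>\<phi>. \<phi> \<in> test_functions S \<Longrightarrow> (LINT x|lebesgue_on S. D x * \<phi> x) = 0"
  shows "AE x in lebesgue_on S. D x = 0"
proof -
  have Sm: "S \<in> sets lebesgue" using S by (simp add: borel_open)
  have int: "integrable lebesgue (\<lambda>x. indicator (cbox a b) x * D x)" if "cbox a b \<subseteq> S" for a b
    using D that integrable_lebesgue_on_iff(1)[of "cbox a b" D] by (auto simp: L1_loc_def)
  have bz: "(LINT x|lebesgue. indicator (box l u) x * (indicator (cbox a b) x * D x)) = 0"
    if ab: "cbox a b \<subseteq> S" and lu: "cbox l u \<subseteq> cbox a b" for a b l u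
  proof -
    let ?h = "\<lambda>x. indicator (cbox a b) x * D x"
    have bm: "bump n l u \<in> borel_measurable lebesgue" for n
    proof -
      have "continuous_on UNIV (bump n l u)" using bump_smooth[of n l u] C_k.simps(1) unfolding smooth_def by metis
      then show ?thesis by (intro measurable_completion) (simp add: borel_measurable_continuous_onI)
    qed
    have hm: "?h \<in> borel_measurable lebesgue" using int[OF ab] by (rule borel_measurable_integrable)
    have "(\<lambda>n. LINT x|lebesgue. ?h x * bump n l u x) \<longlonglongrightarrow> (LINT x|lebesgue. ?h x * indicator (box l u) x)"
    proof (rule integral_dominated_convergence[where w="\<lambda>x. \<bar>?h x\<bar>"])
      show "AE x in lebesgue. norm (?h x * bump n l u x) \<le> \<bar>?h x\<bar>" for n
        using bump_range[of n l u] by (intro AE_I2) (simp add: abs_mult mult_left_le)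
      show "(\<lambda>x. ?h x * bump n l u x) \<in> borel_measurable lebesgue" for n by (rule borel_measurable_times[OF hm bm])
      show "(\<lambda>x. ?h x * indicator (box l u) x) \<in> borel_measurable lebesgue"
        by (rule borel_measurable_times[OF hm borel_measurable_indicator_box])
      show "integrable lebesgue (\<lambda>x. \<bar>?h x\<bar>)" using int[OF ab] by (rule integrable_abs)
    qed (intro AE_I2 tendsto_intros bump_tendsto)
    moreover have "(LINT x|lebesgue. ?h x * bump n l u x) = 0" for n
    proof -
      have "(LINT x|lebesgue_on S. D x * bump n l u x) = (LINT x|lebesgue. ?h x * bump n l u x)"
      proof (rule L1_loc_mult_integrable(2)[OF S D _ _ compact_cbox ab, where C=1])
        have "continuous_on UNIV (bump n l u)" using bump_smooth[of n l u] C_k.simps(1) unfolding smooth_def by metis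
        then show "bump n l u \<in> borel_measurable borel" by (rule borel_measurable_continuous_onI)
        show "\<bar>bump n l u x\<bar> \<le> 1" for x using bump_range[of n l u x] by simp
        show "bump n l u x = 0" if "x \<notin> cbox a b" for x
          using bump_nonzero[of n l u x] that lu box_subset_cbox[of l u] by blast
      qed
      moreover have "bump n l u \<in> test_functions S"
        by (rule bump_test_function[OF subset_trans[OF lu ab]])
      ultimately show ?thesis using zero[of "bump n l u"] by simp
    qed
    ultimately have "(\<lambda>n::nat. 0) \<longlonglongrightarrow> (LINT x|lebesgue. ?h x * indicator (box l u) x)"
      by (simp only:)
    then have "(LINT x|lebesgue. ?h x * indicator (box l u) x) = 0"
      unfolding LIMSEQ_const_iff by (rule sym)
    then show ?thesis by (simp add: mult_ac)
  qed
  have cb: "AE x in lebesgue. x \<in> cbox a b \<longrightarrow> D x = 0" if ab: "cbox a b \<subseteq> S" for a b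
  proof -
    let ?h = "\<lambda>x. indicator (cbox a b) x * D x"
    have hm: "?h \<in> borel_measurable lebesgue" using int[OF ab] by (rule borel_measurable_integrable)
    \<comment> \<open>A Borel representative, since the uniqueness statement for boxes concerns
      \<open>lborel\<close>.\<close>
    obtain g where g[measurable]: "g \<in> borel_measurable lborel" and hg: "AE x in lborel. ?h x = g x"
      using completion_ex_borel_measurable_real[OF hm] by blast
    have hg': "AE x in lebesgue. ?h x = g x" using hg by (rule AE_completion)
    have gm: "g \<in> borel_measurable lebesgue" using g by (rule measurable_completion)
    have "integrable lebesgue g" by (rule integrable_cong_AE_imp[OF int[OF ab] gm]) (use hg' in auto)
    then have gi: "integrable lborel g" using integrable_completion[OF g] by simp
    have "(LINT x|lborel. indicator (box l u) x * g x) = 0" for l u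
    proof -
      \<comment> \<open>The box l u may leave cbox a b. Up to the null boundary, integrating g over
        it means integrating over the intersection, which is again a box and is covered by
        \<open>bz\<close>.\<close>
      obtain l' u' where lu': "box l u \<inter> box a b = box l' u'" "cbox l u \<inter> cbox a b = cbox l' u'"
        using box_Int_box[of l u a b] Int_interval[of l u a b] by blast
      have "(LINT x|lborel. indicator (box l u) x * g x) = (LINT x|lebesgue. indicator (box l u) x * g x)"
        by (rule integral_completion[symmetric]) measurable
      also have "\<dots> = (LINT x|lebesgue. indicator (box l' u') x * ?h x)"
      proof (rule integral_cong_AE)
        show "(\<lambda>x. indicator (box l u) x * g x) \<in> borel_measurable lebesgue"
             "(\<lambda>x. indicator (box l' u') x * ?h x) \<in> borel_measurable lebesgue"
          by (rule borel_measurable_times[OF borel_measurable_indicator_box gm],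
              rule borel_measurable_times[OF borel_measurable_indicator_box hm])
        have "AE x in lebesgue. indicator (cbox a b) x = (indicator (box a b) x :: ennreal)"
          by (rule AE_completion[OF AE_indicator_cbox_box])
        then show "AE x in lebesgue. indicator (box l u) x * g x = indicator (box l' u') x * ?h x"
          using hg'
        proof eventually_elim
          case (elim x)
          then show ?case unfolding lu'(1)[symmetric] by (auto simp: indicator_def split: if_splits)
        qed
      qed
      also have "\<dots> = 0" using lu'(2) by (intro bz ab) auto
      finally show ?thesis .
    qed
    then have "AE x in lborel. g x = 0" by (rule integral_boxes_zero_imp_AE_zero[OF gi])
    then have "AE x in lebesgue. g x = 0" by (rule AE_completion)
    with hg' show ?thesis by eventually_elim (auto simp: indicator_def)
  qed
  have "\<exists>\<D>. countable \<D> \<and> (\<forall>X\<in>\<D>. X \<subseteq> S \<and> (\<exists>a b. X = cbox a b)) \<and> \<Union>\<D> = S"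
  proof (rule open_countable_Union_open_cbox[OF S])
    fix \<D> assume \<D>: "countable \<D>" "\<D> \<subseteq> Pow S" "\<Union>\<D> = S" and box: "\<And>X. X \<in> \<D> \<Longrightarrow> \<exists>a b. X = cbox a b"
    have "X \<subseteq> S \<and> (\<exists>a b. X = cbox a b)" if "X \<in> \<D>" for X
      using box[OF that] \<D>(2) that by (intro conjI) auto
    then show ?thesis using \<D> by (intro exI[of _ \<D>]) simp
  qed
  then obtain \<D> where \<D>: "countable \<D>" "\<forall>X\<in>\<D>. X \<subseteq> S \<and> (\<exists>a b. X = cbox a b)" "\<Union>\<D> = S"
    by blast
  have "AE x in lebesgue. x \<in> X \<longrightarrow> D x = 0" if X: "X \<in> \<D>" for X
  proof -
    obtain a b where "X = cbox a b" "cbox a b \<subseteq> S" using \<D>(2) X by metis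
    then show ?thesis using cb[of a b] by simp
  qed
  then have "AE x in lebesgue. \<forall>X\<in>\<D>. x \<in> X \<longrightarrow> D x = 0"
    by (subst AE_ball_countable[OF \<D>(1)]) (rule ballI)
  then have "AE x in lebesgue. x \<in> S \<longrightarrow> D x = 0" by eventually_elim (use \<D>(3) in blast)
  then show ?thesis using Sm by (simp add: AE_restrict_space_iff)
qed

lemma smooth_imp_C1_grad:
  assumes "smooth \<phi>" shows "C1_grad \<phi> (grad \<phi>)"
proof -
  have "C_k (Suc 0) \<phi>" using assms by (simp add: smooth_def)
  then have d: "\<And>x. \<phi> differentiable at x" and c: "\<And>i. continuous_on UNIV (\<lambda>x. grad \<phi> x $ i)" by auto
  have "(\<phi> has_derivative (\<lambda>h. grad \<phi> x \<bullet> h)) (at x)" for x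
  proof -
    have D: "(\<phi> has_derivative frechet_derivative \<phi> (at x)) (at x)" using d frechet_derivative_works by blast
    then have lin: "linear (frechet_derivative \<phi> (at x))" by (rule has_derivative_linear)
    have "frechet_derivative \<phi> (at x) h = grad \<phi> x \<bullet> h" for h
    proof -
      have "h = (\<Sum>i\<in>UNIV. h $ i *\<^sub>R axis i 1)"
        by (subst basis_expansion[of h, symmetric]) (simp add: scalar_mult_eq_scaleR)
      then have "frechet_derivative \<phi> (at x) h = (\<Sum>i\<in>UNIV. h $ i *\<^sub>R frechet_derivative \<phi> (at x) (axis i 1))"
        using linear_sum[OF lin] linear_scale[OF lin] by (metis (no_types, lifting) sum.cong)
      then show ?thesis by (simp add: grad_def inner_vec_def mult.commute)
    qed
    then show ?thesis using D by (metis ext)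
  qed
  moreover have "continuous_on UNIV (grad \<phi>)"
  proof -
    have "grad \<phi> = (\<lambda>x. \<chi> i. grad \<phi> x $ i)" by (simp add: vec_lambda_eta)
    then show ?thesis using continuous_on_vec_lambda[of UNIV "\<lambda>i x. grad \<phi> x $ i"] c by metis
  qed
  ultimately show ?thesis by (simp add: C1_grad_def)
qed

lemma test_function_grad_zero:
  assumes "x \<notin> closure {x. \<phi> x \<noteq> 0}" shows "grad \<phi> x = 0"
proof -
  have "((\<lambda>_. 0) has_derivative (\<lambda>_. 0 :: real)) (at x)" by simp
  then have "(\<phi> has_derivative (\<lambda>_. 0)) (at x)"
  proof (rule has_derivative_transform_within_open[where s="- closure {x. \<phi> x \<noteq> 0}"])
    show "0 = \<phi> y" if "y \<in> - closure {x. \<phi> x \<noteq> 0}" for y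
    proof (rule ccontr)
      assume "0 \<noteq> \<phi> y"
      then have "y \<in> closure {x. \<phi> x \<noteq> 0}" by (intro subsetD[OF closure_subset]) simp
      then show False using that by simp
    qed
  qed (use assms in auto)
  then show ?thesis by (simp add: vec_eq_iff grad_eqI)
qed

lemma test_function_props:
  assumes "\<phi> \<in> test_functions S"
  shows "\<exists>K C. compact K \<and> K \<subseteq> S \<and> 0 \<le> C \<and> (\<forall>x. x \<notin> K \<longrightarrow> \<phi> x = 0 \<and> grad \<phi> x = 0)
    \<and> (\<forall>x. \<bar>\<phi> x\<bar> \<le> C \<and> norm (grad \<phi> x) \<le> C) \<and> C1_grad \<phi> (grad \<phi>)"
proof -
  let ?K = "closure {x. \<phi> x \<noteq> 0}"
  have K: "compact ?K" "?K \<subseteq> S" "smooth \<phi>" using assms by (auto simp: test_functions_def)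
  have c1: "C1_grad \<phi> (grad \<phi>)" by (rule smooth_imp_C1_grad[OF K(3)])
  have z: "x \<notin> ?K \<Longrightarrow> \<phi> x = 0" "x \<notin> ?K \<Longrightarrow> grad \<phi> x = 0" for x
    using closure_subset[of "{x. \<phi> x \<noteq> 0}"] test_function_grad_zero by auto
  have "bounded (\<phi> ` ?K)" "bounded (grad \<phi> ` ?K)"
    using c1 C1_grad_continuous[OF c1] unfolding C1_grad_def
    by (auto intro!: compact_imp_bounded compact_continuous_image K(1) intro: continuous_on_subset)
  then obtain A B where A: "\<And>x. x \<in> ?K \<Longrightarrow> norm (\<phi> x) \<le> A" and B: "\<And>x. x \<in> ?K \<Longrightarrow> norm (grad \<phi> x) \<le> B"
    unfolding bounded_iff by (metis imageI)
  define C where "C = max 0 (max A B)"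
  have bound: "\<bar>\<phi> x\<bar> \<le> C \<and> norm (grad \<phi> x) \<le> C" for x
  proof (cases "x \<in> ?K")
    case True
    from A[OF True] B[OF True] show ?thesis by (simp add: C_def le_max_iff_disj)
  next
    case False
    from z(1)[OF False] z(2)[OF False] show ?thesis by (simp add: C_def)
  qed
  have C0: "0 \<le> C" by (simp add: C_def)
  show ?thesis
    by (rule exI[of _ ?K], rule exI[of _ C]) (intro conjI allI impI K(1,2) C0 c1 z bound[THEN conjunct1] bound[THEN conjunct2])
qed

section \<open>Linearity and uniqueness of weak gradients\<close>

lemma borel_measurable_component: "f \<in> borel_measurable M \<Longrightarrow> (\<lambda>x. f x $ i) \<in> borel_measurable M"
  for f :: "'b \<Rightarrow> real ^ 'd"
  by (rule measurable_compose[OF _ borel_measurable_nth])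

lemma L1_loc_component:
  fixes G :: "real ^ 'd \<Rightarrow> real ^ 'e"
  assumes "G \<in> L1_loc S" shows "(\<lambda>x. G x $ i) \<in> L1_loc S"
proof -
  have "integrable (lebesgue_on K) (\<lambda>x. G x $ i)" if "integrable (lebesgue_on K) G" for K
    using integrable_bounded_linear[OF bounded_linear_vec_nth that] .
  moreover have "(\<lambda>x. G x $ i) \<in> borel_measurable (lebesgue_on S)"
    by (rule borel_measurable_component) (use assms in \<open>simp add: L1_loc_def\<close>)
  ultimately show ?thesis using assms by (auto simp: L1_loc_def)
qed

lemma L1_loc_lincomb:
  assumes "f \<in> L1_loc S" "g \<in> L1_loc S" shows "(\<lambda>x. s *\<^sub>R f x + t *\<^sub>R g x) \<in> L1_loc S"
  using assms by (auto simp: L1_loc_def)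

lemma has_weak_grad_integrable:
  assumes "open S" "has_weak_grad S v G" "\<phi> \<in> test_functions S"
  shows "integrable (lebesgue_on S) (\<lambda>x. v x * grad \<phi> x $ i)" "integrable (lebesgue_on S) (\<lambda>x. G x $ i * \<phi> x)"
proof -
  obtain K C where K: "compact K" "K \<subseteq> S" and z: "\<forall>x. x \<notin> K \<longrightarrow> \<phi> x = 0 \<and> grad \<phi> x = 0"
    and bd: "\<forall>x. \<bar>\<phi> x\<bar> \<le> C \<and> norm (grad \<phi> x) \<le> C" and c1: "C1_grad \<phi> (grad \<phi>)"
    using test_function_props[OF assms(3)] by blast
  have v: "v \<in> L1_loc S" and G: "(\<lambda>x. G x $ i) \<in> L1_loc S"
    using assms(2) L1_loc_component by (auto simp: has_weak_grad_def)
  show "integrable (lebesgue_on S) (\<lambda>x. v x * grad \<phi> x $ i)"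
  proof (rule L1_loc_mult_integrable(1)[OF assms(1) v _ _ K(1,2)])
    show "(\<lambda>x. grad \<phi> x $ i) \<in> borel_measurable borel"
      by (rule borel_measurable_component[OF C1_grad_measurable(2)[OF c1]])
    show "\<bar>grad \<phi> x $ i\<bar> \<le> C" for x using component_le_norm_cart[of "grad \<phi> x" i] bd[rule_format, of x] by linarith
    show "grad \<phi> x $ i = 0" if "x \<notin> K" for x using z that by simp
  qed
  show "integrable (lebesgue_on S) (\<lambda>x. G x $ i * \<phi> x)"
    by (rule L1_loc_mult_integrable(1)[OF assms(1) G C1_grad_measurable(1)[OF c1] _ K]) (use z bd in auto)
qed

lemma has_weak_grad_lincomb:
  assumes S: "open S" and v: "has_weak_grad S v G" and w: "has_weak_grad S w H"
  shows "has_weak_grad S (\<lambda>x. s * v x + t * w x) (\<lambda>x. s *\<^sub>R G x + t *\<^sub>R H x)"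
  unfolding has_weak_grad_def
proof (intro conjI ballI allI)
  show "(\<lambda>x. s * v x + t * w x) \<in> L1_loc S" "(\<lambda>x. s *\<^sub>R G x + t *\<^sub>R H x) \<in> L1_loc S"
    using v w L1_loc_lincomb[of v S w s t] L1_loc_lincomb[of G S H s t] by (auto simp: has_weak_grad_def)
  fix \<phi> i assume \<phi>: "\<phi> \<in> test_functions S"
  note iv = has_weak_grad_integrable[OF S v \<phi>] and iw = has_weak_grad_integrable[OF S w \<phi>]
  have "(LINT x|lebesgue_on S. (s * v x + t * w x) * grad \<phi> x $ i)
      = (LINT x|lebesgue_on S. s * (v x * grad \<phi> x $ i) + t * (w x * grad \<phi> x $ i))"
    by (intro Bochner_Integration.integral_cong) (simp_all add: algebra_simps)
  also have "\<dots> = s * (LINT x|lebesgue_on S. v x * grad \<phi> x $ i) + t * (LINT x|lebesgue_on S. w x * grad \<phi> x $ i)"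
    using iv(1)[of i] iw(1)[of i] by simp
  also have "\<dots> = - (s * (LINT x|lebesgue_on S. G x $ i * \<phi> x) + t * (LINT x|lebesgue_on S. H x $ i * \<phi> x))"
    using v w \<phi> by (simp add: has_weak_grad_def)
  also have "s * (LINT x|lebesgue_on S. G x $ i * \<phi> x) + t * (LINT x|lebesgue_on S. H x $ i * \<phi> x)
      = (LINT x|lebesgue_on S. s * (G x $ i * \<phi> x) + t * (H x $ i * \<phi> x))"
    using iv(2)[of i] iw(2)[of i] by simp
  also have "\<dots> = (LINT x|lebesgue_on S. (s *\<^sub>R G x + t *\<^sub>R H x) $ i * \<phi> x)"
    by (intro Bochner_Integration.integral_cong) (simp_all add: algebra_simps)
  finally show "(LINT x|lebesgue_on S. (s * v x + t * w x) * grad \<phi> x $ i)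
      = - (LINT x|lebesgue_on S. (s *\<^sub>R G x + t *\<^sub>R H x) $ i * \<phi> x)" .
qed

lemma weak_grad_unique:
  assumes S: "open S" and G: "has_weak_grad S v G" and H: "has_weak_grad S v H"
  shows "AE x in lebesgue_on S. G x = H x"
proof -
  have "AE x in lebesgue_on S. G x $ i - H x $ i = 0" for i
  proof (rule fundamental_lemma[OF S])
    show "(\<lambda>x. G x $ i - H x $ i) \<in> L1_loc S"
      using L1_loc_lincomb[of "\<lambda>x. G x $ i" S "\<lambda>x. H x $ i" 1 "-1"] G H L1_loc_component[of G S i] L1_loc_component[of H S i]
      by (simp add: has_weak_grad_def)
    fix \<phi> assume \<phi>: "\<phi> \<in> test_functions S"
    have "(LINT x|lebesgue_on S. G x $ i * \<phi> x) = (LINT x|lebesgue_on S. H x $ i * \<phi> x)"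
      using G H \<phi> by (simp add: has_weak_grad_def)
    then show "(LINT x|lebesgue_on S. (G x $ i - H x $ i) * \<phi> x) = 0"
      using has_weak_grad_integrable(2)[OF S G \<phi>, of i] has_weak_grad_integrable(2)[OF S H \<phi>, of i]
      by (simp add: left_diff_distrib)
  qed
  then have "AE x in lebesgue_on S. \<forall>i\<in>(UNIV :: 'a set). G x $ i - H x $ i = 0"
    by (subst AE_ball_countable) auto
  then show ?thesis by eventually_elim (simp add: vec_eq_iff)
qed

text \<open>\<open>wgrad\<close> is a choice among representatives, so identities for it, such as
  linearity, are obtained only almost everywhere; this lemma is how they arise.\<close>

lemma wgrad_unique:
  assumes "open S" "has_weak_grad S v G"
  shows "has_weak_grad S v (wgrad S v)" "AE x in lebesgue_on S. wgrad S v x = G x"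
proof -
  show 1: "has_weak_grad S v (wgrad S v)" unfolding wgrad_def by (rule someI[of "has_weak_grad S v", OF assms(2)])
  show "AE x in lebesgue_on S. wgrad S v x = G x" by (rule weak_grad_unique[OF assms(1) 1 assms(2)])
qed

section \<open>Sobolev and Rellich theorems for weakly differentiable functions\<close>

lemma L2_iff: "f \<in> L2 M \<longleftrightarrow> f \<in> borel_measurable M \<and> integrable M (\<lambda>x. (norm (f x))\<^sup>2)"
  by (simp add: Lp_def)

lemma L2_real_iff: "f \<in> L2 M \<longleftrightarrow> f \<in> borel_measurable M \<and> integrable M (\<lambda>x. (f x)\<^sup>2)" for f :: "'a \<Rightarrow> real"
  by (simp add: L2_iff)

lemma L2_product_integrable:
  assumes "f \<in> L2 M" "g \<in> L2 M"
  shows "integrable M (\<lambda>x. norm (f x) * norm (g x))"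
proof (rule Bochner_Integration.integrable_bound)
  show "integrable M (\<lambda>x. (norm (f x))\<^sup>2 + (norm (g x))\<^sup>2)" using assms by (simp add: L2_iff)
  have [measurable]: "f \<in> borel_measurable M" "g \<in> borel_measurable M" using assms by (simp_all add: L2_iff)
  show "(\<lambda>x. norm (f x) * norm (g x)) \<in> borel_measurable M" by measurable
  have "norm (f x) * norm (g x) \<le> (norm (f x))\<^sup>2 + (norm (g x))\<^sup>2" for x
    using sum_squares_bound[of "norm (f x)" "norm (g x)"] mult_nonneg_nonneg[OF norm_ge_zero norm_ge_zero, of "f x" "g x"] by linarith
  then show "AE x in M. norm (norm (f x) * norm (g x)) \<le> norm ((norm (f x))\<^sup>2 + (norm (g x))\<^sup>2)" by simp
qed

lemma L2_inner_integrable: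
  assumes "f \<in> L2 M" "g \<in> L2 M"
  shows "integrable M (\<lambda>x. f x \<bullet> g x)"
proof (rule Bochner_Integration.integrable_bound[OF L2_product_integrable[OF assms]])
  have [measurable]: "f \<in> borel_measurable M" "g \<in> borel_measurable M" using assms by (simp_all add: L2_iff)
  show "(\<lambda>x. f x \<bullet> g x) \<in> borel_measurable M" by measurable
  show "AE x in M. norm (f x \<bullet> g x) \<le> norm (norm (f x) * norm (g x))"
    using Cauchy_Schwarz_ineq2 by (intro AE_I2) (simp add: abs_mult)
qed

lemma norm_lincomb_sq_le:
  "(norm (s *\<^sub>R x + t *\<^sub>R y))\<^sup>2 \<le> 2 * s\<^sup>2 * (norm x)\<^sup>2 + 2 * t\<^sup>2 * (norm (y :: 'a::real_normed_vector))\<^sup>2"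
proof -
  have "norm (s *\<^sub>R x + t *\<^sub>R y) \<le> \<bar>s\<bar> * norm x + \<bar>t\<bar> * norm y"
    using norm_triangle_ineq[of "s *\<^sub>R x" "t *\<^sub>R y"] by simp
  then have "(norm (s *\<^sub>R x + t *\<^sub>R y))\<^sup>2 \<le> (\<bar>s\<bar> * norm x + \<bar>t\<bar> * norm y)\<^sup>2" by (rule power_mono) simp
  also have "\<dots> \<le> 2 * (\<bar>s\<bar> * norm x)\<^sup>2 + 2 * (\<bar>t\<bar> * norm y)\<^sup>2"
    using sum_squares_bound[of "\<bar>s\<bar> * norm x" "\<bar>t\<bar> * norm y"] by (simp add: power2_sum)
  finally show ?thesis by (simp add: power_mult_distrib)
qed

lemma L2_lincomb:
  assumes "f \<in> L2 M" "g \<in> L2 M"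
  shows "(\<lambda>x. s *\<^sub>R f x + t *\<^sub>R g x) \<in> L2 M"
proof -
  have [measurable]: "f \<in> borel_measurable M" "g \<in> borel_measurable M" using assms by (simp_all add: L2_iff)
  have "integrable M (\<lambda>x. (norm (s *\<^sub>R f x + t *\<^sub>R g x))\<^sup>2)"
  proof (rule Bochner_Integration.integrable_bound)
    show "integrable M (\<lambda>x. 2 * s\<^sup>2 * (norm (f x))\<^sup>2 + 2 * t\<^sup>2 * (norm (g x))\<^sup>2)" using assms by (simp add: L2_iff)
    show "AE x in M. norm ((norm (s *\<^sub>R f x + t *\<^sub>R g x))\<^sup>2) \<le> norm (2 * s\<^sup>2 * (norm (f x))\<^sup>2 + 2 * t\<^sup>2 * (norm (g x))\<^sup>2)"
    proof (intro AE_I2)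
      fix x
      show "norm ((norm (s *\<^sub>R f x + t *\<^sub>R g x))\<^sup>2) \<le> norm (2 * s\<^sup>2 * (norm (f x))\<^sup>2 + 2 * t\<^sup>2 * (norm (g x))\<^sup>2)"
        using norm_lincomb_sq_le[of s "f x" t "g x"] by simp
    qed
  qed measurable
  then show ?thesis by (simp add: L2_iff)
qed

lemma L2_diff: "f \<in> L2 M \<Longrightarrow> g \<in> L2 M \<Longrightarrow> (\<lambda>x. f x - g x) \<in> L2 M"
  using L2_lincomb[of f M g 1 "-1"] by simp

text \<open>The difference of the squared norms is at most (1 + 1/\<eta>) times the squared distance
  plus \<eta> times the square of the limit, pointwise. Integrating this gives convergence without a
  triangle inequality for the integral norm.\<close>

lemma L2_norm_tendsto:
  assumes f: "f \<in> L2 M" and F: "\<And>n. F n \<in> L2 M"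
    and lim: "(\<lambda>n. LINT x|M. (norm (f x - F n x))\<^sup>2) \<longlonglongrightarrow> 0"
  shows "(\<lambda>n. LINT x|M. (norm (F n x))\<^sup>2) \<longlonglongrightarrow> (LINT x|M. (norm (f x))\<^sup>2)"
proof (rule LIMSEQ_I)
  fix r :: real assume r: "0 < r"
  define I where "I = (LINT x|M. (norm (f x))\<^sup>2)"
  let ?e = "\<lambda>n. LINT x|M. (norm (f x - F n x))\<^sup>2"
  have I: "0 \<le> I" unfolding I_def by (rule integral_nonneg_AE) simp
  \<comment> \<open>Keeps the part that does not tend to zero, \<eta> I, below r / 2.\<close>
  define \<eta> where "\<eta> = r / (2 * (I + 1))"
  have \<eta>: "0 < \<eta>" using r I by (simp add: \<eta>_def)
  have \<eta>I: "\<eta> * I \<le> r / 2"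
  proof -
    have "\<eta> * I \<le> \<eta> * (I + 1)" using \<eta> by simp
    also have "\<dots> = r / 2" using I by (simp add: \<eta>_def field_simps)
    finally show ?thesis .
  qed
  have diff: "(\<lambda>x. f x - F n x) \<in> L2 M" for n by (rule L2_diff[OF f F])
  have bd: "\<bar>(LINT x|M. (norm (F n x))\<^sup>2) - I\<bar> \<le> (1 + 1 / \<eta>) * ?e n + \<eta> * I" for n
  proof -
    have i: "integrable M (\<lambda>x. (norm (F n x))\<^sup>2)" "integrable M (\<lambda>x. (norm (f x))\<^sup>2)" "integrable M (\<lambda>x. (norm (f x - F n x))\<^sup>2)"
      using F[of n] f diff[of n] by (simp_all add: L2_iff)
    have "(LINT x|M. (norm (F n x))\<^sup>2) - I = (LINT x|M. (norm (F n x))\<^sup>2 - (norm (f x))\<^sup>2)"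
      unfolding I_def using i by simp
    also have "\<bar>\<dots>\<bar> \<le> (LINT x|M. (1 + 1 / \<eta>) * (norm (f x - F n x))\<^sup>2 + \<eta> * (norm (f x))\<^sup>2)"
    proof (rule abs_integral_le)
      fix x
      let ?a = "norm (f x)" and ?b = "norm (F n x)" and ?d = "norm (f x - F n x)"
      have "\<bar>?b - ?a\<bar> \<le> ?d" using norm_triangle_ineq3[of "F n x" "f x"] by (simp add: norm_minus_commute)
      moreover have "\<bar>?b\<^sup>2 - ?a\<^sup>2\<bar> = \<bar>?b - ?a\<bar> * (?b + ?a)" by (simp add: power2_eq_square square_diff_square_factored abs_mult)
      moreover have "?b + ?a \<le> ?d + 2 * ?a" using norm_triangle_sub[of "F n x" "f x"] by (simp add: norm_minus_commute)
      ultimately have "\<bar>?b\<^sup>2 - ?a\<^sup>2\<bar> \<le> ?d * (?d + 2 * ?a)" by (simp add: mult_mono)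
      also have "\<dots> = ?d\<^sup>2 + 2 * ?d * ?a" by (simp add: power2_eq_square algebra_simps)
      also have "2 * ?d * ?a \<le> ?d\<^sup>2 / \<eta> + \<eta> * ?a\<^sup>2"
      proof -
        have "0 \<le> (?d - \<eta> * ?a)\<^sup>2 / \<eta>" using \<eta> by simp
        also have "\<dots> = ?d\<^sup>2 / \<eta> + \<eta> * ?a\<^sup>2 - 2 * ?d * ?a"
          using \<eta> by (simp add: power2_diff power_mult_distrib field_simps power2_eq_square[of \<eta>])
        finally show ?thesis by simp
      qed
      finally show "\<bar>?b\<^sup>2 - ?a\<^sup>2\<bar> \<le> (1 + 1 / \<eta>) * ?d\<^sup>2 + \<eta> * ?a\<^sup>2" by (simp add: distrib_right)
    qed (use i in simp_all)
    also have "\<dots> = (1 + 1 / \<eta>) * ?e n + \<eta> * I" unfolding I_def using i by simp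
    finally show ?thesis .
  qed
  have "(\<lambda>n. (1 + 1 / \<eta>) * ?e n) \<longlonglongrightarrow> (1 + 1 / \<eta>) * 0" by (intro tendsto_mult tendsto_const lim)
  then have "\<forall>\<^sub>F n in sequentially. (1 + 1 / \<eta>) * ?e n < r / 2" using r by (intro order_tendstoD(2)) auto
  then have "\<forall>\<^sub>F n in sequentially. norm ((LINT x|M. (norm (F n x))\<^sup>2) - I) < r"
  proof eventually_elim
    case (elim n)
    have "norm ((LINT x|M. (norm (F n x))\<^sup>2) - I) = \<bar>(LINT x|M. (norm (F n x))\<^sup>2) - I\<bar>" by (rule real_norm_def)
    then show ?case using bd[of n] elim \<eta>I by linarith
  qed
  then show "\<exists>no. \<forall>n\<ge>no. norm ((LINT x|M. (norm (F n x))\<^sup>2) - (LINT x|M. (norm (f x))\<^sup>2)) < r"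
    by (simp only: eventually_sequentially I_def)
qed

lemma (in finite_measure) L2_integrable:
  fixes f :: "'a \<Rightarrow> real"
  assumes "f \<in> L2 M"
  shows "integrable M f" and "(LINT x|M. f x)\<^sup>2 \<le> measure M (space M) * (LINT x|M. (f x)\<^sup>2)"
proof -
  have [measurable]: "f \<in> borel_measurable M" and i2: "integrable M (\<lambda>x. (f x)\<^sup>2)" using assms by (simp_all add: L2_real_iff)
  show i: "integrable M f"
  proof (rule Bochner_Integration.integrable_bound)
    show "integrable M (\<lambda>x. 1 + (f x)\<^sup>2)" using i2 by simp
    have "\<bar>f x\<bar> \<le> 1 + (f x)\<^sup>2" for x
      using sum_squares_bound[of 1 "\<bar>f x\<bar>"] by simp
    then show "AE x in M. norm (f x) \<le> norm (1 + (f x)\<^sup>2)" by simp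
  qed measurable
  \<comment> \<open>The integral of (f + t)^2 is a nonnegative quadratic in t; its discriminant is
    the Cauchy-Schwarz inequality with the constant function 1.\<close>
  have "0 \<le> measure M (space M) * t\<^sup>2 + 2 * (LINT x|M. f x) * t + (LINT x|M. (f x)\<^sup>2)" for t
  proof -
    have "0 \<le> (LINT x|M. (f x + t)\<^sup>2)" by (intro integral_nonneg_AE) simp
    also have "\<dots> = (LINT x|M. (f x)\<^sup>2 + 2 * t * f x + t\<^sup>2)"
      by (intro Bochner_Integration.integral_cong) (simp_all add: power2_sum algebra_simps)
    also have "\<dots> = measure M (space M) * t\<^sup>2 + 2 * (LINT x|M. f x) * t + (LINT x|M. (f x)\<^sup>2)" using i i2 by simp
    finally show ?thesis .
  qed
  then show "(LINT x|M. f x)\<^sup>2 \<le> measure M (space M) * (LINT x|M. (f x)\<^sup>2)"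
    by (rule quadratic_nonneg_bound) simp
qed

lemma (in finite_measure) L2_indicator_tendsto:
  fixes f :: "'a \<Rightarrow> real"
  assumes f: "f \<in> L2 M" and F: "\<And>n. F n \<in> L2 M" and Q[measurable]: "Q \<in> sets M"
    and lim: "(\<lambda>n. LINT x|M. (f x - F n x)\<^sup>2) \<longlonglongrightarrow> 0"
  shows "(\<lambda>n. LINT x|M. indicator Q x * F n x) \<longlonglongrightarrow> (LINT x|M. indicator Q x * f x)"
proof -
  let ?m = "measure M (space M)"
  let ?p = "\<lambda>n. (LINT x|M. indicator Q x * f x) - (LINT x|M. indicator Q x * F n x)"
  have ind: "(\<lambda>x. indicator Q x * g x) \<in> L2 M" if g: "g \<in> L2 M" for g :: "'a \<Rightarrow> real"
  proof -
    have [measurable]: "g \<in> borel_measurable M" using g by (simp add: L2_real_iff)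
    have "integrable M (\<lambda>x. (indicator Q x * g x)\<^sup>2)"
      by (rule Bochner_Integration.integrable_bound[of M "\<lambda>x. (g x)\<^sup>2"])
        (use g in \<open>auto simp: L2_real_iff indicator_def\<close>)
    then show ?thesis by (simp add: L2_real_iff)
  qed
  have le: "(?p n)\<^sup>2 \<le> ?m * (LINT x|M. (f x - F n x)\<^sup>2)" for n
  proof -
    have d: "(\<lambda>x. f x - F n x) \<in> L2 M" by (rule L2_diff[OF f F])
    have "?p n = (LINT x|M. indicator Q x * (f x - F n x))"
      using L2_integrable(1)[OF ind[OF f]] L2_integrable(1)[OF ind[OF F[of n]]] by (simp add: right_diff_distrib)
    then have "(?p n)\<^sup>2 \<le> ?m * (LINT x|M. (indicator Q x * (f x - F n x))\<^sup>2)"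
      using L2_integrable(2)[OF ind[OF d]] by simp
    also have "\<dots> \<le> ?m * (LINT x|M. (f x - F n x)\<^sup>2)"
      using ind[OF d] d by (intro mult_left_mono integral_mono) (auto simp: L2_real_iff indicator_def)
    finally show ?thesis .
  qed
  have "(\<lambda>n. sqrt (?m * (LINT x|M. (f x - F n x)\<^sup>2))) \<longlonglongrightarrow> sqrt (?m * 0)"
    by (intro tendsto_real_sqrt tendsto_mult tendsto_const lim)
  then have lim0: "(\<lambda>n. sqrt (?m * (LINT x|M. (f x - F n x)\<^sup>2))) \<longlonglongrightarrow> 0" by simp
  have "?p \<longlonglongrightarrow> 0"
  proof (rule Lim_null_comparison[OF always_eventually[OF allI] lim0])
    fix n
    have "\<bar>?p n\<bar> = sqrt ((?p n)\<^sup>2)" by simp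
    also have "\<dots> \<le> sqrt (?m * (LINT x|M. (f x - F n x)\<^sup>2))" by (rule real_sqrt_le_mono[OF le])
    finally show "norm (?p n) \<le> sqrt (?m * (LINT x|M. (f x - F n x)\<^sup>2))" by simp
  qed
  then have "(\<lambda>n. (LINT x|M. indicator Q x * f x) - ?p n) \<longlonglongrightarrow> (LINT x|M. indicator Q x * f x) - 0"
    by (intro tendsto_diff tendsto_const)
  then show ?thesis by simp
qed

text \<open>The inequalities for C1 functions use \<open>lborel\<close> on the whole space, the weak
  theory uses \<open>lebesgue_on S\<close>. For functions supported in a compact subset of S the two
  integrals agree.\<close>

lemma compact_support_integral:
  fixes h :: "real ^ 'd \<Rightarrow> real"
  assumes "open S" and h: "h \<in> borel_measurable borel" "\<And>x. \<bar>h x\<bar> \<le> C" and K: "compact K" "K \<subseteq> S" "\<And>x. x \<notin> K \<Longrightarrow> h x = 0"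
  shows "integrable (lebesgue_on S) h" "integrable lborel h" "(LINT x|lebesgue_on S. h x) = (LINT x|lborel. h x)"
proof -
  have S: "S \<in> sets lebesgue" using assms(1) by (simp add: borel_open)
  have Kb: "K \<in> sets borel" using K(1) by (simp add: borel_compact)
  show i: "integrable lborel h"
  proof (rule Bochner_Integration.integrable_bound)
    show "integrable lborel (\<lambda>x. C * indicator K x)"
      using emeasure_compact_finite[OF K(1)] Kb by (intro integrable_mult_right integrable_real_indicator) auto
    show "h \<in> borel_measurable lborel" using h by simp
    show "AE x in lborel. norm (h x) \<le> norm (C * indicator K x)"
    proof (intro AE_I2)
      fix x show "norm (h x) \<le> norm (C * indicator K x)" using h(2)[of x] K(3)[of x] by (cases "x \<in> K") auto
    qed
  qed
  have ind: "(\<lambda>x. indicator S x * h x) = h"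
  proof
    fix x show "indicator S x * h x = h x" using K(2) K(3)[of x] by (cases "x \<in> K") auto
  qed
  show "integrable (lebesgue_on S) h" "(LINT x|lebesgue_on S. h x) = (LINT x|lborel. h x)"
    unfolding integrable_lebesgue_on_iff[OF S] ind using i h(1) by (simp_all add: integrable_completion integral_completion)
qed

section \<open>Test functions and the space H10\<close>

lemma test_function_C1:
  assumes "\<phi> \<in> test_functions S"
  shows "C1_grad \<phi> (grad \<phi>)" "\<forall>x. x \<notin> S \<longrightarrow> \<phi> x = 0"
  using test_function_props[OF assms] by blast+

lemma test_function_integrals:
  assumes S: "open S" and \<phi>: "\<phi> \<in> test_functions S"
  shows "\<phi> \<in> L2 (lebesgue_on S)" "grad \<phi> \<in> L2 (lebesgue_on S)"
    and "(\<integral>\<^sup>+x. ennreal ((norm (grad \<phi> x))\<^sup>2) \<partial>lborel) = ennreal (LINT x|lebesgue_on S. (norm (grad \<phi> x))\<^sup>2)"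
    and "\<And>Q. Q \<in> sets borel \<Longrightarrow> (LINT x|lebesgue_on S. indicator Q x * \<phi> x) = (LINT x|lborel. indicator Q x * \<phi> x)"
    and "\<And>k. 1 \<le> k \<Longrightarrow> (\<integral>\<^sup>+x. ennreal (\<phi> x ^ (2 * k)) \<partial>lborel) = ennreal (LINT x|lebesgue_on S. \<phi> x ^ (2 * k))"
    and "\<And>k. 1 \<le> k \<Longrightarrow> integrable (lebesgue_on S) (\<lambda>x. \<phi> x ^ (2 * k))"
proof -
  obtain K C where K: "compact K" "K \<subseteq> S" and C: "0 \<le> C" and z: "\<forall>x. x \<notin> K \<longrightarrow> \<phi> x = 0 \<and> grad \<phi> x = 0"
    and bd: "\<forall>x. \<bar>\<phi> x\<bar> \<le> C \<and> norm (grad \<phi> x) \<le> C" and c1: "C1_grad \<phi> (grad \<phi>)"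
    using test_function_props[OF \<phi>] by blast
  note [measurable] = C1_grad_measurable[OF c1]
  have gm: "(\<lambda>x. (norm (grad \<phi> x))\<^sup>2) \<in> borel_measurable borel" by measurable
  have gb: "\<bar>(norm (grad \<phi> x))\<^sup>2\<bar> \<le> C\<^sup>2" for x
    using power_mono[OF conjunct2[OF bd[rule_format, of x]], of 2] by simp
  have gz: "(norm (grad \<phi> x))\<^sup>2 = 0" if "x \<notin> K" for x using z that by simp
  note grad = compact_support_integral[OF S gm gb K gz]
  have pm: "(\<lambda>x. \<phi> x ^ (2 * k)) \<in> borel_measurable borel" for k by measurable
  have pb: "\<bar>\<phi> x ^ (2 * k)\<bar> \<le> C ^ (2 * k)" for x k
    using power_mono[OF conjunct1[OF bd[rule_format, of x]], of "2 * k"] by (simp add: power_abs)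
  have pz: "\<phi> x ^ (2 * k) = 0" if "1 \<le> k" "x \<notin> K" for x k using z that by (simp add: power_0_left)
  show "integrable (lebesgue_on S) (\<lambda>x. \<phi> x ^ (2 * k))" if "1 \<le> k" for k
    by (rule compact_support_integral(1)[OF S pm pb K pz[OF that]])
  show "(\<integral>\<^sup>+x. ennreal (\<phi> x ^ (2 * k)) \<partial>lborel) = ennreal (LINT x|lebesgue_on S. \<phi> x ^ (2 * k))" if "1 \<le> k" for k
  proof -
    have "(LINT x|lebesgue_on S. \<phi> x ^ (2 * k)) = (LINT x|lborel. \<phi> x ^ (2 * k))"
      by (rule compact_support_integral(3)[OF S pm pb K pz[OF that]])
    moreover have "(\<integral>\<^sup>+x. ennreal (\<phi> x ^ (2 * k)) \<partial>lborel) = ennreal (LINT x|lborel. \<phi> x ^ (2 * k))"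
      by (rule nn_integral_eq_integral[OF compact_support_integral(2)[OF S pm pb K pz[OF that]]]) (simp_all add: power_mult)
    ultimately show ?thesis by simp
  qed
  show "(\<integral>\<^sup>+x. ennreal ((norm (grad \<phi> x))\<^sup>2) \<partial>lborel) = ennreal (LINT x|lebesgue_on S. (norm (grad \<phi> x))\<^sup>2)"
  proof -
    have "(LINT x|lebesgue_on S. (norm (grad \<phi> x))\<^sup>2) = (LINT x|lborel. (norm (grad \<phi> x))\<^sup>2)" by (rule grad(3))
    moreover have "(\<integral>\<^sup>+x. ennreal ((norm (grad \<phi> x))\<^sup>2) \<partial>lborel) = ennreal (LINT x|lborel. (norm (grad \<phi> x))\<^sup>2)"
      by (rule nn_integral_eq_integral[OF grad(2)]) simp_all
    ultimately show ?thesis by simp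
  qed
  show "\<phi> \<in> L2 (lebesgue_on S)"
    using compact_support_integral(1)[OF S pm pb K pz[of 1]] borel_measurable_lebesgue_on[OF C1_grad_measurable(1)[OF c1]] by (simp add: L2_real_iff)
  show "grad \<phi> \<in> L2 (lebesgue_on S)"
  proof -
    have "grad \<phi> \<in> borel_measurable (lebesgue_on S)"
      by (intro measurable_restrict_space1 measurable_completion) simp
    then show ?thesis using grad(1) by (simp add: L2_iff)
  qed
  show "(LINT x|lebesgue_on S. indicator Q x * \<phi> x) = (LINT x|lborel. indicator Q x * \<phi> x)"
    if [measurable]: "Q \<in> sets borel" for Q
  proof (rule compact_support_integral(3)[OF S _ _ K, where C=C])
    show "\<bar>indicator Q x * \<phi> x\<bar> \<le> C" for x using bd C by (auto simp: indicator_def)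
    show "indicator Q x * \<phi> x = 0" if "x \<notin> K" for x using z that by simp
  qed measurable
qed

text \<open>Membership in \<open>H10\<close> provides some weak gradient; by uniqueness its
  integrability and approximation properties pass to the chosen representative
  \<open>wgrad\<close>.\<close>

lemma H10_approx:
  assumes S: "open S" and v: "v \<in> H10 S"
  shows "v \<in> L2 (lebesgue_on S)" "has_weak_grad S v (wgrad S v)" "wgrad S v \<in> L2 (lebesgue_on S)"
    and "\<exists>\<phi>. (\<forall>n::nat. \<phi> n \<in> test_functions S) \<and> (\<lambda>n. LINT x|lebesgue_on S. (v x - \<phi> n x)\<^sup>2) \<longlonglongrightarrow> 0
      \<and> (\<lambda>n. LINT x|lebesgue_on S. (norm (wgrad S v x - grad (\<phi> n) x))\<^sup>2) \<longlonglongrightarrow> 0"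
proof -
  obtain G \<phi> where G: "G \<in> L2 (lebesgue_on S)" "has_weak_grad S v G" and \<phi>: "\<forall>n. \<phi> n \<in> test_functions S"
    "(\<lambda>n::nat. LINT x|lebesgue_on S. (v x - \<phi> n x)\<^sup>2) \<longlonglongrightarrow> 0"
    "(\<lambda>n. LINT x|lebesgue_on S. (norm (G x - grad (\<phi> n) x))\<^sup>2) \<longlonglongrightarrow> 0"
    using v unfolding H10_def by blast
  show "v \<in> L2 (lebesgue_on S)" using v by (simp add: H10_def)
  note W = wgrad_unique[OF S G(2)]
  show 1: "has_weak_grad S v (wgrad S v)" by (rule W(1))
  have Wm: "wgrad S v \<in> borel_measurable (lebesgue_on S)" using W(1) by (simp add: has_weak_grad_def L1_loc_def)
  have Gm: "G \<in> borel_measurable (lebesgue_on S)" using G by (simp add: L2_iff)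
  have "integrable (lebesgue_on S) (\<lambda>x. (norm (wgrad S v x))\<^sup>2)"
  proof (rule integrable_cong_AE_imp)
    show "integrable (lebesgue_on S) (\<lambda>x. (norm (G x))\<^sup>2)" using G by (simp add: L2_iff)
    show "(\<lambda>x. (norm (wgrad S v x))\<^sup>2) \<in> borel_measurable (lebesgue_on S)" using Wm by measurable
    show "AE x in lebesgue_on S. (norm (G x))\<^sup>2 = (norm (wgrad S v x))\<^sup>2" using W(2) by eventually_elim simp
  qed
  then show "wgrad S v \<in> L2 (lebesgue_on S)" using Wm by (simp add: L2_iff)
  have "(LINT x|lebesgue_on S. (norm (wgrad S v x - grad (\<phi> n) x))\<^sup>2) = (LINT x|lebesgue_on S. (norm (G x - grad (\<phi> n) x))\<^sup>2)" for n
  proof (rule integral_cong_AE)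
    have gm: "grad (\<phi> n) \<in> borel_measurable (lebesgue_on S)"
      using test_function_integrals(2)[OF S \<phi>(1)[rule_format, of n]] by (simp add: L2_iff)
    show "(\<lambda>x. (norm (wgrad S v x - grad (\<phi> n) x))\<^sup>2) \<in> borel_measurable (lebesgue_on S)"
         "(\<lambda>x. (norm (G x - grad (\<phi> n) x))\<^sup>2) \<in> borel_measurable (lebesgue_on S)"
      using Wm Gm gm by measurable
    show "AE x in lebesgue_on S. (norm (wgrad S v x - grad (\<phi> n) x))\<^sup>2 = (norm (G x - grad (\<phi> n) x))\<^sup>2"
      using W(2) by eventually_elim simp
  qed
  then show "\<exists>\<phi>. (\<forall>n::nat. \<phi> n \<in> test_functions S) \<and> (\<lambda>n. LINT x|lebesgue_on S. (v x - \<phi> n x)\<^sup>2) \<longlonglongrightarrow> 0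
      \<and> (\<lambda>n. LINT x|lebesgue_on S. (norm (wgrad S v x - grad (\<phi> n) x))\<^sup>2) \<longlonglongrightarrow> 0"
    using \<phi> by (intro exI[of _ \<phi>]) simp
qed

lemma test_functions_lincomb:
  assumes "\<phi> \<in> test_functions S" "\<psi> \<in> test_functions S"
  shows "(\<lambda>x. s * \<phi> x + t * \<psi> x) \<in> test_functions S"
    and "grad (\<lambda>x. s * \<phi> x + t * \<psi> x) x = s *\<^sub>R grad \<phi> x + t *\<^sub>R grad \<psi> x"
proof -
  let ?f = "\<lambda>x. s * \<phi> x + t * \<psi> x"
  have sm: "smooth \<phi>" "smooth \<psi>" and K: "compact (closure {x. \<phi> x \<noteq> 0})" "closure {x. \<phi> x \<noteq> 0} \<subseteq> S"
    "compact (closure {x. \<psi> x \<noteq> 0})" "closure {x. \<psi> x \<noteq> 0} \<subseteq> S"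
    using assms by (auto simp: test_functions_def)
  have "smooth ?f" using sm unfolding smooth_def by (simp add: C_k_add C_k_mult C_k_const)
  moreover have cl: "closure {x. ?f x \<noteq> 0} \<subseteq> closure {x. \<phi> x \<noteq> 0} \<union> closure {x. \<psi> x \<noteq> 0}"
    unfolding closure_Un[symmetric] by (rule closure_mono) auto
  moreover have "compact (closure {x. ?f x \<noteq> 0})"
    using compact_Int_closed[OF compact_Un[OF K(1,3)] closed_closure, of "{x. ?f x \<noteq> 0}"] cl by (simp add: Int_absorb1)
  ultimately show "?f \<in> test_functions S" using K unfolding test_functions_def by blast
  have "((\<lambda>x. s * \<phi> x + t * \<psi> x) has_derivative (\<lambda>h. s * (grad \<phi> x \<bullet> h) + t * (grad \<psi> x \<bullet> h))) (at x)"
    using smooth_imp_C1_grad[OF sm(1)] smooth_imp_C1_grad[OF sm(2)] unfolding C1_grad_def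
    by (intro has_derivative_add has_derivative_mult_right) auto
  then show "grad ?f x = s *\<^sub>R grad \<phi> x + t *\<^sub>R grad \<psi> x"
    by (simp add: vec_eq_iff grad_eqI inner_axis)
qed

lemma H10_lincomb:
  assumes S: "open S" and v: "v \<in> H10 S" and w: "w \<in> H10 S"
  shows "(\<lambda>x. s * v x + t * w x) \<in> H10 S"
    and "AE x in lebesgue_on S. wgrad S (\<lambda>x. s * v x + t * w x) x = s *\<^sub>R wgrad S v x + t *\<^sub>R wgrad S w x"
proof -
  note Hv = H10_approx[OF S v] and Hw = H10_approx[OF S w]
  let ?M = "lebesgue_on S"
  let ?G = "\<lambda>x. s *\<^sub>R wgrad S v x + t *\<^sub>R wgrad S w x"
  have wg: "has_weak_grad S (\<lambda>x. s * v x + t * w x) ?G" by (rule has_weak_grad_lincomb[OF S Hv(2) Hw(2)])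
  show "AE x in ?M. wgrad S (\<lambda>x. s * v x + t * w x) x = ?G x" by (rule wgrad_unique(2)[OF S wg])
  obtain \<phi> where \<phi>: "\<forall>n::nat. \<phi> n \<in> test_functions S" "(\<lambda>n. LINT x|?M. (norm (v x - \<phi> n x))\<^sup>2) \<longlonglongrightarrow> 0"
      "(\<lambda>n. LINT x|?M. (norm (wgrad S v x - grad (\<phi> n) x))\<^sup>2) \<longlonglongrightarrow> 0" using Hv(4) by auto
  obtain \<psi> where \<psi>: "\<forall>n::nat. \<psi> n \<in> test_functions S" "(\<lambda>n. LINT x|?M. (norm (w x - \<psi> n x))\<^sup>2) \<longlonglongrightarrow> 0"
      "(\<lambda>n. LINT x|?M. (norm (wgrad S w x - grad (\<psi> n) x))\<^sup>2) \<longlonglongrightarrow> 0" using Hw(4) by auto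
  let ?\<chi> = "\<lambda>n x. s * \<phi> n x + t * \<psi> n x"
  have \<chi>: "?\<chi> n \<in> test_functions S" "grad (?\<chi> n) x = s *\<^sub>R grad (\<phi> n) x + t *\<^sub>R grad (\<psi> n) x" for n x
    using test_functions_lincomb[of "\<phi> n" S "\<psi> n" s t] \<phi>(1) \<psi>(1) by auto
  \<comment> \<open>Stated for a general range type, so that it serves both the functions and their
    gradients.\<close>
  have lim: "(\<lambda>n. LINT x|?M. (norm ((s *\<^sub>R f x + t *\<^sub>R g x) - (s *\<^sub>R F n x + t *\<^sub>R H n x)))\<^sup>2) \<longlonglongrightarrow> 0"
    if L2: "f \<in> L2 ?M" "g \<in> L2 ?M" "\<And>n. F n \<in> L2 ?M" "\<And>n. H n \<in> L2 ?M"
      and l: "(\<lambda>n. LINT x|?M. (norm (f x - F n x))\<^sup>2) \<longlonglongrightarrow> 0" "(\<lambda>n. LINT x|?M. (norm (g x - H n x))\<^sup>2) \<longlonglongrightarrow> 0"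
    for f g :: "real ^ 'a \<Rightarrow> 'b::euclidean_space" and F H :: "nat \<Rightarrow> real ^ 'a \<Rightarrow> 'b"
  proof (rule Lim_null_comparison)
    have "(\<lambda>n. 2 * s\<^sup>2 * (LINT x|?M. (norm (f x - F n x))\<^sup>2) + 2 * t\<^sup>2 * (LINT x|?M. (norm (g x - H n x))\<^sup>2)) \<longlonglongrightarrow> 2 * s\<^sup>2 * 0 + 2 * t\<^sup>2 * 0"
      by (intro tendsto_add tendsto_mult tendsto_const l)
    then show "(\<lambda>n. 2 * s\<^sup>2 * (LINT x|?M. (norm (f x - F n x))\<^sup>2) + 2 * t\<^sup>2 * (LINT x|?M. (norm (g x - H n x))\<^sup>2)) \<longlonglongrightarrow> 0" by simp
    have bnd: "norm (LINT x|?M. (norm ((s *\<^sub>R f x + t *\<^sub>R g x) - (s *\<^sub>R F n x + t *\<^sub>R H n x)))\<^sup>2)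
        \<le> 2 * s\<^sup>2 * (LINT x|?M. (norm (f x - F n x))\<^sup>2) + 2 * t\<^sup>2 * (LINT x|?M. (norm (g x - H n x))\<^sup>2)" for n
    proof -
      have d: "(\<lambda>x. f x - F n x) \<in> L2 ?M" "(\<lambda>x. g x - H n x) \<in> L2 ?M" by (rule L2_diff[OF L2(1) L2(3)], rule L2_diff[OF L2(2) L2(4)])
      have eq: "(s *\<^sub>R f x + t *\<^sub>R g x) - (s *\<^sub>R F n x + t *\<^sub>R H n x) = s *\<^sub>R (f x - F n x) + t *\<^sub>R (g x - H n x)" for x
        by (simp add: algebra_simps)
      have i: "integrable ?M (\<lambda>x. (norm (f x - F n x))\<^sup>2)" "integrable ?M (\<lambda>x. (norm (g x - H n x))\<^sup>2)"
        "integrable ?M (\<lambda>x. (norm (s *\<^sub>R (f x - F n x) + t *\<^sub>R (g x - H n x)))\<^sup>2)"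
        using d L2_lincomb[OF d, of s t] by (simp_all add: L2_iff)
      have "\<bar>LINT x|?M. (norm (s *\<^sub>R (f x - F n x) + t *\<^sub>R (g x - H n x)))\<^sup>2\<bar>
          \<le> (LINT x|?M. 2 * s\<^sup>2 * (norm (f x - F n x))\<^sup>2 + 2 * t\<^sup>2 * (norm (g x - H n x))\<^sup>2)"
        by (rule abs_integral_le) (use i norm_lincomb_sq_le in auto)
      also have "\<dots> = 2 * s\<^sup>2 * (LINT x|?M. (norm (f x - F n x))\<^sup>2) + 2 * t\<^sup>2 * (LINT x|?M. (norm (g x - H n x))\<^sup>2)"
        using i by simp
      finally show ?thesis unfolding eq by (simp only: real_norm_def)
    qed
    then show "\<forall>\<^sub>F n in sequentially. norm (LINT x|?M. (norm ((s *\<^sub>R f x + t *\<^sub>R g x) - (s *\<^sub>R F n x + t *\<^sub>R H n x)))\<^sup>2)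
        \<le> 2 * s\<^sup>2 * (LINT x|?M. (norm (f x - F n x))\<^sup>2) + 2 * t\<^sup>2 * (LINT x|?M. (norm (g x - H n x))\<^sup>2)"
      by (intro always_eventually allI)
  qed
  have "(\<lambda>n. LINT x|?M. ((s * v x + t * w x) - ?\<chi> n x)\<^sup>2) \<longlonglongrightarrow> 0"
    using lim[OF Hv(1) Hw(1) test_function_integrals(1)[OF S \<phi>(1)[rule_format]] test_function_integrals(1)[OF S \<psi>(1)[rule_format]] \<phi>(2) \<psi>(2)]
    by simp
  moreover
  have "(\<lambda>n. LINT x|?M. (norm (?G x - grad (?\<chi> n) x))\<^sup>2) \<longlonglongrightarrow> 0"
    unfolding \<chi>(2)
    by (rule lim[OF Hv(3) Hw(3) test_function_integrals(2)[OF S \<phi>(1)[rule_format]] test_function_integrals(2)[OF S \<psi>(1)[rule_format]] \<phi>(3) \<psi>(3)])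
  moreover have "(\<lambda>x. s * v x + t * w x) \<in> L2 ?M" using L2_lincomb[OF Hv(1) Hw(1), of s t] by simp
  moreover have "?G \<in> L2 ?M" by (rule L2_lincomb[OF Hv(3) Hw(3)])
  ultimately show "(\<lambda>x. s * v x + t * w x) \<in> H10 S" 
    unfolding H10_def using wg \<chi>(1)
    by (intro CollectI conjI bexI[of _ ?G] exI[of _ ?\<chi>] allI)
qed

lemma H10_zero: assumes S: "open S" shows "(\<lambda>x. 0) \<in> H10 S"
proof -
  have t: "(\<lambda>x. 0) \<in> test_functions S"
    unfolding test_functions_def smooth_def by (simp add: C_k_const)
  have g: "grad (\<lambda>x. 0) x = 0" for x :: "real ^ 'a"
    by (rule test_function_grad_zero) simp
  have "has_weak_grad S (\<lambda>x. 0) (\<lambda>x. 0)" by (simp add: has_weak_grad_def L1_loc_def)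
  then show ?thesis unfolding H10_def using t g
    by (auto simp: L2_iff intro!: exI[of _ "\<lambda>x. 0"] exI[of _ "\<lambda>n x. 0"])
qed

text \<open>Both sides of the inequality for test functions converge along an approximating
  sequence: the norms by \<open>L2_norm_tendsto\<close>, the integrals over cells because Q has
  finite measure in S.\<close>

lemma H10_rellich:
  assumes S: "open S" "bounded S" and "0 < \<delta>"
  shows "\<exists>J C. finite J \<and> J \<subseteq> sets (lebesgue_on S) \<and> 0 \<le> C \<and>
    (\<forall>v\<in>H10 S. (LINT x|lebesgue_on S. (v x)\<^sup>2) \<le> \<delta> * (LINT x|lebesgue_on S. (norm (wgrad S v x))\<^sup>2)
       + C * (\<Sum>Q\<in>J. (LINT x|lebesgue_on S. indicator Q x * v x)\<^sup>2))"
proof -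
  let ?M = "lebesgue_on S"
  have Sm: "S \<in> sets lebesgue" using S(1) by (simp add: borel_open)
  interpret finite_measure ?M
    by (rule finite_measure_lebesgue_on[OF bounded_set_imp_lmeasurable[OF S(2) Sm]])
  obtain J C where J: "finite J" "J \<subseteq> sets borel" and C: "0 \<le> C" and JC: "\<forall>\<phi> G. C1_grad \<phi> G \<and> (\<forall>x. x \<notin> S \<longrightarrow> \<phi> x = 0) \<longrightarrow>
    (\<integral>\<^sup>+x. ennreal ((\<phi> x)\<^sup>2) \<partial>lborel) \<le> ennreal (C * (\<Sum>Q\<in>J. (LINT x|lborel. indicator Q x * \<phi> x)\<^sup>2))
      + ennreal \<delta> * (\<integral>\<^sup>+x. ennreal ((norm (G x))\<^sup>2) \<partial>lborel)"
    using rellich_C1[OF S(2) assms(3)] by blast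
  \<comment> \<open>Intersecting with S makes the cells measurable for \<open>lebesgue_on S\<close>.
    Different cells may have the same trace on S, which costs the factor card J below.\<close>
  define J' where "J' = (\<lambda>Q. Q \<inter> S) ` J"
  have lebJ: "Q \<inter> S \<in> sets ?M" if "Q \<in> J" for Q
  proof -
    have "Q \<in> sets borel" using J that by blast
    then have "Q \<in> sets lebesgue" by simp
    then show ?thesis using Sm by (auto simp: sets_restrict_space)
  qed
  have indS: "(LINT x|?M. indicator (Q \<inter> S) x * v x) = (LINT x|?M. indicator Q x * v x)" for Q and v :: "real ^ 'a \<Rightarrow> real"
    by (intro Bochner_Integration.integral_cong) (auto simp: indicator_def)
  have test: "(LINT x|?M. (norm (\<phi> x))\<^sup>2) \<le> \<delta> * (LINT x|?M. (norm (grad \<phi> x))\<^sup>2) + C * (\<Sum>Q\<in>J. (LINT x|?M. indicator (Q \<inter> S) x * \<phi> x)\<^sup>2)"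
    if \<phi>: "\<phi> \<in> test_functions S" for \<phi>
  proof -
    have sumeq: "(\<Sum>Q\<in>J. (LINT x|lborel. indicator Q x * \<phi> x)\<^sup>2) = (\<Sum>Q\<in>J. (LINT x|?M. indicator (Q \<inter> S) x * \<phi> x)\<^sup>2)"
      unfolding indS using test_function_integrals(4)[OF S(1) \<phi>] J(2) by (intro sum.cong) auto
    have g0: "0 \<le> (LINT x|?M. (norm (grad \<phi> x))\<^sup>2)" by (intro integral_nonneg_AE) simp
    have s0: "0 \<le> C * (\<Sum>Q\<in>J. (LINT x|?M. indicator (Q \<inter> S) x * \<phi> x)\<^sup>2)" using C by (intro mult_nonneg_nonneg sum_nonneg) auto
    have "(\<integral>\<^sup>+x. ennreal ((\<phi> x)\<^sup>2) \<partial>lborel) \<le> ennreal (C * (\<Sum>Q\<in>J. (LINT x|lborel. indicator Q x * \<phi> x)\<^sup>2))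
      + ennreal \<delta> * (\<integral>\<^sup>+x. ennreal ((norm (grad \<phi> x))\<^sup>2) \<partial>lborel)"
      using JC test_function_C1[OF \<phi>] by blast
    then have "ennreal (LINT x|?M. (\<phi> x)\<^sup>2) \<le> ennreal (C * (\<Sum>Q\<in>J. (LINT x|?M. indicator (Q \<inter> S) x * \<phi> x)\<^sup>2))
      + ennreal \<delta> * ennreal (LINT x|?M. (norm (grad \<phi> x))\<^sup>2)"
      using test_function_integrals(5)[OF S(1) \<phi>, of 1] test_function_integrals(3)[OF S(1) \<phi>] unfolding sumeq by simp
    also have "\<dots> = ennreal (C * (\<Sum>Q\<in>J. (LINT x|?M. indicator (Q \<inter> S) x * \<phi> x)\<^sup>2) + \<delta> * (LINT x|?M. (norm (grad \<phi> x))\<^sup>2))"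
      using s0 g0 assms(3) by (subst ennreal_plus) (auto simp: ennreal_mult)
    finally have "(LINT x|?M. (\<phi> x)\<^sup>2) \<le> C * (\<Sum>Q\<in>J. (LINT x|?M. indicator (Q \<inter> S) x * \<phi> x)\<^sup>2) + \<delta> * (LINT x|?M. (norm (grad \<phi> x))\<^sup>2)"
      using s0 g0 assms(3) by (subst (asm) ennreal_le_iff) auto
    then show ?thesis by simp
  qed
  have main: "(LINT x|?M. (v x)\<^sup>2) \<le> \<delta> * (LINT x|?M. (norm (wgrad S v x))\<^sup>2) + C * (\<Sum>Q\<in>J. (LINT x|?M. indicator (Q \<inter> S) x * v x)\<^sup>2)"
    if v: "v \<in> H10 S" for v
  proof -
    note H = H10_approx[OF S(1) v]
    obtain \<phi> where \<phi>: "\<forall>n::nat. \<phi> n \<in> test_functions S" "(\<lambda>n. LINT x|?M. (v x - \<phi> n x)\<^sup>2) \<longlonglongrightarrow> 0"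
      "(\<lambda>n. LINT x|?M. (norm (wgrad S v x - grad (\<phi> n) x))\<^sup>2) \<longlonglongrightarrow> 0" using H(4) by auto
    have \<phi>2: "(\<lambda>n. LINT x|?M. (norm (v x - \<phi> n x))\<^sup>2) \<longlonglongrightarrow> 0" using \<phi>(2) by simp
    have 1: "(\<lambda>n. LINT x|?M. (norm (\<phi> n x))\<^sup>2) \<longlonglongrightarrow> (LINT x|?M. (norm (v x))\<^sup>2)"
      by (rule L2_norm_tendsto[OF H(1) test_function_integrals(1)[OF S(1) \<phi>(1)[rule_format]] \<phi>2])
    have 2: "(\<lambda>n. LINT x|?M. (norm (grad (\<phi> n) x))\<^sup>2) \<longlonglongrightarrow> (LINT x|?M. (norm (wgrad S v x))\<^sup>2)"
      by (rule L2_norm_tendsto[OF H(3) test_function_integrals(2)[OF S(1) \<phi>(1)[rule_format]] \<phi>(3)])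
    have 3: "(\<lambda>n. LINT x|?M. indicator (Q \<inter> S) x * \<phi> n x) \<longlonglongrightarrow> (LINT x|?M. indicator (Q \<inter> S) x * v x)" if "Q \<in> J" for Q
      by (rule L2_indicator_tendsto[OF H(1) test_function_integrals(1)[OF S(1) \<phi>(1)[rule_format]] lebJ[OF that] \<phi>(2)])
    have "(LINT x|?M. (norm (v x))\<^sup>2) \<le> \<delta> * (LINT x|?M. (norm (wgrad S v x))\<^sup>2) + C * (\<Sum>Q\<in>J. (LINT x|?M. indicator (Q \<inter> S) x * v x)\<^sup>2)"
    proof (rule LIMSEQ_le[OF 1])
      show "(\<lambda>n. \<delta> * (LINT x|?M. (norm (grad (\<phi> n) x))\<^sup>2) + C * (\<Sum>Q\<in>J. (LINT x|?M. indicator (Q \<inter> S) x * \<phi> n x)\<^sup>2))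
        \<longlonglongrightarrow> \<delta> * (LINT x|?M. (norm (wgrad S v x))\<^sup>2) + C * (\<Sum>Q\<in>J. (LINT x|?M. indicator (Q \<inter> S) x * v x)\<^sup>2)"
        by (intro tendsto_add tendsto_mult tendsto_const tendsto_sum tendsto_power 2 3)
    qed (use test \<phi>(1) in blast)
    then show ?thesis by simp
  qed
  have le: "(\<Sum>Q\<in>J. (LINT x|?M. indicator (Q \<inter> S) x * v x)\<^sup>2) \<le> real (card J) * (\<Sum>Q\<in>J'. (LINT x|?M. indicator Q x * v x)\<^sup>2)" for v
  proof (rule sum_bounded_above)
    fix Q assume "Q \<in> J"
    then show "(LINT x|?M. indicator (Q \<inter> S) x * v x)\<^sup>2 \<le> (\<Sum>Q\<in>J'. (LINT x|?M. indicator Q x * v x)\<^sup>2)"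
      using J(1) unfolding J'_def by (intro member_le_sum[where f="\<lambda>Q. (LINT x|?M. indicator Q x * v x)\<^sup>2"]) auto
  qed
  show ?thesis
  proof (intro exI[of _ J'] exI[of _ "C * card J"] conjI ballI)
    fix v assume v: "v \<in> H10 S"
    show "(LINT x|?M. (v x)\<^sup>2) \<le> \<delta> * (LINT x|?M. (norm (wgrad S v x))\<^sup>2) + C * card J * (\<Sum>Q\<in>J'. (LINT x|?M. indicator Q x * v x)\<^sup>2)"
      using main[OF v] mult_left_mono[OF le[of v] C] unfolding mult.assoc by linarith
  qed (use J lebJ C in \<open>auto simp: J'_def\<close>)
qed

text \<open>The approximating functions converge in L2, which says nothing about the powers 2 k
  directly. Fatou's lemma along a subsequence that converges almost everywhere gives both
  integrability and the bound.\<close>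

lemma H10_sobolev:
  fixes S :: "(real ^ 'd) set"
  assumes S: "open S" "bounded S" and dim: "CARD('d) \<le> 2 \<or> CARD('d) = 3 \<and> k = 2" and k: "1 \<le> k"
  shows "\<exists>C\<ge>0. \<forall>v\<in>H10 S. integrable (lebesgue_on S) (\<lambda>x. v x ^ (2 * k)) \<and>
    (LINT x|lebesgue_on S. v x ^ (2 * k)) \<le> C * (LINT x|lebesgue_on S. (norm (wgrad S v x))\<^sup>2) ^ k"
proof -
  let ?M = "lebesgue_on S"
  have dim': "DIM(real ^ 'd) \<le> 2 \<or> DIM(real ^ 'd) = 3 \<and> k = 2" using dim by simp
  obtain C where C: "0 \<le> C" "\<forall>\<phi> G. C1_grad \<phi> G \<and> (\<forall>x. x \<notin> S \<longrightarrow> \<phi> x = 0) \<longrightarrow>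
    (\<integral>\<^sup>+x. ennreal (\<phi> x ^ (2 * k)) \<partial>lborel) \<le> ennreal C * (\<integral>\<^sup>+x. ennreal ((norm (G x))\<^sup>2) \<partial>lborel) ^ k"
    using sobolev_C1[OF S(2) dim' k] by blast
  have test: "(\<integral>\<^sup>+x. ennreal (\<phi> x ^ (2 * k)) \<partial>?M) \<le> ennreal (C * (LINT x|?M. (norm (grad \<phi> x))\<^sup>2) ^ k)"
    if \<phi>: "\<phi> \<in> test_functions S" for \<phi>
  proof -
    have g0: "0 \<le> (LINT x|?M. (norm (grad \<phi> x))\<^sup>2)" by (intro integral_nonneg_AE) simp
    have "(\<integral>\<^sup>+x. ennreal (\<phi> x ^ (2 * k)) \<partial>?M) = ennreal (LINT x|?M. \<phi> x ^ (2 * k))"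
      by (rule nn_integral_eq_integral[OF test_function_integrals(6)[OF S(1) \<phi> k]]) (simp add: power_mult)
    also have "\<dots> = (\<integral>\<^sup>+x. ennreal (\<phi> x ^ (2 * k)) \<partial>lborel)" by (rule test_function_integrals(5)[OF S(1) \<phi> k, symmetric])
    also have "\<dots> \<le> ennreal C * (\<integral>\<^sup>+x. ennreal ((norm (grad \<phi> x))\<^sup>2) \<partial>lborel) ^ k"
      using C(2) test_function_C1[OF \<phi>] by blast
    also have "\<dots> = ennreal (C * (LINT x|?M. (norm (grad \<phi> x))\<^sup>2) ^ k)"
      unfolding test_function_integrals(3)[OF S(1) \<phi>] ennreal_power[OF g0] by (rule ennreal_mult'[OF C(1), symmetric])
    finally show ?thesis .
  qed
  have "integrable ?M (\<lambda>x. v x ^ (2 * k)) \<and> (LINT x|?M. v x ^ (2 * k)) \<le> C * (LINT x|?M. (norm (wgrad S v x))\<^sup>2) ^ k"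
    if v: "v \<in> H10 S" for v
  proof -
    note H = H10_approx[OF S(1) v]
    have vm [measurable]: "v \<in> borel_measurable ?M" using H(1) by (simp add: L2_iff)
    obtain \<phi> where \<phi>: "\<forall>n::nat. \<phi> n \<in> test_functions S" "(\<lambda>n. LINT x|?M. (v x - \<phi> n x)\<^sup>2) \<longlonglongrightarrow> 0"
      "(\<lambda>n. LINT x|?M. (norm (wgrad S v x - grad (\<phi> n) x))\<^sup>2) \<longlonglongrightarrow> 0" using H(4) by auto
    have \<phi>L2: "\<phi> n \<in> L2 ?M" for n by (rule test_function_integrals(1)[OF S(1) \<phi>(1)[rule_format]])
    have \<phi>m [measurable]: "\<phi> n \<in> borel_measurable ?M" for n using \<phi>L2[of n] by (simp add: L2_iff)
    have 2: "(\<lambda>n. LINT x|?M. (norm (grad (\<phi> n) x))\<^sup>2) \<longlonglongrightarrow> (LINT x|?M. (norm (wgrad S v x))\<^sup>2)"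
      by (rule L2_norm_tendsto[OF H(3) test_function_integrals(2)[OF S(1) \<phi>(1)[rule_format]] \<phi>(3)])
    \<comment> \<open>Convergence of the integrals of the squared differences is L1 convergence of
      the squares, hence almost everywhere convergence of a subsequence.\<close>
    have "\<exists>r::nat \<Rightarrow> nat. strict_mono r \<and> (AE x in ?M. (\<lambda>n. (v x - \<phi> (r n) x)\<^sup>2) \<longlonglongrightarrow> 0)"
    proof (rule tendsto_L1_AE_subseq)
      show "integrable ?M (\<lambda>x. (v x - \<phi> n x)\<^sup>2)" for n using L2_diff[OF H(1) \<phi>L2[of n]] by (simp add: L2_real_iff)
      show "(\<lambda>n. LINT x|?M. norm ((v x - \<phi> n x)\<^sup>2)) \<longlonglongrightarrow> 0" using \<phi>(2) by simp
    qed
    then obtain r :: "nat \<Rightarrow> nat" where r: "strict_mono r" "AE x in ?M. (\<lambda>n. (v x - \<phi> (r n) x)\<^sup>2) \<longlonglongrightarrow> 0" by blast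
    have ptw: "AE x in ?M. ennreal (v x ^ (2 * k)) = liminf (\<lambda>n. ennreal (\<phi> (r n) x ^ (2 * k)))"
      using r(2)
    proof eventually_elim
      case (elim x)
      have "(\<lambda>n. sqrt ((v x - \<phi> (r n) x)\<^sup>2)) \<longlonglongrightarrow> sqrt 0" by (rule tendsto_real_sqrt[OF elim])
      then have "(\<lambda>n. \<bar>v x - \<phi> (r n) x\<bar>) \<longlonglongrightarrow> 0" by simp
      then have "(\<lambda>n. v x - \<phi> (r n) x) \<longlonglongrightarrow> 0" by (rule tendsto_rabs_zero_cancel)
      then have "(\<lambda>n. v x - (v x - \<phi> (r n) x)) \<longlonglongrightarrow> v x - 0" by (intro tendsto_diff tendsto_const)
      then have "(\<lambda>n. \<phi> (r n) x) \<longlonglongrightarrow> v x" by simp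
      then have "(\<lambda>n. ennreal (\<phi> (r n) x ^ (2 * k))) \<longlonglongrightarrow> ennreal (v x ^ (2 * k))"
        by (intro tendsto_ennrealI tendsto_power)
      then show ?case by (intro lim_imp_Liminf[symmetric]) auto
    qed
    let ?D = "LINT x|?M. (norm (wgrad S v x))\<^sup>2"
    have D0: "0 \<le> ?D" by (intro integral_nonneg_AE) simp
    have "(\<integral>\<^sup>+x. ennreal (v x ^ (2 * k)) \<partial>?M) = (\<integral>\<^sup>+x. liminf (\<lambda>n. ennreal (\<phi> (r n) x ^ (2 * k))) \<partial>?M)"
      by (rule nn_integral_cong_AE[OF ptw])
    also have "\<dots> \<le> liminf (\<lambda>n. \<integral>\<^sup>+x. ennreal (\<phi> (r n) x ^ (2 * k)) \<partial>?M)"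
      by (rule nn_integral_liminf) measurable
    also have "\<dots> \<le> liminf (\<lambda>n. ennreal (C * (LINT x|?M. (norm (grad (\<phi> (r n)) x))\<^sup>2) ^ k))"
      by (rule Liminf_mono) (use test \<phi>(1) in simp)
    also have "\<dots> = ennreal (C * ?D ^ k)"
    proof (rule lim_imp_Liminf)
      show "(\<lambda>n. ennreal (C * (LINT x|?M. (norm (grad (\<phi> (r n)) x))\<^sup>2) ^ k)) \<longlonglongrightarrow> ennreal (C * ?D ^ k)"
        using LIMSEQ_subseq_LIMSEQ[OF 2 r(1)] by (intro tendsto_ennrealI tendsto_mult tendsto_const tendsto_power) (simp add: o_def)
    qed simp
    finally have le: "(\<integral>\<^sup>+x. ennreal (v x ^ (2 * k)) \<partial>?M) \<le> ennreal (C * ?D ^ k)" .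
    have int: "integrable ?M (\<lambda>x. v x ^ (2 * k))"
    proof (rule integrableI_nonneg)
      show "AE x in ?M. 0 \<le> v x ^ (2 * k)" by (simp add: power_mult)
      show "(\<integral>\<^sup>+x. ennreal (v x ^ (2 * k)) \<partial>?M) < \<infinity>" using le by (rule le_less_trans) simp
    qed measurable
    have "(\<integral>\<^sup>+x. ennreal (v x ^ (2 * k)) \<partial>?M) = ennreal (LINT x|?M. v x ^ (2 * k))"
      by (rule nn_integral_eq_integral[OF int]) (simp add: power_mult)
    then have "ennreal (LINT x|?M. v x ^ (2 * k)) \<le> ennreal (C * ?D ^ k)" using le by simp
    then have "(LINT x|?M. v x ^ (2 * k)) \<le> C * ?D ^ k" using C(1) D0 by (subst (asm) ennreal_le_iff) auto
    then show ?thesis using int by blast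
  qed
  then show ?thesis using C(1) by blast
qed

section \<open>The energy form\<close>

lemma inner_matrix_vector_symmetric:
  fixes B :: "real ^ 'd ^ 'd"
  assumes "transpose B = B"
  shows "(B *v v) \<bullet> w = v \<bullet> (B *v w)"
proof -
  have "B *v v = v v* B" using vector_transpose_matrix[of v B] assms by simp
  then show ?thesis by (simp add: dot_lmul_matrix)
qed

lemma norm_matrix_vector_le:
  fixes B :: "real ^ 'd ^ 'd"
  shows "norm (B *v w) \<le> real CARD('d) * norm B * norm w"
proof -
  have "norm (B *v w) \<le> (\<Sum>i\<in>UNIV. \<bar>(B *v w) $ i\<bar>)" by (rule norm_le_l1_cart)
  also have "\<dots> \<le> (\<Sum>i\<in>(UNIV :: 'd set). norm B * norm w)"
  proof (rule sum_mono)
    fix i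
    have "\<bar>(B *v w) $ i\<bar> = \<bar>B $ i \<bullet> w\<bar>" by (simp add: matrix_vector_mul_component)
    also have "\<dots> \<le> norm (B $ i) * norm w" by (rule Cauchy_Schwarz_ineq2)
    also have "\<dots> \<le> norm B * norm w"
      by (intro mult_right_mono Finite_Cartesian_Product.norm_nth_le) auto
    finally show "\<bar>(B *v w) $ i\<bar> \<le> norm B * norm w" .
  qed
  finally show ?thesis by simp
qed

text \<open>Eigenvectors of different eigenvalues of a symmetric matrix are orthogonal, hence
  independent. Finiteness is what gives \<open>Min\<close> of the set of eigenvalues its
  meaning.\<close>

lemma finite_eigenvalues:
  fixes B :: "real ^ 'd ^ 'd"
  assumes sym: "transpose B = B"
  shows "finite (eigenvalues B)"
proof -
  have "\<forall>s\<in>eigenvalues B. \<exists>v. v \<noteq> 0 \<and> B *v v = s *\<^sub>R v" by (auto simp: eigenvalues_def)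
  then obtain e where e: "\<forall>s\<in>eigenvalues B. e s \<noteq> 0 \<and> B *v e s = s *\<^sub>R e s" by metis
  have orth: "e s \<bullet> e t = 0" if st: "s \<in> eigenvalues B" "t \<in> eigenvalues B" "s \<noteq> t" for s t
  proof -
    have "s * (e s \<bullet> e t) = t * (e s \<bullet> e t)"
      using inner_matrix_vector_symmetric[OF sym, of "e s" "e t"] e st by simp
    then show ?thesis using st(3) by simp
  qed
  have inj: "inj_on e (eigenvalues B)"
  proof (rule inj_onI)
    fix s t assume st: "s \<in> eigenvalues B" "t \<in> eigenvalues B" "e s = e t"
    show "s = t"
    proof (rule ccontr)
      assume "s \<noteq> t"
      then have "e s \<bullet> e s = 0" using orth[OF st(1,2)] st(3) by simp
      then show False using e st(1) by simp
    qed
  qed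
  have "independent (e ` eigenvalues B)"
  proof (rule pairwise_orthogonal_independent)
    show "pairwise orthogonal (e ` eigenvalues B)" unfolding pairwise_def orthogonal_def
    proof (intro ballI impI)
      fix x y assume "x \<in> e ` eigenvalues B" "y \<in> e ` eigenvalues B" "x \<noteq> y"
      then obtain s t where "x = e s" "y = e t" "s \<in> eigenvalues B" "t \<in> eigenvalues B" "s \<noteq> t" by blast
      then show "x \<bullet> y = 0" using orth by simp
    qed
    show "0 \<notin> e ` eigenvalues B" using e by force
  qed
  then have "finite (e ` eigenvalues B)" by (rule independent_imp_finite)
  then show ?thesis by (rule finite_imageD) (rule inj)
qed

text \<open>The minimum l of the quadratic form on the unit sphere is attained, and a minimizer is
  an eigenvector for l. So the smallest eigenvalue is at most l, and l bounds the form from below by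
  homogeneity.\<close>

lemma rayleigh_min_eigenvalue:
  fixes B :: "real ^ 'd ^ 'd"
  assumes sym: "transpose B = B"
  shows "Min (eigenvalues B) * (norm v)\<^sup>2 \<le> (B *v v) \<bullet> v"
proof -
  let ?f = "\<lambda>v. (B *v v) \<bullet> v"
  have ne: "sphere 0 1 \<noteq> ({} :: (real ^ 'd) set)"
    using vector_choose_size[of 1, where 'a="real ^ 'd"] by (auto simp: dist_norm)
  have "continuous_on (sphere 0 1) ?f"
    by (intro continuous_intros linear_continuous_on linear_conv_bounded_linear[THEN iffD1] matrix_vector_mul_linear)
  then obtain v0 where v0: "v0 \<in> sphere 0 1" and min: "\<forall>y\<in>sphere 0 1. ?f v0 \<le> ?f y"
    using continuous_attains_inf[OF compact_sphere ne] by blast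
  define l where "l = ?f v0"
  have n0: "norm v0 = 1" using v0 by simp
  have ge: "l * (norm w)\<^sup>2 \<le> ?f w" for w
  proof (cases "w = 0")
    case False
    let ?y = "(1 / norm w) *\<^sub>R w"
    have "?y \<in> sphere 0 1" using False by simp
    then have "l \<le> ?f ?y" using min unfolding l_def by blast
    also have "?f ?y = ?f w / (norm w)\<^sup>2"
      by (simp add: matrix_vector_mult_scaleR power2_eq_square)
    finally show ?thesis using False by (simp add: field_simps)
  qed (simp add: matrix_vector_mult_0_right)
  have "(B *v v0 - l *\<^sub>R v0) \<bullet> w = 0" for w
  proof -
    \<comment> \<open>The excess over l times the squared norm, along the line v0 + t w. It vanishes
      at t = 0, so the constant term is 0 and the linear coefficient has to vanish.\<close>
    have "0 \<le> (?f w - l * (norm w)\<^sup>2) * t\<^sup>2 + 2 * ((B *v v0 - l *\<^sub>R v0) \<bullet> w) * t + 0" for t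
    proof -
      have "0 \<le> ?f (v0 + t *\<^sub>R w) - l * (norm (v0 + t *\<^sub>R w))\<^sup>2" using ge[of "v0 + t *\<^sub>R w"] by simp
      also have "\<dots> = ?f v0 + 2 * t * ((B *v v0) \<bullet> w) + t\<^sup>2 * ?f w - l * (v0 \<bullet> v0 + 2 * t * (v0 \<bullet> w) + t\<^sup>2 * (w \<bullet> w))"
      proof -
        have "(norm (v0 + t *\<^sub>R w))\<^sup>2 = v0 \<bullet> v0 + 2 * t * (v0 \<bullet> w) + t\<^sup>2 * (w \<bullet> w)"
          by (simp add: power2_norm_eq_inner inner_simps inner_commute[of w v0]) (simp add: power2_eq_square algebra_simps)
        moreover have "?f (v0 + t *\<^sub>R w) = ?f v0 + 2 * t * ((B *v v0) \<bullet> w) + t\<^sup>2 * ?f w"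
          using inner_matrix_vector_symmetric[OF sym, of w v0]
          by (simp add: matrix_vector_right_distrib matrix_vector_mult_scaleR inner_simps inner_commute power2_eq_square algebra_simps)
        ultimately show ?thesis by simp
      qed
      also have "v0 \<bullet> v0 = 1" using n0 by (simp add: norm_eq_1)
      also have "?f v0 + 2 * t * ((B *v v0) \<bullet> w) + t\<^sup>2 * ?f w - l * (1 + 2 * t * (v0 \<bullet> w) + t\<^sup>2 * (w \<bullet> w))
          = (?f w - l * (norm w)\<^sup>2) * t\<^sup>2 + 2 * ((B *v v0 - l *\<^sub>R v0) \<bullet> w) * t + 0"
        unfolding l_def[symmetric] by (simp add: power2_norm_eq_inner inner_simps algebra_simps)
      finally show ?thesis .
    qed
    then have "((B *v v0 - l *\<^sub>R v0) \<bullet> w)\<^sup>2 \<le> (?f w - l * (norm w)\<^sup>2) * 0"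
      by (rule quadratic_nonneg_bound) (use ge[of w] in simp)
    then show ?thesis by simp
  qed
  then have "B *v v0 - l *\<^sub>R v0 = 0" by (metis inner_eq_zero_iff)
  then have "l \<in> eigenvalues B" using n0 unfolding eigenvalues_def by (intro CollectI exI[of _ v0]) auto
  then have "Min (eigenvalues B) \<le> l" by (intro Min_le finite_eigenvalues sym)
  then have "Min (eigenvalues B) * (norm v)\<^sup>2 \<le> l * (norm v)\<^sup>2" by (intro mult_right_mono) auto
  then show ?thesis using ge[of v] by linarith
qed

text \<open>The lower bound comes from the smallest eigenvalue and holds at every point; the upper
  bound comes from essential boundedness of the entries and holds almost everywhere.\<close>

lemma ELL_bounds:
  assumes "ELL \<Omega> T0 A"
  shows "\<exists>\<mu>>0. \<forall>x\<in>\<Omega>. \<forall>v. \<mu> * (norm v)\<^sup>2 \<le> (A x *v v) \<bullet> v"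
    and "\<exists>C\<ge>0. AE x in lebesgue_on \<Omega>. \<forall>v w. \<bar>(A x *v v) \<bullet> w\<bar> \<le> C * (norm v * norm w)"
    and "A \<in> borel_measurable (lebesgue_on \<Omega>)"
    and "\<And>x v w. x \<in> \<Omega> \<Longrightarrow> (A x *v v) \<bullet> w = (A x *v w) \<bullet> v"
proof -
  have sym: "transpose (A x) = A x" if "x \<in> \<Omega>" for x using assms that by (simp add: ELL_def)
  have Am: "A \<in> Linf (lebesgue_on \<Omega>)" using assms by (simp add: ELL_def)
  show "A \<in> borel_measurable (lebesgue_on \<Omega>)" using Am by (simp add: Linf_def)
  show "(A x *v v) \<bullet> w = (A x *v w) \<bullet> v" if "x \<in> \<Omega>" for x v w
    using inner_matrix_vector_symmetric[OF sym[OF that], of v w] by (simp add: inner_commute)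
  have "0 < (INF x\<in>\<Omega>. ereal (Min (eigenvalues (A x))))" using assms by (simp add: ELL_def)
  \<comment> \<open>A real number strictly below the infimum, which is an extended real.\<close>
  then obtain \<mu> where \<mu>: "0 < ereal \<mu>" "ereal \<mu> < (INF x\<in>\<Omega>. ereal (Min (eigenvalues (A x))))"
    using ereal_dense2 by blast
  have "\<mu> * (norm v)\<^sup>2 \<le> (A x *v v) \<bullet> v" if x: "x \<in> \<Omega>" for x v
  proof -
    have "ereal \<mu> \<le> ereal (Min (eigenvalues (A x)))" using less_le_trans[OF \<mu>(2) INF_lower[OF x]] by simp
    then have "\<mu> * (norm v)\<^sup>2 \<le> Min (eigenvalues (A x)) * (norm v)\<^sup>2" by (intro mult_right_mono) auto
    then show ?thesis using rayleigh_min_eigenvalue[OF sym[OF x], of v] by linarith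
  qed
  then show "\<exists>\<mu>>0. \<forall>x\<in>\<Omega>. \<forall>v. \<mu> * (norm v)\<^sup>2 \<le> (A x *v v) \<bullet> v" using \<mu>(1) by (intro exI[of _ \<mu>]) auto
  obtain C where C: "AE x in lebesgue_on \<Omega>. norm (A x) \<le> C" using Am by (auto simp: Linf_def)
  have "AE x in lebesgue_on \<Omega>. \<forall>v w. \<bar>(A x *v v) \<bullet> w\<bar> \<le> real CARD('a) * \<bar>C\<bar> * (norm v * norm w)"
    using C
  proof eventually_elim
    case (elim x)
    show ?case
    proof (intro allI)
      fix v w
      have "\<bar>(A x *v v) \<bullet> w\<bar> \<le> norm (A x *v v) * norm w" by (rule Cauchy_Schwarz_ineq2)
      also have "\<dots> \<le> (real CARD('a) * norm (A x) * norm v) * norm w" by (intro mult_right_mono norm_matrix_vector_le) auto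
      also have "\<dots> \<le> (real CARD('a) * \<bar>C\<bar> * norm v) * norm w" using elim by (intro mult_right_mono mult_left_mono) auto
      finally show "\<bar>(A x *v v) \<bullet> w\<bar> \<le> real CARD('a) * \<bar>C\<bar> * (norm v * norm w)" by (simp add: mult.assoc)
    qed
  qed
  then show "\<exists>C\<ge>0. AE x in lebesgue_on \<Omega>. \<forall>v w. \<bar>(A x *v v) \<bullet> w\<bar> \<le> C * (norm v * norm w)"
    by (intro exI[of _ "real CARD('a) * \<bar>C\<bar>"]) auto
qed

section \<open>Energy form and load on H10\<close>

lemma ELL_integrable:
  assumes ell: "ELL \<Omega> T0 A" and v: "v \<in> L2 (lebesgue_on \<Omega>)" and w: "w \<in> L2 (lebesgue_on \<Omega>)"
  shows "integrable (lebesgue_on \<Omega>) (\<lambda>x. (A x *v v x) \<bullet> w x)"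
proof -
  let ?M = "lebesgue_on \<Omega>"
  obtain C where C: "0 \<le> C" "AE x in ?M. \<forall>v w. \<bar>(A x *v v) \<bullet> w\<bar> \<le> C * (norm v * norm w)"
    using ELL_bounds(2)[OF ell] by blast
  show ?thesis
  proof (rule Bochner_Integration.integrable_bound)
    show "integrable ?M (\<lambda>x. C * (norm (v x) * norm (w x)))"
      by (intro integrable_mult_right L2_product_integrable v w)
    have comp: "(\<lambda>x. A x $ i $ j) \<in> borel_measurable ?M" "(\<lambda>x. v x $ j) \<in> borel_measurable ?M" "(\<lambda>x. w x $ i) \<in> borel_measurable ?M" for i j
    proof -
      have "(\<lambda>x. A x $ i) \<in> borel_measurable ?M"
        by (rule measurable_compose[OF ELL_bounds(3)[OF ell]]) (auto intro!: borel_measurable_continuous_onI continuous_intros)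
      then show "(\<lambda>x. A x $ i $ j) \<in> borel_measurable ?M" by (rule borel_measurable_component)
      show "(\<lambda>x. v x $ j) \<in> borel_measurable ?M" "(\<lambda>x. w x $ i) \<in> borel_measurable ?M"
        using v w borel_measurable_component unfolding L2_iff by blast+
    qed
    have eq: "(A x *v v x) \<bullet> w x = (\<Sum>i\<in>UNIV. (\<Sum>j\<in>UNIV. A x $ i $ j * v x $ j) * w x $ i)" for x
      by (simp add: inner_vec_def matrix_vector_mult_def)
    show "(\<lambda>x. (A x *v v x) \<bullet> w x) \<in> borel_measurable ?M"
      unfolding eq by (intro borel_measurable_sum borel_measurable_times comp)
    show "AE x in ?M. norm ((A x *v v x) \<bullet> w x) \<le> norm (C * (norm (v x) * norm (w x)))"
      using C(2)
    proof eventually_elim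
      case (elim x)
      then show ?case using C(1) by (simp add: abs_mult)
    qed
  qed
qed

lemma a_form_props:
  assumes \<Omega>: "open \<Omega>" and ell: "ELL \<Omega> T0 A"
  shows "\<And>v w z s t. v \<in> H10 \<Omega> \<Longrightarrow> w \<in> H10 \<Omega> \<Longrightarrow> z \<in> H10 \<Omega> \<Longrightarrow>
      a_form \<Omega> A (\<lambda>x. s * v x + t * w x) z = s * a_form \<Omega> A v z + t * a_form \<Omega> A w z"
    and "\<And>v w. a_form \<Omega> A v w = a_form \<Omega> A w v"
    and "\<exists>\<mu>>0. \<forall>v\<in>H10 \<Omega>. \<mu> * (LINT x|lebesgue_on \<Omega>. (norm (wgrad \<Omega> v x))\<^sup>2) \<le> a_form \<Omega> A v v"
proof -
  let ?M = "lebesgue_on \<Omega>"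
  show "a_form \<Omega> A v w = a_form \<Omega> A w v" for v w
    unfolding a_form_def using ELL_bounds(4)[OF ell] by (intro Bochner_Integration.integral_cong) auto
  show "a_form \<Omega> A (\<lambda>x. s * v x + t * w x) z = s * a_form \<Omega> A v z + t * a_form \<Omega> A w z"
    if v: "v \<in> H10 \<Omega>" and w: "w \<in> H10 \<Omega>" and z: "z \<in> H10 \<Omega>" for v w z s t
  proof -
    let ?y = "\<lambda>x. s * v x + t * w x"
    note L = H10_approx(3)[OF \<Omega> v] H10_approx(3)[OF \<Omega> w] H10_approx(3)[OF \<Omega> z] H10_approx(3)[OF \<Omega> H10_lincomb(1)[OF \<Omega> v w], of s t]
    note i = ELL_integrable[OF ell L(1) L(3)] ELL_integrable[OF ell L(2) L(3)] ELL_integrable[OF ell L(4) L(3)]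
    have "a_form \<Omega> A ?y z = (LINT x|?M. s * ((A x *v wgrad \<Omega> v x) \<bullet> wgrad \<Omega> z x) + t * ((A x *v wgrad \<Omega> w x) \<bullet> wgrad \<Omega> z x))"
      unfolding a_form_def
    proof (rule integral_cong_AE)
      show "(\<lambda>x. (A x *v wgrad \<Omega> ?y x) \<bullet> wgrad \<Omega> z x) \<in> borel_measurable ?M" by (rule borel_measurable_integrable[OF i(3)])
      show "(\<lambda>x. s * ((A x *v wgrad \<Omega> v x) \<bullet> wgrad \<Omega> z x) + t * ((A x *v wgrad \<Omega> w x) \<bullet> wgrad \<Omega> z x)) \<in> borel_measurable ?M"
        using i(1,2) by (intro borel_measurable_integrable Bochner_Integration.integrable_add integrable_mult_right)
      show "AE x in ?M. (A x *v wgrad \<Omega> ?y x) \<bullet> wgrad \<Omega> z x = s * ((A x *v wgrad \<Omega> v x) \<bullet> wgrad \<Omega> z x) + t * ((A x *v wgrad \<Omega> w x) \<bullet> wgrad \<Omega> z x)"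
        using H10_lincomb(2)[OF \<Omega> v w, of s t]
        by eventually_elim (simp add: matrix_vector_right_distrib matrix_vector_mult_scaleR inner_simps)
    qed
    also have "\<dots> = s * a_form \<Omega> A v z + t * a_form \<Omega> A w z" unfolding a_form_def using i(1,2) by simp
    finally show ?thesis .
  qed
  obtain \<mu> where \<mu>: "0 < \<mu>" "\<forall>x\<in>\<Omega>. \<forall>v. \<mu> * (norm v)\<^sup>2 \<le> (A x *v v) \<bullet> v" using ELL_bounds(1)[OF ell] by blast
  have "\<mu> * (LINT x|?M. (norm (wgrad \<Omega> v x))\<^sup>2) \<le> a_form \<Omega> A v v" if v: "v \<in> H10 \<Omega>" for v
  proof -
    note L = H10_approx(3)[OF \<Omega> v]
    have "\<mu> * (LINT x|?M. (norm (wgrad \<Omega> v x))\<^sup>2) = (LINT x|?M. \<mu> * (norm (wgrad \<Omega> v x))\<^sup>2)" by simp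
    also have "\<dots> \<le> a_form \<Omega> A v v" unfolding a_form_def
      using L \<mu>(2) by (intro integral_mono ELL_integrable[OF ell] integrable_mult_right) (auto simp: L2_iff)
    finally show ?thesis .
  qed
  then show "\<exists>\<mu>>0. \<forall>v\<in>H10 \<Omega>. \<mu> * (LINT x|lebesgue_on \<Omega>. (norm (wgrad \<Omega> v x))\<^sup>2) \<le> a_form \<Omega> A v v"
    using \<mu>(1) by blast
qed

lemma load_lincomb:
  assumes \<Omega>: "open \<Omega>" and f: "f \<in> L2 (lebesgue_on \<Omega>)" "fv \<in> L2 (lebesgue_on \<Omega>)" and v: "v \<in> H10 \<Omega>" and w: "w \<in> H10 \<Omega>"
  shows "load \<Omega> f fv (\<lambda>x. s * v x + t * w x) = s * load \<Omega> f fv v + t * load \<Omega> f fv w"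
proof -
  let ?M = "lebesgue_on \<Omega>" and ?y = "\<lambda>x. s * v x + t * w x"
  have fi: "integrable ?M (\<lambda>x. f x * v x)" if "v \<in> H10 \<Omega>" for v
    using L2_inner_integrable[OF f(1) H10_approx(1)[OF \<Omega> that]] by simp
  have gi: "integrable ?M (\<lambda>x. fv x \<bullet> wgrad \<Omega> v x)" if "v \<in> H10 \<Omega>" for v
    by (rule L2_inner_integrable[OF f(2) H10_approx(3)[OF \<Omega> that]])
  have "(LINT x|?M. f x * ?y x) = (LINT x|?M. s * (f x * v x) + t * (f x * w x))"
    by (intro Bochner_Integration.integral_cong) (simp_all add: algebra_simps)
  also have "\<dots> = s * (LINT x|?M. f x * v x) + t * (LINT x|?M. f x * w x)" using fi[OF v] fi[OF w] by simp
  finally have 1: "(LINT x|?M. f x * ?y x) = s * (LINT x|?M. f x * v x) + t * (LINT x|?M. f x * w x)" .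
  have "(LINT x|?M. fv x \<bullet> wgrad \<Omega> ?y x) = (LINT x|?M. s * (fv x \<bullet> wgrad \<Omega> v x) + t * (fv x \<bullet> wgrad \<Omega> w x))"
  proof (rule integral_cong_AE)
    show "(\<lambda>x. fv x \<bullet> wgrad \<Omega> ?y x) \<in> borel_measurable ?M" by (rule borel_measurable_integrable[OF gi[OF H10_lincomb(1)[OF \<Omega> v w]]])
    show "(\<lambda>x. s * (fv x \<bullet> wgrad \<Omega> v x) + t * (fv x \<bullet> wgrad \<Omega> w x)) \<in> borel_measurable ?M"
      using gi[OF v] gi[OF w] by (intro borel_measurable_integrable Bochner_Integration.integrable_add integrable_mult_right)
    show "AE x in ?M. fv x \<bullet> wgrad \<Omega> ?y x = s * (fv x \<bullet> wgrad \<Omega> v x) + t * (fv x \<bullet> wgrad \<Omega> w x)"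
      using H10_lincomb(2)[OF \<Omega> v w, of s t] by eventually_elim (simp add: inner_simps)
  qed
  also have "\<dots> = s * (LINT x|?M. fv x \<bullet> wgrad \<Omega> v x) + t * (LINT x|?M. fv x \<bullet> wgrad \<Omega> w x)" using gi[OF v] gi[OF w] by simp
  finally show ?thesis unfolding load_def 1 by (simp add: algebra_simps)
qed

section \<open>Nested finite element spaces\<close>

lemma polynomial_of_degree_lincomb:
  assumes "polynomial_of_degree m p" "polynomial_of_degree m r"
  shows "polynomial_of_degree m (\<lambda>x. s * p x + t * r x)"
proof -
  obtain c d where c: "\<forall>x. p x = (\<Sum>\<alpha> | (\<Sum>i\<in>UNIV. \<alpha> i) \<le> m. c \<alpha> * (\<Prod>i\<in>UNIV. x $ i ^ \<alpha> i))"
    and d: "\<forall>x. r x = (\<Sum>\<alpha> | (\<Sum>i\<in>UNIV. \<alpha> i) \<le> m. d \<alpha> * (\<Prod>i\<in>UNIV. x $ i ^ \<alpha> i))"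
    using assms unfolding polynomial_of_degree_def by blast
  show ?thesis unfolding polynomial_of_degree_def
  proof (intro exI[of _ "\<lambda>\<alpha>. s * c \<alpha> + t * d \<alpha>"] allI)
    fix x
    show "s * p x + t * r x = (\<Sum>\<alpha> | (\<Sum>i\<in>UNIV. \<alpha> i) \<le> m. (s * c \<alpha> + t * d \<alpha>) * (\<Prod>i\<in>UNIV. x $ i ^ \<alpha> i))"
      unfolding c[rule_format] d[rule_format] by (simp add: sum_distrib_left sum.distrib[symmetric] algebra_simps)
  qed
qed

lemma fe_space_linear:
  assumes \<Omega>: "open \<Omega>"
  shows "linear_space (fe_space \<Omega> m M)"
  unfolding linear_space_def
proof (intro conjI ballI allI)
  have "polynomial_of_degree m (\<lambda>x. 0)" unfolding polynomial_of_degree_def by (intro exI[of _ "\<lambda>_. 0"]) simp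
  then show "(\<lambda>x. 0) \<in> fe_space \<Omega> m M" unfolding fe_space_def using H10_zero[OF \<Omega>] by auto
  fix v w s t assume v: "v \<in> fe_space \<Omega> m M" and w: "w \<in> fe_space \<Omega> m M"
  have "\<exists>p. polynomial_of_degree m p \<and> (AE x in lebesgue_on (elt \<tau>). s * v x + t * w x = p x)" if \<tau>: "\<tau> \<in> M" for \<tau>
  proof -
    obtain p r where p: "polynomial_of_degree m p" "AE x in lebesgue_on (elt \<tau>). v x = p x"
      and r: "polynomial_of_degree m r" "AE x in lebesgue_on (elt \<tau>). w x = r x"
      using v w \<tau> unfolding fe_space_def by blast
    have "AE x in lebesgue_on (elt \<tau>). s * v x + t * w x = s * p x + t * r x"
      using p(2) r(2) by eventually_elim simp
    then show ?thesis using polynomial_of_degree_lincomb[OF p(1) r(1)] by blast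
  qed
  moreover have "(\<lambda>x. s * v x + t * w x) \<in> H10 \<Omega>" using v w H10_lincomb(1)[OF \<Omega>] by (simp add: fe_space_def)
  ultimately show "(\<lambda>x. s * v x + t * w x) \<in> fe_space \<Omega> m M" by (simp add: fe_space_def)
qed

lemma elt_measurable: "elt \<tau> \<in> sets lebesgue"
proof -
  have "compact (elt \<tau>)" unfolding elt_def by (rule finite_imp_compact_convex_hull) simp
  then have "elt \<tau> \<in> sets borel" by (rule borel_compact)
  then show ?thesis by simp
qed

text \<open>The vertices of a child are vertices of the parent or the midpoint of its refinement
  edge, all in the convex hull of the parent. A nonempty vertex list makes \<open>hd\<close> and
  \<open>last\<close> actual vertices.\<close>

lemma children_subset:
  assumes ne: "fst \<tau> \<noteq> []" and c: "\<sigma> \<in> children \<tau>"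
  shows "elt \<sigma> \<subseteq> elt \<tau>" "fst \<sigma> \<noteq> []"
proof -
  obtain zs \<gamma> where \<tau>: "\<tau> = (zs, \<gamma>)" by (cases \<tau>)
  define inner where "inner = butlast (tl zs)"
  define mid where "mid = midpoint (hd zs) (last zs)"
  have zs: "zs \<noteq> []" using ne \<tau> by simp
  have mem: "hd zs \<in> set zs" "last zs \<in> set zs" using zs by simp_all
  have inner: "set inner \<subseteq> set zs"
    unfolding inner_def using zs by (meson in_set_butlastD list.set_sel(2) subsetI)
  have hull: "set zs \<subseteq> convex hull (set zs)" by (rule hull_subset)
  have "mid \<in> closed_segment (hd zs) (last zs)" unfolding mid_def by (rule midpoint_in_closed_segment)
  then have mid: "mid \<in> convex hull (set zs)"
    using closed_segment_subset[OF subsetD[OF hull mem(1)] subsetD[OF hull mem(2)] convex_convex_hull] by blast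
  have cases: "fst \<sigma> = hd zs # mid # inner \<or> fst \<sigma> = last zs # mid # take \<gamma> inner @ rev (drop \<gamma> inner)"
    using c unfolding \<tau> children_def Let_def inner_def mid_def by auto
  then show "fst \<sigma> \<noteq> []" by auto
  have "set (take \<gamma> inner @ rev (drop \<gamma> inner)) \<subseteq> set inner"
    using set_take_subset[of \<gamma> inner] set_drop_subset[of \<gamma> inner] by simp
  then have "set (fst \<sigma>) \<subseteq> insert (hd zs) (insert (last zs) (insert mid (set inner)))"
    using cases by auto
  also have "\<dots> \<subseteq> convex hull (set zs)" using mem hull inner mid by blast
  finally show "elt \<sigma> \<subseteq> elt \<tau>" unfolding elt_def \<tau> fst_conv by (intro hull_minimal convex_convex_hull)
qed

text \<open>An element of the new mesh is either old or contained in the bisected one, whose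
  polynomial restricts to it.\<close>

lemma bisect_nested:
  assumes "bisect M M'" and ne: "\<forall>\<tau>\<in>M. fst \<tau> \<noteq> []"
  shows "fe_space \<Omega> m M \<subseteq> fe_space \<Omega> m M'" "\<forall>\<tau>\<in>M'. fst \<tau> \<noteq> []"
proof -
  obtain \<tau> where \<tau>: "\<tau> \<in> M" "M' = M - {\<tau>} \<union> children \<tau>" using assms(1) by (auto elim: bisect.cases)
  note ch = children_subset[OF ne[rule_format, OF \<tau>(1)]]
  show "\<forall>\<tau>\<in>M'. fst \<tau> \<noteq> []" using ne ch(2) \<tau>(2) by auto
  show "fe_space \<Omega> m M \<subseteq> fe_space \<Omega> m M'"
  proof
    fix v assume v: "v \<in> fe_space \<Omega> m M"
    have "\<exists>p. polynomial_of_degree m p \<and> (AE x in lebesgue_on (elt \<sigma>). v x = p x)" if \<sigma>: "\<sigma> \<in> M'" for \<sigma>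
    proof (cases "\<sigma> \<in> M")
      case True
      then show ?thesis using v by (simp add: fe_space_def)
    next
      case False
      then have "\<sigma> \<in> children \<tau>" using \<sigma> \<tau>(2) by blast
      then have sub: "elt \<sigma> \<subseteq> elt \<tau>" by (rule ch(1))
      obtain p where p: "polynomial_of_degree m p" "AE x in lebesgue_on (elt \<tau>). v x = p x"
        using v \<tau>(1) unfolding fe_space_def by blast
      have "AE x in lebesgue. x \<in> elt \<tau> \<longrightarrow> v x = p x" using p(2) elt_measurable[of \<tau>] by (simp add: AE_restrict_space_iff)
      then have "AE x in lebesgue. x \<in> elt \<sigma> \<longrightarrow> v x = p x" by eventually_elim (use sub in blast)
      then have "AE x in lebesgue_on (elt \<sigma>). v x = p x" using elt_measurable[of \<sigma>] by (simp add: AE_restrict_space_iff)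
      then show ?thesis using p(1) by blast
    qed
    then show "v \<in> fe_space \<Omega> m M'" using v by (simp add: fe_space_def)
  qed
qed

lemma bisect_rtranclp_nested:
  assumes "bisect\<^sup>*\<^sup>* M M'" and "\<forall>\<tau>\<in>M. fst \<tau> \<noteq> []"
  shows "fe_space \<Omega> m M \<subseteq> fe_space \<Omega> m M' \<and> (\<forall>\<tau>\<in>M'. fst \<tau> \<noteq> [])"
  using assms
proof (induction rule: rtranclp_induct)
  case (step M' M'')
  then have IH: "fe_space \<Omega> m M \<subseteq> fe_space \<Omega> m M'" "\<forall>\<tau>\<in>M'. fst \<tau> \<noteq> []" by blast+
  show ?case using bisect_nested[OF step.hyps(2) IH(2)] IH(1) by blast
qed simp

section \<open>Verification of the abstract assumptions\<close>

lemma power_le_one_add_power: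
  fixes x :: real
  assumes "0 \<le> x" "i \<le> j" shows "x ^ i \<le> 1 + x ^ j"
proof (cases "x \<le> 1")
  case True
  then have "x ^ i \<le> 1" using assms by (simp add: power_le_one)
  then show ?thesis using assms by (simp add: add_increasing2)
next
  case False
  then have "x ^ i \<le> x ^ j" using assms by (intro power_increasing) auto
  then show ?thesis by simp
qed

lemma CAR_deriv:
  assumes "CAR \<Omega> b" "x \<in> \<Omega>"
  shows "(dxi j b x has_real_derivative dxi (Suc j) b x \<xi>) (at \<xi>)"
proof -
  have "dxi j b x differentiable at \<xi>" using assms by (simp add: CAR_def)
  then have "(dxi j b x has_real_derivative deriv (dxi j b x) \<xi>) (at \<xi>)"
    by (simp add: DERIV_deriv_iff_real_differentiable)
  moreover have "deriv (dxi j b x) = dxi (Suc j) b x" by (simp add: dxi_def fun_eq_iff)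
  ultimately show ?thesis by simp
qed

text \<open>The Sobolev exponent \<open>2 * k = q + 3\<close> is chosen so large that \<open>n \<le> q + 2\<close>, and it is 4 if \<open>d = 3\<close>.\<close>

lemma semilinear_problem_H10:
  fixes \<Omega> :: "(real ^ 'd) set"
  assumes dim: "CARD('d) \<in> {1, 2, 3}"
    and dom: "bounded_lipschitz_domain \<Omega>"
    and f: "f \<in> L2 (lebesgue_on \<Omega>)" "fv \<in> L2 (lebesgue_on \<Omega>)"
    and ell: "ELL \<Omega> T0 A" and car: "CAR \<Omega> b" and mon: "MON \<Omega> b" and cgc: "CGC \<Omega> b"
  shows "\<exists>q R S. semilinear_problem (lebesgue_on \<Omega>) (H10 \<Omega>) (a_form \<Omega> A) (load \<Omega> f fv) b (dxi 1 b) (dxi 2 b) q R S"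
proof -
  let ?M = "lebesgue_on \<Omega>"
  let ?D = "\<lambda>v. LINT x|?M. (norm (wgrad \<Omega> v x))\<^sup>2"
  have op: "open \<Omega>" and bd: "bounded \<Omega>" using dom by (simp_all add: bounded_lipschitz_domain_def)
  have \<Omega>m: "\<Omega> \<in> sets lebesgue" using op by (simp add: borel_open)
  obtain n R where n: "2 \<le> n" "CARD('d) = 3 \<longrightarrow> n \<le> 3" and R: "0 < R"
    and growth: "\<forall>x\<in>\<Omega>. \<forall>\<xi>. \<forall>k\<le>n. \<bar>dxi k b x \<xi>\<bar> \<le> R * (1 + \<bar>\<xi>\<bar> ^ (n - k))"
    using cgc unfolding CGC_def by blast
  \<comment> \<open>The growth exponents n - 1 and n - 2 of the first two derivatives must not
    exceed q + 1 and q, that is n \<le> 2 k - 1. For d = 3 this reads n \<le> 3; otherwise k = n is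
    large enough.\<close>
  define k where "k = (if CARD('d) = 3 then 2 else n)"
  \<comment> \<open>The subtraction does not truncate, because k is at least 2.\<close>
  define q where "q = 2 * k - 3"
  have k: "2 \<le> k" "1 \<le> k" "q + 3 = 2 * k" and nq: "n - 1 \<le> q + 1" "n - 2 \<le> q"
    using n by (auto simp: k_def q_def)
  have kdim: "CARD('d) \<le> 2 \<or> CARD('d) = 3 \<and> k = 2" using dim by (auto simp: k_def)
  obtain C where C: "0 \<le> C" and sob: "\<forall>v\<in>H10 \<Omega>. integrable ?M (\<lambda>x. v x ^ (2 * k)) \<and> (LINT x|?M. v x ^ (2 * k)) \<le> C * ?D v ^ k"
    using H10_sobolev[OF op bd kdim k(2)] by blast
  obtain \<mu> where \<mu>: "0 < \<mu>" and coer: "\<forall>v\<in>H10 \<Omega>. \<mu> * ?D v \<le> a_form \<Omega> A v v"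
    using a_form_props(3)[OF op ell] by blast
  have D0: "0 \<le> ?D v" for v by (intro integral_nonneg_AE) simp
  have a0: "0 \<le> a_form \<Omega> A v v" if "v \<in> H10 \<Omega>" for v
  proof -
    have "0 \<le> \<mu> * ?D v" using \<mu> D0[of v] by simp
    then show ?thesis using coer that by force
  qed
  have pow: "\<bar>y\<bar> ^ (q + 3) = y ^ (2 * k)" for y :: real
    unfolding k(3) by (simp add: power_mult)
  have growth': "\<bar>dxi j b x \<xi>\<bar> \<le> 2 * R * (1 + \<bar>\<xi>\<bar> ^ m)" if x: "x \<in> \<Omega>" and jm: "j \<le> n" "n - j \<le> m" for x \<xi> j m
  proof -
    have "\<bar>dxi j b x \<xi>\<bar> \<le> R * (1 + \<bar>\<xi>\<bar> ^ (n - j))" using growth x jm(1) by blast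
    also have "\<dots> \<le> R * (1 + (1 + \<bar>\<xi>\<bar> ^ m))"
      using R power_le_one_add_power[OF abs_ge_zero jm(2), of \<xi>] by (intro mult_left_mono) auto
    also have "\<dots> \<le> 2 * R * (1 + \<bar>\<xi>\<bar> ^ m)" using R by (simp add: algebra_simps)
    finally show ?thesis .
  qed
  \<comment> \<open>R is doubled because lower powers of |\<xi>| are absorbed into 1 plus the
    required power; dividing by \<mu>^k passes from the gradient integral to the energy.\<close>
  have "semilinear_problem ?M (H10 \<Omega>) (a_form \<Omega> A) (load \<Omega> f fv) b (dxi 1 b) (dxi 2 b) q (2 * R) (C / \<mu> ^ k)"
  proof (intro semilinear_problem.intro semilinear_problem_axioms.intro)
    show "finite_measure ?M" by (rule finite_measure_lebesgue_on[OF bounded_set_imp_lmeasurable[OF bd \<Omega>m]])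
    show "linear_space (H10 \<Omega>)" unfolding linear_space_def using H10_zero[OF op] H10_lincomb(1)[OF op] by blast
    show "v \<in> borel_measurable ?M" if "v \<in> H10 \<Omega>" for v using H10_approx(1)[OF op that] by (simp add: L2_iff)
    show "a_form \<Omega> A (\<lambda>x. s * v x + t * w x) z = s * a_form \<Omega> A v z + t * a_form \<Omega> A w z"
      if "v \<in> H10 \<Omega>" "w \<in> H10 \<Omega>" "z \<in> H10 \<Omega>" for v w z s t
      by (rule a_form_props(1)[OF op ell that])
    show "a_form \<Omega> A v w = a_form \<Omega> A w v" for v w by (rule a_form_props(2)[OF op ell])
    show "0 \<le> a_form \<Omega> A v v" if "v \<in> H10 \<Omega>" for v by (rule a0[OF that])
    show "load \<Omega> f fv (\<lambda>x. s * v x + t * w x) = s * load \<Omega> f fv v + t * load \<Omega> f fv w"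
      if "v \<in> H10 \<Omega>" "w \<in> H10 \<Omega>" for v w s t by (rule load_lincomb[OF op f that])
    show "integrable ?M (\<lambda>x. \<bar>v x\<bar> ^ (q + 3))" if "v \<in> H10 \<Omega>" for v unfolding pow using sob that by blast
    show "(LINT x|?M. \<bar>v x\<bar> ^ (q + 3)) \<le> C / \<mu> ^ k * sqrt (a_form \<Omega> A v v) ^ (q + 3)" if v: "v \<in> H10 \<Omega>" for v
    proof -
      have "?D v \<le> a_form \<Omega> A v v / \<mu>" using coer v \<mu> by (simp add: field_simps)
      then have "?D v ^ k \<le> (a_form \<Omega> A v v / \<mu>) ^ k" using D0[of v] by (rule power_mono)
      then have "C * ?D v ^ k \<le> C * (a_form \<Omega> A v v / \<mu>) ^ k" using C by (rule mult_left_mono)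
      also have "\<dots> = C / \<mu> ^ k * sqrt (a_form \<Omega> A v v) ^ (q + 3)"
        unfolding k(3) power_mult using a0[OF v] by (simp add: power_divide)
      finally show ?thesis unfolding pow using sob v by force
    qed
    show "\<exists>J C. finite J \<and> J \<subseteq> sets ?M \<and> 0 \<le> C \<and>
        (\<forall>v\<in>H10 \<Omega>. (LINT x|?M. (v x)\<^sup>2) \<le> \<delta> * a_form \<Omega> A v v + C * (\<Sum>Q\<in>J. (LINT x|?M. indicator Q x * v x)\<^sup>2))"
      if \<delta>: "0 < \<delta>" for \<delta>
    proof -
      \<comment> \<open>Rellich's inequality is used with \<delta> \<mu>, so that coercivity turns
        the gradient term into \<delta> times the energy.\<close>
      have "0 < \<delta> * \<mu>" using \<delta> \<mu> by simp
      then obtain J C' where J: "finite J" "J \<subseteq> sets ?M" "0 \<le> C'" and JC: "\<forall>v\<in>H10 \<Omega>. (LINT x|?M. (v x)\<^sup>2) \<le> \<delta> * \<mu> * ?D v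
         + C' * (\<Sum>Q\<in>J. (LINT x|?M. indicator Q x * v x)\<^sup>2)"
        using H10_rellich[OF op bd, of "\<delta> * \<mu>"] by blast
      have "(LINT x|?M. (v x)\<^sup>2) \<le> \<delta> * a_form \<Omega> A v v + C' * (\<Sum>Q\<in>J. (LINT x|?M. indicator Q x * v x)\<^sup>2)" if v: "v \<in> H10 \<Omega>" for v
      proof -
        have "\<delta> * (\<mu> * ?D v) \<le> \<delta> * a_form \<Omega> A v v" using coer v \<delta> by (intro mult_left_mono) auto
        then show ?thesis using JC[rule_format, OF v] unfolding mult.assoc by linarith
      qed
      then show ?thesis using J by blast
    qed
    show "0 \<le> C / \<mu> ^ k" "0 \<le> 2 * R" using C \<mu> R by auto
    show "(\<lambda>x. b x \<xi>) \<in> borel_measurable ?M" for \<xi>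
      using conjunct1[OF car[unfolded CAR_def], rule_format, of 0 \<xi>] by (simp add: dxi_def)
    show "(\<lambda>x. dxi 1 b x \<xi>) \<in> borel_measurable ?M" for \<xi>
      using conjunct1[OF car[unfolded CAR_def], rule_format, of 1 \<xi>] .
    fix x \<xi> assume "x \<in> space ?M"
    then have x: "x \<in> \<Omega>" by simp
    show "(b x has_real_derivative dxi 1 b x \<xi>) (at \<xi>)" using CAR_deriv[OF car x, of 0 \<xi>] by (simp add: dxi_def)
    show "(dxi 1 b x has_real_derivative dxi 2 b x \<xi>) (at \<xi>)" using CAR_deriv[OF car x, of 1 \<xi>] by (simp add: numeral_2_eq_2)
    show "b x 0 = 0" "0 \<le> dxi 1 b x \<xi>" using mon x by (auto simp: MON_def)
    show "\<bar>dxi 1 b x \<xi>\<bar> \<le> 2 * R * (1 + \<bar>\<xi>\<bar> ^ (q + 1))" using n(1) nq(1) by (intro growth'[OF x]) auto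
    show "\<bar>dxi 2 b x \<xi>\<bar> \<le> 2 * R * (1 + \<bar>\<xi>\<bar> ^ q)" using n(1) nq(2) by (intro growth'[OF x]) auto
  qed
  then show ?thesis by blast
qed

lemma adaptive_algorithm_nested:
  assumes alg: "adaptive_algorithm \<Omega> A b f fv g gv m \<theta> Cmark T0 T ul zl" and init: "initial_triangulation \<Omega> T0"
  shows "fe_space \<Omega> m (T l) \<subseteq> fe_space \<Omega> m (T (Suc l))"
proof -
  have ref: "bisect\<^sup>*\<^sup>* (T l) (T (Suc l))" for l
    using alg unfolding adaptive_algorithm_def is_refine_def is_conforming_refinement_def by blast
  \<comment> \<open>The invariant under which a bisected element contains its children.\<close>
  have ne: "\<forall>\<tau>\<in>T l. fst \<tau> \<noteq> []" for l
  proof (induction l)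
    case 0
    have "T 0 = T0" using alg by (simp add: adaptive_algorithm_def)
    then show ?case using init by (auto simp: initial_triangulation_def tagged_simplex_def)
  next
    case (Suc l)
    then show ?case using bisect_rtranclp_nested[OF ref] by blast
  qed
  show ?thesis using bisect_rtranclp_nested[OF ref ne] by blast
qed

theorem lemma28:
  fixes \<Omega> :: "(real ^ 'd) set"
    and A :: "real ^ 'd \<Rightarrow> real ^ 'd ^ 'd"
    and b :: "real ^ 'd \<Rightarrow> real \<Rightarrow> real"
    and f g :: "real ^ 'd \<Rightarrow> real"
    and fv gv :: "real ^ 'd \<Rightarrow> real ^ 'd"
    and T0 :: "'d mesh"
    and m :: nat
    and \<theta> :: real and Cmark :: ereal
    and T :: "nat \<Rightarrow> 'd mesh"
    and u :: "real ^ 'd \<Rightarrow> real"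
    and ul zl :: "nat \<Rightarrow> real ^ 'd \<Rightarrow> real"
  assumes "CARD('d) \<in> {1, 2, 3}"
    and "bounded_lipschitz_domain \<Omega>"
    and "initial_triangulation \<Omega> T0"
    and "f \<in> L2 (lebesgue_on \<Omega>)" and "g \<in> L2 (lebesgue_on \<Omega>)"
    and "fv \<in> L2 (lebesgue_on \<Omega>)" and "gv \<in> L2 (lebesgue_on \<Omega>)"
    and "RHS \<Omega> T0 f g fv gv"
    and "ELL \<Omega> T0 A"
    and "CAR \<Omega> b"
    and "MON \<Omega> b"
    and "CGC \<Omega> b"
    and "m \<ge> 1"
    and "0 < \<theta>" and "\<theta> \<le> 1"
    and "1 \<le> Cmark"
    and "primal_solution \<Omega> A b f fv (H10 \<Omega>) u"
    and "adaptive_algorithm \<Omega> A b f fv g gv m \<theta> Cmark T0 T ul zl"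
  shows "\<forall>\<epsilon>. 0 < \<epsilon> \<and> \<epsilon> < 1 \<longrightarrow>
    (\<exists>l0. \<forall>l\<ge>l0. \<forall>k.
       (energy_norm \<Omega> A (\<lambda>x. u x - ul (l + k) x))\<^sup>2
         + (energy_norm \<Omega> A (\<lambda>x. ul (l + k) x - ul l x))\<^sup>2
       \<le> 1 / (1 - \<epsilon>) * (energy_norm \<Omega> A (\<lambda>x. u x - ul l x))\<^sup>2)"
proof -
  have op: "open \<Omega>" using assms(2) by (simp add: bounded_lipschitz_domain_def)
  obtain q R S where "semilinear_problem (lebesgue_on \<Omega>) (H10 \<Omega>) (a_form \<Omega> A) (load \<Omega> f fv) b (dxi 1 b) (dxi 2 b) q R S"
    using semilinear_problem_H10[OF assms(1,2,4,6,9-12)] by blast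
  then interpret semilinear_problem "lebesgue_on \<Omega>" "H10 \<Omega>" "a_form \<Omega> A" "load \<Omega> f fv" b "dxi 1 b" "dxi 2 b" q R S .
  \<comment> \<open>The continuous and the discrete problems differ only in the space V, so one
    identity covers both.\<close>
  have solves: "solves V w \<longleftrightarrow> primal_solution \<Omega> A b f fv V w" for V w
    by (simp add: solves_def primal_solution_def)
  have primal: "primal_solution \<Omega> A b f fv (fe_space \<Omega> m (T l)) (ul l)" for l
    using assms(18) by (simp add: adaptive_algorithm_def)
  interpret galerkin "lebesgue_on \<Omega>" "H10 \<Omega>" "a_form \<Omega> A" "load \<Omega> f fv" b "dxi 1 b" "dxi 2 b" q R S
    "\<lambda>l. fe_space \<Omega> m (T l)" u ul
  proof
    show "linear_space (fe_space \<Omega> m (T l))" for l by (rule fe_space_linear[OF op])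
    show "fe_space \<Omega> m (T l) \<subseteq> H10 \<Omega>" for l by (auto simp: fe_space_def)
    show "fe_space \<Omega> m (T l) \<subseteq> fe_space \<Omega> m (T (Suc l))" for l by (rule adaptive_algorithm_nested[OF assms(18,3)])
    show "solves (H10 \<Omega>) u" unfolding solves by (rule assms(17))
    show "solves (fe_space \<Omega> m (T l)) (ul l)" for l unfolding solves by (rule primal)
  qed
  have N: "N v = energy_norm \<Omega> A v" for v by (simp add: N_def energy_norm_def)
  show ?thesis
  proof (intro allI impI)
    fix \<epsilon> :: real assume "0 < \<epsilon> \<and> \<epsilon> < 1"
    then show "\<exists>l0. \<forall>l\<ge>l0. \<forall>k.
       (energy_norm \<Omega> A (\<lambda>x. u x - ul (l + k) x))\<^sup>2 + (energy_norm \<Omega> A (\<lambda>x. ul (l + k) x - ul l x))\<^sup>2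
       \<le> 1 / (1 - \<epsilon>) * (energy_norm \<Omega> A (\<lambda>x. u x - ul l x))\<^sup>2"
      using quasi_orthogonality[of \<epsilon>] unfolding e_def N by blast
  qed
qed

end
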